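(* Let $\kappa\geqslant 1$ and $m\geqslant 1$ be integers. Let $X=X^1\subset\mathbb{P}^2(\mathbb{C})$ be a smooth projective algebraic curve of degree $d\geqslant\kappa+3$. Let $[T:X:Y]$ be homogeneous coordinates on $\mathbb{P}^2$ with affine coordinates $x=X/T$, $y=Y/T$ on $\{T\neq 0\}\cong\mathbb{C}^2$, such that $[0:1:0]\notin X^1$, $[0:0:1]\notin X^1$, and the line at infinity $\mathbb{P}^1_\infty=\{T=0\}$ intersects $X^1$ transversally in $d$ distinct points. Let $X^1\cap\mathbb{C}^2=\{R(x,y)=0\}$ with $R\in\mathbb{C}[x,y]$ of degree $d$ satisfying, by smoothness, $\{R=0\}\cap\{R_x=0\}\cap\{R_y=0\}=\emptyset$. (1) For every $1\leqslant\lambda\leqslant\kappa$ there exist polynomials with integer coefficients $$\mathcal{J}^\lambda_{\mu_1,\dots,\mu_{\lambda-1}}=\mathcal{J}^\lambda_{\mu_1,\dots,\mu_{\lambda-1}}\Big(\mathsf{R}_{0,1},\,(\mathsf{R}_{i,j})_{2\leqslant i+j\leqslant\mu_1+\cdots+\mu_{\lambda-1}}\Big),$$ indexed by the tuples of nonnegative integers with $\mu_1+2\mu_2+\cdots+(\lambda-1)\mu_{\lambda-1}=\lambda$, such that the following recipe, symmetric (up to an overall sign) under $x\leftrightarrow y$, is well defined (the first two expressions coincide over $\{R_x\neq0\}\cap\{R_y\neq 0\}$) and defines a jet differential $\mathsf{J}^\lambda_R$ of order $\lambda$, holomorphic on all of $X^1$ and vanishing identically at the points of $X^1\cap\mathbb{P}^1_\infty$: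 over $X^1\cap\mathbb{C}^2\cap\{R_x\neq 0\}$, $$\mathsf{J}_R^\lambda=\frac{y^{(\lambda)}}{R_x}+\sum_{\mu_1+\cdots+(\lambda-1)\mu_{\lambda-1}=\lambda}\frac{(y')^{\mu_1}\cdots(y^{(\lambda-1)})^{\mu_{\lambda-1}}}{R_x}\;\mathcal{J}^\lambda_{\mu_1,\dots,\mu_{\lambda-1}}\bigg(\frac{R_y}{R_x},\Big(\frac{R_{x^iy^j}}{R_x}\Big)_{i,j}\bigg);$$ over $X^1\cap\mathbb{C}^2\cap\{R_y\neq 0\}$, $$\mathsf{J}_R^\lambda=-\frac{x^{(\lambda)}}{R_y}-\sum_{\mu_1+\cdots+(\lambda-1)\mu_{\lambda-1}=\lambda}\frac{(x')^{\mu_1}\cdots(x^{(\lambda-1)})^{\mu_{\lambda-1}}}{R_y}\;\mathcal{J}^\lambda_{\mu_1,\dots,\mu_{\lambda-1}}\bigg(\frac{R_x}{R_y},\Big(\frac{R_{y^ix^j}}{R_y}\Big)_{i,j}\bigg);$$ and $\mathsf{J}^\lambda_R=0$ over $X^1\cap\mathbb{P}^1_\infty$. For example, for $\lambda=1,2,3$ (with $\lambda\leqslant\kappa$), over $\{R_x\neq 0\}$ one may take $$\mathsf{J}_R^1=\frac{y'}{R_x},\qquad \mathsf{J}_R^2=\frac{y''}{R_x}+\frac{(y')^2}{R_x}\Big[-\frac{R_{xy}}{R_x}+\frac{R_y}{R_x}\frac{R_{xx}}{R_x}\Big],$$ $$\mathsf{J}_R^3=\frac{y'''}{R_x}+\frac{y''y'}{R_x}\Big[-3\frac{R_{xy}}{R_x}+3\frac{R_y}{R_x}\frac{R_{xx}}{R_x}\Big]+\frac{(y')^3}{R_x}\Big[-6\frac{R_y}{R_x}\frac{R_{xy}}{R_x}\frac{R_{xx}}{R_x}+3\Big(\frac{R_y}{R_x}\Big)^2\Big(\frac{R_{xx}}{R_x}\Big)^2+3\frac{R_y}{R_x}\frac{R_{xxy}}{R_x}-\Big(\frac{R_y}{R_x}\Big)^2\frac{R_{xxx}}{R_x}\Big].$$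 (2) For each tuple $(m_1,\dots,m_\kappa)\in\mathbb{N}^\kappa$ with $m_1+2m_2+\cdots+\kappa m_\kappa=m$, put $\delta=\delta(m_1,\dots,m_\kappa):=m_1(d-3)+m_2(d-4)+\cdots+m_\kappa(d-\kappa-2)$. For all choices of polynomials $\mathsf{G}_{m_1,\dots,m_\kappa}(x,y)\in\mathbb{C}[x,y]$ of degree $\leqslant\delta(m_1,\dots,m_\kappa)$, the expression $$\sum_{m_1+2m_2+\cdots+\kappa m_\kappa=m}\big(\mathsf{J}_R^1\big)^{m_1}\big(\mathsf{J}_R^2\big)^{m_2}\cdots\big(\mathsf{J}_R^\kappa\big)^{m_\kappa}\cdot\mathsf{G}_{m_1,m_2,\dots,m_\kappa}(x,y)$$ is a global holomorphic section over $X^1$ of the Green–Griffiths jet bundle $E^{\mathrm{GG}}_{\kappa,m}T_X^*$. Such sections, with each $\mathsf{G}_{m_1,\dots,m_\kappa}$ taken in the quotient space $\mathbb{C}_\delta[x,y]\big/R\cdot\mathbb{C}_{\delta-d}[x,y]$, yield linearly independent sections, the total number of them (the dimension of the space of sections so obtained) being $$\sum_{m_1+\cdots+\kappa m_\kappa=m}\bigg\{\binom{\delta(m_1,\dots,m_\kappa)+2}{2}-\binom{\delta(m_1,\dots,m_\kappa)-d+2}{2}\bigg\},$$ which is asymptotically equal, as $m\to\infty$, to $$\frac{m^\kappa}{\kappa!\,\kappa!}\Big[d^2\log\kappa+d^2\,\mathrm{O}(1)+\mathrm{O}(d)\Big]+\mathrm{O}\big(m^{\kappa-1}\big).$$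
   Context: $\mathbb{D}\subset\mathbb{C}$ is the unit disc and $J^\kappa(\mathbb{D},X^1)$ is the bundle over $X^1$ of $\kappa$-jets (at a point $\zeta\in\mathbb{D}$) of local holomorphic maps $\zeta\mapsto(x(\zeta),y(\zeta))$ into $X^1$; primes and $^{(\lambda)}$ denote derivatives with respect to $\zeta$. On $X^1\cap\mathbb{C}^2\cap\{R_x\neq0\}$, where $y$ is a local coordinate, $J^\kappa(\mathbb{D},X^1)$ has intrinsic coordinates $(y;y',y'',\dots,y^{(\kappa)})$; on $X^1\cap\mathbb{C}^2\cap\{R_y\neq0\}$, where $x$ is a local coordinate, it has intrinsic coordinates $(x;x',x'',\dots,x^{(\kappa)})$. A holomorphic jet differential of order $\lambda$ over an open set $U\subset X^1$ is a holomorphic function on $J^\lambda(\mathbb{D},X^1)|_U$ which is polynomial in the jet fibre coordinates. The Green–Griffiths bundle $E^{\mathrm{GG}}_{\kappa,m}T_X^*$ is the holomorphic vector bundle on $X=X^1$ whose sections over $U$ are the holomorphic jet differentials of order $\kappa$ which are weighted homogeneous of degree $m$: in a local coordinate $z$ on $X$, finite sums of holomorphic functions times monomials $(z')^{m_1}(z'')^{m_2}\cdots(z^{(\kappa)})^{m_\kappa}$ with $m_1+2m_2+\cdots+\kappa m_\kappa=m$. Subscripts on $R$ denote partial derivatives: $R_{x^iy^j}=\partial_x^i\partial_y^jR$, $R_{y^ix^j}=\partial_y^i\partial_x^jR$. In the first (resp. second) expression for $\mathsf{J}^\lambda_R$, the polynomial $\mathcal{J}^\lambda_\mu$ is evaluated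 at $\mathsf{R}_{0,1}=R_y/R_x$, $\mathsf{R}_{i,j}=R_{x^iy^j}/R_x$ (resp. $\mathsf{R}_{0,1}=R_x/R_y$, $\mathsf{R}_{i,j}=R_{y^ix^j}/R_y$). For $\lambda=1$ the sums are empty. $\mathbb{C}_\delta[x,y]$ denotes the space of polynomials of degree $\leqslant\delta$, with $\mathbb{C}_{\delta-d}[x,y]=0$ if $\delta<d$; accordingly $\binom{a}{2}$ is read as $0$ for $a<2$. In the asymptotic formula, $\mathrm{O}(1)$ is bounded independently of $\kappa$, $d$ and $m$, $\mathrm{O}(d)$ is for $d\to\infty$ with $\kappa$ fixed, and $\mathrm{O}(m^{\kappa-1})$ is for $m\to\infty$ with $\kappa,d$ fixed. *)

theory Defs
  imports
    "HOL-Complex_Analysis.Complex_Analysis"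
    "HOL-Library.Poly_Mapping"
    "HOL-Library.Function_Algebras"
    "HOL-Library.Landau_Symbols"
begin

section \<open>Bivariate complex polynomials\<close>

text \<open>
  An element \<open>P\<close> of \<open>complex poly poly\<close> stands for the polynomial
  \<open>\<Sum>i j. coeff (coeff P j) i x^i y^j\<close>: the outer variable is \<open>y\<close>, the inner one is \<open>x\<close>.
\<close>

definition eval2 :: "complex poly poly \<Rightarrow> complex \<Rightarrow> complex \<Rightarrow> complex" where
  "eval2 P x y = poly (poly P [:y:]) x"

definition total_degree :: "complex poly poly \<Rightarrow> nat" where
  "total_degree P = Max (insert 0 {i + j | i j. coeff (coeff P j) i \<noteq> 0})"

definition partial :: "nat \<Rightarrow> nat \<Rightarrow> complex poly poly \<Rightarrow> complex poly poly" where
  "partial i j P = (map_poly pderiv ^^ i) ((pderiv ^^ j) P)"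

definition polys_le :: "nat \<Rightarrow> complex poly poly set" where
  "polys_le \<delta> = {P. total_degree P \<le> \<delta>}"

definition multiples_le :: "complex poly poly \<Rightarrow> nat \<Rightarrow> nat \<Rightarrow> complex poly poly set" where
  "multiples_le R d \<delta> = (if d \<le> \<delta> then (\<lambda>Q. R * Q) ` polys_le (\<delta> - d) else {0})"

text \<open>Linear independence of the classes of the elements of \<open>B\<close> modulo the subspace \<open>W\<close>.\<close>

definition independent_mod :: "complex poly poly set \<Rightarrow> complex poly poly set \<Rightarrow> bool" where
  "independent_mod W B \<longleftrightarrow> finite B \<and>
     (\<forall>c :: complex poly poly \<Rightarrow> complex.
        (\<Sum>b\<in>B. smult [:c b:] b) \<in> W \<longrightarrow> (\<forall>b\<in>B. c b = 0))"


section \<open>The projective plane\<close>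

definition proj_rel :: "complex \<times> complex \<times> complex \<Rightarrow> complex \<times> complex \<times> complex \<Rightarrow> bool" where
  "proj_rel u v \<longleftrightarrow> u \<noteq> (0, 0, 0) \<and> v \<noteq> (0, 0, 0) \<and>
     (\<exists>c. c \<noteq> 0 \<and> v = (c * fst u, c * fst (snd u), c * snd (snd u)))"

lemma part_equivp_proj_rel: "part_equivp proj_rel"
proof (rule part_equivpI)
  show "\<exists>x. proj_rel x x"
    unfolding proj_rel_def by (intro exI[of _ "(1, 0, 0)"]) (auto intro: exI[of _ 1])
  show "symp proj_rel"
  proof (rule sympI)
    fix u v assume "proj_rel u v"
    then obtain c where c: "c \<noteq> 0" "v = (c * fst u, c * fst (snd u), c * snd (snd u))"
      "u \<noteq> (0, 0, 0)" "v \<noteq> (0, 0, 0)"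
      unfolding proj_rel_def by blast
    then have "u = (inverse c * fst v, inverse c * fst (snd v), inverse c * snd (snd v))"
      by (cases u) (auto simp: field_simps)
    with c show "proj_rel v u"
      unfolding proj_rel_def by (metis nonzero_imp_inverse_nonzero)
  qed
  show "transp proj_rel"
  proof (rule transpI)
    fix u v w assume "proj_rel u v" "proj_rel v w"
    then obtain b c where "b \<noteq> 0" "v = (b * fst u, b * fst (snd u), b * snd (snd u))"
      "c \<noteq> 0" "w = (c * fst v, c * fst (snd v), c * snd (snd v))"
      "u \<noteq> (0, 0, 0)" "w \<noteq> (0, 0, 0)"
      unfolding proj_rel_def by blast
    then show "proj_rel u w"
      unfolding proj_rel_def by (intro conjI exI[of _ "c * b"]) auto
  qed
qed

quotient_type proj2 = "complex \<times> complex \<times> complex" / partial: proj_rel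
  by (rule part_equivp_proj_rel)

text \<open>\<open>pt T X Y\<close> is the point \<open>[T:X:Y]\<close>; it is meaningful only if \<open>(T, X, Y) \<noteq> (0, 0, 0)\<close>.\<close>

definition pt :: "complex \<Rightarrow> complex \<Rightarrow> complex \<Rightarrow> proj2" where
  "pt T X Y = abs_proj2 (T, X, Y)"

text \<open>Affine coordinates; they are meaningful only on \<open>affine_plane\<close>.\<close>

lift_definition xcoord :: "proj2 \<Rightarrow> complex" is "\<lambda>(T, X, Y). X / T"
  by (auto simp: proj_rel_def)

lift_definition ycoord :: "proj2 \<Rightarrow> complex" is "\<lambda>(T, X, Y). Y / T"
  by (auto simp: proj_rel_def)

definition affine_plane :: "proj2 set" where
  "affine_plane = {pt 1 x y | x y. True}"

definition line_at_infinity :: "proj2 set" where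
  "line_at_infinity = {pt 0 X Y | X Y. (X, Y) \<noteq> (0, 0)}"

instantiation proj2 :: topological_space
begin

definition open_proj2 :: "proj2 set \<Rightarrow> bool" where
  "open_proj2 U \<longleftrightarrow> open {v. v \<noteq> (0, 0, 0) \<and> abs_proj2 v \<in> U}"

instance
proof
  have "{v :: complex \<times> complex \<times> complex. v \<noteq> (0, 0, 0) \<and> abs_proj2 v \<in> UNIV} = - {(0, 0, 0)}"
    by auto
  then show "open (UNIV :: proj2 set)"
    unfolding open_proj2_def by (simp only:) (simp add: open_Compl)
next
  fix S T :: "proj2 set" assume "open S" "open T"
  moreover have "{v. v \<noteq> (0, 0, 0) \<and> abs_proj2 v \<in> S \<inter> T} =
     {v. v \<noteq> (0, 0, 0) \<and> abs_proj2 v \<in> S} \<inter> {v. v \<noteq> (0, 0, 0) \<and> abs_proj2 v \<in> T}"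
    by auto
  ultimately show "open (S \<inter> T)"
    unfolding open_proj2_def by (simp only: open_Int)
next
  fix K :: "proj2 set set" assume K: "\<forall>S\<in>K. open S"
  have "{v. v \<noteq> (0, 0, 0) \<and> abs_proj2 v \<in> \<Union>K} =
     (\<Union>S\<in>K. {v. v \<noteq> (0, 0, 0) \<and> abs_proj2 v \<in> S})"
    by auto
  with K show "open (\<Union>K)"
    unfolding open_proj2_def by (simp only:) blast
qed

end


section \<open>Smooth plane curves\<close>

text \<open>The general ternary form of degree \<open>d\<close>.\<close>

definition form :: "nat \<Rightarrow> (nat \<Rightarrow> nat \<Rightarrow> complex) \<Rightarrow> complex \<Rightarrow> complex \<Rightarrow> complex \<Rightarrow> complex" where
  "form d a T X Y = (\<Sum>(i, j)\<in>{(i, j). i + j \<le> d}. a i j * T ^ (d - i - j) * X ^ i * Y ^ j)"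

definition form_T where "form_T d a T X Y = deriv (\<lambda>t. form d a t X Y) T"
definition form_X where "form_X d a T X Y = deriv (\<lambda>t. form d a T t Y) X"
definition form_Y where "form_Y d a T X Y = deriv (\<lambda>t. form d a T X t) Y"

definition smooth_plane_curve :: "nat \<Rightarrow> (nat \<Rightarrow> nat \<Rightarrow> complex) \<Rightarrow> proj2 set \<Rightarrow> bool" where
  "smooth_plane_curve d a C \<longleftrightarrow>
     C = {pt T X Y | T X Y. (T, X, Y) \<noteq> (0, 0, 0) \<and> form d a T X Y = 0} \<and>
     (\<forall>T X Y. (T, X, Y) \<noteq> (0, 0, 0) \<and> form d a T X Y = 0 \<longrightarrow>
        (form_T d a T X Y, form_X d a T X Y, form_Y d a T X Y) \<noteq> (0, 0, 0))"

text \<open>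
  At a smooth point the tangent line has the equation \<open>F_T T + F_X X + F_Y Y = 0\<close>, so it differs
  from the line \<open>T = 0\<close> iff \<open>(F_X, F_Y) \<noteq> (0, 0)\<close> at that point.
\<close>

definition transversal_at_infinity :: "nat \<Rightarrow> (nat \<Rightarrow> nat \<Rightarrow> complex) \<Rightarrow> bool" where
  "transversal_at_infinity d a \<longleftrightarrow>
     (\<forall>X Y. (X, Y) \<noteq> (0, 0) \<and> form d a 0 X Y = 0 \<longrightarrow>
        (form_X d a 0 X Y, form_Y d a 0 X Y) \<noteq> (0, 0))"


section \<open>Holomorphic maps into the projective plane and their jets\<close>

definition holo_lift ::
    "complex set \<Rightarrow> (complex \<Rightarrow> complex) \<Rightarrow> (complex \<Rightarrow> complex) \<Rightarrow> (complex \<Rightarrow> complex) \<Rightarrow>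
     (complex \<Rightarrow> proj2) \<Rightarrow> bool" where
  "holo_lift N T X Y f \<longleftrightarrow>
     T holomorphic_on N \<and> X holomorphic_on N \<and> Y holomorphic_on N \<and>
     (\<forall>w\<in>N. (T w, X w, Y w) \<noteq> (0, 0, 0) \<and> f w = pt (T w) (X w) (Y w))"

definition holo_map_on :: "complex set \<Rightarrow> (complex \<Rightarrow> proj2) \<Rightarrow> bool" where
  "holo_map_on W f \<longleftrightarrow>
     (\<forall>w\<in>W. \<exists>N T X Y. open N \<and> w \<in> N \<and> N \<subseteq> W \<and> holo_lift N T X Y f)"

definition local_map :: "proj2 set \<Rightarrow> complex \<Rightarrow> (complex \<Rightarrow> proj2) \<Rightarrow> bool" where
  "local_map C \<zeta> f \<longleftrightarrow> \<zeta> \<in> ball 0 1 \<and>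
     (\<exists>W. open W \<and> \<zeta> \<in> W \<and> holo_map_on W f \<and> f ` W \<subseteq> C)"

text \<open>
  The jets of \<open>f\<close> at \<open>\<zeta>\<close> and of \<open>g\<close> at \<open>\<eta>\<close> agree up to order \<open>k\<close> iff suitable homogeneous
  lifts have the same derivatives up to order \<open>k\<close>; equivalently, the derivatives of the
  components agree in an affine chart. As in the intrinsic coordinates
  \<open>(y; y', \<dots>, y^(k))\<close>, the base point in the disc is not recorded.
\<close>

definition same_jet ::
    "nat \<Rightarrow> complex \<Rightarrow> (complex \<Rightarrow> proj2) \<Rightarrow> complex \<Rightarrow> (complex \<Rightarrow> proj2) \<Rightarrow> bool" where
  "same_jet k \<zeta> f \<eta> g \<longleftrightarrow>
     (\<exists>M N T X Y T' X' Y'. open M \<and> \<zeta> \<in> M \<and> holo_lift M T X Y f \<and>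
        open N \<and> \<eta> \<in> N \<and> holo_lift N T' X' Y' g \<and>
        (\<forall>i\<le>k. (deriv ^^ i) T \<zeta> = (deriv ^^ i) T' \<eta> \<and>
                (deriv ^^ i) X \<zeta> = (deriv ^^ i) X' \<eta> \<and>
                (deriv ^^ i) Y \<zeta> = (deriv ^^ i) Y' \<eta>))"

type_synonym jet = "(complex \<times> (complex \<Rightarrow> proj2)) set"

definition jet_of :: "nat \<Rightarrow> proj2 set \<Rightarrow> complex \<Rightarrow> (complex \<Rightarrow> proj2) \<Rightarrow> jet" where
  "jet_of k C \<zeta> f = {(\<eta>, g). local_map C \<eta> g \<and> same_jet k \<zeta> f \<eta> g}"

definition jet_bundle :: "nat \<Rightarrow> proj2 set \<Rightarrow> jet set" where
  "jet_bundle k C = {jet_of k C \<zeta> f | \<zeta> f. local_map C \<zeta> f}"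


section \<open>Jet differentials and the Green--Griffiths bundle\<close>

definition local_coord :: "proj2 set \<Rightarrow> proj2 set \<Rightarrow> (proj2 \<Rightarrow> complex) \<Rightarrow> bool" where
  "local_coord C V z \<longleftrightarrow> openin (top_of_set C) V \<and> inj_on z V \<and> open (z ` V) \<and>
     holo_map_on (z ` V) (inv_into V z)"

definition holo_fun_on :: "proj2 set \<Rightarrow> (proj2 \<Rightarrow> complex) \<Rightarrow> (proj2 \<Rightarrow> complex) \<Rightarrow> bool" where
  "holo_fun_on V z a \<longleftrightarrow> (\<lambda>w. a (inv_into V z w)) holomorphic_on z ` V"

text \<open>
  A multi-index \<open>(\<mu>_1, \<dots>, \<mu>_k)\<close> is a function \<open>nat \<Rightarrow> nat\<close> vanishing outside \<open>{1..k}\<close>.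
\<close>

definition multi_indices :: "nat \<Rightarrow> (nat \<Rightarrow> nat) set" where
  "multi_indices k = {\<mu>. \<forall>j. j \<notin> {1..k} \<longrightarrow> \<mu> j = 0}"

definition weighted_indices :: "nat \<Rightarrow> nat \<Rightarrow> (nat \<Rightarrow> nat) set" where
  "weighted_indices k m = {\<mu> \<in> multi_indices k. (\<Sum>j=1..k. j * \<mu> j) = m}"

text \<open>
  Near \<open>p\<close>, in a local coordinate \<open>z\<close>, the function \<open>\<Phi>\<close> on jets of order \<open>k\<close> is a
  combination of the monomials \<open>(z')^\<mu>_1 \<dots> (z^(k))^\<mu>_k\<close>, \<open>\<mu> \<in> M\<close>, with holomorphic coefficients.
\<close>

definition jet_polynomial_near ::
    "nat \<Rightarrow> proj2 set \<Rightarrow> (nat \<Rightarrow> nat) set \<Rightarrow> (jet \<Rightarrow> complex) \<Rightarrow> proj2 \<Rightarrow> bool" where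
  "jet_polynomial_near k C M \<Phi> p \<longleftrightarrow>
     (\<exists>V z a. local_coord C V z \<and> p \<in> V \<and> (\<forall>\<mu>\<in>M. holo_fun_on V z (a \<mu>)) \<and>
        (\<forall>\<zeta> f. local_map C \<zeta> f \<and> f \<zeta> \<in> V \<longrightarrow>
           \<Phi> (jet_of k C \<zeta> f) =
             (\<Sum>\<mu>\<in>M. a \<mu> (f \<zeta>) * (\<Prod>j=1..k. (deriv ^^ j) (\<lambda>w. z (f w)) \<zeta> ^ \<mu> j))))"

text \<open>
  Functions on the jet bundle are represented by functions on the whole type that vanish
  outside it, so that equality of functions is equality on the bundle.
\<close>

definition jet_differential :: "nat \<Rightarrow> proj2 set \<Rightarrow> (jet \<Rightarrow> complex) \<Rightarrow> bool" where
  "jet_differential k C \<Phi> \<longleftrightarrow> (\<forall>u. u \<notin> jet_bundle k C \<longrightarrow> \<Phi> u = 0) \<and>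
     (\<forall>p\<in>C. \<exists>M. finite M \<and> M \<subseteq> multi_indices k \<and> jet_polynomial_near k C M \<Phi> p)"

definition GG_sections :: "nat \<Rightarrow> nat \<Rightarrow> proj2 set \<Rightarrow> (jet \<Rightarrow> complex) set" where
  "GG_sections k m C = {\<Phi>. (\<forall>u. u \<notin> jet_bundle k C \<longrightarrow> \<Phi> u = 0) \<and>
     (\<forall>p\<in>C. jet_polynomial_near k C (weighted_indices k m) \<Phi> p)}"

global_interpretation jet_fun: vector_space "\<lambda>(c :: complex) (\<Phi> :: jet \<Rightarrow> complex) u. c * \<Phi> u"
  by unfold_locales (auto simp: fun_eq_iff algebra_simps)


section \<open>The jet differentials attached to the equation of the curve\<close>

text \<open>Integer polynomials in the variables \<open>R_(i,j)\<close>, indexed by pairs of naturals.\<close>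

type_synonym int_mpoly = "((nat \<times> nat) \<Rightarrow>\<^sub>0 nat) \<Rightarrow>\<^sub>0 int"

definition eval_mpoly :: "int_mpoly \<Rightarrow> (nat \<times> nat \<Rightarrow> complex) \<Rightarrow> complex" where
  "eval_mpoly p r = (\<Sum>t\<in>Poly_Mapping.keys p. of_int (Poly_Mapping.lookup p t) *
     (\<Prod>v\<in>Poly_Mapping.keys t. r v ^ Poly_Mapping.lookup t v))"

definition mpoly_vars :: "int_mpoly \<Rightarrow> (nat \<times> nat) set" where
  "mpoly_vars p = (\<Union>t\<in>Poly_Mapping.keys p. Poly_Mapping.keys t)"

definition x_der :: "(complex \<Rightarrow> proj2) \<Rightarrow> complex \<Rightarrow> nat \<Rightarrow> complex" where
  "x_der f \<zeta> l = (deriv ^^ l) (\<lambda>w. xcoord (f w)) \<zeta>"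

definition y_der :: "(complex \<Rightarrow> proj2) \<Rightarrow> complex \<Rightarrow> nat \<Rightarrow> complex" where
  "y_der f \<zeta> l = (deriv ^^ l) (\<lambda>w. ycoord (f w)) \<zeta>"

definition partial_at :: "complex poly poly \<Rightarrow> nat \<Rightarrow> nat \<Rightarrow> proj2 \<Rightarrow> complex" where
  "partial_at R i j p = eval2 (partial i j R) (xcoord p) (ycoord p)"

text \<open>
  The common shape of the two expressions: \<open>u l\<close> are the derivatives of the local coordinate,
  \<open>D\<close> is the denominator and \<open>r\<close> the values substituted for the variables \<open>R_(i,j)\<close>.
\<close>

definition jet_expr ::
    "((nat \<Rightarrow> nat) \<Rightarrow> int_mpoly) \<Rightarrow> nat \<Rightarrow> (nat \<Rightarrow> complex) \<Rightarrow> complex \<Rightarrow> (nat \<times> nat \<Rightarrow> complex) \<Rightarrow>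
     complex" where
  "jet_expr p l u D r = u l / D +
     (\<Sum>\<mu>\<in>weighted_indices (l - 1) l. (\<Prod>j=1..l - 1. u j ^ \<mu> j) / D * eval_mpoly (p \<mu>) r)"

definition jet_expr_y ::
    "((nat \<Rightarrow> nat) \<Rightarrow> int_mpoly) \<Rightarrow> complex poly poly \<Rightarrow> nat \<Rightarrow> complex \<Rightarrow> (complex \<Rightarrow> proj2) \<Rightarrow>
     complex" where
  "jet_expr_y p R l \<zeta> f = jet_expr p l (y_der f \<zeta>) (partial_at R 1 0 (f \<zeta>))
     (\<lambda>(i, j). partial_at R i j (f \<zeta>) / partial_at R 1 0 (f \<zeta>))"

definition jet_expr_x ::
    "((nat \<Rightarrow> nat) \<Rightarrow> int_mpoly) \<Rightarrow> complex poly poly \<Rightarrow> nat \<Rightarrow> complex \<Rightarrow> (complex \<Rightarrow> proj2) \<Rightarrow>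
     complex" where
  "jet_expr_x p R l \<zeta> f = - jet_expr p l (x_der f \<zeta>) (partial_at R 0 1 (f \<zeta>))
     (\<lambda>(i, j). partial_at R j i (f \<zeta>) / partial_at R 0 1 (f \<zeta>))"


section \<open>The sections built from them\<close>

text \<open>No truncation occurs in \<open>delta\<close> for \<open>d \<ge> k + 3\<close>.\<close>

definition delta :: "nat \<Rightarrow> nat \<Rightarrow> (nat \<Rightarrow> nat) \<Rightarrow> nat" where
  "delta k d \<mu> = (\<Sum>j=1..k. \<mu> j * (d - j - 2))"

text \<open>
  The truncated subtraction \<open>\<delta> + 2 - d\<close> makes the second binomial coefficient \<open>0\<close> for
  \<open>\<delta> - d + 2 < 2\<close>.
\<close>

definition section_count :: "nat \<Rightarrow> nat \<Rightarrow> nat \<Rightarrow> int" where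
  "section_count k d m = (\<Sum>\<mu>\<in>weighted_indices k m.
     int ((delta k d \<mu> + 2) choose 2) - int ((delta k d \<mu> + 2 - d) choose 2))"

definition admissible :: "nat \<Rightarrow> nat \<Rightarrow> nat \<Rightarrow> ((nat \<Rightarrow> nat) \<Rightarrow> complex poly poly) \<Rightarrow> bool" where
  "admissible k d m G \<longleftrightarrow> (\<forall>\<mu>\<in>weighted_indices k m. G \<mu> \<in> polys_le (delta k d \<mu>))"

text \<open>
  The expression in \<open>x, y\<close> makes sense over the affine part of the curve only; the global section
  defined by it is the section agreeing with it there.
\<close>

definition section_given_by ::
    "nat \<Rightarrow> nat \<Rightarrow> proj2 set \<Rightarrow> (nat \<Rightarrow> jet \<Rightarrow> complex) \<Rightarrow> ((nat \<Rightarrow> nat) \<Rightarrow> complex poly poly) \<Rightarrow>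
     (jet \<Rightarrow> complex) \<Rightarrow> bool" where
  "section_given_by k m C J G \<Phi> \<longleftrightarrow> \<Phi> \<in> GG_sections k m C \<and>
     (\<forall>\<zeta> f. local_map C \<zeta> f \<and> f \<zeta> \<in> affine_plane \<longrightarrow>
        \<Phi> (jet_of k C \<zeta> f) =
          (\<Sum>\<mu>\<in>weighted_indices k m. (\<Prod>l=1..k. J l (jet_of l C \<zeta> f) ^ \<mu> l) *
             eval2 (G \<mu>) (xcoord (f \<zeta>)) (ycoord (f \<zeta>))))"

end

theory Submission
  imports Defs
begin

text \<open>
  Along the curve put \<open>J = y' / R_x = - x' / R_y\<close>. The jet differential of order \<open>\<lambda>\<close> is the derivative of
  order \<open>\<lambda> - 1\<close> of \<open>J\<close>, except that for \<open>\<lambda> = 3\<close> a multiple of \<open>J^3\<close> is added to match the given example. At a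
  point at infinity, in the coordinate \<open>t = T / X\<close>, one has \<open>J = t' t^(d-3) k(t)\<close> with \<open>k\<close> holomorphic, so
  the jet differential of order \<open>\<lambda>\<close> vanishes there to order \<open>d - \<lambda> - 2\<close>, and \<open>\<delta>\<close> is precisely the order
  of the pole which \<open>G\<close> may have.

  At an affine point the values of the jet differentials can be prescribed arbitrarily, so a
  vanishing combination has all its coefficients \<open>G\<close> vanishing on the curve. Since \<open>R\<close> is monic in \<open>y\<close>
  up to a constant, \<open>G\<close> can be divided by \<open>R\<close>; the remainder has \<open>y\<close>-degree less than \<open>d\<close> and vanishes at
  the \<open>d\<close> distinct zeros of \<open>R x \<sqdot>\<close> for large \<open>x\<close>, so it is zero. The monomials \<open>x^i y^j\<close> with
  \<open>i + j \<le> \<delta>\<close> and \<open>j < d\<close> are therefore a basis of the quotient.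

  For the asymptotics, the sum of \<open>\<mu>_j\<close> over the multi-indices of weight \<open>n\<close> is
  \<open>n^\<kappa> / (j \<kappa>! \<kappa>!) + O(n^(\<kappa>-1))\<close>; summation over \<open>j\<close> produces the harmonic number of \<open>\<kappa>\<close>.
\<close>

subsection \<open>Bivariate polynomials\<close>

text \<open>One family of integer polynomials has to serve both affine charts. The derivatives are
  therefore computed for an abstract array \<open>A\<close> of functions along a curve, in a setting
  invariant under exchanging x and y, so that the two expressions differ by a sign only. Each
  differentiation costs one power of t by the product rule, which is why d - 3 drops to d -
  \<lambda> - 2; the hypothesis d \<ge> \<kappa> + 3 keeps this exponent positive. The correction of
  order 3 respects it: its factor has degree at most 2d - 4, and 3(d - 3) - (2d - 4) = d - 5. A
  formula in x, y says nothing at infinity, so a section must be extended there. Existence comes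
  from the adapted coordinates. Uniqueness comes from continuity along the map, except when the map
  is constant at a point at infinity; there the positive weight m forces the value 0. For large m
  one has \<delta> \<ge> d, and the difference of the binomials becomes d \<delta> + d(3 - d)/2. It
  is linear in the multi-index, so that only the sums of its components have to be
  estimated.\<close>

lemma eval2_0 [simp]: "eval2 0 x y = 0"
  by (simp add: eval2_def)

lemma eval2_pCons [simp]: "eval2 (pCons p P) x y = poly p x + y * eval2 P x y"
  by (simp add: eval2_def)

lemma eval2_add [simp]: "eval2 (P + Q) x y = eval2 P x y + eval2 Q x y"
  by (simp add: eval2_def)

lemma eval2_diff [simp]: "eval2 (P - Q) x y = eval2 P x y - eval2 Q x y"
  by (simp add: eval2_def)

lemma eval2_minus [simp]: "eval2 (- P) x y = - eval2 P x y"
  by (simp add: eval2_def)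

lemma eval2_mult [simp]: "eval2 (P * Q) x y = eval2 P x y * eval2 Q x y"
  by (simp add: eval2_def)

lemma eval2_smult [simp]: "eval2 (smult p Q) x y = poly p x * eval2 Q x y"
  by (simp add: eval2_def)

lemma eval2_sum: "eval2 (\<Sum>i\<in>A. P i) x y = (\<Sum>i\<in>A. eval2 (P i) x y)"
  by (induction A rule: infinite_finite_induct) auto

lemma eval2_monom [simp]: "eval2 (monom p j) x y = poly p x * y ^ j"
  by (simp add: eval2_def poly_monom poly_power)

lemma finite_pairs_sum_le [simp]: "finite {(i::nat, j). i + j \<le> d}"
  by (rule finite_subset[of _ "{..d} \<times> {..d}"]) auto

text \<open>The exponents of the nonzero coefficients form a finite set, so the \<open>Max\<close>
  in \<open>total_degree\<close> is a true maximum and the bound can be tested coefficient by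
  coefficient.\<close>

lemma mem_polys_le: "P \<in> polys_le d \<longleftrightarrow> (\<forall>i j. coeff (coeff P j) i \<noteq> 0 \<longrightarrow> i + j \<le> d)"
proof -
  have "finite {i + j | i j. coeff (coeff P j) i \<noteq> 0}"
  proof (rule finite_subset)
    show "{i + j | i j. coeff (coeff P j) i \<noteq> 0}
        \<subseteq> (\<lambda>(i, j). i + j) ` (Sigma {..degree P} (\<lambda>j. {..degree (coeff P j)}) )\<inverse>"
    proof safe
      fix i j assume "coeff (coeff P j) i \<noteq> 0"
      moreover from this have "coeff P j \<noteq> 0" by auto
      ultimately have "j \<le> degree P" "i \<le> degree (coeff P j)"
        by (auto intro: le_degree)
      then show "i + j \<in> (\<lambda>(i, j). i + j) ` (Sigma {..degree P} (\<lambda>j. {..degree (coeff P j)}) )\<inverse>"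
        by (intro image_eqI[of _ _ "(i, j)"]) auto
    qed
  qed auto
  then show ?thesis
    unfolding polys_le_def total_degree_def by auto
qed

lemma polys_le_0 [simp]: "0 \<in> polys_le d"
  by (simp add: mem_polys_le)

lemma polys_le_add: "P \<in> polys_le d \<Longrightarrow> Q \<in> polys_le d \<Longrightarrow> P + Q \<in> polys_le d"
  unfolding mem_polys_le by (metis add.right_neutral coeff_add)

lemma polys_le_smult: "P \<in> polys_le d \<Longrightarrow> smult [:c:] P \<in> polys_le d"
  unfolding mem_polys_le by auto

lemma polys_le_minus: "P \<in> polys_le d \<Longrightarrow> - P \<in> polys_le d"
  unfolding mem_polys_le by simp

lemma polys_le_diff: "P \<in> polys_le d \<Longrightarrow> Q \<in> polys_le d \<Longrightarrow> P - Q \<in> polys_le d"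
  using polys_le_add[of P d "- Q"] polys_le_minus by simp

lemma polys_le_mono: "P \<in> polys_le d \<Longrightarrow> d \<le> e \<Longrightarrow> P \<in> polys_le e"
  unfolding mem_polys_le by (meson order_trans)

lemma polys_le_sum: "(\<And>i. i \<in> A \<Longrightarrow> P i \<in> polys_le d) \<Longrightarrow> (\<Sum>i\<in>A. P i) \<in> polys_le d"
  by (induction A rule: infinite_finite_induct) (auto intro: polys_le_add)

lemma polys_le_mult:
  assumes "P \<in> polys_le a" "Q \<in> polys_le b"
  shows "P * Q \<in> polys_le (a + b)"
  unfolding mem_polys_le
proof safe
  fix i j assume "coeff (coeff (P * Q) j) i \<noteq> 0"
  then have "(\<Sum>n\<le>j. \<Sum>k\<le>i. coeff (coeff P n) k * coeff (coeff Q (j - n)) (i - k)) \<noteq> 0"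
    by (simp add: coeff_mult coeff_sum)
  then obtain n where n: "n \<le> j"
    "(\<Sum>k\<le>i. coeff (coeff P n) k * coeff (coeff Q (j - n)) (i - k)) \<noteq> 0"
    by (meson atMost_iff sum.not_neutral_contains_not_neutral)
  then obtain k where k: "k \<le> i" "coeff (coeff P n) k * coeff (coeff Q (j - n)) (i - k) \<noteq> 0"
    by (meson atMost_iff sum.not_neutral_contains_not_neutral)
  with assms have "k + n \<le> a" "i - k + (j - n) \<le> b"
    unfolding mem_polys_le by (blast dest: mult_eq_0_iff[THEN iffD2, OF disjI1] mult_eq_0_iff[THEN iffD2, OF disjI2])+
  with n k show "i + j \<le> a + b" by linarith
qed

lemma polys_le_monom:
  "(\<And>i. coeff p i \<noteq> 0 \<Longrightarrow> i + j \<le> d) \<Longrightarrow> monom p j \<in> polys_le d"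
  unfolding mem_polys_le by auto

lemma poly_poly_eqI: "(\<And>i j. coeff (coeff P j) i = coeff (coeff Q j) i) \<Longrightarrow> P = Q"
  by (intro poly_eqI)

lemma polys_le_expand:
  assumes "P \<in> polys_le d"
  shows "P = (\<Sum>(i, j)\<in>{(i, j). i + j \<le> d}. smult [:coeff (coeff P j) i:] (monom (monom 1 i) j))"
    (is "_ = ?S")
proof (rule poly_poly_eqI)
  fix i j
  have "coeff (coeff ?S j) i = (\<Sum>p\<in>{(i, j). i + j \<le> d}. if p = (i, j) then coeff (coeff P j) i else 0)"
    unfolding coeff_sum by (intro sum.cong) (auto split: prod.splits)
  also have "\<dots> = coeff (coeff P j) i"
    using assms by (subst sum.delta) (auto simp: mem_polys_le)
  finally show "coeff (coeff P j) i = coeff (coeff ?S j) i" by simp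
qed

lemma eval2_polys_le:
  assumes "P \<in> polys_le d"
  shows "eval2 P x y = (\<Sum>(i, j)\<in>{(i, j). i + j \<le> d}. coeff (coeff P j) i * x ^ i * y ^ j)"
  by (subst polys_le_expand[OF assms])
    (simp add: eval2_sum case_prod_unfold poly_monom mult.assoc)

text \<open>Division in y by a polynomial with constant leading coefficient. Total degrees do not
  grow: the coefficient of y^n in \<open>G\<close> has x-degree at most e - n, so the quotient term
  \<open>T\<close> has total degree at most e - d. For e < d nothing is divided and Q = 0.\<close>

lemma division_by_monic_in_y:
  assumes R: "R \<in> polys_le d" "coeff R d = [:c:]" "c \<noteq> 0" and G: "G \<in> polys_le e"
  shows "\<exists>Q S. G = R * Q + S \<and> S \<in> polys_le e \<and> (\<forall>j\<ge>d. coeff S j = 0) \<and>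
           (if d \<le> e then Q \<in> polys_le (e - d) else Q = 0)"
  using G
proof (induction "degree G" arbitrary: G rule: less_induct)
  case less
  show ?case
  proof (cases "\<forall>j\<ge>d. coeff G j = 0")
    case True
    then show ?thesis
      using less.prems by (intro exI[of _ 0] exI[of _ G]) auto
  next
    case False
    then obtain j where j: "d \<le> j" "coeff G j \<noteq> 0" by auto
    then have nz: "G \<noteq> 0" and n: "d \<le> degree G"
      using le_degree[OF j(2)] by auto
    define n where "n = degree G"
    have "coeff G n \<noteq> 0" using nz by (simp add: n_def)
    then obtain i where "coeff (coeff G n) i \<noteq> 0"
      by (meson leading_coeff_0_iff)
    then have ne: "n \<le> e" using less.prems unfolding mem_polys_le by force
    define T where "T = monom (smult (1 / c) (coeff G n)) (n - d)"
    have T: "T \<in> polys_le (e - d)"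
      unfolding T_def
    proof (rule polys_le_monom)
      fix i assume "coeff (smult (1 / c) (coeff G n)) i \<noteq> 0"
      then have "i + n \<le> e" using less.prems unfolding mem_polys_le by simp
      then show "i + (n - d) \<le> e - d" using n by (simp add: n_def)
    qed
    define G' where "G' = G - R * T"
    have RT: "R * T \<in> polys_le e"
      using polys_le_mult[OF R(1) T] n ne by (simp add: n_def)
    then have G': "G' \<in> polys_le e"
      unfolding G'_def by (rule polys_le_diff[OF less.prems])
    have Rdeg: "coeff R j = 0" if "j > d" for j
      using R(1) that unfolding mem_polys_le
      by (metis add.commute leD leading_coeff_0_iff trans_less_add1)
    have RTc: "coeff (R * T) j = (if j < n - d then 0 else smult (1 / c) (coeff G n) * coeff R (j - (n - d)))" for j
      unfolding T_def mult.commute[of R] by (simp add: coeff_monom_mult)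
    have "coeff G' j = 0" if "j \<ge> n" for j
    proof (cases "j = n")
      case True
      then show ?thesis using n R by (simp add: G'_def RTc n_def)
    next
      case False
      with that have "coeff G j = 0" by (simp add: n_def coeff_eq_0)
      moreover have "coeff R (j - (n - d)) = 0" using False that n by (intro Rdeg) (simp add: n_def)
      ultimately show ?thesis using that by (simp add: G'_def RTc)
    qed
    then have "G' = 0 \<or> degree G' < n"
      by (metis leading_coeff_0_iff not_le)
    then have "\<exists>Q S. G' = R * Q + S \<and> S \<in> polys_le e \<and> (\<forall>j\<ge>d. coeff S j = 0) \<and>
           (if d \<le> e then Q \<in> polys_le (e - d) else Q = 0)"
    proof
      assume "G' = 0"
      then show ?thesis by (intro exI[of _ 0] exI[of _ 0]) auto
    next
      assume "degree G' < n"
      then show ?thesis using less.hyps[OF _ G'] by (simp add: n_def)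
    qed
    then obtain Q S where "G' = R * Q + S" "S \<in> polys_le e" "\<forall>j\<ge>d. coeff S j = 0"
      "if d \<le> e then Q \<in> polys_le (e - d) else Q = 0" by blast
    then show ?thesis
      using T n ne by (intro exI[of _ "Q + T"] exI[of _ S])
        (auto simp: G'_def algebra_simps n_def intro: polys_le_add)
  qed
qed

section \<open>Partial derivatives of bivariate polynomials\<close>

lemma partial_0_0 [simp]: "partial 0 0 P = P"
  by (simp add: partial_def)

lemma partial_Suc_left: "partial (Suc i) j P = map_poly pderiv (partial i j P)"
  by (simp add: partial_def)

lemma pderiv_map_poly_pderiv:
  "pderiv (map_poly pderiv P) = map_poly pderiv (pderiv (P :: complex poly poly))"
  by (intro poly_poly_eqI) (simp add: coeff_map_poly coeff_pderiv of_nat_poly)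

lemma partial_Suc_right: "partial i (Suc j) P = pderiv (partial i j P)"
proof -
  have "(map_poly pderiv ^^ i) (pderiv Q) = pderiv ((map_poly pderiv ^^ i) Q)" for Q :: "complex poly poly"
    by (induction i) (simp_all add: pderiv_map_poly_pderiv)
  then show ?thesis by (simp add: partial_def)
qed

lemma polys_le_partial: "P \<in> polys_le d \<Longrightarrow> partial i j P \<in> polys_le (d - (i + j))"
proof (induction i)
  case 0
  then show ?case
  proof (induction j)
    case (Suc j)
    then have "partial 0 j P \<in> polys_le (d - j)" by simp
    then show ?case
      unfolding partial_Suc_right mem_polys_le
    proof (intro allI impI)
      fix k l assume "coeff (coeff (pderiv (partial 0 j P)) l) k \<noteq> 0"
      then have "coeff (coeff (partial 0 j P) (Suc l)) k \<noteq> 0"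
        by (auto simp: coeff_pderiv of_nat_poly)
      with \<open>partial 0 j P \<in> polys_le (d - j)\<close> have "k + Suc l \<le> d - j"
        unfolding mem_polys_le by blast
      then show "k + l \<le> d - (0 + Suc j)" by linarith
    qed
  qed auto
next
  case (Suc i)
  then have *: "coeff (coeff (partial i j P) l) k \<noteq> 0 \<Longrightarrow> k + l \<le> d - (i + j)" for k l
    unfolding mem_polys_le by auto
  show ?case
    unfolding partial_Suc_left mem_polys_le
  proof (intro allI impI)
    fix k l assume "coeff (coeff (map_poly pderiv (partial i j P)) l) k \<noteq> 0"
    then have "coeff (coeff (partial i j P) l) (Suc k) \<noteq> 0"
      by (auto simp: coeff_map_poly coeff_pderiv)
    from *[OF this] show "k + l \<le> d - (Suc i + j)" by linarith
  qed
qed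

lemma has_derivative_eval2:
  "((\<lambda>p. eval2 P (fst p) (snd p)) has_derivative
     (\<lambda>h. eval2 (partial 1 0 P) (fst p) (snd p) * fst h + eval2 (partial 0 1 P) (fst p) (snd p) * snd h))
     (at p)"
proof (induction P)
  case (pCons q P)
  have q: "((\<lambda>p. poly q (fst p)) has_derivative (\<lambda>h. poly (pderiv q) (fst p) * fst h)) (at p)"
    by (rule has_derivative_compose[OF has_derivative_fst[OF has_derivative_ident],
          of "poly q" "\<lambda>h. poly (pderiv q) (fst p) * h"])
       (use poly_DERIV[of q "fst p"] in \<open>simp add: has_field_derivative_def\<close>)
  show ?case
    using has_derivative_add[OF q has_derivative_mult[OF has_derivative_snd[OF has_derivative_ident] pCons.IH]]
    by (simp add: partial_def pderiv_pCons map_poly_pCons algebra_simps)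
qed (simp add: partial_def)

lemma DERIV_eval2:
  assumes "(x has_field_derivative x') (at w)" "(y has_field_derivative y') (at w)"
  shows "((\<lambda>w. eval2 P (x w) (y w)) has_field_derivative
           (eval2 (partial 1 0 P) (x w) (y w) * x' + eval2 (partial 0 1 P) (x w) (y w) * y')) (at w)"
proof (induction P)
  case (pCons q P)
  have "((\<lambda>w. poly q (x w)) has_field_derivative poly (pderiv q) (x w) * x') (at w)"
    by (rule DERIV_chain2[OF poly_DERIV assms(1)])
  from DERIV_add[OF this DERIV_mult[OF assms(2) pCons.IH]] show ?case
    by (simp add: partial_def pderiv_pCons map_poly_pCons algebra_simps)
qed (simp add: partial_def)

lemma continuous_on_eval2 [continuous_intros]:
  assumes "continuous_on S f" "continuous_on S g"
  shows "continuous_on S (\<lambda>w. eval2 P (f w) (g w))"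
proof (induction P)
  case (pCons q P)
  then show ?case using assms by (auto intro!: continuous_intros)
qed auto

lemma holomorphic_on_eval2 [holomorphic_intros]:
  assumes "f holomorphic_on S" "g holomorphic_on S"
  shows "(\<lambda>w. eval2 P (f w) (g w)) holomorphic_on S"
proof (induction P)
  case (pCons q P)
  have "(\<lambda>w. poly q (f w)) holomorphic_on S"
    using assms(1) by (rule holomorphic_on_compose_gen[of _ _ "poly q" UNIV, unfolded o_def])
      (auto intro!: holomorphic_intros)
  then show ?case using pCons assms by (auto intro!: holomorphic_intros)
qed auto

text \<open>The dehomogenization of a ternary form at \<open>X = 1\<close>, in the variables \<open>T\<close> (inner) and \<open>Y\<close> (outer).\<close>

definition infpoly :: "nat \<Rightarrow> (nat \<Rightarrow> nat \<Rightarrow> complex) \<Rightarrow> complex poly poly" where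
  "infpoly d a = (\<Sum>(i, j)\<in>{(i, j). i + j \<le> d}. monom (monom (a i j) (d - i - j)) j)"

lemma coeff_infpoly:
  "coeff (coeff (infpoly d a) j) i = (if i + j \<le> d then a (d - i - j) j else 0)"
proof -
  have "coeff (coeff (infpoly d a) j) i =
      (\<Sum>p\<in>{(i, j). i + j \<le> d}. if p = (d - i - j, j) then (if i + j \<le> d then a (d - i - j) j else 0) else 0)"
    unfolding infpoly_def coeff_sum by (intro sum.cong) (auto split: prod.splits)
  also have "\<dots> = (if i + j \<le> d then a (d - i - j) j else 0)"
    by (subst sum.delta) auto
  finally show ?thesis .
qed

lemma eval2_infpoly: "eval2 (infpoly d a) t s = form d a t 1 s"
  unfolding infpoly_def form_def
  by (simp add: eval2_sum case_prod_unfold poly_monom mult.assoc)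

definition hompoly :: "nat \<Rightarrow> complex poly poly \<Rightarrow> complex poly poly" where
  "hompoly d P = infpoly d (\<lambda>i j. coeff (coeff P j) i)"

lemma form_coeffs:
  assumes "P \<in> polys_le d" "t \<noteq> 0"
  shows "form d (\<lambda>i j. coeff (coeff P j) i) t u v = t ^ d * eval2 P (u / t) (v / t)"
  unfolding form_def eval2_polys_le[OF assms(1)] sum_distrib_left
proof (intro sum.cong refl, clarify)
  fix i j :: nat assume "i + j \<le> d"
  then have "t ^ d = t ^ (d - i - j) * t ^ i * t ^ j"
    by (simp flip: power_add)
  then show "coeff (coeff P j) i * t ^ (d - i - j) * u ^ i * v ^ j =
      t ^ d * (coeff (coeff P j) i * (u / t) ^ i * (v / t) ^ j)"
    using assms(2) by (simp add: power_divide)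
qed

lemma eval2_hompoly:
  "P \<in> polys_le d \<Longrightarrow> t \<noteq> 0 \<Longrightarrow> eval2 (hompoly d P) t s = t ^ d * eval2 P (1 / t) (s / t)"
  unfolding hompoly_def eval2_infpoly by (rule form_coeffs)

text \<open>The affine variable y and the chart variable s both come from the homogeneous coordinate
  Y, so differentiation by it commutes with homogenization at the cost of one degree.\<close>

lemma pderiv_hompoly:
  assumes "d \<ge> 1" shows "partial 0 1 (hompoly d P) = hompoly (d - 1) (partial 0 1 P)"
proof (rule poly_poly_eqI)
  fix i j
  have "d - i - Suc j = d - 1 - i - j" by simp
  then show "coeff (coeff (partial 0 1 (hompoly d P)) j) i = coeff (coeff (hompoly (d - 1) (partial 0 1 P)) j) i"
    using assms by (auto simp: hompoly_def partial_def coeff_pderiv coeff_infpoly of_nat_poly)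
qed

section \<open>The points at infinity as roots of a polynomial in one variable\<close>

lemma eval2_infpoly_0:
  "eval2 (infpoly d a) 0 s = poly (\<Sum>j\<le>d. monom (a (d - j) j) j) s"
proof -
  have "eval2 (infpoly d a) 0 s = (\<Sum>(i, j)\<in>{(i, j). i + j \<le> d}. if i = d - j then a (d - j) j * s ^ j else 0)"
    unfolding infpoly_def eval2_sum by (intro sum.cong) (auto simp: poly_monom power_0_left)
  also have "\<dots> = (\<Sum>(i, j)\<in>(\<lambda>j. (d - j, j)) ` {..d}. a (d - j) j * s ^ j)"
    by (intro sum.mono_neutral_cong_right) auto
  also have "\<dots> = (\<Sum>j\<le>d. a (d - j) j * s ^ j)"
    by (subst sum.reindex) (auto simp: inj_on_def)
  finally show ?thesis by (simp add: poly_sum poly_monom)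
qed

text \<open>Both sides are derivatives of the same function of \<open>s\<close>; uniqueness of the
  derivative replaces a comparison of coefficients.\<close>

lemma partial_infpoly_0:
  "eval2 (partial 0 1 (infpoly d a)) 0 s = poly (pderiv (\<Sum>j\<le>d. monom (a (d - j) j) j)) s"
proof -
  have "((\<lambda>s. eval2 (infpoly d a) 0 s) has_field_derivative eval2 (partial 0 1 (infpoly d a)) 0 s) (at s)"
    using DERIV_eval2[of "\<lambda>_. 0" 0 s "\<lambda>s. s" 1 "infpoly d a"] by simp
  moreover have "((\<lambda>s. eval2 (infpoly d a) 0 s) has_field_derivative
       poly (pderiv (\<Sum>j\<le>d. monom (a (d - j) j) j)) s) (at s)"
    unfolding eval2_infpoly_0 by (rule poly_DERIV)
  ultimately show ?thesis by (rule DERIV_unique)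
qed

text \<open>Dividing \<open>q\<close> by the linear factor of a double root would lose no root,
  leaving d roots for a polynomial of degree less than d.\<close>

lemma pderiv_nonzero_if_many_roots:
  fixes q :: "complex poly"
  assumes "q \<noteq> 0" "degree q \<le> d" "card {s. poly q s = 0} = d" "poly q s = 0"
  shows "poly (pderiv q) s \<noteq> 0"
proof
  assume *: "poly (pderiv q) s = 0"
  obtain r where r: "q = [:-s, 1:] * r"
    using assms(4) by (auto simp: poly_eq_0_iff_dvd)
  with assms have rnz: "r \<noteq> 0" by auto
  have "poly r s = 0" using * unfolding r pderiv_mult by (simp add: pderiv_pCons)
  then have "{s. poly q s = 0} \<subseteq> {s. poly r s = 0}" by (auto simp: r)
  then have "d \<le> card {s. poly r s = 0}"
    using assms(3) card_mono[OF poly_roots_finite[OF rnz]] by metis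
  also have "\<dots> \<le> degree r" by (rule card_poly_roots_bound[OF rnz])
  also have "degree r < d"
    using assms(2) rnz unfolding r by (subst (asm) degree_mult_eq) auto
  finally show False by simp
qed

lemma infpoly_simple_roots:
  assumes "\<exists>j\<le>d. a (d - j) j \<noteq> 0" "card {s. eval2 (infpoly d a) 0 s = 0} = d"
    "eval2 (infpoly d a) 0 s = 0"
  shows "eval2 (partial 0 1 (infpoly d a)) 0 s \<noteq> 0"
proof -
  let ?q = "\<Sum>j\<le>d. monom (a (d - j) j) j"
  have c: "coeff ?q j = (if j \<le> d then a (d - j) j else 0)" for j
    by (simp add: coeff_sum if_distrib cong: if_cong)
  have "?q \<noteq> 0" using assms(1) c by (metis coeff_0)
  moreover have "degree ?q \<le> d" by (rule degree_le) (simp add: c)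
  ultimately show ?thesis
    using assms(2,3) unfolding eval2_infpoly_0 partial_infpoly_0
    by (intro pderiv_nonzero_if_many_roots) auto
qed

text \<open>Without the term Y^d the restriction to the line at infinity would have degree less than
  d and too few roots. Applied to \<open>R\<close> this says that \<open>R\<close> is monic in y up
  to a constant.\<close>

lemma infpoly_top_coeff:
  assumes "\<exists>j\<le>d. a (d - j) j \<noteq> 0" "card {s. eval2 (infpoly d a) 0 s = 0} = d"
  shows "a 0 d \<noteq> 0"
proof
  assume 0: "a 0 d = 0"
  let ?q = "\<Sum>j\<le>d. monom (a (d - j) j) j"
  have c: "coeff ?q j = (if j \<le> d then a (d - j) j else 0)" for j
    by (simp add: coeff_sum if_distrib cong: if_cong)
  have nz: "?q \<noteq> 0" using assms(1) c by (metis coeff_0)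
  have "degree ?q < d"
  proof -
    have "degree ?q \<noteq> d"
      using nz c[of d] 0 by (metis diff_self_eq_0 leading_coeff_0_iff order_refl)
    moreover have "degree ?q \<le> d" by (rule degree_le) (simp add: c)
    ultimately show ?thesis by simp
  qed
  then show False
    using card_poly_roots_bound[OF nz] assms(2) unfolding eval2_infpoly_0 by simp
qed

subsection \<open>The holomorphic implicit function theorem in two variables\<close>

text \<open>The real inverse function theorem is applied to (u, v) \<mapsto> (H (u, v), v). It
  yields only a real derivative of \<open>g\<close>; differentiating H (g v, v) = 0 shows that this
  derivative is multiplication by -B/A, hence complex linear.\<close>

lemma holomorphic_implicit_function:
  fixes H A B :: "complex \<times> complex \<Rightarrow> complex"
  assumes H: "\<And>p. (H has_derivative (\<lambda>h. A p * fst h + B p * snd h)) (at p)"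
    and A: "continuous_on UNIV A" and B: "continuous_on UNIV B"
    and p0: "H (u0, v0) = 0" "A (u0, v0) \<noteq> 0"
  shows "\<exists>U N g. open U \<and> (u0, v0) \<in> U \<and> open N \<and> v0 \<in> N \<and> g holomorphic_on N \<and> g v0 = u0 \<and>
           {p \<in> U. H p = 0} = (\<lambda>v. (g v, v)) ` N \<and> (\<forall>p\<in>U. A p \<noteq> 0)"
proof -
  define F where "F = (\<lambda>p. (H p, snd p))"
  define L where "L = (\<lambda>p h. (A p * fst h + B p * snd h, snd h) :: complex \<times> complex)"
  have bl: "bounded_linear (L p)" for p
    unfolding L_def
    by (intro bounded_linear_Pair bounded_linear_add bounded_linear_mult_const bounded_linear_const_mult
        bounded_linear_fst bounded_linear_snd)
  define F' where "F' = (\<lambda>p. Blinfun (L p))"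
  have F'[simp]: "blinfun_apply (F' p) = L p" for p
    unfolding F'_def by (rule bounded_linear_Blinfun_apply[OF bl])
  have derF: "(F has_derivative blinfun_apply (F' p)) (at p)" for p
    unfolding F_def F' L_def by (intro has_derivative_Pair H has_derivative_snd has_derivative_ident)
  have contF: "continuous_on UNIV F'"
  proof (rule continuous_on_blinfun_componentwise)
    fix i :: "complex \<times> complex"
    show "continuous_on UNIV (\<lambda>p. blinfun_apply (F' p) i)"
      unfolding F' L_def by (intro continuous_intros A B)
  qed
  define a b where "a = A (u0, v0)" and "b = B (u0, v0)"
  \<comment> \<open>The inverse of the linear map \<open>L (u0, v0)\<close>.\<close>
  define M where "M = (\<lambda>h. ((fst h - b * snd h) * inverse a, snd h) :: complex \<times> complex)"
  have blM: "bounded_linear M"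
    unfolding M_def
    by (intro bounded_linear_Pair bounded_linear_sub bounded_linear_mult_const bounded_linear_const_mult
        bounded_linear_fst bounded_linear_snd)
  have inv: "Blinfun M o\<^sub>L F' (u0, v0) = id_blinfun"
    by (rule blinfun_eqI)
      (use p0 in \<open>simp add: bounded_linear_Blinfun_apply[OF blM], simp add: M_def L_def a_def b_def prod_eq_iff\<close>)
  obtain U' V G G' where U': "open U'" "(u0, v0) \<in> U'" and V: "open V" "F (u0, v0) \<in> V"
    and hom: "homeomorphism U' V F G"
    and derG: "\<And>y. y \<in> V \<Longrightarrow> (G has_derivative (G' y)) (at y)"
    by (rule inverse_function_theorem[OF open_UNIV derF contF UNIV_I inv]) blast
  \<comment> \<open>Shrinking keeps \<open>A\<close> nonzero on all of \<open>U\<close>, so that the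
    relation for the derivative of \<open>g\<close> can be solved at every point of
    \<open>N\<close>.\<close>
  define U where "U = U' \<inter> {p. A p \<noteq> 0}"
  define g where "g = (\<lambda>v. fst (G (0, v)))"
  define N where "N = {v. (0, v) \<in> F ` U}"
  have "open {p. A p \<noteq> 0}"
    using open_Collect_neq[OF A continuous_on_const[of UNIV 0]] by simp
  then have oU: "open U" unfolding U_def using U' by blast
  have UU: "U \<subseteq> U'" by (auto simp: U_def)
  have FU: "F ` U \<subseteq> V" using hom UU by (auto simp: homeomorphism_def)
  have "openin (top_of_set V) (F ` U)"
    using homeomorphism_imp_open_map[OF hom, of U] oU UU by (metis open_subset)
  then have oFU: "open (F ` U)" using V by (metis openin_open_trans)
  have "N = (\<lambda>v. (0, v)) -` (F ` U)" by (auto simp: N_def)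
  moreover have "continuous_on UNIV (\<lambda>v :: complex. (0 :: complex, v))"
    by (intro continuous_intros)
  ultimately have oN: "open N"
    using open_vimage[OF oFU] by metis
  have GU: "G (F p) = p" if "p \<in> U" for p using hom UU that by (auto simp: homeomorphism_def)
  have u0: "(u0, v0) \<in> U" using U' p0 by (auto simp: U_def)
  have F0: "F (u0, v0) = (0, v0)" using p0 by (simp add: F_def)
  have v0: "v0 \<in> N" unfolding N_def using u0 F0 by (metis (mono_tags) image_eqI mem_Collect_eq)
  have Gv: "G (0, v) = (g v, v) \<and> (g v, v) \<in> U \<and> H (g v, v) = 0" if "v \<in> N" for v
  proof -
    from that obtain p where p: "p \<in> U" "F p = (0, v)" unfolding N_def by auto
    then have "G (0, v) = p" using GU by metis
    with p show ?thesis by (cases p) (auto simp: F_def g_def)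
  qed
  have set_eq: "{p \<in> U. H p = 0} = (\<lambda>v. (g v, v)) ` N"
  proof safe
    fix u v assume p: "(u, v) \<in> U" "H (u, v) = 0"
    then have "(0, v) \<in> F ` U" by (auto simp: F_def intro!: image_eqI[of _ _ "(u, v)"])
    then have v: "v \<in> N" by (simp add: N_def)
    have "G (0, v) = (u, v)" using GU[OF p(1)] p by (simp add: F_def)
    then show "(u, v) \<in> (\<lambda>v. (g v, v)) ` N" using v Gv[OF v] by auto
  qed (use Gv in auto)
  have "g field_differentiable (at v)" if v: "v \<in> N" for v
  proof -
    have "(0, v) \<in> V" using v FU by (auto simp: N_def)
    then have G': "(G has_derivative G' (0, v)) (at (0, v))" by (rule derG)
    have "((\<lambda>v. (0, v)) has_derivative (\<lambda>h. (0, h))) (at v)"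
      by (intro has_derivative_Pair has_derivative_const has_derivative_ident)
    from has_derivative_compose[OF this G']
    have "((\<lambda>v. G (0, v)) has_derivative (\<lambda>h. G' (0, v) (0, h))) (at v)" .
    then have dg: "(g has_derivative (\<lambda>h. fst (G' (0, v) (0, h)))) (at v)"
      unfolding g_def by (rule has_derivative_fst)
    define D where "D = (\<lambda>h. fst (G' (0, v) (0, h)))"
    have "((\<lambda>v. (g v, v)) has_derivative (\<lambda>h. (D h, h))) (at v)"
      using dg unfolding D_def by (intro has_derivative_Pair has_derivative_ident)
    from has_derivative_compose[OF this H]
    have "((\<lambda>v. H (g v, v)) has_derivative (\<lambda>h. A (g v, v) * D h + B (g v, v) * h)) (at v)"
      by simp
    moreover have "((\<lambda>v. H (g v, v)) has_derivative (\<lambda>h. 0)) (at v)"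
      using Gv v oN by (intro has_derivative_transform_within_open[OF has_derivative_const[of 0] oN v]) auto
    ultimately have "(\<lambda>h. A (g v, v) * D h + B (g v, v) * h) = (\<lambda>h. 0)"
      by (rule has_derivative_unique)
    then have "A (g v, v) * D h + B (g v, v) * h = 0" for h by metis
    moreover have "A (g v, v) \<noteq> 0" using Gv[OF v] by (auto simp: U_def)
    ultimately have "D h = (- B (g v, v) / A (g v, v)) * h" for h
      by (simp add: field_simps add_eq_0_iff)
    then have "D = (*) (- B (g v, v) / A (g v, v))" by (rule ext)
    with dg show ?thesis unfolding field_differentiable_def has_field_derivative_def D_def by auto
  qed
  then have "g holomorphic_on N"
    unfolding holomorphic_on_def by (blast intro: field_differentiable_at_within)
  moreover have "g v0 = u0" using GU[OF u0] F0 by (simp add: g_def)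
  ultimately show ?thesis
    using oU u0 oN v0 set_eq by (intro exI[of _ U] exI[of _ N] exI[of _ g]) (auto simp: U_def)
qed

subsection \<open>Points and charts of the projective plane\<close>

lemma proj_rel_refl: "v \<noteq> (0, 0, 0) \<Longrightarrow> proj_rel v v"
  unfolding proj_rel_def by (intro conjI exI[of _ 1]) auto

lemma abs_proj2_eq_iff:
  assumes "u \<noteq> (0, 0, 0)" "v \<noteq> (0, 0, 0)"
  shows "abs_proj2 u = abs_proj2 v \<longleftrightarrow> proj_rel u v"
  using Quotient3_rel[OF Quotient3_proj2, of u v] proj_rel_refl[OF assms(1)] proj_rel_refl[OF assms(2)]
  by blast

lemma pt_eq_iff:
  assumes "(T, X, Y) \<noteq> (0, 0, 0)" "(T', X', Y') \<noteq> (0, 0, 0)"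
  shows "pt T X Y = pt T' X' Y' \<longleftrightarrow> (\<exists>c. c \<noteq> 0 \<and> T' = c * T \<and> X' = c * X \<and> Y' = c * Y)"
  using assms unfolding pt_def abs_proj2_eq_iff[OF assms] proj_rel_def by auto

text \<open>Together with \<open>scoord\<close> these are the affine coordinates of the chart X
  \<noteq> 0. It contains all points of the curve at infinity, since [0:0:1] does not lie on the
  curve.\<close>

lift_definition tcoord :: "proj2 \<Rightarrow> complex" is "\<lambda>(T, X, Y). T / X"
  by (auto simp: proj_rel_def)

lift_definition scoord :: "proj2 \<Rightarrow> complex" is "\<lambda>(T, X, Y). Y / X"
  by (auto simp: proj_rel_def)

lemma coords_pt:
  assumes "(T, X, Y) \<noteq> (0, 0, 0)"
  shows "xcoord (pt T X Y) = X / T" "ycoord (pt T X Y) = Y / T"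
    "tcoord (pt T X Y) = T / X" "scoord (pt T X Y) = Y / X"
  using proj_rel_refl[OF assms] unfolding pt_def
  by (simp_all add: xcoord.abs_eq ycoord.abs_eq tcoord.abs_eq scoord.abs_eq)

lemma coords_affine [simp]: "xcoord (pt 1 x y) = x" "ycoord (pt 1 x y) = y"
  by (simp_all add: coords_pt)

lemma coords_infinity [simp]: "tcoord (pt t 1 s) = t" "scoord (pt t 1 s) = s"
  by (simp_all add: coords_pt)

lemma pt_exhaust: obtains T X Y where "(T, X, Y) \<noteq> (0, 0, 0)" "p = pt T X Y"
proof (induction p rule: proj2.abs_induct)
  case (1 v)
  then have "v \<noteq> (0, 0, 0)" by (auto simp: proj_rel_def)
  then show thesis using 1(2)[of "fst v" "fst (snd v)" "snd (snd v)"] by (auto simp: pt_def)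
qed

lemma pt_affine_eq: "T \<noteq> 0 \<Longrightarrow> pt T X Y = pt 1 (X / T) (Y / T)"
  by (subst pt_eq_iff) (auto intro!: exI[of _ "1 / T"])

lemma pt_infinity_eq: "X \<noteq> 0 \<Longrightarrow> pt T X Y = pt (T / X) 1 (Y / X)"
  by (subst pt_eq_iff) (auto intro!: exI[of _ "1 / X"])

lemma pt_in_affine_plane:
  assumes "(T, X, Y) \<noteq> (0, 0, 0)"
  shows "pt T X Y \<in> affine_plane \<longleftrightarrow> T \<noteq> 0"
proof
  assume "pt T X Y \<in> affine_plane"
  then obtain x y where "pt T X Y = pt 1 x y" by (auto simp: affine_plane_def)
  then show "T \<noteq> 0" using assms by (subst (asm) pt_eq_iff) auto
next
  assume "T \<noteq> 0" then show "pt T X Y \<in> affine_plane"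
    using pt_affine_eq[of T X Y] unfolding affine_plane_def by blast
qed

lemma pt_in_line_at_infinity:
  assumes "(T, X, Y) \<noteq> (0, 0, 0)"
  shows "pt T X Y \<in> line_at_infinity \<longleftrightarrow> T = 0"
proof
  assume "pt T X Y \<in> line_at_infinity"
  then obtain x y where "pt T X Y = pt 0 x y" "(x, y) \<noteq> (0, 0)" by (auto simp: line_at_infinity_def)
  then show "T = 0" using assms by (subst (asm) pt_eq_iff) auto
next
  assume "T = 0" with assms show "pt T X Y \<in> line_at_infinity"
    by (auto simp: line_at_infinity_def)
qed

lemma line_at_infinity_iff: "p \<in> line_at_infinity \<longleftrightarrow> p \<notin> affine_plane"
  by (cases p rule: pt_exhaust) (simp add: pt_in_line_at_infinity pt_in_affine_plane)

lemma affine_planeE: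
  assumes "p \<in> affine_plane" shows "p = pt 1 (xcoord p) (ycoord p)"
  using assms by (auto simp: affine_plane_def)

lemma pt_1_eq_iff [simp]: "pt 1 x y = pt 1 x' y' \<longleftrightarrow> x = x' \<and> y = y'"
  by (subst pt_eq_iff) auto

lemma pt_mid_1_eq_iff [simp]: "pt t 1 s = pt t' 1 s' \<longleftrightarrow> t = t' \<and> s = s'"
  by (subst pt_eq_iff) auto

text \<open>Openness in the plane means openness of the cone in the punctured C^3. That cone is the
  preimage of \<open>U\<close> under the quotients by T, on the open set T \<noteq> 0.\<close>

lemma open_affine_chart:
  assumes "open U" shows "open {pt 1 x y | x y. (x, y) \<in> U}"
proof -
  define A where "A = {pt 1 x y | x y. (x, y) \<in> U}"
  let ?f = "\<lambda>v :: complex \<times> complex \<times> complex. (fst (snd v) / fst v, snd (snd v) / fst v)"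
  have mem: "pt T X Y \<in> A \<longleftrightarrow> T \<noteq> 0 \<and> ?f (T, X, Y) \<in> U" if nz: "(T, X, Y) \<noteq> (0, 0, 0)" for T X Y
  proof
    assume "pt T X Y \<in> A"
    then obtain x y where *: "pt T X Y = pt 1 x y" "(x, y) \<in> U" unfolding A_def by blast
    from *(1) obtain c where "c \<noteq> 0" "(1, x, y) = (c * T, c * X, c * Y)"
      using nz by (subst (asm) pt_eq_iff) auto
    then have "T \<noteq> 0" "c * T = 1" "x = c * X" "y = c * Y" by auto
    then have "c = 1 / T" by (simp add: eq_divide_eq)
    with \<open>x = _\<close> \<open>y = _\<close> have "?f (T, X, Y) = (x, y)" by simp
    with * \<open>T \<noteq> 0\<close> show "T \<noteq> 0 \<and> ?f (T, X, Y) \<in> U" by simp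
  next
    assume "T \<noteq> 0 \<and> ?f (T, X, Y) \<in> U"
    then show "pt T X Y \<in> A" unfolding A_def using pt_affine_eq[of T X Y] by auto
  qed
  have "{v. v \<noteq> (0, 0, 0) \<and> abs_proj2 v \<in> A} = ?f -` U \<inter> {v. fst v \<noteq> 0}" (is "?L = ?R")
  proof (rule set_eqI)
    fix v :: "complex \<times> complex \<times> complex"
    obtain T X Y where v: "v = (T, X, Y)" by (cases v)
    show "v \<in> ?L \<longleftrightarrow> v \<in> ?R"
    proof (cases "v = (0, 0, 0)")
      case False
      with mem[of T X Y] show ?thesis by (simp add: v pt_def conj_commute)
    qed auto
  qed
  moreover have "open {v :: complex \<times> complex \<times> complex. fst v \<noteq> 0}"
    by (intro open_Collect_neq continuous_intros)
  moreover have "continuous_on {v. fst v \<noteq> 0} ?f"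
    by (intro continuous_intros) auto
  ultimately show ?thesis
    unfolding open_proj2_def A_def[symmetric] using continuous_on_open_vimage[of "{v. fst v \<noteq> 0}" ?f] assms by simp
qed

lemma open_infinity_chart:
  assumes "open U" shows "open {pt t 1 s | t s. (t, s) \<in> U}"
proof -
  define A where "A = {pt t 1 s | t s. (t, s) \<in> U}"
  let ?f = "\<lambda>v :: complex \<times> complex \<times> complex. (fst v / fst (snd v), snd (snd v) / fst (snd v))"
  have mem: "pt T X Y \<in> A \<longleftrightarrow> X \<noteq> 0 \<and> ?f (T, X, Y) \<in> U" if nz: "(T, X, Y) \<noteq> (0, 0, 0)" for T X Y
  proof
    assume "pt T X Y \<in> A"
    then obtain t s where *: "pt T X Y = pt t 1 s" "(t, s) \<in> U" unfolding A_def by blast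
    from *(1) obtain c where "c \<noteq> 0" "(1, t, s) = (c * X, c * T, c * Y)"
      using nz by (subst (asm) pt_eq_iff) auto
    then have "X \<noteq> 0" "c * X = 1" "t = c * T" "s = c * Y" by auto
    then have "c = 1 / X" by (simp add: eq_divide_eq)
    with \<open>t = _\<close> \<open>s = _\<close> have "?f (T, X, Y) = (t, s)" by simp
    with * \<open>X \<noteq> 0\<close> show "X \<noteq> 0 \<and> ?f (T, X, Y) \<in> U" by simp
  next
    assume "X \<noteq> 0 \<and> ?f (T, X, Y) \<in> U"
    then show "pt T X Y \<in> A" unfolding A_def using pt_infinity_eq[of X T Y] by auto
  qed
  have "{v. v \<noteq> (0, 0, 0) \<and> abs_proj2 v \<in> A} = ?f -` U \<inter> {v. fst (snd v) \<noteq> 0}" (is "?L = ?R")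
  proof (rule set_eqI)
    fix v :: "complex \<times> complex \<times> complex"
    obtain T X Y where v: "v = (T, X, Y)" by (cases v)
    show "v \<in> ?L \<longleftrightarrow> v \<in> ?R"
    proof (cases "v = (0, 0, 0)")
      case False
      with mem[of T X Y] show ?thesis by (simp add: v pt_def conj_commute)
    qed auto
  qed
  moreover have "open {v :: complex \<times> complex \<times> complex. fst (snd v) \<noteq> 0}"
    by (intro open_Collect_neq continuous_intros)
  moreover have "continuous_on {v. fst (snd v) \<noteq> 0} ?f"
    by (intro continuous_intros) auto
  ultimately show ?thesis
    unfolding open_proj2_def A_def[symmetric] using continuous_on_open_vimage[of "{v. fst (snd v) \<noteq> 0}" ?f] assms by simp
qed

subsection \<open>Holomorphic maps and their jets\<close>

lemma holo_lift_subset: "holo_lift N T X Y f \<Longrightarrow> M \<subseteq> N \<Longrightarrow> holo_lift M T X Y f"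
  unfolding holo_lift_def by (auto intro: holomorphic_on_subset)

lemma open_holo_lift_vimage:
  assumes "holo_lift N T X Y f" "open N" "open U"
  shows "open {w \<in> N. f w \<in> U}"
proof -
  have "continuous_on N (\<lambda>w. (T w, X w, Y w))"
  proof (intro continuous_on_Pair holomorphic_on_imp_continuous_on)
    show "T holomorphic_on N" "X holomorphic_on N" "Y holomorphic_on N"
      using assms(1) by (simp_all add: holo_lift_def)
  qed
  moreover have "open {v. v \<noteq> (0, 0, 0) \<and> abs_proj2 v \<in> U}"
    using assms(3) unfolding open_proj2_def .
  ultimately have "open ((\<lambda>w. (T w, X w, Y w)) -` {v. v \<noteq> (0, 0, 0) \<and> abs_proj2 v \<in> U} \<inter> N)"
    using continuous_on_open_vimage[OF assms(2)] by blast
  moreover have "(\<lambda>w. (T w, X w, Y w)) -` {v. v \<noteq> (0, 0, 0) \<and> abs_proj2 v \<in> U} \<inter> N = {w \<in> N. f w \<in> U}"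
    using assms(1) unfolding holo_lift_def pt_def by auto
  ultimately show ?thesis by simp
qed

lemma local_map_lift:
  assumes "local_map C \<zeta> f"
  obtains N T X Y where "open N" "\<zeta> \<in> N" "holo_lift N T X Y f" "f ` N \<subseteq> C"
    "\<forall>w\<in>N. local_map C w f"
proof -
  from assms obtain W where W: "\<zeta> \<in> ball 0 1" "open W" "\<zeta> \<in> W" "holo_map_on W f" "f ` W \<subseteq> C"
    unfolding local_map_def by blast
  from W(3,4) obtain N T X Y where N: "open N" "\<zeta> \<in> N" "N \<subseteq> W" "holo_lift N T X Y f"
    unfolding holo_map_on_def by metis
  show thesis
  proof (rule that)
    show "open (N \<inter> ball 0 1)" using N(1) by (intro open_Int open_ball)
    show "\<zeta> \<in> N \<inter> ball 0 1" using N(2) W(1) by (rule IntI)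
    show "holo_lift (N \<inter> ball 0 1) T X Y f" by (rule holo_lift_subset[OF N(4) Int_lower1])
    show "f ` (N \<inter> ball 0 1) \<subseteq> C" using N(3) W(5) by blast
    show "\<forall>w\<in>N \<inter> ball 0 1. local_map C w f"
    proof
      fix w assume "w \<in> N \<inter> ball 0 1"
      then have w: "w \<in> ball 0 1" "w \<in> W" using N(3) by auto
      show "local_map C w f"
        unfolding local_map_def using w(1) by (rule conjI) (intro exI[of _ W] conjI W(2,4,5) w(2))
    qed
  qed
qed

lemma holo_map_on_if_lift: "open N \<Longrightarrow> holo_lift N T X Y f \<Longrightarrow> holo_map_on N f"
  unfolding holo_map_on_def by blast

lemma local_map_in_openin:
  assumes "local_map C \<zeta> f" "openin (top_of_set C) V" "f \<zeta> \<in> V"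
  obtains N where "open N" "\<zeta> \<in> N" "f ` N \<subseteq> V" "\<forall>w\<in>N. local_map C w f"
proof -
  obtain U where U: "open U" "V = C \<inter> U" using assms(2) by (auto simp: openin_open)
  obtain N T X Y where N: "open N" "\<zeta> \<in> N" "holo_lift N T X Y f" "f ` N \<subseteq> C"
    "\<forall>w\<in>N. local_map C w f"
    using local_map_lift[OF assms(1)] by metis
  have "open {w \<in> N. f w \<in> U}" by (rule open_holo_lift_vimage[OF N(3,1) U(1)])
  with N U assms(3) show thesis
    by (intro that[of "{w \<in> N. f w \<in> U}"]) auto
qed

text \<open>The Leibniz rule for Z = (Z/S) S expresses the n-th derivative of Z through the
  derivatives of Z/S up to order n and those of S. As S does not vanish, it can be solved for the
  n-th derivative of the quotient.\<close>

lemma higher_deriv_quotient_cong: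
  assumes "open M" "\<zeta> \<in> M" "S holomorphic_on M" "Z holomorphic_on M" "\<And>w. w \<in> M \<Longrightarrow> S w \<noteq> 0"
    and "open N" "\<eta> \<in> N" "S' holomorphic_on N" "Z' holomorphic_on N" "\<And>w. w \<in> N \<Longrightarrow> S' w \<noteq> 0"
    and eq: "\<And>i. i \<le> k \<Longrightarrow> (deriv ^^ i) S \<zeta> = (deriv ^^ i) S' \<eta>"
      "\<And>i. i \<le> k \<Longrightarrow> (deriv ^^ i) Z \<zeta> = (deriv ^^ i) Z' \<eta>"
    and "i \<le> k"
  shows "(deriv ^^ i) (\<lambda>w. Z w / S w) \<zeta> = (deriv ^^ i) (\<lambda>w. Z' w / S' w) \<eta>"
  using \<open>i \<le> k\<close>
proof (induction i rule: less_induct)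
  case (less n)
  have expand: "(deriv ^^ n) F \<xi> = (\<Sum>i<n. of_nat (n choose i) * (deriv ^^ i) (\<lambda>w. F w / G w) \<xi> * (deriv ^^ (n - i)) G \<xi>)
       + (deriv ^^ n) (\<lambda>w. F w / G w) \<xi> * G \<xi>"
    if "open M" "\<xi> \<in> M" "G holomorphic_on M" "F holomorphic_on M" and nz: "\<And>w. w \<in> M \<Longrightarrow> G w \<noteq> 0"
    for F G :: "complex \<Rightarrow> complex" and M \<xi>
  proof -
    have "(deriv ^^ n) F \<xi> = (deriv ^^ n) (\<lambda>w. F w / G w * G w) \<xi>"
    proof (rule higher_deriv_transform_within_open[OF that(4) _ that(1,2)])
      show "(\<lambda>w. F w / G w * G w) holomorphic_on M"
        using that by (intro holomorphic_on_mult holomorphic_on_divide)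
    qed (use nz in simp)
    also have "\<dots> = (\<Sum>i=0..n. of_nat (n choose i) * (deriv ^^ i) (\<lambda>w. F w / G w) \<xi> * (deriv ^^ (n - i)) G \<xi>)"
      using that by (intro higher_deriv_mult[of _ M]) (simp_all add: holomorphic_on_divide)
    also have "{0..n} = insert n {..<n}" by auto
    finally show ?thesis by simp
  qed
  have "(deriv ^^ i) (\<lambda>w. Z w / S w) \<zeta> = (deriv ^^ i) (\<lambda>w. Z' w / S' w) \<eta>" if "i < n" for i
    using less that by auto
  moreover have "(deriv ^^ (n - i)) S \<zeta> = (deriv ^^ (n - i)) S' \<eta>" "(deriv ^^ n) Z \<zeta> = (deriv ^^ n) Z' \<eta>" for i
    using eq less.prems by auto
  moreover have "S \<zeta> = S' \<eta>" using eq(1)[of 0] by simp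
  ultimately have "(deriv ^^ n) (\<lambda>w. Z w / S w) \<zeta> * S \<zeta> = (deriv ^^ n) (\<lambda>w. Z' w / S' w) \<eta> * S \<zeta>"
    using expand[of M \<zeta> S Z] expand[of N \<eta> S' Z'] assms by simp
  then show ?case using assms by auto
qed

lemma same_jet_refl:
  assumes "local_map C \<zeta> f" shows "same_jet k \<zeta> f \<zeta> f"
proof -
  obtain N T X Y where "open N" "\<zeta> \<in> N" "holo_lift N T X Y f"
    using local_map_lift[OF assms] by metis
  then show ?thesis unfolding same_jet_def by blast
qed

lemma same_jet_mono: "same_jet k \<zeta> f \<eta> g \<Longrightarrow> l \<le> k \<Longrightarrow> same_jet l \<zeta> f \<eta> g"
  unfolding same_jet_def by (meson order_trans)

text \<open>By reflexivity the second map belongs to its own class, hence to that of the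
  first.\<close>

lemma jet_of_eq_same_jet:
  assumes "local_map C \<eta> g" "jet_of k C \<zeta> f = jet_of k C \<eta> g"
  shows "same_jet k \<zeta> f \<eta> g"
proof -
  have "(\<eta>, g) \<in> jet_of k C \<eta> g"
    using assms(1) same_jet_refl[OF assms(1)] by (simp add: jet_of_def)
  then show ?thesis using assms(2) by (metis (no_types, lifting) case_prodD jet_of_def mem_Collect_eq)
qed

lemma same_jet_base: assumes "same_jet k \<zeta> f \<eta> g" shows "f \<zeta> = g \<eta>"
  using assms unfolding same_jet_def holo_lift_def by fastforce

text \<open>
  The Boolean \<open>b\<close> selects the chart \<open>T \<noteq> 0\<close> or \<open>X \<noteq> 0\<close>, and \<open>c\<close> the first or second coordinate in it.
\<close>

definition coord :: "bool \<Rightarrow> bool \<Rightarrow> proj2 \<Rightarrow> complex" where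
  "coord b c = (if b then if c then xcoord else ycoord else if c then tcoord else scoord)"

definition chart_dom :: "bool \<Rightarrow> proj2 set" where
  "chart_dom b = {p. if b then p \<in> affine_plane else (\<exists>t s. p = pt t 1 s)}"

lemma pt_in_infinity_chart:
  assumes "(T, X, Y) \<noteq> (0, 0, 0)"
  shows "pt T X Y \<in> chart_dom False \<longleftrightarrow> X \<noteq> 0"
proof
  assume "pt T X Y \<in> chart_dom False"
  then obtain t s where "pt T X Y = pt t 1 s" by (auto simp: chart_dom_def)
  then show "X \<noteq> 0" using assms by (subst (asm) pt_eq_iff) auto
next
  assume "X \<noteq> 0" then show "pt T X Y \<in> chart_dom False"
    using pt_infinity_eq[of X T Y] by (auto simp: chart_dom_def)
qed

lemma open_chart_dom: "open (chart_dom b)"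
proof (cases b)
  case True
  then show ?thesis using open_affine_chart[of UNIV] by (simp add: chart_dom_def affine_plane_def)
next
  case False
  then show ?thesis using open_infinity_chart[of UNIV] by (simp add: chart_dom_def)
qed

lemma coord_lift:
  assumes "holo_lift N T X Y f" "open N" "f \<zeta> \<in> chart_dom b" "\<zeta> \<in> N"
  obtains M where "open M" "\<zeta> \<in> M" "M \<subseteq> N" "\<forall>w\<in>M. f w \<in> chart_dom b"
    "\<forall>w\<in>M. (if b then T else X) w \<noteq> 0"
    "\<forall>c. \<forall>w\<in>M. coord b c (f w) = (if c then if b then X else T else Y) w / (if b then T else X) w"
proof -
  define M where "M = {w \<in> N. f w \<in> chart_dom b}"
  have "open M" unfolding M_def by (rule open_holo_lift_vimage[OF assms(1,2) open_chart_dom])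
  moreover have "(if b then T else X) w \<noteq> 0 \<and>
      coord b c (f w) = (if c then if b then X else T else Y) w / (if b then T else X) w" if "w \<in> M" for c w
  proof -
    from that have f: "(T w, X w, Y w) \<noteq> (0, 0, 0)" "f w = pt (T w) (X w) (Y w)"
      using assms(1) by (auto simp: M_def holo_lift_def)
    have "(if b then T w else X w) \<noteq> 0"
      using that pt_in_affine_plane[OF f(1)] pt_in_infinity_chart[OF f(1)]
      by (cases b) (auto simp: M_def f(2) chart_dom_def[of True])
    then show ?thesis
      using f coords_pt[OF f(1)] by (auto simp: coord_def)
  qed
  ultimately show thesis using assms by (intro that[of M]) (auto simp: M_def)
qed

lemma coord_holo_lift:
  assumes "holo_lift N T X Y f" "open N" "\<zeta> \<in> N" "f \<zeta> \<in> chart_dom b"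
  obtains M where "open M" "\<zeta> \<in> M" "M \<subseteq> N" "\<forall>c. (\<lambda>w. coord b c (f w)) holomorphic_on M"
proof -
  obtain M where M: "open M" "\<zeta> \<in> M" "M \<subseteq> N" "\<forall>w\<in>M. f w \<in> chart_dom b"
    "\<forall>w\<in>M. (if b then T else X) w \<noteq> 0"
    "\<forall>c. \<forall>w\<in>M. coord b c (f w) = (if c then if b then X else T else Y) w / (if b then T else X) w"
    using coord_lift[OF assms(1,2,4,3)] by metis
  have "(\<lambda>w. coord b c (f w)) holomorphic_on M" for c
  proof -
    have "(\<lambda>w. (if c then if b then X else T else Y) w / (if b then T else X) w) holomorphic_on M"
      using assms(1) M(3,5) unfolding holo_lift_def
      by (intro holomorphic_on_divide) (auto intro: holomorphic_on_subset)
    then show ?thesis using M(6) by (simp cong: holomorphic_cong)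
  qed
  with M show thesis by (intro that[of M]) auto
qed

lemma coord_holomorphic:
  assumes "local_map C \<zeta> f" "f \<zeta> \<in> chart_dom b"
  obtains M where "open M" "\<zeta> \<in> M" "\<forall>w\<in>M. f w \<in> chart_dom b"
    "\<forall>w\<in>M. local_map C w f" "\<forall>c. (\<lambda>w. coord b c (f w)) holomorphic_on M"
proof -
  obtain N T X Y where N: "open N" "\<zeta> \<in> N" "holo_lift N T X Y f" "\<forall>w\<in>N. local_map C w f"
    using local_map_lift[OF assms(1)] by metis
  obtain M where M: "open M" "\<zeta> \<in> M" "M \<subseteq> N" "\<forall>c. (\<lambda>w. coord b c (f w)) holomorphic_on M"
    using coord_holo_lift[OF N(3,1,2) assms(2)] by metis
  have "open {w \<in> N. f w \<in> chart_dom b}"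
    by (rule open_holo_lift_vimage[OF N(3,1) open_chart_dom])
  then have "open (M \<inter> {w \<in> N. f w \<in> chart_dom b})" using M(1) by (rule open_Int[rotated])
  moreover have "\<forall>c. (\<lambda>w. coord b c (f w)) holomorphic_on M \<inter> {w \<in> N. f w \<in> chart_dom b}"
    using M(4) by (meson holomorphic_on_subset Int_lower1)
  ultimately show thesis
    using M(2) N(2,4) assms(2) by (intro that[of "M \<inter> {w \<in> N. f w \<in> chart_dom b}"]) simp_all
qed

text \<open>Jets are defined through some pair of homogeneous lifts. Affine coordinates are
  quotients of components of these lifts, so equality of the jets becomes equality of the
  derivatives in every chart.\<close>

lemma same_jet_coord:
  assumes "same_jet k \<zeta> f \<eta> g" "f \<zeta> \<in> chart_dom b" "i \<le> k"
  shows "(deriv ^^ i) (\<lambda>w. coord b c (f w)) \<zeta> = (deriv ^^ i) (\<lambda>w. coord b c (g w)) \<eta>"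
proof -
  obtain M0 N0 T X Y T' X' Y' where
    M0: "open M0" "\<zeta> \<in> M0" "holo_lift M0 T X Y f" and N0: "open N0" "\<eta> \<in> N0" "holo_lift N0 T' X' Y' g"
    and eq: "\<And>i. i \<le> k \<Longrightarrow> (deriv ^^ i) T \<zeta> = (deriv ^^ i) T' \<eta> \<and>
       (deriv ^^ i) X \<zeta> = (deriv ^^ i) X' \<eta> \<and> (deriv ^^ i) Y \<zeta> = (deriv ^^ i) Y' \<eta>"
    using assms(1) unfolding same_jet_def by blast
  have "g \<eta> \<in> chart_dom b" using assms(1,2) same_jet_base by metis
  obtain M where M: "open M" "\<zeta> \<in> M" "M \<subseteq> M0" 
    "\<forall>w\<in>M. (if b then T else X) w \<noteq> 0"
    "\<forall>c. \<forall>w\<in>M. coord b c (f w) = (if c then if b then X else T else Y) w / (if b then T else X) w"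
    using coord_lift[OF M0(3,1) assms(2) M0(2)] by metis
  obtain N where N: "open N" "\<eta> \<in> N" "N \<subseteq> N0" 
    "\<forall>w\<in>N. (if b then T' else X') w \<noteq> 0"
    "\<forall>c. \<forall>w\<in>N. coord b c (g w) = (if c then if b then X' else T' else Y') w / (if b then T' else X') w"
    using coord_lift[OF N0(3,1) \<open>g \<eta> \<in> _\<close> N0(2)] by metis
  have hol: "T holomorphic_on M" "X holomorphic_on M" "Y holomorphic_on M"
    "T' holomorphic_on N" "X' holomorphic_on N" "Y' holomorphic_on N"
    using M0 N0 M(3) N(3) unfolding holo_lift_def by (auto intro: holomorphic_on_subset)
  define F where "F = (if c then if b then X else T else Y)"
  define F' where "F' = (if c then if b then X' else T' else Y')"
  define G where "G = (if b then T else X)"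
  define G' where "G' = (if b then T' else X')"
  have holF: "F holomorphic_on M" "F' holomorphic_on N" "G holomorphic_on M" "G' holomorphic_on N"
    using hol by (auto simp: F_def F'_def G_def G'_def)
  have nz: "G w \<noteq> 0" if "w \<in> M" for w using M(4) that by (auto simp: G_def)
  have nz': "G' w \<noteq> 0" if "w \<in> N" for w using N(4) that by (auto simp: G'_def)
  have quot: "(\<lambda>w. F w / G w) holomorphic_on M" "(\<lambda>w. F' w / G' w) holomorphic_on N"
    using holF nz nz' by (auto intro!: holomorphic_intros)
  have "(deriv ^^ i) (\<lambda>w. coord b c (f w)) \<zeta> = (deriv ^^ i) (\<lambda>w. F w / G w) \<zeta>"
    using M(1,2,5) quot(1)
    by (intro higher_deriv_transform_within_open[of _ M])
       (auto simp: F_def G_def cong: holomorphic_cong)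
  also have "\<dots> = (deriv ^^ i) (\<lambda>w. F' w / G' w) \<eta>"
    using eq assms(3)
    by (intro higher_deriv_quotient_cong[OF M(1,2) holF(3,1) nz N(1,2) holF(4,2) nz'])
       (auto simp: F_def F'_def G_def G'_def)
  also have "\<dots> = (deriv ^^ i) (\<lambda>w. coord b c (g w)) \<eta>"
    using N(1,2,5) quot(2)
    by (intro higher_deriv_transform_within_open[of _ N])
       (auto simp: F'_def G'_def cong: holomorphic_cong)
  finally show ?thesis .
qed

text \<open>Because of the choice, this is meaningful only if \<open>val \<zeta> f\<close> depends on the jet of \<open>f\<close> at \<open>\<zeta>\<close> alone.\<close>

definition jet_lift :: "nat \<Rightarrow> proj2 set \<Rightarrow> (complex \<Rightarrow> (complex \<Rightarrow> proj2) \<Rightarrow> complex) \<Rightarrow> jet \<Rightarrow> complex" where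
  "jet_lift k C val u = (if u \<in> jet_bundle k C
     then (case SOME (\<zeta>, f). local_map C \<zeta> f \<and> u = jet_of k C \<zeta> f of (\<zeta>, f) \<Rightarrow> val \<zeta> f) else 0)"

lemma jet_lift_jet_of:
  assumes "\<And>\<zeta> f \<eta> g. local_map C \<zeta> f \<Longrightarrow> local_map C \<eta> g \<Longrightarrow> same_jet k \<zeta> f \<eta> g \<Longrightarrow> val \<zeta> f = val \<eta> g"
    and "local_map C \<zeta> f"
  shows "jet_lift k C val (jet_of k C \<zeta> f) = val \<zeta> f"
proof -
  let ?P = "\<lambda>(\<eta>, g). local_map C \<eta> g \<and> jet_of k C \<zeta> f = jet_of k C \<eta> g"
  obtain \<eta> g where *: "(SOME p. ?P p) = (\<eta>, g)" by fastforce
  have "?P (SOME p. ?P p)"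
    using assms(2) by (intro someI[of ?P "(\<zeta>, f)"]) simp
  then have "local_map C \<eta> g" "jet_of k C \<zeta> f = jet_of k C \<eta> g" using * by auto
  then have "val \<zeta> f = val \<eta> g"
    using assms jet_of_eq_same_jet by metis
  moreover have "jet_of k C \<zeta> f \<in> jet_bundle k C" using assms(2) by (auto simp: jet_bundle_def)
  ultimately show ?thesis using * by (simp add: jet_lift_def)
qed

lemma jet_lift_outside: "u \<notin> jet_bundle k C \<Longrightarrow> jet_lift k C val u = 0"
  by (simp add: jet_lift_def)

subsection \<open>Weighted homogeneous polynomials in the jet variables\<close>

lemma finite_weighted_indices [simp]: "finite (weighted_indices k m)"
proof (rule finite_subset)
  show "weighted_indices k m \<subseteq> {\<mu>. \<forall>j. (j \<in> {1..k} \<longrightarrow> \<mu> j \<in> {..m}) \<and> (j \<notin> {1..k} \<longrightarrow> \<mu> j = 0)}"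
  proof safe
    fix \<mu> j assume \<mu>: "\<mu> \<in> weighted_indices k m" and j: "j \<in> {1..k}"
    have "\<mu> j \<le> j * \<mu> j" using j by simp
    also have "\<dots> \<le> (\<Sum>j=1..k. j * \<mu> j)" by (rule member_le_sum[OF j]) auto
    finally show "\<mu> j \<le> m" using \<mu> by (simp add: weighted_indices_def)
  qed (auto simp: weighted_indices_def multi_indices_def)
qed (rule finite_set_of_finite_funs; simp)

lemma weighted_indices_add:
  "\<mu> \<in> weighted_indices k m \<Longrightarrow> \<nu> \<in> weighted_indices k n \<Longrightarrow>
     (\<lambda>j. \<mu> j + \<nu> j) \<in> weighted_indices k (m + n)"
  by (auto simp: weighted_indices_def multi_indices_def algebra_simps sum.distrib)

definition jmonom :: "nat \<Rightarrow> (nat \<Rightarrow> complex) \<Rightarrow> (nat \<Rightarrow> nat) \<Rightarrow> complex" where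
  "jmonom k c \<mu> = (\<Prod>j=1..k. c j ^ \<mu> j)"

lemma jmonom_add: "jmonom k c (\<lambda>j. \<mu> j + \<nu> j) = jmonom k c \<mu> * jmonom k c \<nu>"
  by (simp add: jmonom_def power_add prod.distrib)

definition single_index :: "nat \<Rightarrow> nat \<Rightarrow> nat" where
  "single_index j = (\<lambda>i. if i = j then 1 else 0)"

lemma jmonom_single: "j \<in> {1..k} \<Longrightarrow> jmonom k c (single_index j) = c j"
  unfolding jmonom_def single_index_def by (simp add: if_distrib prod.delta cong: if_cong)

lemma single_index_weighted: "j \<in> {1..k} \<Longrightarrow> single_index j \<in> weighted_indices k j"
  by (auto simp: weighted_indices_def multi_indices_def single_index_def if_distrib sum.delta cong: if_cong)

lemma sum_single_index: "j \<in> {1..k} \<Longrightarrow> (\<Sum>q=1..k. single_index j q) = 1"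
  by (simp add: single_index_def)

text \<open>Polynomials in the jet variables \<open>c 1\<close>, ..., \<open>c k\<close>, weighted
  homogeneous of the given degree, with coefficients holomorphic in the base coordinate
  \<open>t\<close>. Describing them by generators makes closure under products and total
  differentiation an induction.\<close>

inductive wpoly :: "complex set \<Rightarrow> nat \<Rightarrow> nat \<Rightarrow> (complex \<Rightarrow> (nat \<Rightarrow> complex) \<Rightarrow> complex) \<Rightarrow> bool"
  for Z k where
  coef: "b holomorphic_on Z \<Longrightarrow> wpoly Z k 0 (\<lambda>t c. b t)"
| var: "1 \<le> j \<Longrightarrow> j \<le> k \<Longrightarrow> wpoly Z k j (\<lambda>t c. c j)"
| zero: "wpoly Z k m (\<lambda>t c. 0)"
| add: "wpoly Z k m E \<Longrightarrow> wpoly Z k m F \<Longrightarrow> wpoly Z k m (\<lambda>t c. E t c + F t c)"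
| mult: "wpoly Z k m E \<Longrightarrow> wpoly Z k n F \<Longrightarrow> wpoly Z k (m + n) (\<lambda>t c. E t c * F t c)"

lemma wpoly_coef_mult: "b holomorphic_on Z \<Longrightarrow> wpoly Z k m E \<Longrightarrow> wpoly Z k m (\<lambda>t c. b t * E t c)"
  using wpoly.mult[OF wpoly.coef] by fastforce

lemma wpoly_mono: "wpoly Z k m E \<Longrightarrow> k \<le> k' \<Longrightarrow> wpoly Z k' m E"
  by (induction rule: wpoly.induct) (auto intro: wpoly.intros)

lemma wpoly_power: "wpoly Z k m E \<Longrightarrow> wpoly Z k (n * m) (\<lambda>t c. E t c ^ n)"
proof (induction n)
  case 0
  show ?case using wpoly.coef[of "\<lambda>_. 1"] by simp
next
  case (Suc n)
  then show ?case using wpoly.mult[of Z k m E "n * m"] by simp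
qed

lemma wpoly_prod:
  assumes "finite I" "\<And>i. i \<in> I \<Longrightarrow> wpoly Z k (m i) (E i)"
  shows "wpoly Z k (\<Sum>i\<in>I. m i) (\<lambda>t c. \<Prod>i\<in>I. E i t c)"
  using assms
proof (induction rule: finite_induct)
  case empty
  show ?case using wpoly.coef[of "\<lambda>_. 1"] by simp
next
  case (insert i I)
  then show ?case using wpoly.mult[of Z k "m i" "E i"] by simp
qed

lemma wpoly_sum:
  assumes "finite I" "\<And>i. i \<in> I \<Longrightarrow> wpoly Z k m (E i)"
  shows "wpoly Z k m (\<lambda>t c. \<Sum>i\<in>I. E i t c)"
  using assms by (induction rule: finite_induct) (auto intro: wpoly.intros)

lemma wpoly_cong:
  assumes "wpoly Z k m E" "\<And>j. j \<in> {1..k} \<Longrightarrow> c j = c' j"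
  shows "E t c = E t c'"
  using assms by (induction rule: wpoly.induct) auto

text \<open>The explicit shape that the definition of the Green-Griffiths bundle demands; every
  \<open>wpoly\<close> is brought into it.\<close>

definition normal_form :: "complex set \<Rightarrow> nat \<Rightarrow> nat \<Rightarrow> (complex \<Rightarrow> (nat \<Rightarrow> complex) \<Rightarrow> complex) \<Rightarrow> bool" where
  "normal_form Z k m E \<longleftrightarrow> (\<exists>b. (\<forall>\<mu>\<in>weighted_indices k m. b \<mu> holomorphic_on Z) \<and>
     (\<forall>t c. E t c = (\<Sum>\<mu>\<in>weighted_indices k m. b \<mu> t * jmonom k c \<mu>)))"

lemma normal_form_monomial:
  assumes "\<mu> \<in> weighted_indices k m" "b holomorphic_on Z"
  shows "normal_form Z k m (\<lambda>t c. b t * jmonom k c \<mu>)"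
  unfolding normal_form_def
proof (intro exI[of _ "\<lambda>\<nu> t. if \<nu> = \<mu> then b t else 0"] conjI ballI allI)
  fix \<nu> show "(\<lambda>t. if \<nu> = \<mu> then b t else 0) holomorphic_on Z"
    using assms(2) by (cases "\<nu> = \<mu>") auto
next
  fix t c
  have "(\<Sum>\<nu>\<in>weighted_indices k m. (if \<nu> = \<mu> then b t else 0) * jmonom k c \<nu>) =
      (\<Sum>\<nu>\<in>weighted_indices k m. if \<nu> = \<mu> then b t * jmonom k c \<mu> else 0)"
    by (intro sum.cong) auto
  then show "b t * jmonom k c \<mu> = (\<Sum>\<nu>\<in>weighted_indices k m. (if \<nu> = \<mu> then b t else 0) * jmonom k c \<nu>)"
    using assms(1) by simp
qed

lemma normal_form_add:
  assumes "normal_form Z k m E" "normal_form Z k m F"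
  shows "normal_form Z k m (\<lambda>t c. E t c + F t c)"
proof -
  from assms obtain a b where
    "\<forall>\<mu>\<in>weighted_indices k m. a \<mu> holomorphic_on Z" "\<forall>\<mu>\<in>weighted_indices k m. b \<mu> holomorphic_on Z"
    "\<forall>t c. E t c = (\<Sum>\<mu>\<in>weighted_indices k m. a \<mu> t * jmonom k c \<mu>)"
    "\<forall>t c. F t c = (\<Sum>\<mu>\<in>weighted_indices k m. b \<mu> t * jmonom k c \<mu>)"
    unfolding normal_form_def by blast
  then show ?thesis
    unfolding normal_form_def
    by (intro exI[of _ "\<lambda>\<mu> t. a \<mu> t + b \<mu> t"]) (auto intro!: holomorphic_intros simp: algebra_simps sum.distrib)
qed

lemma normal_form_zero: "normal_form Z k m (\<lambda>t c. 0)"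
  unfolding normal_form_def by (intro exI[of _ "\<lambda>_ _. 0"]) auto

lemma normal_form_sum:
  assumes "finite I" "\<And>i. i \<in> I \<Longrightarrow> normal_form Z k m (E i)"
  shows "normal_form Z k m (\<lambda>t c. \<Sum>i\<in>I. E i t c)"
  using assms by (induction rule: finite_induct) (auto intro: normal_form_zero normal_form_add)

lemma normal_form_mult:
  assumes "normal_form Z k m E" "normal_form Z k n F"
  shows "normal_form Z k (m + n) (\<lambda>t c. E t c * F t c)"
proof -
  from assms obtain a b where
    a: "\<forall>\<mu>\<in>weighted_indices k m. a \<mu> holomorphic_on Z" and b: "\<forall>\<mu>\<in>weighted_indices k n. b \<mu> holomorphic_on Z"
    and E: "\<forall>t c. E t c = (\<Sum>\<mu>\<in>weighted_indices k m. a \<mu> t * jmonom k c \<mu>)"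
    and F: "\<forall>t c. F t c = (\<Sum>\<mu>\<in>weighted_indices k n. b \<mu> t * jmonom k c \<mu>)"
    unfolding normal_form_def by blast
  have "(\<lambda>t c. E t c * F t c) = (\<lambda>t c. \<Sum>\<mu>\<in>weighted_indices k m. \<Sum>\<nu>\<in>weighted_indices k n.
      (a \<mu> t * b \<nu> t) * jmonom k c (\<lambda>j. \<mu> j + \<nu> j))"
    by (intro ext) (simp add: E F sum_product jmonom_add mult_ac)
  moreover have "normal_form Z k (m + n) \<dots>"
    using a b by (intro normal_form_sum normal_form_monomial weighted_indices_add holomorphic_intros) auto
  ultimately show ?thesis by simp
qed

lemma wpoly_normal_form: "wpoly Z k m E \<Longrightarrow> normal_form Z k m E"
proof (induction rule: wpoly.induct)
  case (coef b)
  have 0: "(\<lambda>_. 0) \<in> weighted_indices k 0" by (simp add: weighted_indices_def multi_indices_def)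
  show ?case using normal_form_monomial[OF 0 coef] by (simp add: jmonom_def)
next
  case (var j)
  show ?case
    using normal_form_monomial[OF single_index_weighted, of j k "\<lambda>_. 1" Z] var by (simp add: jmonom_single)
qed (auto intro: normal_form_zero normal_form_add normal_form_mult)

text \<open>Total differentiation along a map raises order and weight by one: a coefficient b
  contributes b'(t) \<open>c 1\<close>, and \<open>c j\<close> becomes \<open>c (Suc j)\<close>. The
  resulting \<open>E'\<close> does not depend on the map.\<close>

lemma wpoly_deriv:
  assumes "wpoly Z k m E" "open Z"
  shows "\<exists>E'. wpoly Z (Suc k) (Suc m) E' \<and> (\<forall>u \<zeta>. u analytic_on {\<zeta>} \<longrightarrow> u \<zeta> \<in> Z \<longrightarrow>
     ((\<lambda>w. E (u w) (\<lambda>j. (deriv ^^ j) u w)) has_field_derivative E' (u \<zeta>) (\<lambda>j. (deriv ^^ j) u \<zeta>)) (at \<zeta>))"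
  using assms(1)
proof (induction rule: wpoly.induct)
  case (coef b)
  have "deriv b holomorphic_on Z" using coef assms(2) by (rule holomorphic_deriv)
  then have "wpoly Z (Suc k) (Suc 0) (\<lambda>t c. deriv b t * c 1)"
    using wpoly_coef_mult[OF _ wpoly.var[of 1 "Suc k"]] by simp
  moreover have "((\<lambda>w. b (u w)) has_field_derivative deriv b (u \<zeta>) * (deriv ^^ 1) u \<zeta>) (at \<zeta>)"
    if "u analytic_on {\<zeta>}" "u \<zeta> \<in> Z" for u \<zeta>
  proof -
    have "(u has_field_derivative deriv u \<zeta>) (at \<zeta>)"
      using that(1) analytic_on_imp_differentiable_at DERIV_deriv_iff_field_differentiable by blast
    moreover have "(b has_field_derivative deriv b (u \<zeta>)) (at (u \<zeta>))"
      using coef assms(2) that(2) by (rule holomorphic_derivI)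
    ultimately show ?thesis using DERIV_chain2[of b "deriv b (u \<zeta>)" u \<zeta> "deriv u \<zeta>"] by simp
  qed
  ultimately show ?case by blast
next
  case (var j)
  have "wpoly Z (Suc k) (Suc j) (\<lambda>t c. c (Suc j))"
    using var by (intro wpoly.var) auto
  moreover have "((\<lambda>w. (deriv ^^ j) u w) has_field_derivative (deriv ^^ Suc j) u \<zeta>) (at \<zeta>)"
    if "u analytic_on {\<zeta>}" for u \<zeta>
    using that unfolding analytic_at by (metis has_field_derivative_higher_deriv)
  ultimately show ?case by blast
next
  case (zero m)
  show ?case by (intro exI[of _ "\<lambda>t c. 0"]) (auto intro: wpoly.zero)
next
  case (add m E F)
  then obtain E' F' where E': "wpoly Z (Suc k) (Suc m) E'"
    "\<forall>u \<zeta>. u analytic_on {\<zeta>} \<longrightarrow> u \<zeta> \<in> Z \<longrightarrow>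
     ((\<lambda>w. E (u w) (\<lambda>j. (deriv ^^ j) u w)) has_field_derivative E' (u \<zeta>) (\<lambda>j. (deriv ^^ j) u \<zeta>)) (at \<zeta>)"
    and F': "wpoly Z (Suc k) (Suc m) F'"
    "\<forall>u \<zeta>. u analytic_on {\<zeta>} \<longrightarrow> u \<zeta> \<in> Z \<longrightarrow>
     ((\<lambda>w. F (u w) (\<lambda>j. (deriv ^^ j) u w)) has_field_derivative F' (u \<zeta>) (\<lambda>j. (deriv ^^ j) u \<zeta>)) (at \<zeta>)"
    by blast
  then show ?case
    by (intro exI[of _ "\<lambda>t c. E' t c + F' t c"] conjI wpoly.add) (auto intro: DERIV_add)
next
  case (mult m E n F)
  then obtain E' F' where E': "wpoly Z (Suc k) (Suc m) E'"
    "\<forall>u \<zeta>. u analytic_on {\<zeta>} \<longrightarrow> u \<zeta> \<in> Z \<longrightarrow>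
     ((\<lambda>w. E (u w) (\<lambda>j. (deriv ^^ j) u w)) has_field_derivative E' (u \<zeta>) (\<lambda>j. (deriv ^^ j) u \<zeta>)) (at \<zeta>)"
    and F': "wpoly Z (Suc k) (Suc n) F'"
    "\<forall>u \<zeta>. u analytic_on {\<zeta>} \<longrightarrow> u \<zeta> \<in> Z \<longrightarrow>
     ((\<lambda>w. F (u w) (\<lambda>j. (deriv ^^ j) u w)) has_field_derivative F' (u \<zeta>) (\<lambda>j. (deriv ^^ j) u \<zeta>)) (at \<zeta>)"
    by blast
  have "wpoly Z (Suc k) (Suc (m + n)) (\<lambda>t c. E' t c * F t c + F' t c * E t c)"
    using wpoly.mult[OF E'(1) wpoly_mono[OF mult.hyps(2), of "Suc k"]]
      wpoly.mult[OF F'(1) wpoly_mono[OF mult.hyps(1), of "Suc k"]]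
    by (intro wpoly.add) (simp_all add: add.commute)
  then show ?case
    using E'(2) F'(2) by (intro exI[of _ "\<lambda>t c. E' t c * F t c + F' t c * E t c"] conjI) (auto intro!: DERIV_mult)
qed

subsection \<open>The integer polynomials of the recipe\<close>

text \<open>The variables that the recipe allows in the polynomial of a tuple whose entries have the
  sum \<open>s\<close>.\<close>

definition admissible_vars :: "nat \<Rightarrow> (nat \<times> nat) set" where
  "admissible_vars s = insert (0, 1) {(i, j). 2 \<le> i + j \<and> i + j \<le> s}"

lemma admissible_vars_mono: "s \<le> s' \<Longrightarrow> admissible_vars s \<subseteq> admissible_vars s'"
  by (auto simp: admissible_vars_def)

text \<open>
  The degree \<open>s\<close> in the \<open>c j\<close> bounds the order of the partial derivatives \<open>r (i, j)\<close>.
\<close>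

inductive jmon :: "nat \<Rightarrow> nat \<Rightarrow> nat \<Rightarrow> ((nat \<Rightarrow> complex) \<Rightarrow> (nat \<times> nat \<Rightarrow> complex) \<Rightarrow> complex) \<Rightarrow> bool"
  for k where
  base: "j \<in> {1..k} \<Longrightarrow> jmon k j 1 (\<lambda>c r. c j)"
| coef: "jmon k m s E \<Longrightarrow> v \<in> admissible_vars s \<Longrightarrow> jmon k m s (\<lambda>c r. r v * E c r)"
| var: "jmon k m s E \<Longrightarrow> j \<in> {1..k} \<Longrightarrow> jmon k (m + j) (Suc s) (\<lambda>c r. c j * E c r)"

text \<open>Only sums and negatives are formed, no scalar multiples, so that all coefficients are
  integers. Here \<open>s\<close> is a lower bound for the degrees: monomials of higher degree in
  the \<open>c j\<close> may contain partial derivatives of higher order.\<close>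

inductive jspan :: "nat \<Rightarrow> nat \<Rightarrow> nat \<Rightarrow> ((nat \<Rightarrow> complex) \<Rightarrow> (nat \<times> nat \<Rightarrow> complex) \<Rightarrow> complex) \<Rightarrow> bool"
  for k m s where
  zero: "jspan k m s (\<lambda>c r. 0)"
| mon: "jmon k m s' E \<Longrightarrow> s \<le> s' \<Longrightarrow> jspan k m s E"
| add: "jspan k m s E \<Longrightarrow> jspan k m s F \<Longrightarrow> jspan k m s (\<lambda>c r. E c r + F c r)"
| minus: "jspan k m s E \<Longrightarrow> jspan k m s (\<lambda>c r. - E c r)"

lemma jspan_diff: "jspan k m s E \<Longrightarrow> jspan k m s F \<Longrightarrow> jspan k m s (\<lambda>c r. E c r - F c r)"
  using jspan.add[OF _ jspan.minus] by fastforce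

lemma jmon_mono: "jmon k m s E \<Longrightarrow> k \<le> k' \<Longrightarrow> jmon k' m s E"
proof (induction rule: jmon.induct)
  case (base j)
  then show ?case by (intro jmon.base) auto
qed (auto intro: jmon.coef jmon.var)

lemma jmon_degree: "jmon k m s E \<Longrightarrow> 1 \<le> s"
  by (induction rule: jmon.induct) auto

lemma jspan_mono: "jspan k m s E \<Longrightarrow> k \<le> k' \<Longrightarrow> s' \<le> s \<Longrightarrow> jspan k' m s' E"
proof (induction rule: jspan.induct)
  case (mon s'' E)
  then show ?case by (intro jspan.mon[of _ _ s'']) (auto intro: jmon_mono)
qed (auto intro: jspan.intros)

lemma jspan_coef: "jspan k m s E \<Longrightarrow> v \<in> admissible_vars s \<Longrightarrow> jspan k m s (\<lambda>c r. r v * E c r)"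
proof (induction rule: jspan.induct)
  case (mon s' E)
  then have "v \<in> admissible_vars s'" using admissible_vars_mono[of s s'] by auto
  with mon show ?case by (intro jspan.mon[of _ _ s'] jmon.coef) auto
qed (auto simp: distrib_left intro: jspan.intros)

lemma jspan_var: "jspan k m s E \<Longrightarrow> j \<in> {1..k} \<Longrightarrow> jspan k (m + j) (Suc s) (\<lambda>c r. c j * E c r)"
proof (induction rule: jspan.induct)
  case (mon s' E)
  then show ?case by (intro jspan.mon[of _ _ "Suc s'"] jmon.var) auto
qed (auto simp: distrib_left intro: jspan.intros)

text \<open>Terms may cancel in the sum, so all three evaluations are extended to the union of the
  two sets of keys.\<close>

lemma eval_mpoly_add: "eval_mpoly (p + q) r = eval_mpoly p r + eval_mpoly q r"
proof -
  let ?m = "\<lambda>t. \<Prod>v\<in>Poly_Mapping.keys t. r v ^ Poly_Mapping.lookup t v"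
  have *: "eval_mpoly p r = (\<Sum>t\<in>S. of_int (Poly_Mapping.lookup p t) * ?m t)"
    if "Poly_Mapping.keys p \<subseteq> S" "finite S" for p :: int_mpoly and S
    unfolding eval_mpoly_def using that
    by (intro sum.mono_neutral_left) (auto simp: in_keys_iff)
  let ?S = "Poly_Mapping.keys p \<union> Poly_Mapping.keys q"
  have "Poly_Mapping.keys (p + q) \<subseteq> ?S" by (rule Poly_Mapping.keys_add)
  then show ?thesis
    by (subst (1 2 3) *[of _ ?S]) (auto simp: lookup_add algebra_simps sum.distrib)
qed

lemma eval_mpoly_uminus: "eval_mpoly (- p) r = - eval_mpoly p r"
  by (simp add: eval_mpoly_def sum_negf)

lemma eval_mpoly_0 [simp]: "eval_mpoly 0 r = 0"
  by (simp add: eval_mpoly_def)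

lemma mpoly_vars_simps:
  "mpoly_vars 0 = {}" "mpoly_vars (- p) = mpoly_vars p" "mpoly_vars (p + q) \<subseteq> mpoly_vars p \<union> mpoly_vars q"
  unfolding mpoly_vars_def using Poly_Mapping.keys_add[of p q] by auto

lemma jmon_normal_form:
  assumes "jmon k m s E"
  shows "\<exists>\<mu>\<in>weighted_indices k m. (\<Sum>q=1..k. \<mu> q) = s \<and> (\<exists>t. Poly_Mapping.keys t \<subseteq> admissible_vars s \<and>
     (\<forall>c r. E c r = jmonom k c \<mu> * (\<Prod>v\<in>Poly_Mapping.keys t. r v ^ Poly_Mapping.lookup t v)))"
  using assms
proof (induction rule: jmon.induct)
  case (base j)
  with sum_single_index[OF base] show ?case
    by (intro bexI[of _ "single_index j"] conjI exI[of _ 0])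
       (simp_all add: single_index_weighted jmonom_single)
next
  case (coef m s E v)
  then obtain \<mu> t where *: "\<mu> \<in> weighted_indices k m" "(\<Sum>q=1..k. \<mu> q) = s"
    "Poly_Mapping.keys t \<subseteq> admissible_vars s"
    "\<forall>c r. E c r = jmonom k c \<mu> * (\<Prod>v\<in>Poly_Mapping.keys t. r v ^ Poly_Mapping.lookup t v)" by blast
  define t' where "t' = t + Poly_Mapping.single v 1"
  have keys: "Poly_Mapping.keys t' = insert v (Poly_Mapping.keys t)"
    by (auto simp: t'_def in_keys_iff lookup_add lookup_single when_def split: if_splits)
  have "(\<Prod>v\<in>Poly_Mapping.keys t'. r v ^ Poly_Mapping.lookup t' v) =
      r v * (\<Prod>v\<in>Poly_Mapping.keys t. r v ^ Poly_Mapping.lookup t v)" for r :: "nat \<times> nat \<Rightarrow> complex"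
  proof -
    have "(\<Prod>v\<in>Poly_Mapping.keys t'. r v ^ Poly_Mapping.lookup t' v) =
      (\<Prod>w\<in>Poly_Mapping.keys t'. r w ^ Poly_Mapping.lookup t w * (if w = v then r v else 1))"
      by (intro prod.cong) (auto simp: t'_def lookup_add lookup_single power_add when_def)
    also have "\<dots> = (\<Prod>w\<in>Poly_Mapping.keys t'. r w ^ Poly_Mapping.lookup t w) * r v"
      by (simp add: prod.distrib keys)
    also have "(\<Prod>w\<in>Poly_Mapping.keys t'. r w ^ Poly_Mapping.lookup t w) =
        (\<Prod>w\<in>Poly_Mapping.keys t. r w ^ Poly_Mapping.lookup t w)"
      unfolding keys by (intro prod.mono_neutral_right) (auto simp: in_keys_iff)
    finally show ?thesis by simp
  qed
  with * coef.hyps keys show ?case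
    by (intro bexI[of _ \<mu>] conjI exI[of _ t']) auto
next
  case (var m s E j)
  then obtain \<mu> t where *: "\<mu> \<in> weighted_indices k m" "(\<Sum>q=1..k. \<mu> q) = s"
    "Poly_Mapping.keys t \<subseteq> admissible_vars s"
    "\<forall>c r. E c r = jmonom k c \<mu> * (\<Prod>v\<in>Poly_Mapping.keys t. r v ^ Poly_Mapping.lookup t v)" by blast
  have "(\<lambda>i. \<mu> i + single_index j i) \<in> weighted_indices k (m + j)"
    by (rule weighted_indices_add[OF *(1) single_index_weighted[OF var.hyps(2)]])
  moreover have "(\<Sum>q=1..k. \<mu> q + single_index j q) = Suc s"
    using sum_single_index[OF var.hyps(2)] *(2) by (simp add: sum.distrib)
  moreover have "Poly_Mapping.keys t \<subseteq> admissible_vars (Suc s)"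
    using *(3) admissible_vars_mono[of s "Suc s"] by auto
  ultimately show ?case
    using *(4) var.hyps(2)
    by (intro bexI[of _ "\<lambda>i. \<mu> i + single_index j i"] conjI exI[of _ t])
       (simp_all add: jmonom_add jmonom_single mult_ac)
qed

text \<open>Terms with the same exponent \<mu> in the \<open>c j\<close> are collected. All of them
  have as degree the sum of the entries of \<mu>, so the bound on the variables of each term passes
  to the collected polynomial.\<close>

lemma jspan_normal_form:
  assumes "jspan k m s E"
  shows "\<exists>p. (\<forall>\<mu>\<in>weighted_indices k m. mpoly_vars (p \<mu>) \<subseteq> admissible_vars (\<Sum>q=1..k. \<mu> q)) \<and>
    (\<forall>c r. E c r = (\<Sum>\<mu>\<in>weighted_indices k m. jmonom k c \<mu> * eval_mpoly (p \<mu>) r))"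
  using assms
proof (induction rule: jspan.induct)
  case zero
  show ?case by (intro exI[of _ "\<lambda>_. 0"]) (simp add: mpoly_vars_simps)
next
  case (mon s' E)
  from jmon_normal_form[OF mon(1)] obtain \<mu> t where *: "\<mu> \<in> weighted_indices k m" "(\<Sum>q=1..k. \<mu> q) = s'"
    "Poly_Mapping.keys t \<subseteq> admissible_vars s'"
    "\<forall>c r. E c r = jmonom k c \<mu> * (\<Prod>v\<in>Poly_Mapping.keys t. r v ^ Poly_Mapping.lookup t v)" by blast
  define p :: "(nat \<Rightarrow> nat) \<Rightarrow> int_mpoly" where
    "p = (\<lambda>\<nu>. if \<nu> = \<mu> then Poly_Mapping.single t 1 else 0)"
  have "(\<Sum>\<nu>\<in>weighted_indices k m. jmonom k c \<nu> * eval_mpoly (p \<nu>) r) =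
      (\<Sum>\<nu>\<in>weighted_indices k m. if \<nu> = \<mu> then jmonom k c \<mu> * eval_mpoly (Poly_Mapping.single t 1) r else 0)" for c r
    by (intro sum.cong) (auto simp: p_def)
  then have "(\<Sum>\<nu>\<in>weighted_indices k m. jmonom k c \<nu> * eval_mpoly (p \<nu>) r) = E c r" for c r
    using *(1,4) by (simp add: eval_mpoly_def)
  then show ?case
    using * by (intro exI[of _ p]) (auto simp: p_def mpoly_vars_def split: if_splits)
next
  case (add E F)
  then obtain p q where
    p: "\<forall>\<mu>\<in>weighted_indices k m. mpoly_vars (p \<mu>) \<subseteq> admissible_vars (\<Sum>q=1..k. \<mu> q)" and
    q: "\<forall>\<mu>\<in>weighted_indices k m. mpoly_vars (q \<mu>) \<subseteq> admissible_vars (\<Sum>q=1..k. \<mu> q)" and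
    EF: "\<forall>c r. E c r = (\<Sum>\<mu>\<in>weighted_indices k m. jmonom k c \<mu> * eval_mpoly (p \<mu>) r)"
    "\<forall>c r. F c r = (\<Sum>\<mu>\<in>weighted_indices k m. jmonom k c \<mu> * eval_mpoly (q \<mu>) r)" by blast
  show ?case
  proof (intro exI[of _ "\<lambda>\<mu>. p \<mu> + q \<mu>"] conjI ballI allI)
    fix \<mu> assume "\<mu> \<in> weighted_indices k m"
    with p q mpoly_vars_simps(3)[of "p \<mu>" "q \<mu>"]
    show "mpoly_vars (p \<mu> + q \<mu>) \<subseteq> admissible_vars (\<Sum>q=1..k. \<mu> q)" by blast
  qed (simp add: EF eval_mpoly_add distrib_left sum.distrib)
next
  case (minus E)
  then obtain p where
    "\<forall>\<mu>\<in>weighted_indices k m. mpoly_vars (p \<mu>) \<subseteq> admissible_vars (\<Sum>q=1..k. \<mu> q)"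
    "\<forall>c r. E c r = (\<Sum>\<mu>\<in>weighted_indices k m. jmonom k c \<mu> * eval_mpoly (p \<mu>) r)" by blast
  then show ?case
    by (intro exI[of _ "\<lambda>\<mu>. - p \<mu>"] conjI)
       (simp_all add: mpoly_vars_simps eval_mpoly_uminus sum_negf)
qed

text \<open>
  Along a curve in \<open>{R = 0}\<close> one has \<open>x' = - (R_y / R_x) y'\<close>; so the derivative of
  \<open>r (i, j) = R_(i,j) / R_x\<close> is \<open>y'\<close> times the following expression.
\<close>

definition dratio :: "(nat \<times> nat \<Rightarrow> complex) \<Rightarrow> nat \<times> nat \<Rightarrow> complex" where
  "dratio r v = r (fst v, Suc (snd v)) - r (0, 1) * r (Suc (fst v), snd v)
     - r v * (r (1, 1) - r (0, 1) * r (2, 0))"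

text \<open>The differential system satisfied by the derivatives of y and by the ratios of the
  partial derivatives of \<open>R\<close>. Its right-hand sides are polynomials in the same
  unknowns, so iterated differentiation is a formal operation on \<open>jspan\<close>.\<close>

definition jet_solution :: "(nat \<Rightarrow> complex \<Rightarrow> complex) \<Rightarrow> (nat \<times> nat \<Rightarrow> complex \<Rightarrow> complex) \<Rightarrow> complex \<Rightarrow> bool" where
  "jet_solution c r w \<longleftrightarrow> (\<forall>j\<ge>1. (c j has_field_derivative c (Suc j) w) (at w)) \<and>
     (\<forall>v. (r v has_field_derivative c 1 w * dratio (\<lambda>v. r v w) v) (at w))"

text \<open>Differentiating a ratio raises the order of its partial derivatives by one, but also
  multiplies by \<open>c 1\<close>. The degree rises by one as well, so the bound tying orders to
  degrees survives.\<close>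

lemma jspan_dratio:
  assumes "jspan k m s E" "v \<in> admissible_vars s" "1 \<le> s" "1 \<le> k"
  shows "jspan k (Suc m) s (\<lambda>c r. c 1 * dratio r v * E c r)"
proof -
  have E: "jspan k (m + 1) (Suc s) (\<lambda>c r. c 1 * E c r)"
    using assms by (intro jspan_var) auto
  have adm: "(0, 1) \<in> admissible_vars (Suc s)" "(1, 1) \<in> admissible_vars (Suc s)" "(2, 0) \<in> admissible_vars (Suc s)"
    "v \<in> admissible_vars (Suc s)" "(fst v, Suc (snd v)) \<in> admissible_vars (Suc s)"
    "(Suc (fst v), snd v) \<in> admissible_vars (Suc s)"
    using assms(2,3) by (auto simp: admissible_vars_def)
  have "jspan k (m + 1) (Suc s) (\<lambda>c r. r (fst v, Suc (snd v)) * (c 1 * E c r)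
      - r (0, 1) * (r (Suc (fst v), snd v) * (c 1 * E c r))
      - r v * (r (1, 1) * (c 1 * E c r) - r (0, 1) * (r (2, 0) * (c 1 * E c r))))"
    by (intro jspan_diff jspan_coef E adm)
  also have "(\<lambda>c r. r (fst v, Suc (snd v)) * (c 1 * E c r)
      - r (0, 1) * (r (Suc (fst v), snd v) * (c 1 * E c r))
      - r v * (r (1, 1) * (c 1 * E c r) - r (0, 1) * (r (2, 0) * (c 1 * E c r)))) =
      (\<lambda>c r. c 1 * dratio r v * E c r)"
    by (intro ext) (simp add: dratio_def algebra_simps)
  finally show ?thesis by (auto intro: jspan_mono)
qed

lemma jmon_deriv:
  assumes "jmon k m s E"
  shows "\<exists>E'. jspan (Suc k) (Suc m) s E' \<and> (\<forall>c r w. jet_solution c r w \<longrightarrow>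
     ((\<lambda>w. E (\<lambda>j. c j w) (\<lambda>v. r v w)) has_field_derivative E' (\<lambda>j. c j w) (\<lambda>v. r v w)) (at w))"
  using assms
proof (induction rule: jmon.induct)
  case (base j)
  have "jspan (Suc k) (Suc j) 1 (\<lambda>c r. c (Suc j))"
    using base by (intro jspan.mon[OF jmon.base]) auto
  then show ?case
    using base by (intro exI[of _ "\<lambda>c r. c (Suc j)"]) (auto simp: jet_solution_def)
next
  case (coef m s E v)
  then obtain E' where E': "jspan (Suc k) (Suc m) s E'" "\<forall>c r w. jet_solution c r w \<longrightarrow>
     ((\<lambda>w. E (\<lambda>j. c j w) (\<lambda>v. r v w)) has_field_derivative E' (\<lambda>j. c j w) (\<lambda>v. r v w)) (at w)" by blast
  have "jspan (Suc k) m s E"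
    using coef.hyps(1) by (intro jspan.mon[OF jmon_mono]) auto
  then have "jspan (Suc k) (Suc m) s (\<lambda>c r. c 1 * dratio r v * E c r + r v * E' c r)"
    using E'(1) coef.hyps jmon_degree[OF coef.hyps(1)]
    by (intro jspan.add jspan_dratio jspan_coef) auto
  moreover have "((\<lambda>w. r v w * E (\<lambda>j. c j w) (\<lambda>v. r v w)) has_field_derivative
      c 1 w * dratio (\<lambda>v. r v w) v * E (\<lambda>j. c j w) (\<lambda>v. r v w) + r v w * E' (\<lambda>j. c j w) (\<lambda>v. r v w)) (at w)"
    if "jet_solution c r w" for c r w
  proof -
    have "(r v has_field_derivative c 1 w * dratio (\<lambda>v. r v w) v) (at w)"
      using that unfolding jet_solution_def by blast
    from DERIV_mult[OF this E'(2)[rule_format, OF that]] show ?thesis by (simp add: algebra_simps)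
  qed
  ultimately show ?case by blast
next
  case (var m s E j)
  then obtain E' where E': "jspan (Suc k) (Suc m) s E'" "\<forall>c r w. jet_solution c r w \<longrightarrow>
     ((\<lambda>w. E (\<lambda>j. c j w) (\<lambda>v. r v w)) has_field_derivative E' (\<lambda>j. c j w) (\<lambda>v. r v w)) (at w)" by blast
  have E: "jspan (Suc k) m s E"
    using var.hyps(1) by (intro jspan.mon[OF jmon_mono]) auto
  have "jspan (Suc k) (Suc (m + j)) (Suc s) (\<lambda>c r. c (Suc j) * E c r + c j * E' c r)"
    using jspan_var[OF E, of "Suc j"] jspan_var[OF E'(1), of j] var.hyps(2)
    by (intro jspan.add) auto
  moreover have "((\<lambda>w. c j w * E (\<lambda>j. c j w) (\<lambda>v. r v w)) has_field_derivative
      c (Suc j) w * E (\<lambda>j. c j w) (\<lambda>v. r v w) + c j w * E' (\<lambda>j. c j w) (\<lambda>v. r v w)) (at w)"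
    if "jet_solution c r w" for c r w
  proof -
    have "(c j has_field_derivative c (Suc j) w) (at w)"
      using that var.hyps(2) by (simp add: jet_solution_def)
    from DERIV_mult[OF this E'(2)[rule_format, OF that]] show ?thesis by (simp add: algebra_simps)
  qed
  ultimately show ?case by blast
qed

lemma jspan_deriv:
  assumes "jspan k m s E"
  shows "\<exists>E'. jspan (Suc k) (Suc m) s E' \<and> (\<forall>c r w. jet_solution c r w \<longrightarrow>
     ((\<lambda>w. E (\<lambda>j. c j w) (\<lambda>v. r v w)) has_field_derivative E' (\<lambda>j. c j w) (\<lambda>v. r v w)) (at w))"
  using assms
proof (induction rule: jspan.induct)
  case zero
  show ?case by (intro exI[of _ "\<lambda>_ _. 0"]) (auto intro: jspan.zero)
next
  case (mon s' E)
  from jmon_deriv[OF mon(1)] show ?case using mon(2) by (meson jspan_mono order_refl)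
next
  case (add E F)
  then obtain E' F' where "jspan (Suc k) (Suc m) s E'" "jspan (Suc k) (Suc m) s F'"
    "\<forall>c r w. jet_solution c r w \<longrightarrow>
     ((\<lambda>w. E (\<lambda>j. c j w) (\<lambda>v. r v w)) has_field_derivative E' (\<lambda>j. c j w) (\<lambda>v. r v w)) (at w)"
    "\<forall>c r w. jet_solution c r w \<longrightarrow>
     ((\<lambda>w. F (\<lambda>j. c j w) (\<lambda>v. r v w)) has_field_derivative F' (\<lambda>j. c j w) (\<lambda>v. r v w)) (at w)" by blast
  then show ?case
    by (intro exI[of _ "\<lambda>c r. E' c r + F' c r"]) (auto intro: jspan.add DERIV_add)
next
  case (minus E)
  then obtain E' where "jspan (Suc k) (Suc m) s E'"
    "\<forall>c r w. jet_solution c r w \<longrightarrow>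
     ((\<lambda>w. E (\<lambda>j. c j w) (\<lambda>v. r v w)) has_field_derivative E' (\<lambda>j. c j w) (\<lambda>v. r v w)) (at w)" by blast
  then show ?case
    by (intro exI[of _ "\<lambda>c r. - E' c r"]) (auto intro: jspan.minus DERIV_minus)
qed

text \<open>
  \<open>A i j\<close> stands for the partial derivative \<open>R_(i,j)\<close> along the curve \<open>(x, y)\<close> contained in \<open>{R = 0}\<close>.
  The setting is symmetric up to exchanging \<open>x, y\<close> and transposing \<open>A\<close>.
\<close>

definition along_curve :: "complex set \<Rightarrow> (complex \<Rightarrow> complex) \<Rightarrow> (complex \<Rightarrow> complex) \<Rightarrow>
    (nat \<Rightarrow> nat \<Rightarrow> complex \<Rightarrow> complex) \<Rightarrow> bool" where
  "along_curve N x y A \<longleftrightarrow> open N \<and> x holomorphic_on N \<and> y holomorphic_on N \<and>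
     (\<forall>w\<in>N. A 1 0 w * deriv x w + A 0 1 w * deriv y w = 0 \<and>
       (\<forall>i j. (A i j has_field_derivative A (Suc i) j w * deriv x w + A i (Suc j) w * deriv y w) (at w)))"

lemma along_curve_swap: "along_curve N x y A \<Longrightarrow> along_curve N y x (\<lambda>i j. A j i)"
  by (auto simp: along_curve_def add.commute)

text \<open>The relation between x' and y' eliminates x'. The second claim is the logarithmic
  derivative of the denominator, written in the ratios, as needed to differentiate quotients by
  \<open>A 1 0\<close>.\<close>

lemma along_curve_jet_solution:
  assumes "along_curve N x y A" "w \<in> N" "A 1 0 w \<noteq> 0"
  shows "jet_solution (\<lambda>j. (deriv ^^ j) y) (\<lambda>(i, j) w. A i j w / A 1 0 w) w"
    "(A 1 0 has_field_derivative A 1 0 w * (deriv y w * (A 1 1 w / A 1 0 w - A 0 1 w / A 1 0 w * (A 2 0 w / A 1 0 w)))) (at w)"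
proof -
  have rel: "deriv x w = - (A 0 1 w / A 1 0 w) * deriv y w"
    using assms unfolding along_curve_def by (simp add: field_simps add_eq_0_iff)
  have dA: "(A i j has_field_derivative A (Suc i) j w * deriv x w + A i (Suc j) w * deriv y w) (at w)" for i j
    using assms unfolding along_curve_def by blast
  show d10: "(A 1 0 has_field_derivative A 1 0 w * (deriv y w * (A 1 1 w / A 1 0 w - A 0 1 w / A 1 0 w * (A 2 0 w / A 1 0 w)))) (at w)"
    by (rule DERIV_cong[OF dA[of 1 0]])
       (use assms(3) in \<open>simp add: rel field_simps numeral_2_eq_2\<close>)
  show "jet_solution (\<lambda>j. (deriv ^^ j) y) (\<lambda>(i, j) w. A i j w / A 1 0 w) w"
    unfolding jet_solution_def
  proof (intro conjI allI impI)
    fix j :: nat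
    show "((deriv ^^ j) y has_field_derivative (deriv ^^ Suc j) y w) (at w)"
      using assms unfolding along_curve_def by (intro has_field_derivative_higher_deriv[of _ N]) auto
  next
    fix v :: "nat \<times> nat"
    obtain i j where v: "v = (i, j)" by (cases v)
    show "((case v of (i, j) \<Rightarrow> \<lambda>w. A i j w / A 1 0 w) has_field_derivative
       (deriv ^^ 1) y w * dratio (\<lambda>v. (case v of (i, j) \<Rightarrow> \<lambda>w. A i j w / A 1 0 w) w) v) (at w)"
      unfolding v prod.case
      by (rule DERIV_cong[OF DERIV_divide[OF dA[of i j] d10 assms(3)]])
         (use assms(3) in \<open>simp add: rel dratio_def field_simps\<close>)
  qed
qed

text \<open>The order of the quantifiers matters: \<open>E\<close> depends on \<open>l\<close> only
  and serves all curves and arrays \<open>A\<close>, in particular those obtained by exchanging x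
  and y.\<close>

lemma iterated_quotient_derivative:
  assumes "1 \<le> l"
  shows "\<exists>E. jspan (l - 1) l 1 E \<and> (\<forall>N x y A w. along_curve N x y A \<and> (\<forall>w\<in>N. A 1 0 w \<noteq> 0) \<and> w \<in> N \<longrightarrow>
     (deriv ^^ (l - 1)) (\<lambda>w. deriv y w / A 1 0 w) w =
       ((deriv ^^ l) y w + E (\<lambda>j. (deriv ^^ j) y w) (\<lambda>(i, j). A i j w / A 1 0 w)) / A 1 0 w)"
  using assms
proof (induction l rule: dec_induct)
  case base
  show ?case by (intro exI[of _ "\<lambda>_ _. 0"]) (auto intro: jspan.zero)
next
  case (step l)
  then obtain E where E: "jspan (l - 1) l 1 E"
    "\<And>N x y A w. along_curve N x y A \<Longrightarrow> (\<forall>w\<in>N. A 1 0 w \<noteq> 0) \<Longrightarrow> w \<in> N \<Longrightarrow>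
     (deriv ^^ (l - 1)) (\<lambda>w. deriv y w / A 1 0 w) w =
       ((deriv ^^ l) y w + E (\<lambda>j. (deriv ^^ j) y w) (\<lambda>(i, j). A i j w / A 1 0 w)) / A 1 0 w" by blast
  obtain E' where E': "jspan (Suc (l - 1)) (Suc l) 1 E'" "\<And>c r w. jet_solution c r w \<Longrightarrow>
     ((\<lambda>w. E (\<lambda>j. c j w) (\<lambda>v. r v w)) has_field_derivative E' (\<lambda>j. c j w) (\<lambda>v. r v w)) (at w)"
    using jspan_deriv[OF E(1)] by blast
  \<comment> \<open>The subtracted part comes from differentiating the denominator
    \<open>A 1 0\<close>.\<close>
  define F where "F = (\<lambda>(c :: nat \<Rightarrow> complex) (r :: nat \<times> nat \<Rightarrow> complex).
    E' c r - (r (1, 1) * (c 1 * (c l + E c r)) - r (0, 1) * (r (2, 0) * (c 1 * (c l + E c r)))))"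
  have "jspan l l 1 (\<lambda>c r. c l + E c r)"
    using step by (intro jspan.add jspan.mon[OF jmon.base] jspan_mono[OF E(1)]) auto
  from jspan_var[OF this, of 1] step have "jspan l (Suc l) 2 (\<lambda>c r. c 1 * (c l + E c r))"
    by (simp add: numeral_2_eq_2)
  then have "jspan l (Suc l) 2 (\<lambda>c r. r (1, 1) * (c 1 * (c l + E c r)) - r (0, 1) * (r (2, 0) * (c 1 * (c l + E c r))))"
    by (intro jspan_diff jspan_coef) (auto simp: admissible_vars_def)
  then have "jspan l (Suc l) 1 (\<lambda>c r. r (1, 1) * (c 1 * (c l + E c r)) - r (0, 1) * (r (2, 0) * (c 1 * (c l + E c r))))"
    by (rule jspan_mono) auto
  with E'(1) step have F: "jspan l (Suc l) 1 F"
    unfolding F_def by (intro jspan_diff[of _ _ _ E']) auto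
  have "(deriv ^^ l) (\<lambda>w. deriv y w / A 1 0 w) w =
       ((deriv ^^ Suc l) y w + F (\<lambda>j. (deriv ^^ j) y w) (\<lambda>(i, j). A i j w / A 1 0 w)) / A 1 0 w"
    if curve: "along_curve N x y A" and nz: "\<forall>w\<in>N. A 1 0 w \<noteq> 0" and w: "w \<in> N" for N x y A w
  proof -
    define c where "c = (\<lambda>j w. (deriv ^^ j) y w)"
    define r where "r = (\<lambda>v w. (case v of (i, j) \<Rightarrow> A i j w / A 1 0 w))"
    have sol: "jet_solution c r w"
      using along_curve_jet_solution(1)[OF curve w] nz w unfolding c_def r_def by (simp add: case_prod_unfold)
    have oN: "open N" using curve by (simp add: along_curve_def)
    have dc: "(c l has_field_derivative c (Suc l) w) (at w)"
      using sol step by (simp add: jet_solution_def)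
    have d10: "(A 1 0 has_field_derivative A 1 0 w * (c 1 w * (r (1, 1) w - r (0, 1) w * r (2, 0) w))) (at w)"
      using along_curve_jet_solution(2)[OF curve w] nz w unfolding c_def r_def by simp
    have nzw: "A 1 0 w \<noteq> 0" using nz w by blast
    let ?e = "\<lambda>w. E (\<lambda>j. c j w) (\<lambda>v. r v w)"
    have "((\<lambda>w. (c l w + ?e w) / A 1 0 w) has_field_derivative
        (c (Suc l) w + F (\<lambda>j. c j w) (\<lambda>v. r v w)) / A 1 0 w) (at w)"
      by (rule DERIV_cong[OF DERIV_divide[OF DERIV_add[OF dc E'(2)[OF sol]] d10 nzw]])
         (use nzw in \<open>simp add: F_def field_simps\<close>)
    moreover have "(deriv ^^ (l - 1)) (\<lambda>w. deriv y w / A 1 0 w) w = (c l w + ?e w) / A 1 0 w" if "w \<in> N" for w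
      using E(2)[OF curve nz that] unfolding c_def r_def by (simp add: case_prod_unfold)
    ultimately have "((deriv ^^ (l - 1)) (\<lambda>w. deriv y w / A 1 0 w) has_field_derivative
        (c (Suc l) w + F (\<lambda>j. c j w) (\<lambda>v. r v w)) / A 1 0 w) (at w)"
      using has_field_derivative_transform_within_open[OF _ oN w] by (metis (no_types, lifting))
    then have "(deriv ^^ Suc (l - 1)) (\<lambda>w. deriv y w / A 1 0 w) w =
        (c (Suc l) w + F (\<lambda>j. c j w) (\<lambda>v. r v w)) / A 1 0 w"
      by (simp add: DERIV_imp_deriv)
    then show ?thesis using step unfolding c_def r_def by (simp add: case_prod_unfold)
  qed
  with F show ?case by (intro exI[of _ F]) (simp only: diff_Suc_1, blast)
qed

text \<open>
  The term of order 3 is added to match the example; by symmetry of \<open>cubic_factor\<close> it is compatible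
  with the exchange of \<open>x\<close> and \<open>y\<close>.
\<close>

definition cubic_factor :: "(nat \<Rightarrow> nat \<Rightarrow> 'a :: comm_ring_1) \<Rightarrow> 'a" where
  "cubic_factor A = A 0 1 * A 2 1 + A 1 0 * A 1 2 - A 1 1 ^ 2 - A 1 1 ^ 2 - A 2 0 * A 0 2"

lemma cubic_factor_swap: "cubic_factor (\<lambda>i j. A j i) = cubic_factor A"
  by (simp add: cubic_factor_def algebra_simps)

text \<open>Quantification over all curves allows the same \<open>p\<close> to be used for (x, y)
  with \<open>A\<close> and for (y, x) with the transposed array.\<close>

definition recipe_for :: "((nat \<Rightarrow> nat) \<Rightarrow> int_mpoly) \<Rightarrow> nat \<Rightarrow> bool" where
  "recipe_for p l \<longleftrightarrow> (\<forall>N x y A w. along_curve N x y A \<and> (\<forall>w\<in>N. A 1 0 w \<noteq> 0) \<and> w \<in> N \<longrightarrow>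
     (deriv ^^ (l - 1)) (\<lambda>w. deriv y w / A 1 0 w) w +
        (if l = 3 then (deriv y w / A 1 0 w) ^ 3 * cubic_factor (\<lambda>i j. A i j w) else 0) =
       jet_expr p l (\<lambda>j. (deriv ^^ j) y w) (A 1 0 w) (\<lambda>(i, j). A i j w / A 1 0 w))"

lemma jet_recipe:
  assumes "1 \<le> l"
  shows "\<exists>p. (\<forall>\<mu>\<in>weighted_indices (l - 1) l. mpoly_vars (p \<mu>) \<subseteq> admissible_vars (\<Sum>q=1..l - 1. \<mu> q)) \<and>
    recipe_for p l"
proof -
  obtain E where E: "jspan (l - 1) l 1 E"
    "\<And>N x y A w. along_curve N x y A \<Longrightarrow> (\<forall>w\<in>N. A 1 0 w \<noteq> 0) \<Longrightarrow> w \<in> N \<Longrightarrow>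
     (deriv ^^ (l - 1)) (\<lambda>w. deriv y w / A 1 0 w) w =
       ((deriv ^^ l) y w + E (\<lambda>j. (deriv ^^ j) y w) (\<lambda>(i, j). A i j w / A 1 0 w)) / A 1 0 w"
    using iterated_quotient_derivative[OF assms] by blast
  define M where "M = (\<lambda>(c :: nat \<Rightarrow> complex) (r :: nat \<times> nat \<Rightarrow> complex). c 1 * (c 1 * c 1))"
  \<comment> \<open>Dividing \<open>cubic_factor\<close> by the square of \<open>A 1 0\<close> turns
    it into a polynomial in the ratios, \<open>A 1 0\<close> itself becoming 1. The cube of y' /
    \<open>A 1 0\<close> then leaves a single denominator.\<close>
  define F where "F = (\<lambda>(c :: nat \<Rightarrow> complex) (r :: nat \<times> nat \<Rightarrow> complex).
     r (0, 1) * (r (2, 1) * M c r) + r (1, 2) * M c r - r (1, 1) * (r (1, 1) * M c r)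
       - r (1, 1) * (r (1, 1) * M c r) - r (2, 0) * (r (0, 2) * M c r))"
  \<comment> \<open>Degree 3 is what admits the third-order variables \<open>r (2, 1)\<close> and
    \<open>r (1, 2)\<close>.\<close>
  have M: "jmon 2 3 3 M"
    unfolding M_def using jmon.var[OF jmon.var[OF jmon.base[of 1 2], of 1], of 1]
    by (simp add: numeral_3_eq_3)
  have "jspan 2 3 3 F"
    unfolding F_def by (intro jspan_diff jspan.add jspan_coef jspan.mon[OF M order_refl])
      (simp_all add: admissible_vars_def)
  then have F: "jspan 2 3 1 F"
    by (rule jspan_mono) auto
  have corr: "(deriv y w / A 1 0 w) ^ 3 * cubic_factor (\<lambda>i j. A i j w) =
      F (\<lambda>j. (deriv ^^ j) y w) (\<lambda>(i, j). A i j w / A 1 0 w) / A 1 0 w"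
    if "A 1 0 w \<noteq> 0" for y :: "complex \<Rightarrow> complex" and A :: "nat \<Rightarrow> nat \<Rightarrow> complex \<Rightarrow> complex" and w
    using that by (simp add: F_def M_def cubic_factor_def field_simps power2_eq_square power3_eq_cube)
  define H where "H = (\<lambda>c r. E c r + (if l = 3 then F c r else 0))"
  have "jspan (l - 1) l 1 H"
  proof (cases "l = 3")
    case True
    then show ?thesis unfolding H_def using jspan.add[OF E(1)] F by (simp add: numeral_2_eq_2)
  next
    case False
    then show ?thesis unfolding H_def using E(1) by simp
  qed
  from jspan_normal_form[OF this] obtain p where
    p: "\<forall>\<mu>\<in>weighted_indices (l - 1) l. mpoly_vars (p \<mu>) \<subseteq> admissible_vars (\<Sum>q=1..l - 1. \<mu> q)"
    "\<And>c r. H c r = (\<Sum>\<mu>\<in>weighted_indices (l - 1) l. jmonom (l - 1) c \<mu> * eval_mpoly (p \<mu>) r)" by blast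
  have expr: "jet_expr p l c D r = (c l + H c r) / D" for c D r
    unfolding jet_expr_def p(2) jmonom_def
    by (simp add: add_divide_distrib sum_divide_distrib)
  have "(deriv ^^ (l - 1)) (\<lambda>w. deriv y w / A 1 0 w) w +
        (if l = 3 then (deriv y w / A 1 0 w) ^ 3 * cubic_factor (\<lambda>i j. A i j w) else 0) =
       jet_expr p l (\<lambda>j. (deriv ^^ j) y w) (A 1 0 w) (\<lambda>(i, j). A i j w / A 1 0 w)"
    if "along_curve N x y A" "\<forall>w\<in>N. A 1 0 w \<noteq> 0" "w \<in> N" for N x y A w
  proof -
    have "A 1 0 w \<noteq> 0" using that by blast
    from corr[of A w y, OF this] show ?thesis
      unfolding expr E(2)[OF that] H_def by (auto simp: add_divide_distrib)
  qed
  with p(1) show ?thesis unfolding recipe_for_def by blast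
qed

section \<open>Solving the equation of a curve for one coordinate\<close>

lemma implicit_y:
  assumes "eval2 P x0 y0 = 0" "eval2 (partial 0 1 P) x0 y0 \<noteq> 0"
  obtains U N g where "open U" "(x0, y0) \<in> U" "open N" "x0 \<in> N" "g holomorphic_on N" "g x0 = y0"
    "\<And>x y. (x, y) \<in> U \<and> eval2 P x y = 0 \<longleftrightarrow> x \<in> N \<and> y = g x"
    "\<And>x y. (x, y) \<in> U \<Longrightarrow> eval2 (partial 0 1 P) x y \<noteq> 0"
proof -
  define H where "H = (\<lambda>p :: complex \<times> complex. eval2 P (snd p) (fst p))"
  define A where "A = (\<lambda>p :: complex \<times> complex. eval2 (partial 0 1 P) (snd p) (fst p))"
  define B where "B = (\<lambda>p :: complex \<times> complex. eval2 (partial 1 0 P) (snd p) (fst p))"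
  have "(H has_derivative (\<lambda>h. A p * fst h + B p * snd h)) (at p)" for p
  proof -
    have "((\<lambda>p :: complex \<times> complex. (snd p, fst p)) has_derivative (\<lambda>h. (snd h, fst h))) (at p)"
      by (intro has_derivative_Pair has_derivative_fst has_derivative_snd has_derivative_ident)
    from has_derivative_compose[OF this has_derivative_eval2[of P]]
    show ?thesis by (simp add: H_def A_def B_def add.commute)
  qed
  moreover have "continuous_on UNIV A" "continuous_on UNIV B"
    unfolding A_def B_def by (intro continuous_intros)+
  moreover have "H (y0, x0) = 0" "A (y0, x0) \<noteq> 0" using assms by (simp_all add: H_def A_def)
  ultimately obtain U N g where *: "open U" "(y0, x0) \<in> U" "open N" "x0 \<in> N" "g holomorphic_on N" "g x0 = y0"
    "{p \<in> U. H p = 0} = (\<lambda>v. (g v, v)) ` N" "\<forall>p\<in>U. A p \<noteq> 0"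
    using holomorphic_implicit_function[of H A B y0 x0] by blast
  show thesis
  proof (rule that[of "prod.swap -` U" N g])
    show "open (prod.swap -` U)"
      by (intro open_vimage *(1)) (auto simp: prod.swap_def intro!: continuous_intros)
    show "(x, y) \<in> prod.swap -` U \<and> eval2 P x y = 0 \<longleftrightarrow> x \<in> N \<and> y = g x" for x y
    proof -
      have "(y, x) \<in> {p \<in> U. H p = 0} \<longleftrightarrow> (y, x) \<in> (\<lambda>v. (g v, v)) ` N" by (simp only: *(7))
      then show ?thesis by (auto simp: H_def)
    qed
    show "eval2 (partial 0 1 P) x y \<noteq> 0" if "(x, y) \<in> prod.swap -` U" for x y
      using *(8)[rule_format, of "(y, x)"] that by (simp add: A_def)
  qed (use * in auto)
qed

lemma implicit_x:
  assumes "eval2 P x0 y0 = 0" "eval2 (partial 1 0 P) x0 y0 \<noteq> 0"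
  obtains U N g where "open U" "(x0, y0) \<in> U" "open N" "y0 \<in> N" "g holomorphic_on N" "g y0 = x0"
    "\<And>x y. (x, y) \<in> U \<and> eval2 P x y = 0 \<longleftrightarrow> y \<in> N \<and> x = g y"
    "\<And>x y. (x, y) \<in> U \<Longrightarrow> eval2 (partial 1 0 P) x y \<noteq> 0"
proof -
  define H where "H = (\<lambda>p :: complex \<times> complex. eval2 P (fst p) (snd p))"
  define A where "A = (\<lambda>p :: complex \<times> complex. eval2 (partial 1 0 P) (fst p) (snd p))"
  define B where "B = (\<lambda>p :: complex \<times> complex. eval2 (partial 0 1 P) (fst p) (snd p))"
  have "(H has_derivative (\<lambda>h. A p * fst h + B p * snd h)) (at p)" for p
    unfolding H_def A_def B_def by (rule has_derivative_eval2)
  moreover have "continuous_on UNIV A" "continuous_on UNIV B"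
    unfolding A_def B_def by (intro continuous_intros)+
  moreover have "H (x0, y0) = 0" "A (x0, y0) \<noteq> 0" using assms by (simp_all add: H_def A_def)
  ultimately obtain U N g where *: "open U" "(x0, y0) \<in> U" "open N" "y0 \<in> N" "g holomorphic_on N" "g y0 = x0"
    "{p \<in> U. H p = 0} = (\<lambda>v. (g v, v)) ` N" "\<forall>p\<in>U. A p \<noteq> 0"
    using holomorphic_implicit_function[of H A B x0 y0] by blast
  show thesis
  proof (rule that[OF *(1-6)])
    show "(x, y) \<in> U \<and> eval2 P x y = 0 \<longleftrightarrow> y \<in> N \<and> x = g y" for x y
    proof -
      have "(x, y) \<in> {p \<in> U. H p = 0} \<longleftrightarrow> (x, y) \<in> (\<lambda>v. (g v, v)) ` N" by (simp only: *(7))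
      then show ?thesis by (auto simp: H_def)
    qed
    show "eval2 (partial 1 0 P) x y \<noteq> 0" if "(x, y) \<in> U" for x y
      using *(8)[rule_format, of "(x, y)"] that by (simp add: A_def)
  qed
qed

lemma local_coord_param:
  assumes "open B" "holo_lift B T X Y \<psi>" "\<And>w. w \<in> B \<Longrightarrow> z (\<psi> w) = w" "openin (top_of_set C) (\<psi> ` B)"
  shows "local_coord C (\<psi> ` B) z" "z ` \<psi> ` B = B" "\<And>w. w \<in> B \<Longrightarrow> inv_into (\<psi> ` B) z w = \<psi> w"
proof -
  show 1: "z ` \<psi> ` B = B" using assms(3) by force
  have inj: "inj_on z (\<psi> ` B)" using assms(3) by (auto simp: inj_on_def)
  show 2: "inv_into (\<psi> ` B) z w = \<psi> w" if "w \<in> B" for w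
    using inv_into_f_f[OF inj, of "\<psi> w"] assms(3)[OF that] that by auto
  have "holo_lift B T X Y (inv_into (\<psi> ` B) z)"
    using assms(2) 2 unfolding holo_lift_def by auto
  then have "holo_map_on B (inv_into (\<psi> ` B) z)"
    by (rule holo_map_on_if_lift[OF assms(1)])
  then show "local_coord C (\<psi> ` B) z"
    unfolding local_coord_def 1 using assms(1,4) inj by blast
qed

lemma eval2_cubic_factor:
  "eval2 (cubic_factor P) x y = cubic_factor (\<lambda>i j. eval2 (P i j) x y)"
  by (simp only: cubic_factor_def power2_eq_square eval2_add eval2_diff eval2_mult)

text \<open>Every product consists of two derivatives of \<open>R\<close> whose orders add up to
  4.\<close>

lemma cubic_factor_polys_le:
  assumes "R \<in> polys_le d" "3 \<le> d"
  shows "cubic_factor (\<lambda>i j. partial i j R) \<in> polys_le (2 * d - 4)"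
proof -
  have le: "partial i j R * partial k l R \<in> polys_le (2 * d - 4)" if "i + j \<le> d" "k + l \<le> d" "i + j + (k + l) = 4" for i j k l
  proof -
    have "partial i j R * partial k l R \<in> polys_le ((d - (i + j)) + (d - (k + l)))"
      by (intro polys_le_mult polys_le_partial assms)
    then show ?thesis by (rule polys_le_mono) (use that in linarith)
  qed
  show ?thesis
    unfolding cubic_factor_def power2_eq_square
    by (intro polys_le_diff polys_le_add le) (use assms in auto)
qed

subsection \<open>The jet differentials on a smooth plane curve\<close>

text \<open>The hypotheses of the theorem rewritten for the polynomial \<open>R\<close>: the points
  at infinity and their simplicity are expressed by the homogenization of \<open>R\<close> instead
  of the given form.\<close>

locale plane_curve =
  fixes C :: "proj2 set" and R :: "complex poly poly" and d :: nat
  assumes d: "4 \<le> d" and R_le: "R \<in> polys_le d"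
    and top_coeff: "coeff (coeff R d) 0 \<noteq> 0"
    and C_affine: "\<And>x y. pt 1 x y \<in> C \<longleftrightarrow> eval2 R x y = 0"
    and C_infinity: "\<And>t s. pt t 1 s \<in> C \<longleftrightarrow> eval2 (hompoly d R) t s = 0"
    and C_corner: "pt 0 0 1 \<notin> C"
    and smooth: "\<And>x y. eval2 R x y = 0 \<Longrightarrow> eval2 (partial 1 0 R) x y \<noteq> 0 \<or> eval2 (partial 0 1 R) x y \<noteq> 0"
    and smooth_infinity: "\<And>s. eval2 (hompoly d R) 0 s = 0 \<Longrightarrow> eval2 (partial 0 1 (hompoly d R)) 0 s \<noteq> 0"
    and card_infinity: "card {s. eval2 (hompoly d R) 0 s = 0} = d"
begin

abbreviation Rd :: "nat \<Rightarrow> nat \<Rightarrow> proj2 \<Rightarrow> complex" where "Rd \<equiv> partial_at R"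

lemma C_not_affine:
  assumes "p \<in> C" "p \<notin> affine_plane"
  obtains s where "p = pt 0 1 s" "eval2 (hompoly d R) 0 s = 0"
proof -
  obtain T X Y where p: "(T, X, Y) \<noteq> (0, 0, 0)" "p = pt T X Y" by (rule pt_exhaust)
  then have T: "T = 0" using assms(2) pt_in_affine_plane by blast
  have "X \<noteq> 0"
  proof
    assume "X = 0"
    then have "pt T X Y = pt 0 0 1" using p T by (subst pt_eq_iff) (auto intro!: exI[of _ "1 / Y"])
    then show False using assms(1) p C_corner by simp
  qed
  then have "p = pt 0 1 (Y / X)" using pt_infinity_eq[of X T Y] p T by simp
  then show thesis using that assms(1) C_infinity by metis
qed

lemma along_curve_local_map:
  assumes "local_map C \<zeta> f" "f \<zeta> \<in> affine_plane"
  obtains N where "open N" "\<zeta> \<in> N" "f ` N \<subseteq> C \<inter> affine_plane" "\<forall>w\<in>N. local_map C w f"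
    "along_curve N (\<lambda>w. xcoord (f w)) (\<lambda>w. ycoord (f w)) (\<lambda>i j w. Rd i j (f w))"
proof -
  have "f \<zeta> \<in> chart_dom True" using assms(2) by (simp add: chart_dom_def)
  then obtain N where N: "open N" "\<zeta> \<in> N" "\<forall>w\<in>N. f w \<in> chart_dom True" "\<forall>w\<in>N. local_map C w f"
    "\<forall>c. (\<lambda>w. coord True c (f w)) holomorphic_on N"
    using coord_holomorphic[OF assms(1)] by metis
  have aff: "f w \<in> affine_plane" "f w \<in> C" if "w \<in> N" for w
    using N(3,4) that by (auto simp: chart_dom_def local_map_def)
  have hol: "(\<lambda>w. xcoord (f w)) holomorphic_on N" "(\<lambda>w. ycoord (f w)) holomorphic_on N"
    using N(5)[rule_format, of True] N(5)[rule_format, of False] by (simp_all add: coord_def)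
  have dR: "((\<lambda>w. Rd i j (f w)) has_field_derivative
      Rd (Suc i) j (f w) * deriv (\<lambda>w. xcoord (f w)) w + Rd i (Suc j) (f w) * deriv (\<lambda>w. ycoord (f w)) w) (at w)"
    if "w \<in> N" for i j w
    using DERIV_eval2[OF holomorphic_derivI[OF hol(1) N(1) that] holomorphic_derivI[OF hol(2) N(1) that],
        of "partial i j R"]
    by (simp add: partial_at_def partial_Suc_left[of 0] partial_Suc_right[of 0 0] partial_Suc_left partial_Suc_right)
  have "Rd 0 0 (f w) = 0" if "w \<in> N" for w
    using aff[OF that] affine_planeE[OF aff(1)[OF that]] C_affine
    by (metis partial_0_0 partial_at_def)
  then have "Rd 1 0 (f w) * deriv (\<lambda>w. xcoord (f w)) w + Rd 0 1 (f w) * deriv (\<lambda>w. ycoord (f w)) w = 0"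
    if "w \<in> N" for w
    using DERIV_unique[OF dR[OF that, of 0 0]
        has_field_derivative_transform_within_open[OF DERIV_const[of 0] N(1) that]] by simp
  with dR have "along_curve N (\<lambda>w. xcoord (f w)) (\<lambda>w. ycoord (f w)) (\<lambda>i j w. Rd i j (f w))"
    unfolding along_curve_def using N(1) hol by blast
  with N aff show thesis by (intro that) auto
qed

text \<open>By smoothness one of the denominators is nonzero at each affine point of the curve.
  Where both are, the two quotients agree, because R(x, y) = 0 has been differentiated along the
  map.\<close>

definition J1 :: "(complex \<Rightarrow> proj2) \<Rightarrow> complex \<Rightarrow> complex" where
  "J1 f w = (if Rd 1 0 (f w) \<noteq> 0 then deriv (\<lambda>w. ycoord (f w)) w / Rd 1 0 (f w)
     else - deriv (\<lambda>w. xcoord (f w)) w / Rd 0 1 (f w))"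

lemma J1_y: "Rd 1 0 (f w) \<noteq> 0 \<Longrightarrow> J1 f w = deriv (\<lambda>w. ycoord (f w)) w / Rd 1 0 (f w)"
  by (simp add: J1_def)

lemma J1_x:
  assumes "local_map C w f" "f w \<in> affine_plane" "Rd 0 1 (f w) \<noteq> 0"
  shows "J1 f w = - deriv (\<lambda>w. xcoord (f w)) w / Rd 0 1 (f w)"
proof (cases "Rd 1 0 (f w) = 0")
  case False
  obtain N where "w \<in> N" "along_curve N (\<lambda>w. xcoord (f w)) (\<lambda>w. ycoord (f w)) (\<lambda>i j w. Rd i j (f w))"
    using along_curve_local_map[OF assms(1,2)] by metis
  then have "Rd 1 0 (f w) * deriv (\<lambda>w. xcoord (f w)) w + Rd 0 1 (f w) * deriv (\<lambda>w. ycoord (f w)) w = 0"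
    by (simp add: along_curve_def)
  then show ?thesis using False assms(3) by (simp add: J1_def field_simps add_eq_0_iff)
qed (simp add: J1_def)

text \<open>
  A coordinate in which \<open>J1\<close> becomes \<open>z' \<phi>(z)^(d-3) k(z)\<close>, where \<open>\<phi>\<close> vanishes precisely at infinity:
  \<open>\<phi> = 1\<close> at affine points and \<open>\<phi>(t) = t\<close> at a point at infinity.
\<close>

definition adapted ::
    "proj2 set \<Rightarrow> (proj2 \<Rightarrow> complex) \<Rightarrow> (complex \<Rightarrow> complex) \<Rightarrow> (complex \<Rightarrow> complex) \<Rightarrow> bool" where
  "adapted V z \<phi> k \<longleftrightarrow> local_coord C V z \<and> \<phi> holomorphic_on z ` V \<and> k holomorphic_on z ` V \<and>
     V \<subseteq> C \<and> (\<exists>b c. z = coord b c \<and> V \<subseteq> chart_dom b) \<and>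
     (\<forall>q\<in>V. q \<notin> affine_plane \<longleftrightarrow> \<phi> (z q) = 0) \<and>
     (\<forall>q\<in>V. \<forall>q'\<in>V. q \<notin> affine_plane \<and> q' \<notin> affine_plane \<longrightarrow> q = q') \<and>
     (\<forall>\<zeta> f. local_map C \<zeta> f \<and> f \<zeta> \<in> V \<inter> affine_plane \<longrightarrow>
        J1 f \<zeta> = deriv (\<lambda>w. z (f w)) \<zeta> * \<phi> (z (f \<zeta>)) ^ (d - 3) * k (z (f \<zeta>))) \<and>
     (\<forall>\<delta>. \<forall>G\<in>polys_le \<delta>. \<exists>\<gamma>. \<gamma> holomorphic_on z ` V \<and>
        (\<forall>q\<in>V \<inter> affine_plane. \<phi> (z q) ^ \<delta> * eval2 G (xcoord q) (ycoord q) = \<gamma> (z q)))"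

section \<open>Existence of adapted coordinates\<close>

lemma adapted_affine_y:
  assumes "eval2 R x0 y0 = 0" "eval2 (partial 0 1 R) x0 y0 \<noteq> 0"
  shows "\<exists>V \<phi> k. pt 1 x0 y0 \<in> V \<and> adapted V xcoord \<phi> k \<and> V \<subseteq> affine_plane"
proof -
  obtain U N g where *: "open U" "(x0, y0) \<in> U" "open N" "x0 \<in> N" "g holomorphic_on N" "g x0 = y0"
    and eq: "\<And>x y. (x, y) \<in> U \<and> eval2 R x y = 0 \<longleftrightarrow> x \<in> N \<and> y = g x"
    and nz: "\<And>x y. (x, y) \<in> U \<Longrightarrow> eval2 (partial 0 1 R) x y \<noteq> 0"
    using implicit_y[OF assms] by metis
  define \<psi> where "\<psi> = (\<lambda>w. pt 1 w (g w))"
  have V: "\<psi> ` N = C \<inter> {pt 1 x y | x y. (x, y) \<in> U}"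
  proof -
    have "C \<inter> {pt 1 x y | x y. (x, y) \<in> U} = {pt 1 x y | x y. (x, y) \<in> U \<and> eval2 R x y = 0}"
      using C_affine by auto
    also have "\<dots> = \<psi> ` N" unfolding eq by (auto simp: \<psi>_def)
    finally show ?thesis by simp
  qed
  have "openin (top_of_set C) (\<psi> ` N)"
    unfolding V by (intro openin_open_Int open_affine_chart *)
  moreover have "holo_lift N (\<lambda>_. 1) (\<lambda>w. w) g \<psi>"
    using *(5) by (auto simp: holo_lift_def \<psi>_def intro!: holomorphic_intros)
  ultimately have coord: "local_coord C (\<psi> ` N) xcoord" and zV: "xcoord ` \<psi> ` N = N"
    using local_coord_param[OF *(3), of "\<lambda>_. 1" "\<lambda>w. w" g \<psi> xcoord C] by (auto simp: \<psi>_def)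
  have inV: "\<exists>w\<in>N. q = pt 1 w (g w)" if "q \<in> \<psi> ` N" for q
    using that by (auto simp: \<psi>_def)
  have aff: "q \<in> affine_plane" if "q \<in> \<psi> ` N" for q
    using inV[OF that] by (auto simp: affine_plane_def)
  have nzg: "eval2 (partial 0 1 R) w (g w) \<noteq> 0" if "w \<in> N" for w
    using nz eq that by blast
  have "adapted (\<psi> ` N) xcoord (\<lambda>_. 1) (\<lambda>w. - 1 / eval2 (partial 0 1 R) w (g w))"
    unfolding adapted_def zV
  proof (intro conjI allI ballI impI)
    show "(\<lambda>w. - 1 / eval2 (partial 0 1 R) w (g w)) holomorphic_on N"
      using nzg *(5) by (intro holomorphic_intros) auto
    show "\<psi> ` N \<subseteq> C" using V by blast
    show "\<exists>b c. xcoord = coord b c \<and> \<psi> ` N \<subseteq> chart_dom b"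
      using aff by (intro exI[of _ True]) (auto simp: coord_def chart_dom_def)
  next
    fix \<zeta> f assume as: "local_map C \<zeta> f \<and> f \<zeta> \<in> \<psi> ` N \<inter> affine_plane"
    then obtain w where w: "w \<in> N" "f \<zeta> = pt 1 w (g w)" using inV by blast
    then have "Rd 0 1 (f \<zeta>) = eval2 (partial 0 1 R) w (g w)" by (simp add: partial_at_def)
    with J1_x[of \<zeta> f] as nzg[OF w(1)] w
    show "J1 f \<zeta> = deriv (\<lambda>w. xcoord (f w)) \<zeta> * 1 ^ (d - 3) * (- 1 / eval2 (partial 0 1 R) (xcoord (f \<zeta>)) (g (xcoord (f \<zeta>))))"
      by simp
  next
    fix \<delta> G assume "G \<in> polys_le \<delta>"
    show "\<exists>\<gamma>. \<gamma> holomorphic_on N \<and> (\<forall>q\<in>\<psi> ` N \<inter> affine_plane. 1 ^ \<delta> * eval2 G (xcoord q) (ycoord q) = \<gamma> (xcoord q))"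
      using *(5) by (intro exI[of _ "\<lambda>w. eval2 G w (g w)"]) (auto simp: \<psi>_def intro!: holomorphic_intros)
  qed (use coord aff in auto)
  moreover have "pt 1 x0 y0 \<in> \<psi> ` N" using *(4,6) by (auto simp: \<psi>_def)
  moreover have "\<psi> ` N \<subseteq> affine_plane" using aff by blast
  ultimately show ?thesis by blast
qed

lemma adapted_affine_x:
  assumes "eval2 R x0 y0 = 0" "eval2 (partial 1 0 R) x0 y0 \<noteq> 0"
  shows "\<exists>V \<phi> k. pt 1 x0 y0 \<in> V \<and> adapted V ycoord \<phi> k \<and> V \<subseteq> affine_plane"
proof -
  obtain U N g where *: "open U" "(x0, y0) \<in> U" "open N" "y0 \<in> N" "g holomorphic_on N" "g y0 = x0"
    and eq: "\<And>x y. (x, y) \<in> U \<and> eval2 R x y = 0 \<longleftrightarrow> y \<in> N \<and> x = g y"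
    and nz: "\<And>x y. (x, y) \<in> U \<Longrightarrow> eval2 (partial 1 0 R) x y \<noteq> 0"
    using implicit_x[OF assms] by metis
  define \<psi> where "\<psi> = (\<lambda>w. pt 1 (g w) w)"
  have V: "\<psi> ` N = C \<inter> {pt 1 x y | x y. (x, y) \<in> U}"
  proof -
    have "C \<inter> {pt 1 x y | x y. (x, y) \<in> U} = {pt 1 x y | x y. (x, y) \<in> U \<and> eval2 R x y = 0}"
      using C_affine by auto
    also have "\<dots> = \<psi> ` N" unfolding eq by (auto simp: \<psi>_def)
    finally show ?thesis by simp
  qed
  have "openin (top_of_set C) (\<psi> ` N)"
    unfolding V by (intro openin_open_Int open_affine_chart *)
  moreover have "holo_lift N (\<lambda>_. 1) g (\<lambda>w. w) \<psi>"
    using *(5) by (auto simp: holo_lift_def \<psi>_def intro!: holomorphic_intros)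
  ultimately have coord: "local_coord C (\<psi> ` N) ycoord" and zV: "ycoord ` \<psi> ` N = N"
    using local_coord_param[OF *(3), of "\<lambda>_. 1" g "\<lambda>w. w" \<psi> ycoord C] by (auto simp: \<psi>_def)
  have inV: "\<exists>w\<in>N. q = pt 1 (g w) w" if "q \<in> \<psi> ` N" for q
    using that by (auto simp: \<psi>_def)
  have aff: "q \<in> affine_plane" if "q \<in> \<psi> ` N" for q
    using inV[OF that] by (auto simp: affine_plane_def)
  have nzg: "eval2 (partial 1 0 R) (g w) w \<noteq> 0" if "w \<in> N" for w
    using nz eq that by blast
  have "adapted (\<psi> ` N) ycoord (\<lambda>_. 1) (\<lambda>w. 1 / eval2 (partial 1 0 R) (g w) w)"
    unfolding adapted_def zV
  proof (intro conjI allI ballI impI)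
    show "(\<lambda>w. 1 / eval2 (partial 1 0 R) (g w) w) holomorphic_on N"
      using nzg *(5) by (intro holomorphic_intros) auto
    show "\<psi> ` N \<subseteq> C" using V by blast
    show "\<exists>b c. ycoord = coord b c \<and> \<psi> ` N \<subseteq> chart_dom b"
      using aff by (intro exI[of _ True] exI[of _ False]) (auto simp: coord_def chart_dom_def)
  next
    fix \<zeta> f assume as: "local_map C \<zeta> f \<and> f \<zeta> \<in> \<psi> ` N \<inter> affine_plane"
    then obtain w where w: "w \<in> N" "f \<zeta> = pt 1 (g w) w" using inV by blast
    then have "Rd 1 0 (f \<zeta>) = eval2 (partial 1 0 R) (g w) w" by (simp add: partial_at_def)
    with J1_y[of f \<zeta>] nzg[OF w(1)] w
    show "J1 f \<zeta> = deriv (\<lambda>w. ycoord (f w)) \<zeta> * 1 ^ (d - 3) * (1 / eval2 (partial 1 0 R) (g (ycoord (f \<zeta>))) (ycoord (f \<zeta>)))"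
      by simp
  next
    fix \<delta> G assume "G \<in> polys_le \<delta>"
    show "\<exists>\<gamma>. \<gamma> holomorphic_on N \<and> (\<forall>q\<in>\<psi> ` N \<inter> affine_plane. 1 ^ \<delta> * eval2 G (xcoord q) (ycoord q) = \<gamma> (ycoord q))"
      using *(5) by (intro exI[of _ "\<lambda>w. eval2 G (g w) w"]) (auto simp: \<psi>_def intro!: holomorphic_intros)
  qed (use coord aff in auto)
  moreover have "pt 1 x0 y0 \<in> \<psi> ` N" using *(4,6) by (auto simp: \<psi>_def)
  moreover have "\<psi> ` N \<subseteq> affine_plane" using aff by blast
  ultimately show ?thesis by blast
qed

lemma coords_of_infinity_chart:
  assumes "t \<noteq> 0"
  shows "pt t 1 s \<in> affine_plane" "xcoord (pt t 1 s) = 1 / t" "ycoord (pt t 1 s) = s / t"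
  using assms by (simp_all add: pt_in_affine_plane coords_pt)

text \<open>With x = 1/t and y = s/t one has x' = -t'/t^2, and R_y is t^(1-d) times the s-derivative
  of the homogenization \<open>?H\<close>. Hence -x'/R_y is t' t^(d-3) divided by that derivative,
  which does not vanish. A polynomial of degree at most \<delta> becomes t^(-\<delta>) times its
  homogenization.\<close>

lemma adapted_infinity:
  assumes "eval2 (hompoly d R) 0 s0 = 0"
  shows "\<exists>V \<phi> k. pt 0 1 s0 \<in> V \<and> adapted V tcoord \<phi> k"
proof -
  let ?H = "hompoly d R"
  obtain U N g where *: "open U" "(0, s0) \<in> U" "open N" "0 \<in> N" "g holomorphic_on N" "g 0 = s0"
    and eq: "\<And>t s. (t, s) \<in> U \<and> eval2 ?H t s = 0 \<longleftrightarrow> t \<in> N \<and> s = g t"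
    and nz: "\<And>t s. (t, s) \<in> U \<Longrightarrow> eval2 (partial 0 1 ?H) t s \<noteq> 0"
    using implicit_y[OF assms smooth_infinity[OF assms]] by metis
  define \<psi> where "\<psi> = (\<lambda>t. pt t 1 (g t))"
  have V: "\<psi> ` N = C \<inter> {pt t 1 s | t s. (t, s) \<in> U}"
  proof -
    have "C \<inter> {pt t 1 s | t s. (t, s) \<in> U} = {pt t 1 s | t s. (t, s) \<in> U \<and> eval2 ?H t s = 0}"
      using C_infinity by auto
    also have "\<dots> = \<psi> ` N" unfolding eq by (auto simp: \<psi>_def)
    finally show ?thesis by simp
  qed
  have op: "openin (top_of_set C) (\<psi> ` N)"
    unfolding V by (intro openin_open_Int open_infinity_chart *)
  moreover have "holo_lift N (\<lambda>t. t) (\<lambda>_. 1) g \<psi>"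
    using *(5) by (auto simp: holo_lift_def \<psi>_def intro!: holomorphic_intros)
  ultimately have coord: "local_coord C (\<psi> ` N) tcoord" and zV: "tcoord ` \<psi> ` N = N"
    using local_coord_param[OF *(3), of "\<lambda>t. t" "\<lambda>_. 1" g \<psi> tcoord C] by (auto simp: \<psi>_def)
  have inV: "\<exists>t\<in>N. q = pt t 1 (g t)" if "q \<in> \<psi> ` N" for q
    using that by (auto simp: \<psi>_def)
  have aff: "q \<in> affine_plane \<longleftrightarrow> tcoord q \<noteq> 0" if "q \<in> \<psi> ` N" for q
    using inV[OF that] by (auto simp: pt_in_affine_plane)
  have inVaff: "\<exists>t\<in>N. t \<noteq> 0 \<and> q = pt t 1 (g t)" if q: "q \<in> \<psi> ` N" "q \<in> affine_plane" for q
  proof -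
    obtain t where t: "t \<in> N" "q = pt t 1 (g t)" using inV[OF q(1)] by blast
    then have "t \<noteq> 0" using aff[OF q(1)] q(2) by simp
    with t show ?thesis by blast
  qed
  have nzg: "eval2 (partial 0 1 ?H) t (g t) \<noteq> 0" if "t \<in> N" for t
    using nz eq that by blast
  have "adapted (\<psi> ` N) tcoord (\<lambda>t. t) (\<lambda>t. 1 / eval2 (partial 0 1 ?H) t (g t))"
    unfolding adapted_def zV
  proof (intro conjI allI ballI impI)
    show "(\<lambda>t. 1 / eval2 (partial 0 1 ?H) t (g t)) holomorphic_on N"
      using nzg *(5) by (intro holomorphic_intros) auto
    show "\<psi> ` N \<subseteq> C" using V by blast
    show "\<exists>b c. tcoord = coord b c \<and> \<psi> ` N \<subseteq> chart_dom b"
      using inV by (intro exI[of _ False] exI[of _ True]) (auto simp: coord_def chart_dom_def \<psi>_def)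
    show "q = q'" if "q \<in> \<psi> ` N" "q' \<in> \<psi> ` N" "q \<notin> affine_plane \<and> q' \<notin> affine_plane" for q q'
      using inV[OF that(1)] inV[OF that(2)] aff[OF that(1)] aff[OF that(2)] that(3) by auto
  next
    fix \<zeta> f assume as: "local_map C \<zeta> f \<and> f \<zeta> \<in> \<psi> ` N \<inter> affine_plane"
    then obtain t where t: "t \<in> N" "f \<zeta> = pt t 1 (g t)" using inV by blast
    have "tcoord (f \<zeta>) \<noteq> 0" using aff[of "f \<zeta>"] as by blast
    then have t0: "t \<noteq> 0" using t(2) by simp
    \<comment> \<open>The map stays in the chart and in the affine plane near \<zeta>, so that x =
      1/t holds on a neighbourhood and may be differentiated.\<close>
    have "openin (top_of_set C) (\<psi> ` N \<inter> affine_plane)"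
      using op open_chart_dom[of True] by (simp add: chart_dom_def openin_Int_open)
    then obtain M where M: "open M" "\<zeta> \<in> M" "f ` M \<subseteq> \<psi> ` N \<inter> affine_plane"
      using local_map_in_openin[of C \<zeta> f] as by metis
    have "f \<zeta> \<in> chart_dom False" using t(2) by (auto simp: chart_dom_def)
    then obtain M' where M': "open M'" "\<zeta> \<in> M'" "(\<lambda>w. coord False True (f w)) holomorphic_on M'"
      using coord_holomorphic[of C \<zeta> f False] as by metis
    have dt: "((\<lambda>w. tcoord (f w)) has_field_derivative deriv (\<lambda>w. tcoord (f w)) \<zeta>) (at \<zeta>)"
      using holomorphic_derivI[OF M'(3,1,2)] by (simp add: coord_def)
    have "((\<lambda>w. 1 / tcoord (f w)) has_field_derivative (- deriv (\<lambda>w. tcoord (f w)) \<zeta> / t ^ 2)) (at \<zeta>)"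
      by (rule DERIV_cong[OF DERIV_divide[OF DERIV_const dt]]) (use t t0 in \<open>auto simp: power2_eq_square\<close>)
    moreover have "1 / tcoord (f w) = xcoord (f w)" if "w \<in> M" for w
    proof -
      have "f w \<in> \<psi> ` N" "f w \<in> affine_plane" using M(3) that by auto
      then obtain t' where "f w = pt t' 1 (g t')" "t' \<noteq> 0" using inVaff by blast
      then show ?thesis by (simp add: coords_of_infinity_chart)
    qed
    ultimately have "((\<lambda>w. xcoord (f w)) has_field_derivative (- deriv (\<lambda>w. tcoord (f w)) \<zeta> / t ^ 2)) (at \<zeta>)"
      by (rule has_field_derivative_transform_within_open[OF _ M(1,2)])
    then have dx: "deriv (\<lambda>w. xcoord (f w)) \<zeta> = - deriv (\<lambda>w. tcoord (f w)) \<zeta> / t ^ 2"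
      by (rule DERIV_imp_deriv)
    \<comment> \<open>\<open>R\<close> has degree d and its y-derivative degree at most d - 1; this
      is the exponent of t.\<close>
    have Rdt: "Rd 0 1 (f \<zeta>) = eval2 (partial 0 1 ?H) t (g t) / t ^ (d - 1)"
    proof -
      have "partial 0 1 R \<in> polys_le (d - 1)" using polys_le_partial[OF R_le, of 0 1] by simp
      from eval2_hompoly[OF this t0, of "g t"] show ?thesis
        unfolding partial_at_def t(2) using t0 d pderiv_hompoly[of d R]
        by (simp add: coords_of_infinity_chart)
    qed
    have "J1 f \<zeta> = - deriv (\<lambda>w. xcoord (f w)) \<zeta> / Rd 0 1 (f \<zeta>)"
    proof (rule J1_x)
      show "Rd 0 1 (f \<zeta>) \<noteq> 0" unfolding Rdt using nzg[OF t(1)] t0 by simp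
    qed (use as in blast)+
    also have "\<dots> = deriv (\<lambda>w. tcoord (f w)) \<zeta> * (t ^ (d - 1) / t ^ 2) * (1 / eval2 (partial 0 1 ?H) t (g t))"
      unfolding dx Rdt by simp
    also have "t ^ (d - 1) / t ^ 2 = t ^ (d - 3)"
      using t0 d by (simp add: power_diff[symmetric] numeral_3_eq_3)
    finally show "J1 f \<zeta> = deriv (\<lambda>w. tcoord (f w)) \<zeta> * tcoord (f \<zeta>) ^ (d - 3) * (1 / eval2 (partial 0 1 ?H) (tcoord (f \<zeta>)) (g (tcoord (f \<zeta>))))"
      by (simp add: t)
  next
    fix \<delta> G assume G: "G \<in> polys_le \<delta>"
    have "(\<lambda>t. eval2 (hompoly \<delta> G) t (g t)) holomorphic_on N"
      using *(5) by (auto intro!: holomorphic_intros)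
    moreover have "tcoord q ^ \<delta> * eval2 G (xcoord q) (ycoord q) = eval2 (hompoly \<delta> G) (tcoord q) (g (tcoord q))"
      if q: "q \<in> \<psi> ` N \<inter> affine_plane" for q
    proof -
      obtain t where "q = pt t 1 (g t)" "t \<noteq> 0" using inVaff[of q] q by blast
      then show ?thesis using eval2_hompoly[OF G, of t "g t"] by (simp add: coords_of_infinity_chart)
    qed
    ultimately show "\<exists>\<gamma>. \<gamma> holomorphic_on N \<and> (\<forall>q\<in>\<psi> ` N \<inter> affine_plane. tcoord q ^ \<delta> * eval2 G (xcoord q) (ycoord q) = \<gamma> (tcoord q))"
      by blast
  qed (use coord aff in auto)
  moreover have "pt 0 1 s0 \<in> \<psi> ` N" using *(4,6) by (auto simp: \<psi>_def)
  ultimately show ?thesis by blast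
qed

lemma adapted_exists:
  assumes "p \<in> C"
  obtains V z \<phi> k where "p \<in> V" "adapted V z \<phi> k"
proof (cases "p \<in> affine_plane")
  case True
  then obtain x y where p: "p = pt 1 x y" by (auto simp: affine_plane_def)
  then have "eval2 R x y = 0" using assms C_affine by simp
  then show thesis
    using smooth adapted_affine_x adapted_affine_y that unfolding p by blast
next
  case False
  then show thesis using C_not_affine[OF assms] adapted_infinity that by metis
qed

end

lemma jet_polynomial_near_wpoly:
  assumes "local_coord C V z" "p \<in> V" "wpoly (z ` V) k m E"
    and "\<And>\<zeta> f. local_map C \<zeta> f \<Longrightarrow> f \<zeta> \<in> V \<Longrightarrow>
       \<Phi> (jet_of k C \<zeta> f) = E (z (f \<zeta>)) (\<lambda>j. (deriv ^^ j) (\<lambda>w. z (f w)) \<zeta>)"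
  shows "jet_polynomial_near k C (weighted_indices k m) \<Phi> p"
proof -
  obtain b where b: "\<forall>\<mu>\<in>weighted_indices k m. b \<mu> holomorphic_on z ` V"
    "\<forall>t c. E t c = (\<Sum>\<mu>\<in>weighted_indices k m. b \<mu> t * jmonom k c \<mu>)"
    using wpoly_normal_form[OF assms(3)] unfolding normal_form_def by blast
  have "holo_fun_on V z (\<lambda>q. b \<mu> (z q))" if "\<mu> \<in> weighted_indices k m" for \<mu>
  proof -
    have "(\<lambda>w. b \<mu> (z (inv_into V z w))) holomorphic_on z ` V \<longleftrightarrow> b \<mu> holomorphic_on z ` V"
      by (intro holomorphic_cong) (auto simp: f_inv_into_f)
    then show ?thesis using b(1) that by (simp add: holo_fun_on_def)
  qed
  with assms b(2) show ?thesis
    unfolding jet_polynomial_near_def jmonom_def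
    by (intro exI[of _ V] exI[of _ z] exI[of _ "\<lambda>\<mu> q. b \<mu> (z q)"]) auto
qed

section \<open>Jet differentials and sections in adapted coordinates\<close>

context plane_curve
begin

lemma adaptedD:
  assumes "adapted V z \<phi> k"
  shows "local_coord C V z" "\<phi> holomorphic_on z ` V" "k holomorphic_on z ` V" "V \<subseteq> C"
    "\<exists>b c. z = coord b c \<and> V \<subseteq> chart_dom b"
    "q \<in> V \<Longrightarrow> q \<notin> affine_plane \<longleftrightarrow> \<phi> (z q) = 0"
    "q \<in> V \<Longrightarrow> q' \<in> V \<Longrightarrow> q \<notin> affine_plane \<Longrightarrow> q' \<notin> affine_plane \<Longrightarrow> q = q'"
    "local_map C \<zeta> f \<Longrightarrow> f \<zeta> \<in> V \<inter> affine_plane \<Longrightarrow>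
        J1 f \<zeta> = deriv (\<lambda>w. z (f w)) \<zeta> * \<phi> (z (f \<zeta>)) ^ (d - 3) * k (z (f \<zeta>))"
    "G \<in> polys_le \<delta> \<Longrightarrow> \<exists>\<gamma>. \<gamma> holomorphic_on z ` V \<and>
        (\<forall>q\<in>V \<inter> affine_plane. \<phi> (z q) ^ \<delta> * eval2 G (xcoord q) (ycoord q) = \<gamma> (z q))"
proof -
  note * = assms[unfolded adapted_def]
  show "local_coord C V z" by (rule *[THEN conjunct1])
  note * = *[THEN conjunct2]
  show "\<phi> holomorphic_on z ` V" by (rule *[THEN conjunct1])
  note * = *[THEN conjunct2]
  show "k holomorphic_on z ` V" by (rule *[THEN conjunct1])
  note * = *[THEN conjunct2]
  show "V \<subseteq> C" by (rule *[THEN conjunct1])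
  note * = *[THEN conjunct2]
  show "\<exists>b c. z = coord b c \<and> V \<subseteq> chart_dom b" by (rule *[THEN conjunct1])
  note * = *[THEN conjunct2]
  show "q \<in> V \<Longrightarrow> q \<notin> affine_plane \<longleftrightarrow> \<phi> (z q) = 0" by (rule *[THEN conjunct1, rule_format])
  note * = *[THEN conjunct2]
  show "q \<in> V \<Longrightarrow> q' \<in> V \<Longrightarrow> q \<notin> affine_plane \<Longrightarrow> q' \<notin> affine_plane \<Longrightarrow> q = q'"
    by (rule *[THEN conjunct1, rule_format]) simp_all
  note * = *[THEN conjunct2]
  show "local_map C \<zeta> f \<Longrightarrow> f \<zeta> \<in> V \<inter> affine_plane \<Longrightarrow>
        J1 f \<zeta> = deriv (\<lambda>w. z (f w)) \<zeta> * \<phi> (z (f \<zeta>)) ^ (d - 3) * k (z (f \<zeta>))"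
    by (rule *[THEN conjunct1, rule_format]) simp
  show "G \<in> polys_le \<delta> \<Longrightarrow> \<exists>\<gamma>. \<gamma> holomorphic_on z ` V \<and>
        (\<forall>q\<in>V \<inter> affine_plane. \<phi> (z q) ^ \<delta> * eval2 G (xcoord q) (ycoord q) = \<gamma> (z q))"
    by (rule *[THEN conjunct2, rule_format])
qed

lemma adapted_nbhd:
  assumes "adapted V z \<phi> k" "local_map C \<zeta> f" "f \<zeta> \<in> W" "W \<subseteq> V" "openin (top_of_set C) W"
  obtains N where "open N" "\<zeta> \<in> N" "f ` N \<subseteq> W" "\<forall>w\<in>N. local_map C w f" "(\<lambda>w. z (f w)) holomorphic_on N"
proof -
  obtain b c where bc: "z = coord b c" "V \<subseteq> chart_dom b" using adaptedD(5)[OF assms(1)] by blast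
  obtain N where N: "open N" "\<zeta> \<in> N" "f ` N \<subseteq> W" "\<forall>w\<in>N. local_map C w f"
    using local_map_in_openin[OF assms(2,5,3)] by metis
  obtain M where M: "open M" "\<zeta> \<in> M" "\<forall>c. (\<lambda>w. coord b c (f w)) holomorphic_on M"
  proof -
    have "f \<zeta> \<in> chart_dom b" using assms(3,4) bc(2) by blast
    from coord_holomorphic[OF assms(2) this] show thesis using that by metis
  qed
  have "(\<lambda>w. z (f w)) holomorphic_on N \<inter> M"
    using M(3) unfolding bc(1) by (meson holomorphic_on_subset inf_le2)
  with N M show thesis by (intro that[of "N \<inter> M"]) auto
qed

lemma openin_affine_part:
  assumes "adapted V z \<phi> k" shows "openin (top_of_set C) V" "openin (top_of_set C) (V \<inter> affine_plane)"
proof -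
  show V: "openin (top_of_set C) V" using adaptedD(1)[OF assms] by (simp add: local_coord_def)
  show "openin (top_of_set C) (V \<inter> affine_plane)"
    using openin_Int_open[OF V open_chart_dom[of True]] by (simp add: chart_dom_def)
qed

text \<open>The derivative of \<phi>^(n+1) E is \<phi>^n ((n + 1) \<phi>' u' E + \<phi> E'): one
  factor \<phi> is lost per differentiation, starting from the exponent d - 3 for l = 1.\<close>

lemma adapted_J1_deriv:
  assumes ad: "adapted V z \<phi> k" and l: "1 \<le> l"
  shows "l \<le> d - 2 \<Longrightarrow> \<exists>E. wpoly (z ` V) l l E \<and> (\<forall>\<zeta> f. local_map C \<zeta> f \<longrightarrow> f \<zeta> \<in> V \<inter> affine_plane \<longrightarrow>
     (deriv ^^ (l - 1)) (J1 f) \<zeta> =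
       \<phi> (z (f \<zeta>)) ^ (d - 2 - l) * E (z (f \<zeta>)) (\<lambda>j. (deriv ^^ j) (\<lambda>w. z (f w)) \<zeta>))"
  using l
proof (induction l rule: dec_induct)
  case base
  have "wpoly (z ` V) 1 1 (\<lambda>t c. k t * c 1)"
    by (intro wpoly_coef_mult wpoly.var adaptedD(3)[OF ad]) auto
  moreover have "(deriv ^^ (1 - 1)) (J1 f) \<zeta> = \<phi> (z (f \<zeta>)) ^ (d - 2 - 1) * (k (z (f \<zeta>)) * (deriv ^^ 1) (\<lambda>w. z (f w)) \<zeta>)"
    if "local_map C \<zeta> f" "f \<zeta> \<in> V \<inter> affine_plane" for \<zeta> f
  proof -
    have "J1 f \<zeta> = deriv (\<lambda>w. z (f w)) \<zeta> * \<phi> (z (f \<zeta>)) ^ (d - 3) * k (z (f \<zeta>))"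
      by (rule adaptedD(8)[OF ad that])
    moreover have "d - 2 - 1 = d - 3" by simp
    ultimately show ?thesis by (simp only: diff_self_eq_0 funpow.simps id_apply One_nat_def o_apply) (simp add: mult_ac)
  qed
  ultimately show ?case by (intro exI[of _ "\<lambda>t c. k t * c 1"]) blast
next
  case (step l)
  define n where "n = d - 2 - Suc l"
  have n: "d - 2 - l = Suc n" using step.prems by (simp add: n_def)
  obtain E where E: "wpoly (z ` V) l l E" "\<And>\<zeta> f. local_map C \<zeta> f \<Longrightarrow> f \<zeta> \<in> V \<inter> affine_plane \<Longrightarrow>
     (deriv ^^ (l - 1)) (J1 f) \<zeta> = \<phi> (z (f \<zeta>)) ^ Suc n * E (z (f \<zeta>)) (\<lambda>j. (deriv ^^ j) (\<lambda>w. z (f w)) \<zeta>)"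
    using step.IH step.prems unfolding n by auto
  have oz: "open (z ` V)" and hol: "\<phi> holomorphic_on z ` V"
    using adaptedD(1,2)[OF ad] by (simp_all add: local_coord_def)
  obtain E' where E': "wpoly (z ` V) (Suc l) (Suc l) E'" "\<And>u \<zeta>. u analytic_on {\<zeta>} \<Longrightarrow> u \<zeta> \<in> z ` V \<Longrightarrow>
     ((\<lambda>w. E (u w) (\<lambda>j. (deriv ^^ j) u w)) has_field_derivative E' (u \<zeta>) (\<lambda>j. (deriv ^^ j) u \<zeta>)) (at \<zeta>)"
    using wpoly_deriv[OF E(1) oz] by blast
  define F where "F = (\<lambda>t c. (of_nat (Suc n) * deriv \<phi> t) * (c 1 * E t c) + \<phi> t * E' t c)"
  have "wpoly (z ` V) (Suc l) (1 + l) (\<lambda>t c. c 1 * E t c)"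
    by (intro wpoly.mult wpoly.var wpoly_mono[OF E(1)]) auto
  then have F: "wpoly (z ` V) (Suc l) (Suc l) F"
    unfolding F_def using E'(1) hol oz
    by (intro wpoly.add wpoly_coef_mult holomorphic_intros) (simp_all add: holomorphic_deriv)
  have "(deriv ^^ (Suc l - 1)) (J1 f) \<zeta> = \<phi> (z (f \<zeta>)) ^ n * F (z (f \<zeta>)) (\<lambda>j. (deriv ^^ j) (\<lambda>w. z (f w)) \<zeta>)"
    if f: "local_map C \<zeta> f" "f \<zeta> \<in> V \<inter> affine_plane" for \<zeta> f
  proof -
    obtain N where N: "open N" "\<zeta> \<in> N" "f ` N \<subseteq> V \<inter> affine_plane" "\<forall>w\<in>N. local_map C w f"
      "(\<lambda>w. z (f w)) holomorphic_on N"
      using adapted_nbhd[OF ad f Int_lower1 openin_affine_part(2)[OF ad]] by metis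
    define u where "u = (\<lambda>w. z (f w))"
    have du: "(u has_field_derivative deriv u \<zeta>) (at \<zeta>)"
      unfolding u_def using N by (intro holomorphic_derivI[of _ N])
    have u\<zeta>: "u \<zeta> \<in> z ` V" using f(2) by (simp add: u_def)
    have "u analytic_on {\<zeta>}" unfolding analytic_at u_def using N by blast
    note dE = E'(2)[OF this u\<zeta>]
    have d\<phi>: "((\<lambda>w. \<phi> (u w)) has_field_derivative deriv \<phi> (u \<zeta>) * deriv u \<zeta>) (at \<zeta>)"
      by (rule DERIV_chain2[OF holomorphic_derivI[OF hol oz u\<zeta>] du])
    have "((\<lambda>w. \<phi> (u w) ^ Suc n * E (u w) (\<lambda>j. (deriv ^^ j) u w)) has_field_derivative
        \<phi> (u \<zeta>) ^ n * F (u \<zeta>) (\<lambda>j. (deriv ^^ j) u \<zeta>)) (at \<zeta>)"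
      by (rule DERIV_cong[OF DERIV_mult[OF DERIV_power_Suc[OF d\<phi>, of n] dE]])
         (simp add: F_def algebra_simps)
    moreover have "\<phi> (u w) ^ Suc n * E (u w) (\<lambda>j. (deriv ^^ j) u w) = (deriv ^^ (l - 1)) (J1 f) w" if "w \<in> N" for w
    proof -
      have "f w \<in> V \<inter> affine_plane" using N(3) that by blast
      then show ?thesis using E(2)[of w f] N(4) that unfolding u_def by simp
    qed
    ultimately have "((deriv ^^ (l - 1)) (J1 f) has_field_derivative
        \<phi> (u \<zeta>) ^ n * F (u \<zeta>) (\<lambda>j. (deriv ^^ j) u \<zeta>)) (at \<zeta>)"
      by (rule has_field_derivative_transform_within_open[OF _ N(1,2)])
    then have "(deriv ^^ Suc (l - 1)) (J1 f) \<zeta> = \<phi> (u \<zeta>) ^ n * F (u \<zeta>) (\<lambda>j. (deriv ^^ j) u \<zeta>)"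
      by (simp add: DERIV_imp_deriv)
    moreover have "Suc (l - 1) = Suc l - 1" using step.hyps by simp
    ultimately show ?thesis unfolding u_def by simp
  qed
  with F show ?case unfolding n_def by blast
qed

text \<open>The value 0 at infinity is imposed. It is the holomorphic continuation because the
  exponent d - 2 - l of \<phi> is positive for l \<le> d - 3.\<close>

definition Jval :: "nat \<Rightarrow> complex \<Rightarrow> (complex \<Rightarrow> proj2) \<Rightarrow> complex" where
  "Jval l \<zeta> f = (if f \<zeta> \<in> affine_plane then (deriv ^^ (l - 1)) (J1 f) \<zeta> +
     (if l = 3 then J1 f \<zeta> ^ 3 * cubic_factor (\<lambda>i j. Rd i j (f \<zeta>)) else 0) else 0)"

lemma adapted_Jval:
  assumes ad: "adapted V z \<phi> k" and l: "1 \<le> l" "l \<le> d - 3"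
  shows "\<exists>E. wpoly (z ` V) l l E \<and> (\<forall>\<zeta> f. local_map C \<zeta> f \<longrightarrow> f \<zeta> \<in> V \<inter> affine_plane \<longrightarrow>
     Jval l \<zeta> f = \<phi> (z (f \<zeta>)) ^ (d - 2 - l) * E (z (f \<zeta>)) (\<lambda>j. (deriv ^^ j) (\<lambda>w. z (f w)) \<zeta>))"
proof -
  obtain E where E: "wpoly (z ` V) l l E" "\<And>\<zeta> f. local_map C \<zeta> f \<Longrightarrow> f \<zeta> \<in> V \<inter> affine_plane \<Longrightarrow>
     (deriv ^^ (l - 1)) (J1 f) \<zeta> = \<phi> (z (f \<zeta>)) ^ (d - 2 - l) * E (z (f \<zeta>)) (\<lambda>j. (deriv ^^ j) (\<lambda>w. z (f w)) \<zeta>)"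
  proof -
    have "l \<le> d - 2" using l(2) by simp
    from adapted_J1_deriv[OF ad l(1) this] show thesis using that by blast
  qed
  show ?thesis
  proof (cases "l = 3")
    case False
    then show ?thesis using E by (intro exI[of _ E]) (simp add: Jval_def)
  next
    case l3: True
    define P where "P = cubic_factor (\<lambda>i j. partial i j R)"
    have "P \<in> polys_le (2 * d - 4)"
      unfolding P_def using R_le d by (intro cubic_factor_polys_le) auto
    then obtain \<gamma> where \<gamma>: "\<gamma> holomorphic_on z ` V"
      "\<And>q. q \<in> V \<inter> affine_plane \<Longrightarrow> \<phi> (z q) ^ (2 * d - 4) * eval2 P (xcoord q) (ycoord q) = \<gamma> (z q)"
      using adaptedD(9)[OF ad] by metis
    define F where "F = (\<lambda>t c. E t c + (k t ^ 3 * \<gamma> t) * c 1 ^ 3)"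
    have "wpoly (z ` V) l (3 * 1) (\<lambda>t c. c 1 ^ 3)"
      using l by (intro wpoly_power wpoly.var) auto
    then have F: "wpoly (z ` V) l l F"
      unfolding F_def using E(1) \<gamma>(1) adaptedD(3)[OF ad] l3
      by (intro wpoly.add wpoly_coef_mult holomorphic_intros) auto
    have "Jval l \<zeta> f = \<phi> (z (f \<zeta>)) ^ (d - 2 - l) * F (z (f \<zeta>)) (\<lambda>j. (deriv ^^ j) (\<lambda>w. z (f w)) \<zeta>)"
      if f: "local_map C \<zeta> f" "f \<zeta> \<in> V \<inter> affine_plane" for \<zeta> f
    proof -
      let ?\<phi> = "\<phi> (z (f \<zeta>))"
      have J: "J1 f \<zeta> = deriv (\<lambda>w. z (f w)) \<zeta> * ?\<phi> ^ (d - 3) * k (z (f \<zeta>))"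
        by (rule adaptedD(8)[OF ad f])
      have "(?\<phi> ^ (d - 3)) ^ 3 = ?\<phi> ^ (d - 2 - l) * ?\<phi> ^ (2 * d - 4)"
      proof -
        \<comment> \<open>The zero of the cube of \<open>J1\<close> absorbs the pole of order at
          most 2d - 4 of \<open>P\<close>. What remains is d - 5, the exponent required for order
          3.\<close>
        have "(d - 3) * 3 = (d - 2 - l) + (2 * d - 4)" using l l3 by simp
        then show ?thesis by (simp only: power_mult[symmetric] power_add[symmetric])
      qed
      then have "J1 f \<zeta> ^ 3 * eval2 P (xcoord (f \<zeta>)) (ycoord (f \<zeta>)) =
          ?\<phi> ^ (d - 2 - l) * (deriv (\<lambda>w. z (f w)) \<zeta> ^ 3 * k (z (f \<zeta>)) ^ 3 *
            (?\<phi> ^ (2 * d - 4) * eval2 P (xcoord (f \<zeta>)) (ycoord (f \<zeta>))))"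
        unfolding J power_mult_distrib by simp
      also have "\<dots> = ?\<phi> ^ (d - 2 - l) * (deriv (\<lambda>w. z (f w)) \<zeta> ^ 3 * k (z (f \<zeta>)) ^ 3 * \<gamma> (z (f \<zeta>)))"
        using \<gamma>(2)[OF f(2)] by simp
      finally have "J1 f \<zeta> ^ 3 * cubic_factor (\<lambda>i j. Rd i j (f \<zeta>)) = \<dots>"
        by (simp add: P_def eval2_cubic_factor partial_at_def)
      then show ?thesis
        using E(2)[OF f] f(2) l3 by (simp add: Jval_def F_def algebra_simps)
    qed
    with F show ?thesis by blast
  qed
qed

lemma same_jet_adapted_coord:
  assumes "adapted V z \<phi> kk" "same_jet k \<zeta> f \<eta> g" "f \<zeta> \<in> V" "i \<le> k"
  shows "(deriv ^^ i) (\<lambda>w. z (f w)) \<zeta> = (deriv ^^ i) (\<lambda>w. z (g w)) \<eta>"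
proof -
  obtain b c where bc: "z = coord b c" "V \<subseteq> chart_dom b" using adaptedD(5)[OF assms(1)] by blast
  show ?thesis unfolding bc(1) using same_jet_coord[OF assms(2) _ assms(4)] assms(3) bc(2) by blast
qed

text \<open>In an adapted coordinate the value is a function of the base point and of the
  derivatives up to order \<open>l\<close>, and these are determined by the jet.\<close>

lemma Jval_cong:
  assumes "local_map C \<zeta> f" "local_map C \<eta> g" "same_jet l \<zeta> f \<eta> g" "1 \<le> l" "l \<le> d - 3"
  shows "Jval l \<zeta> f = Jval l \<eta> g"
proof (cases "f \<zeta> \<in> affine_plane")
  case True
  have fg: "f \<zeta> = g \<eta>" by (rule same_jet_base[OF assms(3)])
  have "f \<zeta> \<in> C" using assms(1) by (auto simp: local_map_def)
  then obtain V z \<phi> k where V: "f \<zeta> \<in> V" "adapted V z \<phi> k" by (rule adapted_exists)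
  obtain E where E: "wpoly (z ` V) l l E" "\<And>\<zeta> f. local_map C \<zeta> f \<Longrightarrow> f \<zeta> \<in> V \<inter> affine_plane \<Longrightarrow>
     Jval l \<zeta> f = \<phi> (z (f \<zeta>)) ^ (d - 2 - l) * E (z (f \<zeta>)) (\<lambda>j. (deriv ^^ j) (\<lambda>w. z (f w)) \<zeta>)"
    using adapted_Jval[OF V(2) assms(4,5)] by blast
  have "E (z (f \<zeta>)) (\<lambda>j. (deriv ^^ j) (\<lambda>w. z (f w)) \<zeta>) = E (z (f \<zeta>)) (\<lambda>j. (deriv ^^ j) (\<lambda>w. z (g w)) \<eta>)"
    by (rule wpoly_cong[OF E(1)]) (use same_jet_adapted_coord[OF V(2) assms(3) V(1)] in auto)
  then show ?thesis using E(2)[OF assms(1)] E(2)[OF assms(2)] True V(1) fg by simp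
qed (use same_jet_base[OF assms(3)] in \<open>simp add: Jval_def\<close>)

definition J :: "nat \<Rightarrow> jet \<Rightarrow> complex" where
  "J l = jet_lift l C (Jval l)"

lemma J_jet_of: "1 \<le> l \<Longrightarrow> l \<le> d - 3 \<Longrightarrow> local_map C \<zeta> f \<Longrightarrow> J l (jet_of l C \<zeta> f) = Jval l \<zeta> f"
  unfolding J_def by (rule jet_lift_jet_of) (auto intro: Jval_cong)

lemma J_jet_differential:
  assumes l: "1 \<le> l" "l \<le> d - 3"
  shows "jet_differential l C (J l)"
  unfolding jet_differential_def
proof (intro conjI allI impI ballI)
  fix u assume "u \<notin> jet_bundle l C"
  then show "J l u = 0" by (simp add: J_def jet_lift_outside)
next
  fix p assume "p \<in> C"
  then obtain V z \<phi> k where V: "p \<in> V" "adapted V z \<phi> k" by (rule adapted_exists)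
  obtain E where E: "wpoly (z ` V) l l E" "\<And>\<zeta> f. local_map C \<zeta> f \<Longrightarrow> f \<zeta> \<in> V \<inter> affine_plane \<Longrightarrow>
     Jval l \<zeta> f = \<phi> (z (f \<zeta>)) ^ (d - 2 - l) * E (z (f \<zeta>)) (\<lambda>j. (deriv ^^ j) (\<lambda>w. z (f w)) \<zeta>)"
    using adapted_Jval[OF V(2) l] by blast
  have "jet_polynomial_near l C (weighted_indices l l) (J l) p"
  proof (rule jet_polynomial_near_wpoly[where V = V and z = z and E = "\<lambda>t c. \<phi> t ^ (d - 2 - l) * E t c"])
    show "local_coord C V z" by (rule adaptedD(1)[OF V(2)])
    show "wpoly (z ` V) l l (\<lambda>t c. \<phi> t ^ (d - 2 - l) * E t c)"
      by (intro wpoly_coef_mult[OF _ E(1)] holomorphic_intros adaptedD(2)[OF V(2)])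
    show "J l (jet_of l C \<zeta> f) = \<phi> (z (f \<zeta>)) ^ (d - 2 - l) * E (z (f \<zeta>)) (\<lambda>j. (deriv ^^ j) (\<lambda>w. z (f w)) \<zeta>)"
      if "local_map C \<zeta> f" "f \<zeta> \<in> V" for \<zeta> f
    proof (cases "f \<zeta> \<in> affine_plane")
      case True
      then show ?thesis using E(2)[of \<zeta> f] that l by (simp add: J_jet_of)
    next
      case False
      then have "\<phi> (z (f \<zeta>)) = 0" using adaptedD(6)[OF V(2) that(2)] by simp
      \<comment> \<open>The exponent being positive, the local expression vanishes at infinity and
        agrees with the imposed value.\<close>
      moreover have "d - 2 - l \<noteq> 0" using l by simp
      ultimately show ?thesis using False that l by (simp add: J_jet_of Jval_def power_0_left)
    qed
  qed (fact V(1))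
  then show "\<exists>M. finite M \<and> M \<subseteq> multi_indices l \<and> jet_polynomial_near l C M (J l) p"
    by (intro exI[of _ "weighted_indices l l"] conjI finite_weighted_indices)
       (simp_all add: weighted_indices_def)
qed

definition secval :: "nat \<Rightarrow> nat \<Rightarrow> ((nat \<Rightarrow> nat) \<Rightarrow> complex poly poly) \<Rightarrow> complex \<Rightarrow> (complex \<Rightarrow> proj2) \<Rightarrow> complex" where
  "secval k m G \<zeta> f = (\<Sum>\<mu>\<in>weighted_indices k m. (\<Prod>l=1..k. Jval l \<zeta> f ^ \<mu> l) *
     eval2 (G \<mu>) (xcoord (f \<zeta>)) (ycoord (f \<zeta>)))"

text \<open>The powers of \<phi> in the product of the jet differentials add up to
  \<open>delta k d \<mu>\<close>, which absorbs the pole of \<open>G \<mu>\<close>. So the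
  expression remains holomorphic in the coordinate, across infinity.\<close>

lemma adapted_secval:
  assumes ad: "adapted V z \<phi> kk" and k: "k \<le> d - 3" and G: "admissible k d m G"
  shows "\<exists>E. wpoly (z ` V) k m E \<and> (\<forall>\<zeta> f. local_map C \<zeta> f \<longrightarrow> f \<zeta> \<in> V \<inter> affine_plane \<longrightarrow>
     secval k m G \<zeta> f = E (z (f \<zeta>)) (\<lambda>j. (deriv ^^ j) (\<lambda>w. z (f w)) \<zeta>))"
proof -
  have "\<forall>l\<in>{1..k}. \<exists>E. wpoly (z ` V) l l E \<and> (\<forall>\<zeta> f. local_map C \<zeta> f \<longrightarrow> f \<zeta> \<in> V \<inter> affine_plane \<longrightarrow>
     Jval l \<zeta> f = \<phi> (z (f \<zeta>)) ^ (d - 2 - l) * E (z (f \<zeta>)) (\<lambda>j. (deriv ^^ j) (\<lambda>w. z (f w)) \<zeta>))"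
    using k by (intro ballI adapted_Jval[OF ad]) auto
  from bchoice[OF this] obtain E where E: "\<And>l. l \<in> {1..k} \<Longrightarrow> wpoly (z ` V) l l (E l)"
    "\<And>l \<zeta> f. l \<in> {1..k} \<Longrightarrow> local_map C \<zeta> f \<Longrightarrow> f \<zeta> \<in> V \<inter> affine_plane \<Longrightarrow>
     Jval l \<zeta> f = \<phi> (z (f \<zeta>)) ^ (d - 2 - l) * E l (z (f \<zeta>)) (\<lambda>j. (deriv ^^ j) (\<lambda>w. z (f w)) \<zeta>)" by blast
  have "\<forall>\<mu>\<in>weighted_indices k m. \<exists>\<gamma>. \<gamma> holomorphic_on z ` V \<and>
     (\<forall>q\<in>V \<inter> affine_plane. \<phi> (z q) ^ delta k d \<mu> * eval2 (G \<mu>) (xcoord q) (ycoord q) = \<gamma> (z q))"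
    using adaptedD(9)[OF ad] G unfolding admissible_def by metis
  from bchoice[OF this] obtain \<gamma> where \<gamma>: "\<And>\<mu>. \<mu> \<in> weighted_indices k m \<Longrightarrow> \<gamma> \<mu> holomorphic_on z ` V"
    "\<And>\<mu> q. \<mu> \<in> weighted_indices k m \<Longrightarrow> q \<in> V \<inter> affine_plane \<Longrightarrow>
      \<phi> (z q) ^ delta k d \<mu> * eval2 (G \<mu>) (xcoord q) (ycoord q) = \<gamma> \<mu> (z q)" by blast
  define F where "F = (\<lambda>t c. \<Sum>\<mu>\<in>weighted_indices k m. \<gamma> \<mu> t * (\<Prod>l=1..k. E l t c ^ \<mu> l))"
  have "wpoly (z ` V) k m (\<lambda>t c. \<gamma> \<mu> t * (\<Prod>l=1..k. E l t c ^ \<mu> l))" if \<mu>: "\<mu> \<in> weighted_indices k m" for \<mu>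
  proof -
    have "wpoly (z ` V) k (\<Sum>l=1..k. \<mu> l * l) (\<lambda>t c. \<Prod>l=1..k. E l t c ^ \<mu> l)"
      by (intro wpoly_prod wpoly_power wpoly_mono[OF E(1)]) auto
    moreover have "(\<Sum>l=1..k. \<mu> l * l) = m"
      using \<mu> by (simp add: weighted_indices_def mult.commute)
    ultimately show ?thesis using \<gamma>(1)[OF \<mu>] by (intro wpoly_coef_mult) auto
  qed
  then have F: "wpoly (z ` V) k m F" unfolding F_def by (intro wpoly_sum) auto
  have "secval k m G \<zeta> f = F (z (f \<zeta>)) (\<lambda>j. (deriv ^^ j) (\<lambda>w. z (f w)) \<zeta>)"
    if f: "local_map C \<zeta> f" "f \<zeta> \<in> V \<inter> affine_plane" for \<zeta> f
    unfolding secval_def F_def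
  proof (rule sum.cong[OF refl])
    fix \<mu> assume \<mu>: "\<mu> \<in> weighted_indices k m"
    let ?\<phi> = "\<phi> (z (f \<zeta>))"
    let ?e = "\<lambda>l. E l (z (f \<zeta>)) (\<lambda>j. (deriv ^^ j) (\<lambda>w. z (f w)) \<zeta>)"
    have "(\<Prod>l=1..k. Jval l \<zeta> f ^ \<mu> l) = (\<Prod>l=1..k. ?\<phi> ^ (\<mu> l * (d - l - 2)) * ?e l ^ \<mu> l)"
    proof (rule prod.cong[OF refl])
      fix l assume l: "l \<in> {1..k}"
      have "d - 2 - l = d - l - 2" by simp
      then show "Jval l \<zeta> f ^ \<mu> l = ?\<phi> ^ (\<mu> l * (d - l - 2)) * ?e l ^ \<mu> l"
        using E(2)[OF l f] by (simp add: power_mult_distrib mult.commute flip: power_mult)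
    qed
    also have "\<dots> = ?\<phi> ^ delta k d \<mu> * (\<Prod>l=1..k. ?e l ^ \<mu> l)"
      by (simp add: prod.distrib delta_def power_sum)
    finally have P: "(\<Prod>l=1..k. Jval l \<zeta> f ^ \<mu> l) = ?\<phi> ^ delta k d \<mu> * (\<Prod>l=1..k. ?e l ^ \<mu> l)" .
    show "(\<Prod>l=1..k. Jval l \<zeta> f ^ \<mu> l) * eval2 (G \<mu>) (xcoord (f \<zeta>)) (ycoord (f \<zeta>)) =
        \<gamma> \<mu> (z (f \<zeta>)) * (\<Prod>l=1..k. ?e l ^ \<mu> l)"
      unfolding P \<gamma>(2)[OF \<mu> f(2), symmetric] by (simp only: mult_ac)
  qed
  with F show ?thesis by blast
qed

text \<open>A neighbourhood with no point at infinity other than possibly \<open>p\<close>: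
  prescribing values there involves no compatibility between different points at infinity.\<close>

lemma adapted_exists':
  assumes "p \<in> C"
  shows "\<exists>V z \<phi> k. p \<in> V \<and> adapted V z \<phi> k \<and> (\<forall>q\<in>V. q \<notin> affine_plane \<longrightarrow> q = p)"
proof -
  obtain V z \<phi> k where V: "p \<in> V" "adapted V z \<phi> k" using adapted_exists[OF assms] by metis
  show ?thesis
  proof (cases "p \<in> affine_plane")
    case False
    with V adaptedD(7)[OF V(2)] show ?thesis by blast
  next
    case True
    then obtain x y where p: "p = pt 1 x y" by (auto simp: affine_plane_def)
    then have "eval2 R x y = 0" using assms C_affine by simp
    then have "\<exists>V z \<phi> k. p \<in> V \<and> adapted V z \<phi> k \<and> V \<subseteq> affine_plane"
      using smooth adapted_affine_x adapted_affine_y unfolding p by meson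
    then show ?thesis by blast
  qed
qed

text \<open>
  The value at infinity is read off from the expression in the adapted coordinate chosen there.
\<close>

lemma section_exists:
  assumes k: "k \<le> d - 3" and G: "admissible k d m G"
  shows "\<exists>\<Phi>. section_given_by k m C J G \<Phi>"
proof -
  have "\<forall>p\<in>C. \<exists>Q. case Q of (V, z, E) \<Rightarrow> p \<in> V \<and> (\<exists>\<phi> k. adapted V z \<phi> k) \<and>
     (\<forall>q\<in>V. q \<notin> affine_plane \<longrightarrow> q = p) \<and> wpoly (z ` V) k m E \<and>
     (\<forall>\<zeta> f. local_map C \<zeta> f \<longrightarrow> f \<zeta> \<in> V \<inter> affine_plane \<longrightarrow>
        secval k m G \<zeta> f = E (z (f \<zeta>)) (\<lambda>j. (deriv ^^ j) (\<lambda>w. z (f w)) \<zeta>))"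
  proof
    fix p assume "p \<in> C"
    from adapted_exists'[OF this] obtain V z \<phi> kk where
      V: "p \<in> V" "adapted V z \<phi> kk" "\<forall>q\<in>V. q \<notin> affine_plane \<longrightarrow> q = p" by blast
    from adapted_secval[OF V(2) k G] obtain E where "wpoly (z ` V) k m E"
      "\<forall>\<zeta> f. local_map C \<zeta> f \<longrightarrow> f \<zeta> \<in> V \<inter> affine_plane \<longrightarrow>
        secval k m G \<zeta> f = E (z (f \<zeta>)) (\<lambda>j. (deriv ^^ j) (\<lambda>w. z (f w)) \<zeta>)" by blast
    with V show "\<exists>Q. case Q of (V, z, E) \<Rightarrow> p \<in> V \<and> (\<exists>\<phi> k. adapted V z \<phi> k) \<and>
     (\<forall>q\<in>V. q \<notin> affine_plane \<longrightarrow> q = p) \<and> wpoly (z ` V) k m E \<and>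
     (\<forall>\<zeta> f. local_map C \<zeta> f \<longrightarrow> f \<zeta> \<in> V \<inter> affine_plane \<longrightarrow>
        secval k m G \<zeta> f = E (z (f \<zeta>)) (\<lambda>j. (deriv ^^ j) (\<lambda>w. z (f w)) \<zeta>))"
      by (intro exI[of _ "(V, z, E)"]) auto
  qed
  from bchoice[OF this] obtain Q where Q: "\<forall>p\<in>C. case Q p of (V, z, E) \<Rightarrow> p \<in> V \<and> (\<exists>\<phi> k. adapted V z \<phi> k) \<and>
     (\<forall>q\<in>V. q \<notin> affine_plane \<longrightarrow> q = p) \<and> wpoly (z ` V) k m E \<and>
     (\<forall>\<zeta> f. local_map C \<zeta> f \<longrightarrow> f \<zeta> \<in> V \<inter> affine_plane \<longrightarrow>
        secval k m G \<zeta> f = E (z (f \<zeta>)) (\<lambda>j. (deriv ^^ j) (\<lambda>w. z (f w)) \<zeta>))" by blast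
  define V where "V = (\<lambda>p. fst (Q p))"
  define z where "z = (\<lambda>p. fst (snd (Q p)))"
  define E where "E = (\<lambda>p. snd (snd (Q p)))"
  have VQ: "p \<in> V p" "\<exists>\<phi> k. adapted (V p) (z p) \<phi> k" "\<And>q. q \<in> V p \<Longrightarrow> q \<notin> affine_plane \<Longrightarrow> q = p"
    "wpoly (z p ` V p) k m (E p)"
    "\<And>\<zeta> f. local_map C \<zeta> f \<Longrightarrow> f \<zeta> \<in> V p \<inter> affine_plane \<Longrightarrow>
        secval k m G \<zeta> f = E p (z p (f \<zeta>)) (\<lambda>j. (deriv ^^ j) (\<lambda>w. z p (f w)) \<zeta>)" if "p \<in> C" for p
    using Q[rule_format, OF that] unfolding V_def z_def E_def by (auto simp: case_prod_unfold)
  define val where "val = (\<lambda>\<zeta> f. if f \<zeta> \<in> affine_plane then secval k m G \<zeta> f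
     else E (f \<zeta>) (z (f \<zeta>) (f \<zeta>)) (\<lambda>j. (deriv ^^ j) (\<lambda>w. z (f \<zeta>) (f w)) \<zeta>))"
  have inC: "f \<zeta> \<in> C" if "local_map C \<zeta> f" for \<zeta> f using that by (auto simp: local_map_def)
  have val_cong: "val \<zeta> f = val \<eta> g" if fg: "local_map C \<zeta> f" "local_map C \<eta> g" "same_jet k \<zeta> f \<eta> g" for \<zeta> f \<eta> g
  proof -
    have b: "f \<zeta> = g \<eta>" by (rule same_jet_base[OF fg(3)])
    show ?thesis
    proof (cases "f \<zeta> \<in> affine_plane")
      case True
      have "Jval l \<zeta> f = Jval l \<eta> g" if "l \<in> {1..k}" for l
        using that k by (intro Jval_cong fg same_jet_mono[OF fg(3)]) auto
      then show ?thesis using True b by (simp add: val_def secval_def)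
    next
      case False
      obtain \<phi> kk where ad: "adapted (V (f \<zeta>)) (z (f \<zeta>)) \<phi> kk" using VQ(2)[OF inC[OF fg(1)]] by blast
      have "E (f \<zeta>) (z (f \<zeta>) (f \<zeta>)) (\<lambda>j. (deriv ^^ j) (\<lambda>w. z (f \<zeta>) (f w)) \<zeta>) =
          E (f \<zeta>) (z (f \<zeta>) (f \<zeta>)) (\<lambda>j. (deriv ^^ j) (\<lambda>w. z (f \<zeta>) (g w)) \<eta>)"
        by (rule wpoly_cong[OF VQ(4)[OF inC[OF fg(1)]]])
           (use same_jet_adapted_coord[OF ad fg(3) VQ(1)[OF inC[OF fg(1)]]] in auto)
      then show ?thesis using False b by (simp add: val_def)
    qed
  qed
  define \<Phi> where "\<Phi> = jet_lift k C val"
  have \<Phi>: "\<Phi> (jet_of k C \<zeta> f) = val \<zeta> f" if "local_map C \<zeta> f" for \<zeta> f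
    unfolding \<Phi>_def by (rule jet_lift_jet_of[OF val_cong that])
  have "jet_polynomial_near k C (weighted_indices k m) \<Phi> p" if p: "p \<in> C" for p
  proof (rule jet_polynomial_near_wpoly[OF _ VQ(1)[OF p] VQ(4)[OF p]])
    show "local_coord C (V p) (z p)" using VQ(2)[OF p] adaptedD(1) by blast
    show "\<Phi> (jet_of k C \<zeta> f) = E p (z p (f \<zeta>)) (\<lambda>j. (deriv ^^ j) (\<lambda>w. z p (f w)) \<zeta>)"
      if "local_map C \<zeta> f" "f \<zeta> \<in> V p" for \<zeta> f
    proof (cases "f \<zeta> \<in> affine_plane")
      case True
      then show ?thesis using VQ(5)[OF p that(1)] that by (simp add: \<Phi> val_def)
    next
      case False
      \<comment> \<open>\<open>val\<close> uses the coordinate chosen for \<open>f \<zeta>\<close>,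
        the claim that chosen for \<open>p\<close>; they coincide since \<open>V p\<close> has no
        other point at infinity.\<close>
      then have "f \<zeta> = p" using VQ(3)[OF p that(2)] by simp
      then show ?thesis using False that by (simp add: \<Phi> val_def)
    qed
  qed
  then have "\<Phi> \<in> GG_sections k m C"
    by (auto simp: GG_sections_def \<Phi>_def jet_lift_outside)
  moreover have "\<Phi> (jet_of k C \<zeta> f) = (\<Sum>\<mu>\<in>weighted_indices k m. (\<Prod>l=1..k. J l (jet_of l C \<zeta> f) ^ \<mu> l) *
             eval2 (G \<mu>) (xcoord (f \<zeta>)) (ycoord (f \<zeta>)))"
    if "local_map C \<zeta> f" "f \<zeta> \<in> affine_plane" for \<zeta> f
  proof -
    have "J l (jet_of l C \<zeta> f) = Jval l \<zeta> f" if "l \<in> {1..k}" for l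
      using that k \<open>local_map C \<zeta> f\<close> by (intro J_jet_of) auto
    then show ?thesis using that by (simp add: \<Phi> val_def secval_def)
  qed
  ultimately show ?thesis unfolding section_given_by_def by blast
qed

lemma section_given_by_iff:
  assumes "k \<le> d - 3"
  shows "section_given_by k m C J G \<Phi> \<longleftrightarrow> \<Phi> \<in> GG_sections k m C \<and>
     (\<forall>\<zeta> f. local_map C \<zeta> f \<and> f \<zeta> \<in> affine_plane \<longrightarrow> \<Phi> (jet_of k C \<zeta> f) = secval k m G \<zeta> f)"
proof -
  have "(\<Prod>l=1..k. J l (jet_of l C \<zeta> f) ^ \<mu> l) = (\<Prod>l=1..k. Jval l \<zeta> f ^ \<mu> l)"
    if "local_map C \<zeta> f" for \<zeta> f \<mu>
    using assms that by (intro prod.cong) (auto simp: J_jet_of)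
  then show ?thesis unfolding section_given_by_def secval_def by (simp cong: conj_cong)
qed

end

section \<open>Sections are determined by their values over the affine part\<close>

context plane_curve
begin

text \<open>
  An arbitrary local coordinate is compared with an adapted one: the transition function is
  holomorphic and injective, hence has a holomorphic inverse.
\<close>

lemma local_coord_holomorphic:
  assumes lc: "local_coord C V z" and f: "local_map C \<zeta> f" "f \<zeta> \<in> V"
  obtains N where "open N" "\<zeta> \<in> N" "f ` N \<subseteq> V" "\<forall>w\<in>N. local_map C w f" "(\<lambda>w. z (f w)) holomorphic_on N"
proof -
  have opV: "openin (top_of_set C) V" and injz: "inj_on z V" and oz: "open (z ` V)"
    and hol: "holo_map_on (z ` V) (inv_into V z)"
    using lc by (simp_all add: local_coord_def)
  define h where "h = inv_into V z"
  have hz: "h (z q) = q" if "q \<in> V" for q using that injz by (simp add: h_def)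
  have hV: "h v \<in> V" "z (h v) = v" if "v \<in> z ` V" for v
    using that by (auto simp: hz)
  have "f \<zeta> \<in> C" using f by (auto simp: local_map_def)
  then obtain V0 z0 \<phi> k where V0: "f \<zeta> \<in> V0" "adapted V0 z0 \<phi> k" by (rule adapted_exists)
  obtain b c where bc: "z0 = coord b c" "V0 \<subseteq> chart_dom b" using adaptedD(5)[OF V0(2)] by blast
  obtain U where U: "open U" "V0 = C \<inter> U"
    using openin_affine_part(1)[OF V0(2)] by (auto simp: openin_open)
  have VC: "V \<subseteq> C" using openin_imp_subset[OF opV] by simp
  define S where "S = {v \<in> z ` V. h v \<in> V0}"
  have lift: "\<exists>N T X Y. open N \<and> v \<in> N \<and> N \<subseteq> z ` V \<and> holo_lift N T X Y h" if "v \<in> z ` V" for v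
    using hol that unfolding holo_map_on_def h_def by blast
  have oS: "open S"
    unfolding open_subopen[of S]
  proof
    fix v assume v: "v \<in> S"
    then obtain N T X Y where N: "open N" "v \<in> N" "N \<subseteq> z ` V" "holo_lift N T X Y h"
      using lift[of v] unfolding S_def by blast
    have "open {w \<in> N. h w \<in> U}" by (rule open_holo_lift_vimage[OF N(4,1) U(1)])
    moreover have "v \<in> {w \<in> N. h w \<in> U}" using v N(2) U(2) by (simp add: S_def)
    moreover have "{w \<in> N. h w \<in> U} \<subseteq> S"
    proof
      fix w assume w: "w \<in> {w \<in> N. h w \<in> U}"
      then have "w \<in> z ` V" using N(3) by blast
      with w VC hV(1)[of w] show "w \<in> S" by (auto simp: S_def U(2))
    qed
    ultimately show "\<exists>N. open N \<and> v \<in> N \<and> N \<subseteq> S" by blast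
  qed
  \<comment> \<open>The transition function from the given coordinate \<open>z\<close> to the
    adapted coordinate \<open>z0\<close>.\<close>
  define g where "g = (\<lambda>v. z0 (h v))"
  have "g holomorphic_on S"
    unfolding holomorphic_on_def
  proof
    fix v assume v: "v \<in> S"
    then obtain N T X Y where N: "open N" "v \<in> N" "N \<subseteq> z ` V" "holo_lift N T X Y h"
      using lift[of v] unfolding S_def by blast
    have "h v \<in> chart_dom b" using v bc(2) by (auto simp: S_def)
    then obtain M where M: "open M" "v \<in> M" "\<forall>c. (\<lambda>w. coord b c (h w)) holomorphic_on M"
      using coord_holo_lift[OF N(4,1,2)] by metis
    have "g holomorphic_on M" using M(3) by (simp add: g_def bc(1))
    then show "g field_differentiable at v within S"
      using holomorphic_on_imp_differentiable_at[OF _ M(1,2)] field_differentiable_at_within by blast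
  qed
  moreover have "inj_on g S"
  proof (rule inj_onI)
    fix v w assume vw: "v \<in> S" "w \<in> S" "g v = g w"
    have "inj_on z0 V0" using adaptedD(1)[OF V0(2)] by (simp add: local_coord_def)
    moreover have "h v \<in> V0" "h w \<in> V0" "z0 (h v) = z0 (h w)" using vw by (simp_all add: S_def g_def)
    ultimately have "h v = h w" by (metis inj_onD)
    moreover have "v \<in> z ` V" "w \<in> z ` V" using vw by (simp_all add: S_def)
    ultimately show "v = w" using hV(2) by metis
  qed
  ultimately obtain g' where g': "g' holomorphic_on (g ` S)" "\<And>v. v \<in> S \<Longrightarrow> g' (g v) = v"
    using holomorphic_has_inverse[OF _ oS, of g] by metis
  have "f \<zeta> \<in> V \<inter> V0" using f V0 by blast
  moreover have "openin (top_of_set C) (V \<inter> V0)"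
    using opV openin_affine_part(1)[OF V0(2)] by (rule openin_Int)
  ultimately obtain N where N: "open N" "\<zeta> \<in> N" "f ` N \<subseteq> V \<inter> V0" "\<forall>w\<in>N. local_map C w f"
    "(\<lambda>w. z0 (f w)) holomorphic_on N"
    using adapted_nbhd[OF V0(2) f(1), of "V \<inter> V0"] by (metis Int_lower2)
  have zS: "z (f w) \<in> S \<and> g (z (f w)) = z0 (f w)" if "w \<in> N" for w
  proof -
    have "f w \<in> V" "f w \<in> V0" using N(3) that by auto
    then show ?thesis using hz by (auto simp: S_def g_def)
  qed
  have "(\<lambda>w. g' (z0 (f w))) holomorphic_on N"
  proof -
    have "(\<lambda>w. z0 (f w)) ` N \<subseteq> g ` S" using zS by force
    from holomorphic_on_compose_gen[OF N(5) g'(1) this] show ?thesis by (simp add: o_def)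
  qed
  moreover have "g' (z0 (f w)) = z (f w)" if "w \<in> N" for w
    using zS[OF that] g'(2) by metis
  ultimately have "(\<lambda>w. z (f w)) holomorphic_on N"
    using holomorphic_transform by (metis (no_types, lifting))
  with N show thesis by (intro that[of N]) auto
qed

text \<open>Along a map the coefficients become holomorphic functions of the disc variable. That
  \<open>u\<close> factors through \<open>f\<close> is recorded for locally constant maps, for which
  \<open>u\<close> must be constant too.\<close>

lemma GG_section_expansion:
  assumes "\<Phi> \<in> GG_sections k m C" "local_map C \<zeta> f"
  obtains N u \<alpha> where "open N" "\<zeta> \<in> N" "\<forall>w\<in>N. local_map C w f" "u holomorphic_on N"
    "\<forall>\<mu>\<in>weighted_indices k m. \<alpha> \<mu> holomorphic_on N"
    "\<forall>w\<in>N. \<Phi> (jet_of k C w f) = (\<Sum>\<mu>\<in>weighted_indices k m. \<alpha> \<mu> w * (\<Prod>j=1..k. (deriv ^^ j) u w ^ \<mu> j))"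
    "\<exists>z. u = (\<lambda>w. z (f w))"
proof -
  have "f \<zeta> \<in> C" using assms(2) by (auto simp: local_map_def)
  then have "jet_polynomial_near k C (weighted_indices k m) \<Phi> (f \<zeta>)"
    using assms(1) by (simp add: GG_sections_def)
  then obtain V z a where V: "local_coord C V z" "f \<zeta> \<in> V" "\<forall>\<mu>\<in>weighted_indices k m. holo_fun_on V z (a \<mu>)"
    "\<forall>\<zeta> f. local_map C \<zeta> f \<and> f \<zeta> \<in> V \<longrightarrow> \<Phi> (jet_of k C \<zeta> f) =
             (\<Sum>\<mu>\<in>weighted_indices k m. a \<mu> (f \<zeta>) * (\<Prod>j=1..k. (deriv ^^ j) (\<lambda>w. z (f w)) \<zeta> ^ \<mu> j))"
    unfolding jet_polynomial_near_def by blast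
  obtain N where N: "open N" "\<zeta> \<in> N" "f ` N \<subseteq> V" "\<forall>w\<in>N. local_map C w f" "(\<lambda>w. z (f w)) holomorphic_on N"
    using local_coord_holomorphic[OF V(1) assms(2) V(2)] by metis
  show thesis
  proof (rule that[of N "\<lambda>w. z (f w)" "\<lambda>\<mu> w. a \<mu> (f w)"])
    show "\<forall>\<mu>\<in>weighted_indices k m. (\<lambda>w. a \<mu> (f w)) holomorphic_on N"
    proof
      fix \<mu> assume "\<mu> \<in> weighted_indices k m"
      then have *: "(\<lambda>w. a \<mu> (inv_into V z w)) holomorphic_on z ` V"
        using V(3) by (simp add: holo_fun_on_def)
      have "(\<lambda>w. z (f w)) ` N \<subseteq> z ` V" using N(3) by blast
      from holomorphic_on_compose_gen[OF N(5) * this]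
      have "(\<lambda>w. a \<mu> (inv_into V z (z (f w)))) holomorphic_on N" by (simp add: o_def)
      moreover have "inv_into V z (z (f w)) = f w" if "w \<in> N" for w
        using V(1) N(3) that by (intro inv_into_f_f) (auto simp: local_coord_def)
      ultimately show "(\<lambda>w. a \<mu> (f w)) holomorphic_on N"
        by (simp cong: holomorphic_cong)
    qed
    show "\<forall>w\<in>N. \<Phi> (jet_of k C w f) =
       (\<Sum>\<mu>\<in>weighted_indices k m. a \<mu> (f w) * (\<Prod>j=1..k. (deriv ^^ j) (\<lambda>w. z (f w)) w ^ \<mu> j))"
    proof
      fix w assume "w \<in> N"
      then have "local_map C w f \<and> f w \<in> V" using N(3,4) by blast
      then show "\<Phi> (jet_of k C w f) =
       (\<Sum>\<mu>\<in>weighted_indices k m. a \<mu> (f w) * (\<Prod>j=1..k. (deriv ^^ j) (\<lambda>w. z (f w)) w ^ \<mu> j))"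
        using V(4) by blast
    qed
  qed (use N in auto)
qed

lemma GG_section_isCont:
  assumes "\<Phi> \<in> GG_sections k m C" "local_map C \<zeta> f"
  shows "isCont (\<lambda>w. \<Phi> (jet_of k C w f)) \<zeta>"
proof (rule GG_section_expansion[OF assms])
  fix N u \<alpha> assume N: "open N" "\<zeta> \<in> N" "u holomorphic_on N"
    "\<forall>\<mu>\<in>weighted_indices k m. \<alpha> \<mu> holomorphic_on N"
    "\<forall>w\<in>N. \<Phi> (jet_of k C w f) = (\<Sum>\<mu>\<in>weighted_indices k m. \<alpha> \<mu> w * (\<Prod>j=1..k. (deriv ^^ j) u w ^ \<mu> j))"
  have "(\<lambda>w. \<Sum>\<mu>\<in>weighted_indices k m. \<alpha> \<mu> w * (\<Prod>j=1..k. (deriv ^^ j) u w ^ \<mu> j)) holomorphic_on N"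
    using N by (intro holomorphic_intros) auto
  then have "(\<lambda>w. \<Phi> (jet_of k C w f)) holomorphic_on N"
    using N(5) by (simp cong: holomorphic_cong)
  then show ?thesis
    using N(1,2) continuous_on_eq_continuous_at holomorphic_on_imp_continuous_on by blast
qed

text \<open>All derivatives of a locally constant map vanish, and a monomial of positive weight
  contains at least one of them.\<close>

lemma GG_section_constant:
  assumes "\<Phi> \<in> GG_sections k m C" "local_map C \<zeta> f" "1 \<le> m"
    and "open M" "\<zeta> \<in> M" "\<And>w. w \<in> M \<Longrightarrow> f w = f \<zeta>"
  shows "\<Phi> (jet_of k C \<zeta> f) = 0"
proof (rule GG_section_expansion[OF assms(1,2)])
  fix N u \<alpha> assume N0: "open N" "\<zeta> \<in> N" "u holomorphic_on N" "\<exists>z. u = (\<lambda>w. z (f w))"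
    "\<forall>w\<in>N. \<Phi> (jet_of k C w f) = (\<Sum>\<mu>\<in>weighted_indices k m. \<alpha> \<mu> w * (\<Prod>j=1..k. (deriv ^^ j) u w ^ \<mu> j))"
  from N0(4) obtain z where z: "u = (\<lambda>w. z (f w))" ..
  note N = N0(1-3) z N0(5)
  have du: "(deriv ^^ j) u \<zeta> = 0" if "j \<ge> 1" for j
  proof -
    have "(deriv ^^ j) u \<zeta> = (deriv ^^ j) (\<lambda>_. u \<zeta>) \<zeta>"
    proof (rule higher_deriv_transform_within_open)
      show "u holomorphic_on N \<inter> M" by (rule holomorphic_on_subset[OF N(3) Int_lower1])
      show "open (N \<inter> M)" by (rule open_Int[OF N(1) assms(4)])
      show "\<zeta> \<in> N \<inter> M" using N(2) assms(5) by (rule IntI)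
      show "u w = u \<zeta>" if "w \<in> N \<inter> M" for w
      proof -
        have "f w = f \<zeta>" using that assms(6) by blast
        then show ?thesis by (simp only: z)
      qed
    qed (rule holomorphic_on_const)
    then show ?thesis using that by (simp add: higher_deriv_const)
  qed
  have "(\<Prod>j=1..k. (deriv ^^ j) u \<zeta> ^ \<mu> j) = 0" if \<mu>: "\<mu> \<in> weighted_indices k m" for \<mu>
  proof -
    have "(\<Sum>j=1..k. j * \<mu> j) \<noteq> 0" using \<mu> assms(3) by (simp add: weighted_indices_def)
    then obtain j where j: "j \<in> {1..k}" "j * \<mu> j \<noteq> 0" by (meson sum.neutral)
    then have "(deriv ^^ j) u \<zeta> ^ \<mu> j = 0" using du[of j] by (simp add: power_0_left)
    then show ?thesis using j(1) by (meson finite_atLeastAtMost prod_zero)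
  qed
  then have "(\<Sum>\<mu>\<in>weighted_indices k m. \<alpha> \<mu> \<zeta> * (\<Prod>j=1..k. (deriv ^^ j) u \<zeta> ^ \<mu> j)) = 0"
    by (intro sum.neutral ballI) (simp only: mult_zero_right)
  then show ?thesis by (rule trans[OF bspec[OF N(5) N(2)]])
qed

text \<open>A jet at infinity is approached along its own map. If the map is affine in a punctured
  neighbourhood, continuity gives the value 0. Otherwise the map is constant near the point, and
  sections of positive weight vanish on its jet.\<close>

lemma GG_combination_zero:
  assumes I: "finite I" "\<And>i. i \<in> I \<Longrightarrow> \<Phi> i \<in> GG_sections k m C" and m: "1 \<le> m"
    and aff: "\<And>\<zeta> f. local_map C \<zeta> f \<Longrightarrow> f \<zeta> \<in> affine_plane \<Longrightarrow> (\<Sum>i\<in>I. c i * \<Phi> i (jet_of k C \<zeta> f)) = 0"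
  shows "(\<Sum>i\<in>I. c i * \<Phi> i v) = 0"
proof (cases "v \<in> jet_bundle k C")
  case False
  then show ?thesis using I(2) by (intro sum.neutral) (auto simp: GG_sections_def)
next
  case True
  then obtain \<zeta> f where v: "v = jet_of k C \<zeta> f" and f: "local_map C \<zeta> f" by (auto simp: jet_bundle_def)
  show ?thesis
  proof (cases "f \<zeta> \<in> affine_plane")
    case True
    then show ?thesis using aff[OF f] v by simp
  next
    case inf: False
    have "f \<zeta> \<in> C" using f by (auto simp: local_map_def)
    then obtain V z \<phi> kk where V: "f \<zeta> \<in> V" "adapted V z \<phi> kk" by (rule adapted_exists)
    obtain N where N: "open N" "\<zeta> \<in> N" "f ` N \<subseteq> V" "\<forall>w\<in>N. local_map C w f" "(\<lambda>w. z (f w)) holomorphic_on N"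
      using adapted_nbhd[OF V(2) f V(1) order_refl openin_affine_part(1)[OF V(2)]] by metis
    obtain r where r: "0 < r" "ball \<zeta> r \<subseteq> N" using N(1,2) open_contains_ball by blast
    define h where "h = (\<lambda>w. \<phi> (z (f w)))"
    have fV: "f w \<in> V" if "w \<in> ball \<zeta> r" for w using N(3) r(2) that by blast
    have h: "h w = 0 \<longleftrightarrow> f w \<notin> affine_plane" if "w \<in> ball \<zeta> r" for w
      using adaptedD(6)[OF V(2) fV[OF that]] by (simp add: h_def)
    have "h holomorphic_on ball \<zeta> r"
    proof -
      have "(\<lambda>w. z (f w)) holomorphic_on ball \<zeta> r" by (rule holomorphic_on_subset[OF N(5) r(2)])
      moreover have "(\<lambda>w. z (f w)) ` ball \<zeta> r \<subseteq> z ` V" using fV by blast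
      ultimately show ?thesis
        using holomorphic_on_compose_gen[OF _ adaptedD(2)[OF V(2)]] unfolding h_def by (simp add: o_def)
    qed
    moreover have h0: "h \<zeta> = 0" using h[of \<zeta>] r(1) inf by simp
    ultimately show ?thesis
    proof (cases "\<forall>w\<in>ball \<zeta> r. h w = 0")
      case True
      \<comment> \<open>\<open>V\<close> contains at most one point at infinity, so a map staying at
        infinity near \<zeta> is constant there.\<close>
      have const: "f w = f \<zeta>" if w: "w \<in> ball \<zeta> r" for w
        by (rule adaptedD(7)[OF V(2) fV[OF w] V(1) _ inf]) (use h[OF w] True w in blast)
      have "\<zeta> \<in> ball \<zeta> r" using r(1) by simp
      then have "\<Phi> i v = 0" if "i \<in> I" for i
        unfolding v by (rule GG_section_constant[OF I(2)[OF that] f m open_ball _ const])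
      then show ?thesis by simp
    next
      case False
      then obtain \<beta> where \<beta>: "\<beta> \<in> ball \<zeta> r" "h \<beta> \<noteq> 0" by blast
      have \<zeta>: "\<zeta> \<in> ball \<zeta> r" using r(1) by simp
      \<comment> \<open>The zero of \<open>h\<close> at \<zeta> is isolated: the punctured disc is
        mapped into the affine plane, and the value at \<zeta> is a limit of zeros.\<close>
      obtain s where s: "0 < s" "ball \<zeta> s \<subseteq> ball \<zeta> r" "\<And>w. w \<in> ball \<zeta> s - {\<zeta>} \<Longrightarrow> h w \<noteq> 0"
        using isolated_zeros[OF \<open>h holomorphic_on ball \<zeta> r\<close> open_ball connected_ball \<zeta> h0 \<beta>] by metis
      define S where "S = (\<lambda>w. \<Sum>i\<in>I. c i * \<Phi> i (jet_of k C w f))"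
      have "isCont S \<zeta>"
        unfolding S_def using GG_section_isCont[OF I(2) f] by (intro continuous_intros) auto
      moreover have "eventually (\<lambda>w. S w = 0) (at \<zeta>)"
        unfolding eventually_at_topological
      proof (intro exI[of _ "ball \<zeta> s"] conjI ballI impI)
        fix w assume w: "w \<in> ball \<zeta> s" "w \<noteq> \<zeta>"
        then have "w \<in> ball \<zeta> r" using s(2) by blast
        then have "f w \<in> affine_plane" "local_map C w f"
          using h[of w] s(3)[of w] w N(4) r(2) by auto
        then show "S w = 0" unfolding S_def by (intro aff)
      qed (use s(1) in auto)
      ultimately have "S \<zeta> = 0"
        by (metis isCont_def tendsto_eventually tendsto_unique trivial_limit_at)
      then show ?thesis by (simp add: S_def v)
    qed
  qed
qed

lemma section_unique:
  assumes "1 \<le> m" "\<Phi> \<in> GG_sections k m C" "\<Phi>' \<in> GG_sections k m C"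
    and "\<And>\<zeta> f. local_map C \<zeta> f \<Longrightarrow> f \<zeta> \<in> affine_plane \<Longrightarrow> \<Phi> (jet_of k C \<zeta> f) = \<Phi>' (jet_of k C \<zeta> f)"
  shows "\<Phi> = \<Phi>'"
proof
  fix v
  have "(\<Sum>i\<in>{False, True}. (if i then 1 else - 1) * (if i then \<Phi> else \<Phi>') v) = 0"
  proof (rule GG_combination_zero[where k = k and m = m])
    show "(if i then \<Phi> else \<Phi>') \<in> GG_sections k m C" for i using assms(2,3) by simp
    show "(\<Sum>i\<in>{False, True}. (if i then 1 else - 1) * (if i then \<Phi> else \<Phi>') (jet_of k C \<zeta> f)) = 0"
      if "local_map C \<zeta> f" "f \<zeta> \<in> affine_plane" for \<zeta> f
      using assms(4)[OF that] by simp
  qed (use assms(1) in simp_all)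
  then show "\<Phi> v = \<Phi>' v" by simp
qed

end

subsection \<open>Linear independence\<close>

lemma sum_powers_zero:
  fixes c :: "'i \<Rightarrow> complex"
  assumes "finite W" "\<And>t. (\<Sum>\<mu>\<in>W. c \<mu> * t ^ e \<mu>) = 0"
  shows "(\<Sum>\<mu>\<in>{\<mu>\<in>W. e \<mu> = n}. c \<mu>) = 0"
proof -
  define P where "P = (\<Sum>\<mu>\<in>W. monom (c \<mu>) (e \<mu>))"
  have "\<forall>t. poly P t = 0" using assms(2) by (simp add: P_def poly_sum poly_monom)
  then have "P = 0" by (simp only: poly_all_0_iff_0)
  then have "coeff P n = 0" by simp
  then have "(\<Sum>\<mu>\<in>W. if e \<mu> = n then c \<mu> else 0) = 0" by (simp add: P_def coeff_sum)
  then show ?thesis using assms(1) by (simp add: sum.inter_filter)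
qed

text \<open>Induction on the number of variables: the last one is set to a free value t, and
  comparing coefficients in t isolates the exponents that agree with \<mu> in the last
  entry.\<close>

lemma jmonom_independent:
  assumes "finite W" "\<And>\<mu> \<nu>. \<mu> \<in> W \<Longrightarrow> \<nu> \<in> W \<Longrightarrow> (\<forall>j\<in>{1..k}. \<mu> j = \<nu> j) \<Longrightarrow> \<mu> = \<nu>"
    and "\<And>v. (\<Sum>\<mu>\<in>W. h \<mu> * jmonom k v \<mu>) = 0" and "\<mu> \<in> W"
  shows "h \<mu> = 0"
  using assms
proof (induction k arbitrary: W)
  case 0
  have "\<nu> = \<mu>" if "\<nu> \<in> W" for \<nu> using "0.prems"(2)[OF that "0.prems"(4)] by simp
  then have "W = {\<mu>}" using "0.prems"(4) by blast
  then show ?case using "0.prems"(3) by (simp add: jmonom_def)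
next
  case (Suc k)
  define W' where "W' = {\<nu>\<in>W. \<nu> (Suc k) = \<mu> (Suc k)}"
  show ?case
  proof (rule Suc.IH[of W'])
    show "finite W'" "\<mu> \<in> W'" using Suc.prems(1,4) by (auto simp: W'_def)
    fix \<rho> \<nu> assume "\<rho> \<in> W'" "\<nu> \<in> W'" and eq: "\<forall>j\<in>{1..k}. \<rho> j = \<nu> j"
    moreover from this have "\<rho> j = \<nu> j" if "j \<in> {1..Suc k}" for j
      using that by (cases "j = Suc k") (auto simp: W'_def)
    ultimately show "\<rho> = \<nu>" using Suc.prems(2)[of \<rho> \<nu>] by (auto simp: W'_def)
  next
    fix v :: "nat \<Rightarrow> complex"
    have "(\<Sum>\<nu>\<in>W. (h \<nu> * jmonom k v \<nu>) * t ^ \<nu> (Suc k)) = 0" for t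
    proof -
      have eq: "jmonom (Suc k) (v(Suc k := t)) \<nu> = jmonom k v \<nu> * t ^ \<nu> (Suc k)" for \<nu>
        unfolding jmonom_def by (simp cong: prod.cong_simp)
      show ?thesis using Suc.prems(3)[of "v(Suc k := t)"] unfolding eq by (simp add: mult.assoc)
    qed
    from sum_powers_zero[OF Suc.prems(1) this, of "\<mu> (Suc k)"]
    show "(\<Sum>\<nu>\<in>W'. h \<nu> * jmonom k v \<nu>) = 0" by (simp add: W'_def)
  qed
qed

lemma jet_expr_cong:
  "(\<And>j. j \<in> {1..l} \<Longrightarrow> u j = u' j) \<Longrightarrow> 1 \<le> l \<Longrightarrow> jet_expr p l u D r = jet_expr p l u' D r"
  unfolding jet_expr_def by (intro arg_cong2[of _ _ _ _ "(+)"] sum.cong refl) (auto intro!: prod.cong)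

text \<open>The system is triangular: \<open>u l\<close> enters the expression of order
  \<open>l\<close> linearly with the factor 1/D, and everything else there involves lower indices
  only.\<close>

lemma jet_expr_solvable:
  assumes "D \<noteq> 0"
  shows "\<exists>u. \<forall>l\<in>{1..k}. jet_expr (p l) l u D r = v l"
proof (induction k)
  case (Suc k)
  then obtain u where u: "\<forall>l\<in>{1..k}. jet_expr (p l) l u D r = v l" by blast
  \<comment> \<open>The contribution of the lower derivatives: the expression with the top
    derivative set to 0.\<close>
  define s where "s = jet_expr (p (Suc k)) (Suc k) (u(Suc k := 0)) D r"
  define u' where "u' = u(Suc k := D * (v (Suc k) - s))"
  have "(\<Sum>\<mu>\<in>weighted_indices k (Suc k). (\<Prod>j=1..k. u' j ^ \<mu> j) / D * eval_mpoly (p (Suc k) \<mu>) r) =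
      (\<Sum>\<mu>\<in>weighted_indices k (Suc k). (\<Prod>j=1..k. (u(Suc k := 0)) j ^ \<mu> j) / D * eval_mpoly (p (Suc k) \<mu>) r)"
    by (intro sum.cong refl arg_cong2[of _ _ _ _ "(*)"] arg_cong2[of _ _ _ _ "(/)"] prod.cong)
       (auto simp: u'_def)
  then have "jet_expr (p (Suc k)) (Suc k) u' D r = u' (Suc k) / D + s"
    by (simp add: jet_expr_def s_def)
  also have "\<dots> = v (Suc k)" using assms by (simp add: u'_def)
  finally have "jet_expr (p (Suc k)) (Suc k) u' D r = v (Suc k)" .
  moreover have "jet_expr (p l) l u' D r = v l" if "l \<in> {1..k}" for l
  proof -
    have "jet_expr (p l) l u' D r = jet_expr (p l) l u D r"
      using that by (intro jet_expr_cong) (auto simp: u'_def)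
    then show ?thesis using u that by simp
  qed
  ultimately show ?case by (intro exI[of _ u']) (auto simp: le_Suc_eq)
qed auto

lemma higher_deriv_poly: "(deriv ^^ n) (poly p) = poly ((pderiv ^^ n) p)" for p :: "complex poly"
proof (induction n)
  case (Suc n)
  have "deriv (poly q) = poly (pderiv q)" for q :: "complex poly"
    by (rule ext) (rule DERIV_imp_deriv[OF poly_DERIV])
  then show ?case using Suc by simp
qed simp

lemma exists_poly_derivs:
  obtains q :: "complex poly" where "\<And>l. l \<le> k \<Longrightarrow> (deriv ^^ l) (poly q) 0 = u l"
proof
  define q where "q = (\<Sum>l\<le>k. monom (u l / fact l) l)"
  fix l assume "l \<le> k"
  then have "coeff q l = u l / fact l"
    by (simp add: q_def coeff_sum)
  then show "(deriv ^^ l) (poly q) 0 = u l"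
    by (simp add: higher_deriv_poly poly_0_coeff_0 coeff_higher_pderiv flip: pochhammer_fact)
qed

lemma eval2_as_poly_in_y: "eval2 P x y = poly (map_poly (\<lambda>p. poly p x) P) y"
  by (induction P) (simp_all add: map_poly_pCons)

section \<open>Prescribing the jet differentials at an affine point\<close>

context plane_curve
begin

text \<open>The sign \<epsilon> is 1 over R_x \<noteq> 0 and -1 over R_y \<noteq> 0. Since
  \<epsilon>^3 = \<epsilon>, the cubic correction carries the same sign as the derivative.\<close>

lemma Jval_recipe:
  assumes p: "recipe_for p l" and curve: "along_curve N x y A" and nz: "\<forall>w\<in>N. A 1 0 w \<noteq> 0" and \<zeta>: "\<zeta> \<in> N"
    and J: "\<And>w. w \<in> N \<Longrightarrow> J1 f w = \<epsilon> * (deriv y w / A 1 0 w)" and \<epsilon>: "\<epsilon> ^ 3 = \<epsilon>"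
    and f: "f \<zeta> \<in> affine_plane" "cubic_factor (\<lambda>i j. Rd i j (f \<zeta>)) = cubic_factor (\<lambda>i j. A i j \<zeta>)"
  shows "Jval l \<zeta> f = \<epsilon> * jet_expr p l (\<lambda>j. (deriv ^^ j) y \<zeta>) (A 1 0 \<zeta>) (\<lambda>(i, j). A i j \<zeta> / A 1 0 \<zeta>)"
proof -
  have oN: "open N" and hol: "y holomorphic_on N" using curve by (simp_all add: along_curve_def)
  have hA: "A 1 0 holomorphic_on N"
    using curve unfolding along_curve_def holomorphic_on_def field_differentiable_def
    by (meson has_field_derivative_at_within)
  define q where "q = (\<lambda>w. deriv y w / A 1 0 w)"
  have hq: "q holomorphic_on N"
    unfolding q_def using hol hA oN nz by (intro holomorphic_intros) auto
  have Jq: "J1 f w = \<epsilon> * q w" if "w \<in> N" for w using J[OF that] by (simp add: q_def)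
  have hJ: "(\<lambda>w. \<epsilon> * q w) holomorphic_on N" using hq by (intro holomorphic_intros)
  have "(deriv ^^ (l - 1)) (J1 f) \<zeta> = (deriv ^^ (l - 1)) (\<lambda>w. \<epsilon> * q w) \<zeta>"
    by (rule higher_deriv_transform_within_open[OF _ hJ oN \<zeta> Jq])
       (use hJ in \<open>simp add: holomorphic_cong[OF refl Jq]\<close>)
  also have "\<dots> = \<epsilon> * (deriv ^^ (l - 1)) q \<zeta>"
    by (rule higher_deriv_cmult[OF hq \<zeta> oN])
  finally have d: "(deriv ^^ (l - 1)) (J1 f) \<zeta> = \<epsilon> * (deriv ^^ (l - 1)) q \<zeta>" .
  have "Jval l \<zeta> f = \<epsilon> * ((deriv ^^ (l - 1)) q \<zeta> + (if l = 3 then q \<zeta> ^ 3 * cubic_factor (\<lambda>i j. A i j \<zeta>) else 0))"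
    using f d Jq[OF \<zeta>] \<epsilon> by (simp add: Jval_def power_mult_distrib algebra_simps)
  with p show ?thesis using curve nz \<zeta> unfolding recipe_for_def q_def by simp
qed

lemma along_curve_nonzero:
  assumes "local_map C \<zeta> f" "f \<zeta> \<in> affine_plane" "Rd i j (f \<zeta>) \<noteq> 0"
  obtains N where "along_curve N (\<lambda>w. xcoord (f w)) (\<lambda>w. ycoord (f w)) (\<lambda>i j w. Rd i j (f w))"
    "\<forall>w\<in>N. local_map C w f \<and> f w \<in> affine_plane" "\<zeta> \<in> N" "\<forall>w\<in>N. Rd i j (f w) \<noteq> 0"
proof -
  obtain N where N: "open N" "\<zeta> \<in> N" "f ` N \<subseteq> C \<inter> affine_plane" "\<forall>w\<in>N. local_map C w f"
    "along_curve N (\<lambda>w. xcoord (f w)) (\<lambda>w. ycoord (f w)) (\<lambda>i j w. Rd i j (f w))"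
    using along_curve_local_map[OF assms(1,2)] by metis
  have "isCont (\<lambda>w. Rd i j (f w)) w" if "w \<in> N" for w
    using N(5) that unfolding along_curve_def by (meson DERIV_isCont)
  then have "continuous_on N (\<lambda>w. Rd i j (f w))"
    by (simp add: continuous_at_imp_continuous_on)
  then have op: "open (N \<inter> (\<lambda>w. Rd i j (f w)) -` (- {0}))"
    by (rule continuous_open_preimage[OF _ N(1)]) (simp add: open_Compl)
  have "along_curve (N \<inter> (\<lambda>w. Rd i j (f w)) -` (- {0})) (\<lambda>w. xcoord (f w)) (\<lambda>w. ycoord (f w)) (\<lambda>i j w. Rd i j (f w))"
    using N(5) op unfolding along_curve_def
    by (elim conjE, intro conjI) (auto intro: holomorphic_on_subset)
  then show thesis
    by (rule that) (use N assms(3) in auto)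
qed

text \<open>The second expression is the same recipe for the curve with x and y exchanged;
  \<open>cubic_factor\<close> is unchanged by this, and the sign is that of
  \<open>J1_x\<close>.\<close>

lemma jet_expressions:
  assumes l: "1 \<le> l"
  shows "\<exists>p. (\<forall>\<mu>\<in>weighted_indices (l - 1) l. mpoly_vars (p \<mu>) \<subseteq> admissible_vars (\<Sum>q=1..l - 1. \<mu> q)) \<and>
    (\<forall>\<zeta> f. local_map C \<zeta> f \<longrightarrow> f \<zeta> \<in> affine_plane \<longrightarrow>
      (Rd 1 0 (f \<zeta>) \<noteq> 0 \<longrightarrow> Jval l \<zeta> f = jet_expr_y p R l \<zeta> f) \<and>
      (Rd 0 1 (f \<zeta>) \<noteq> 0 \<longrightarrow> Jval l \<zeta> f = jet_expr_x p R l \<zeta> f))"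
proof -
  obtain p where p: "\<forall>\<mu>\<in>weighted_indices (l - 1) l. mpoly_vars (p \<mu>) \<subseteq> admissible_vars (\<Sum>q=1..l - 1. \<mu> q)"
    "recipe_for p l"
    using jet_recipe[OF l] by blast
  have "Jval l \<zeta> f = jet_expr_y p R l \<zeta> f" if *: "local_map C \<zeta> f" "f \<zeta> \<in> affine_plane" "Rd 1 0 (f \<zeta>) \<noteq> 0" for \<zeta> f
  proof (rule along_curve_nonzero[OF *])
    fix N assume N: "along_curve N (\<lambda>w. xcoord (f w)) (\<lambda>w. ycoord (f w)) (\<lambda>i j w. Rd i j (f w))"
      "\<zeta> \<in> N" "\<forall>w\<in>N. Rd 1 0 (f w) \<noteq> 0"
    have "Jval l \<zeta> f = 1 * jet_expr p l (\<lambda>j. (deriv ^^ j) (\<lambda>w. ycoord (f w)) \<zeta>) (Rd 1 0 (f \<zeta>))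
        (\<lambda>(i, j). Rd i j (f \<zeta>) / Rd 1 0 (f \<zeta>))"
      by (rule Jval_recipe[OF p(2) N(1,3,2)]) (use N *(2) in \<open>simp_all add: J1_y\<close>)
    then show ?thesis by (simp add: jet_expr_y_def y_der_def[abs_def])
  qed
  moreover have "Jval l \<zeta> f = jet_expr_x p R l \<zeta> f" if *: "local_map C \<zeta> f" "f \<zeta> \<in> affine_plane" "Rd 0 1 (f \<zeta>) \<noteq> 0" for \<zeta> f
  proof (rule along_curve_nonzero[OF *])
    fix N assume N: "along_curve N (\<lambda>w. xcoord (f w)) (\<lambda>w. ycoord (f w)) (\<lambda>i j w. Rd i j (f w))"
      "\<forall>w\<in>N. local_map C w f \<and> f w \<in> affine_plane" "\<zeta> \<in> N" "\<forall>w\<in>N. Rd 0 1 (f w) \<noteq> 0"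
    have "Jval l \<zeta> f = (- 1) * jet_expr p l (\<lambda>j. (deriv ^^ j) (\<lambda>w. xcoord (f w)) \<zeta>) (Rd 0 1 (f \<zeta>))
        (\<lambda>(i, j). Rd j i (f \<zeta>) / Rd 0 1 (f \<zeta>))"
    proof (rule Jval_recipe[OF p(2) along_curve_swap[OF N(1)] N(4,3)])
      show "J1 f w = (- 1) * (deriv (\<lambda>w. xcoord (f w)) w / Rd 0 1 (f w))" if "w \<in> N" for w
        using J1_x[of w f] N(2,4) that by simp
    qed (use *(2) cubic_factor_swap[of "\<lambda>i j. Rd i j (f \<zeta>)"] in simp_all)
    then show ?thesis by (simp add: jet_expr_x_def x_der_def[abs_def])
  qed
  ultimately show ?thesis using p(1) by blast
qed

text \<open>The prescribed values are solved for the derivatives of x, a polynomial with these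
  derivatives at 0 is taken for x, and y is the implicit function of x.\<close>

lemma exists_local_map_with_jets:
  assumes "eval2 R x0 y0 = 0" "eval2 (partial 0 1 R) x0 y0 \<noteq> 0"
  shows "\<exists>f. local_map C 0 f \<and> f 0 = pt 1 x0 y0 \<and> (\<forall>l\<in>{1..k}. Jval l 0 f = v l)"
proof -
  have "\<forall>l\<in>{1..k}. \<exists>p. \<forall>\<zeta> f. local_map C \<zeta> f \<longrightarrow> f \<zeta> \<in> affine_plane \<longrightarrow>
      Rd 0 1 (f \<zeta>) \<noteq> 0 \<longrightarrow> Jval l \<zeta> f = jet_expr_x p R l \<zeta> f"
  proof
    fix l assume "l \<in> {1..k}"
    then have "1 \<le> l" by simp
    from jet_expressions[OF this] show "\<exists>p. \<forall>\<zeta> f. local_map C \<zeta> f \<longrightarrow> f \<zeta> \<in> affine_plane \<longrightarrow>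
      Rd 0 1 (f \<zeta>) \<noteq> 0 \<longrightarrow> Jval l \<zeta> f = jet_expr_x p R l \<zeta> f" by blast
  qed
  from bchoice[OF this] obtain p where p: "\<And>l \<zeta> f. l \<in> {1..k} \<Longrightarrow> local_map C \<zeta> f \<Longrightarrow> f \<zeta> \<in> affine_plane \<Longrightarrow>
      Rd 0 1 (f \<zeta>) \<noteq> 0 \<Longrightarrow> Jval l \<zeta> f = jet_expr_x (p l) R l \<zeta> f" by blast
  obtain U N g where *: "open U" "(x0, y0) \<in> U" "open N" "x0 \<in> N" "g holomorphic_on N" "g x0 = y0"
    and eq: "\<And>x y. (x, y) \<in> U \<and> eval2 R x y = 0 \<longleftrightarrow> x \<in> N \<and> y = g x"
    using implicit_y[OF assms] by metis
  define D where "D = Rd 0 1 (pt 1 x0 y0)"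
  define r where "r = (\<lambda>(i, j). Rd j i (pt 1 x0 y0) / D)"
  have D: "D \<noteq> 0" using assms(2) by (simp add: D_def partial_at_def)
  \<comment> \<open>The minus sign compensates that of \<open>jet_expr_x\<close>.\<close>
  obtain u where u: "\<And>l. l \<in> {1..k} \<Longrightarrow> jet_expr (p l) l u D r = - v l"
    using jet_expr_solvable[OF D, of k p r "\<lambda>l. - v l"] by blast
  \<comment> \<open>The expressions of order at least 1 do not read the entry 0, which is free to
    hold the base point \<open>x0\<close>.\<close>
  obtain q where q: "\<And>l. l \<le> k \<Longrightarrow> (deriv ^^ l) (poly q) 0 = (u(0 := x0)) l"
    using exists_poly_derivs by metis
  define f where "f = (\<lambda>w. pt 1 (poly q w) (g (poly q w)))"
  define W where "W = poly q -` N"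
  have q0: "poly q 0 = x0" using q[of 0] by simp
  have oW: "open W" unfolding W_def by (intro open_vimage *(3)) (auto intro!: continuous_intros)
  have hq: "poly q holomorphic_on W" by (auto intro!: holomorphic_intros)
  have "poly q ` W \<subseteq> N" by (auto simp: W_def)
  from holomorphic_on_compose_gen[OF hq *(5) this]
  have "holo_lift W (\<lambda>_. 1) (poly q) (\<lambda>w. g (poly q w)) f"
    using hq by (auto simp: holo_lift_def f_def o_def)
  then have "holo_map_on W f" by (rule holo_map_on_if_lift[OF oW])
  moreover have "f ` W \<subseteq> C" using eq C_affine by (auto simp: f_def W_def)
  moreover have "0 \<in> W" using q0 *(4) by (simp add: W_def)
  ultimately have f: "local_map C 0 f" unfolding local_map_def using oW by auto
  have f0: "f 0 = pt 1 x0 y0" using q0 *(6) by (simp add: f_def)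
  have "Jval l 0 f = v l" if l: "l \<in> {1..k}" for l
  proof -
    have "Jval l 0 f = jet_expr_x (p l) R l 0 f"
      using D by (intro p[OF l f]) (auto simp: f0 D_def affine_plane_def)
    also have "\<dots> = - jet_expr (p l) l (x_der f 0) D r"
      by (simp add: jet_expr_x_def f0 D_def r_def)
    also have "jet_expr (p l) l (x_der f 0) D r = jet_expr (p l) l u D r"
      using q l by (intro jet_expr_cong) (auto simp: x_der_def f_def)
    finally show ?thesis using u[OF l] by simp
  qed
  with f f0 show ?thesis by blast
qed

text \<open>As the jet differentials take arbitrary values \<open>v\<close> over the point, the
  vanishing of the expression is a polynomial identity in \<open>v\<close>.\<close>

lemma sections_vanish_pointwise:
  assumes "\<And>\<zeta> f. local_map C \<zeta> f \<Longrightarrow> f \<zeta> \<in> affine_plane \<Longrightarrow> secval k m G \<zeta> f = 0"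
    and "eval2 R x0 y0 = 0" "eval2 (partial 0 1 R) x0 y0 \<noteq> 0" "\<mu> \<in> weighted_indices k m"
  shows "eval2 (G \<mu>) x0 y0 = 0"
proof (rule jmonom_independent[of "weighted_indices k m" k "\<lambda>\<mu>. eval2 (G \<mu>) x0 y0"])
  show "finite (weighted_indices k m)" by simp
  show "\<mu> \<in> weighted_indices k m" by fact
next
  fix \<mu> \<nu> assume *: "\<mu> \<in> weighted_indices k m" "\<nu> \<in> weighted_indices k m" "\<forall>j\<in>{1..k}. \<mu> j = \<nu> j"
  show "\<mu> = \<nu>"
  proof
    fix j show "\<mu> j = \<nu> j"
      using * by (cases "j \<in> {1..k}") (auto simp: weighted_indices_def multi_indices_def)
  qed
next
  fix v :: "nat \<Rightarrow> complex"
  obtain f where f: "local_map C 0 f" "f 0 = pt 1 x0 y0" "\<forall>l\<in>{1..k}. Jval l 0 f = v l"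
    using exists_local_map_with_jets[OF assms(2,3), of k v] by blast
  have "secval k m G 0 f = 0"
    using f by (intro assms(1)) (auto simp: affine_plane_def)
  moreover have "(\<Prod>l=1..k. Jval l 0 f ^ \<mu> l) = jmonom k v \<mu>" for \<mu>
    unfolding jmonom_def using f(3) by (intro prod.cong) auto
  ultimately show "(\<Sum>\<mu>\<in>weighted_indices k m. eval2 (G \<mu>) x0 y0 * jmonom k v \<mu>) = 0"
    by (simp add: secval_def f(2) mult.commute)
qed

text \<open>
  Since the curve has \<open>d\<close> simple points at infinity, for large \<open>x\<close> the polynomial \<open>R x \<sqdot>\<close> has
  \<open>d\<close> distinct simple zeros.
\<close>

lemma zero_if_vanishing_on_curve:
  assumes deg: "\<forall>j\<ge>d. coeff S j = 0"
    and van: "\<And>x y. eval2 R x y = 0 \<Longrightarrow> eval2 (partial 0 1 R) x y \<noteq> 0 \<Longrightarrow> eval2 S x y = 0"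
  shows "S = 0"
proof -
  let ?H = "hompoly d R"
  let ?A = "{s. eval2 ?H 0 s = 0}"
  have finA: "finite ?A" using card_infinity d by (metis card.infinite not_numeral_le_zero)
  \<comment> \<open>One branch of the curve through each point at infinity. The s-derivative stays
    nonzero along it, which gives R_y \<noteq> 0 at its affine points as \<open>van\<close>
    demands.\<close>
  have "\<forall>s\<in>?A. \<exists>g. isCont g 0 \<and> g 0 = s \<and>
      eventually (\<lambda>t. eval2 ?H t (g t) = 0 \<and> eval2 (partial 0 1 ?H) t (g t) \<noteq> 0) (at 0)"
  proof
    fix s assume "s \<in> ?A"
    then have s: "eval2 ?H 0 s = 0" by simp
    obtain U N g where *: "open U" "(0, s) \<in> U" "open N" "0 \<in> N" "g holomorphic_on N" "g 0 = s"
      "\<And>x y. (x, y) \<in> U \<and> eval2 ?H x y = 0 \<longleftrightarrow> x \<in> N \<and> y = g x"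
      "\<And>x y. (x, y) \<in> U \<Longrightarrow> eval2 (partial 0 1 ?H) x y \<noteq> 0"
      using implicit_y[OF s smooth_infinity[OF s]] by metis
    have "isCont g 0"
      using *(3,4,5) continuous_on_eq_continuous_at holomorphic_on_imp_continuous_on by blast
    moreover have "eventually (\<lambda>t. t \<in> N) (at 0)"
      using *(3,4) by (rule eventually_at_in_open')
    then have "eventually (\<lambda>t. eval2 ?H t (g t) = 0 \<and> eval2 (partial 0 1 ?H) t (g t) \<noteq> 0) (at 0)"
      by eventually_elim (use *(7,8) in blast)
    ultimately show "\<exists>g. isCont g 0 \<and> g 0 = s \<and>
      eventually (\<lambda>t. eval2 ?H t (g t) = 0 \<and> eval2 (partial 0 1 ?H) t (g t) \<noteq> 0) (at 0)"
      using *(6) by blast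
  qed
  from bchoice[OF this] obtain g where g: "\<And>s. s \<in> ?A \<Longrightarrow> isCont (g s) 0" "\<And>s. s \<in> ?A \<Longrightarrow> g s 0 = s"
    "\<And>s. s \<in> ?A \<Longrightarrow> eventually (\<lambda>t. eval2 ?H t (g s t) = 0 \<and> eval2 (partial 0 1 ?H) t (g s t) \<noteq> 0) (at 0)"
    by blast
  \<comment> \<open>Distinct branches have distinct limits at t = 0, hence distinct values for small
    t.\<close>
  have "eventually (\<lambda>t. \<forall>p\<in>{p\<in>?A \<times> ?A. fst p \<noteq> snd p}. g (fst p) t \<noteq> g (snd p) t) (at 0)"
  proof (rule eventually_ball_finite)
    show "finite {p\<in>?A \<times> ?A. fst p \<noteq> snd p}" using finA by auto
    show "\<forall>p\<in>{p\<in>?A \<times> ?A. fst p \<noteq> snd p}. eventually (\<lambda>t. g (fst p) t \<noteq> g (snd p) t) (at 0)"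
    proof
      fix p assume p: "p \<in> {p\<in>?A \<times> ?A. fst p \<noteq> snd p}"
      then have "((\<lambda>t. g (fst p) t - g (snd p) t) \<longlongrightarrow> fst p - snd p) (at 0)"
        using g(1,2)[of "fst p"] g(1,2)[of "snd p"] by (intro tendsto_diff) (auto simp: isCont_def)
      moreover have "fst p - snd p \<noteq> 0" using p by auto
      ultimately have "eventually (\<lambda>t. g (fst p) t - g (snd p) t \<noteq> 0) (at 0)"
        by (rule tendsto_imp_eventually_ne)
      then show "eventually (\<lambda>t. g (fst p) t \<noteq> g (snd p) t) (at 0)" by simp
    qed
  qed
  moreover have "eventually (\<lambda>t. \<forall>s\<in>?A. eval2 ?H t (g s t) = 0 \<and> eval2 (partial 0 1 ?H) t (g s t) \<noteq> 0) (at 0)"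
    using g(3) by (intro eventually_ball_finite finA) auto
  moreover have "eventually (\<lambda>t :: complex. t \<noteq> 0) (at 0)"
    by (rule eventually_neq_at_within)
  ultimately have ev: "eventually (\<lambda>t. t \<noteq> 0 \<and> (\<forall>j. poly (coeff S j) (1 / t) = 0)) (at 0)"
  proof eventually_elim
    case (elim t)
    \<comment> \<open>The points (1/t, \<open>y s\<close>) are affine points of the curve on the
      line x = 1/t.\<close>
    define y where "y = (\<lambda>s. g s t / t)"
    define T where "T = map_poly (\<lambda>p. poly p (1 / t)) S"
    have inj: "inj_on y ?A"
    proof (rule inj_onI)
      fix s s' assume s: "s \<in> ?A" "s' \<in> ?A" "y s = y s'"
      then have "g s t = g s' t" using elim(3) by (simp add: y_def)
      then show "s = s'" using elim(1) s by fastforce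
    qed
    have "poly T (y s) = 0" if s: "s \<in> ?A" for s
    proof -
      have "partial 0 1 R \<in> polys_le (d - 1)" using polys_le_partial[OF R_le, of 0 1] by simp
      from eval2_hompoly[OF this elim(3), of "g s t"] eval2_hompoly[OF R_le elim(3), of "g s t"]
      have "eval2 R (1 / t) (y s) = 0" "eval2 (partial 0 1 R) (1 / t) (y s) \<noteq> 0"
        using elim(2)[rule_format, OF s] elim(3) pderiv_hompoly[of d R] d by (auto simp: y_def)
      then show ?thesis using van by (simp add: T_def flip: eval2_as_poly_in_y)
    qed
    then have sub: "y ` ?A \<subseteq> {x. poly T x = 0}" by auto
    have T: "coeff T j = poly (coeff S j) (1 / t)" for j by (simp add: T_def coeff_map_poly)
    \<comment> \<open>The restriction of \<open>S\<close> to that line has degree less than d but d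
      different roots.\<close>
    have "T = 0"
    proof (rule ccontr)
      assume nz: "T \<noteq> 0"
      have "d = card (y ` ?A)" using card_image[OF inj] card_infinity by simp
      also have "\<dots> \<le> card {x. poly T x = 0}" by (rule card_mono[OF poly_roots_finite[OF nz] sub])
      also have "\<dots> \<le> degree T" by (rule card_poly_roots_bound[OF nz])
      finally have "coeff T (degree T) = 0" using deg by (simp add: T)
      then show False using nz by simp
    qed
    then show ?case using elim(3) T by (metis coeff_0)
  qed
  then obtain e where e: "e > 0" "\<And>t. t \<noteq> 0 \<Longrightarrow> norm t < e \<Longrightarrow> \<forall>j. poly (coeff S j) (1 / t) = 0"
    unfolding eventually_at by (auto simp: dist_norm)
  have "coeff S j = 0" for j
  proof (rule ccontr)
    assume nz: "coeff S j \<noteq> 0"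
    \<comment> \<open>The coefficient vanishes at 1/t for all small t \<noteq> 0; the values t =
      e/(n + 2) provide infinitely many such points. The shift by 2 gives |t| < e already for n =
      0.\<close>
    have "(\<lambda>n. 1 / (complex_of_real e / of_nat (n + 2))) ` UNIV \<subseteq> {x. poly (coeff S j) x = 0}"
    proof (intro subsetI, elim imageE)
      fix x n assume x: "x = 1 / (complex_of_real e / of_nat (n + 2))"
      have n2: "norm (of_nat (n + 2) :: complex) = real (n + 2)" by (rule norm_of_nat)
      have "norm (complex_of_real e / of_nat (n + 2)) = e / real (n + 2)"
        using e(1) unfolding norm_divide n2 by simp
      also have "\<dots> < e / 1" using e(1) by (intro divide_strict_left_mono) auto
      finally have "norm (complex_of_real e / of_nat (n + 2)) < e" by simp
      then have "\<forall>j. poly (coeff S j) (1 / (complex_of_real e / of_nat (n + 2))) = 0"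
        using e(1) n2 by (intro e(2)) (auto simp del: of_nat_add)
      then show "x \<in> {x. poly (coeff S j) x = 0}" unfolding x by blast
    qed
    moreover have "finite {x. poly (coeff S j) x = 0}" by (rule poly_roots_finite[OF nz])
    ultimately have "finite (range (\<lambda>n. 1 / (complex_of_real e / of_nat (n + 2))))"
      by (rule finite_subset)
    moreover have "inj (\<lambda>n. 1 / (complex_of_real e / of_nat (n + 2)))"
      using e(1) by (auto simp: inj_def simp flip: of_nat_add)
    ultimately show False using finite_imageD infinite_UNIV_nat by blast
  qed
  then show ?thesis by (simp add: poly_eq_iff)
qed

section \<open>Reduction modulo the equation of the curve\<close>

lemma top_coeff_y: "\<exists>c. coeff R d = [:c:] \<and> c \<noteq> 0"
proof (intro exI conjI)
  show "coeff R d = [:coeff (coeff R d) 0:]"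
  proof (rule poly_eqI)
    fix i show "coeff (coeff R d) i = coeff [:coeff (coeff R d) 0:] i"
      using R_le unfolding mem_polys_le by (cases i) force+
  qed
qed (rule top_coeff)

lemma reduction_mod_R:
  assumes "G \<in> polys_le e"
  obtains Q S where "G = R * Q + S" "S \<in> polys_le e" "\<forall>j\<ge>d. coeff S j = 0" "R * Q \<in> multiples_le R d e"
proof -
  obtain c where "coeff R d = [:c:]" "c \<noteq> 0" using top_coeff_y by blast
  from division_by_monic_in_y[OF R_le this assms] obtain Q S where
    *: "G = R * Q + S" "S \<in> polys_le e" "\<forall>j\<ge>d. coeff S j = 0"
    "if d \<le> e then Q \<in> polys_le (e - d) else Q = 0" by blast
  have "R * Q \<in> multiples_le R d e" using *(4) by (auto simp: multiples_le_def split: if_splits)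
  then show thesis by (rule that[OF *(1-3)])
qed

lemma vanishing_imp_multiple:
  assumes "G \<in> polys_le e"
    and "\<And>x y. eval2 R x y = 0 \<Longrightarrow> eval2 (partial 0 1 R) x y \<noteq> 0 \<Longrightarrow> eval2 G x y = 0"
  shows "G \<in> multiples_le R d e"
proof (rule reduction_mod_R[OF assms(1)])
  fix Q S assume *: "G = R * Q + S" "\<forall>j\<ge>d. coeff S j = 0" "R * Q \<in> multiples_le R d e"
  have "S = 0"
  proof (rule zero_if_vanishing_on_curve[OF *(2)])
    fix x y assume xy: "eval2 R x y = 0" "eval2 (partial 0 1 R) x y \<noteq> 0"
    show "eval2 S x y = 0" using assms(2)[OF xy] xy(1) by (simp add: *(1))
  qed
  with * show ?thesis by simp
qed

lemma multiples_le_eval: "P \<in> multiples_le R d e \<Longrightarrow> eval2 R x y = 0 \<Longrightarrow> eval2 P x y = 0"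
  by (auto simp: multiples_le_def split: if_splits)

text \<open>The kernel of the linear map from polynomials to expressions; both independence and the
  dimension rest on it.\<close>

lemma section_zero_iff:
  assumes "admissible k d m G"
  shows "(\<forall>\<zeta> f. local_map C \<zeta> f \<and> f \<zeta> \<in> affine_plane \<longrightarrow> secval k m G \<zeta> f = 0) \<longleftrightarrow>
     (\<forall>\<mu>\<in>weighted_indices k m. G \<mu> \<in> multiples_le R d (delta k d \<mu>))"
proof (intro iffI ballI allI impI)
  fix \<mu> assume *: "\<forall>\<zeta> f. local_map C \<zeta> f \<and> f \<zeta> \<in> affine_plane \<longrightarrow> secval k m G \<zeta> f = 0"
    and \<mu>: "\<mu> \<in> weighted_indices k m"
  show "G \<mu> \<in> multiples_le R d (delta k d \<mu>)"
  proof (rule vanishing_imp_multiple)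
    show "G \<mu> \<in> polys_le (delta k d \<mu>)" using assms \<mu> by (simp add: admissible_def)
    show "eval2 (G \<mu>) x y = 0" if "eval2 R x y = 0" "eval2 (partial 0 1 R) x y \<noteq> 0" for x y
      using * by (intro sections_vanish_pointwise[OF _ that \<mu>]) blast
  qed
next
  fix \<zeta> f assume *: "\<forall>\<mu>\<in>weighted_indices k m. G \<mu> \<in> multiples_le R d (delta k d \<mu>)"
    and f: "local_map C \<zeta> f \<and> f \<zeta> \<in> affine_plane"
  have "f \<zeta> \<in> C" using f by (auto simp: local_map_def)
  then have "eval2 R (xcoord (f \<zeta>)) (ycoord (f \<zeta>)) = 0"
    using C_affine affine_planeE f by metis
  then show "secval k m G \<zeta> f = 0"
    unfolding secval_def using * multiples_le_eval by (intro sum.neutral) auto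
qed

end

subsection \<open>Low orders, and the dimension of the space of sections\<close>

text \<open>This is where \<open>cubic_factor\<close> comes from. The coefficient of y1^3/D in the
  plain second derivative of \<open>q\<close> contains - r 1 2 + 2 r 0 1 r 2 1 + 2 (r 1 1)^2 + r 2 0
  r 0 2. The correction cancels all of these except the second, whose factor 2 it raises to the 3 of
  the example.\<close>

lemma low_order_derivatives:
  assumes curve: "along_curve N x y A" and nz: "\<forall>w\<in>N. A 1 0 w \<noteq> 0" and \<zeta>: "\<zeta> \<in> N"
  defines "q \<equiv> \<lambda>w. deriv y w / A 1 0 w" and "D \<equiv> A 1 0 \<zeta>" and "r \<equiv> \<lambda>i j. A i j \<zeta> / A 1 0 \<zeta>"
    and "y1 \<equiv> deriv y \<zeta>" and "y2 \<equiv> (deriv ^^ 2) y \<zeta>" and "y3 \<equiv> (deriv ^^ 3) y \<zeta>"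
  shows "deriv q \<zeta> = y2 / D + y1 ^ 2 / D * (- r 1 1 + r 0 1 * r 2 0)"
    "(deriv ^^ 2) q \<zeta> + q \<zeta> ^ 3 * cubic_factor (\<lambda>i j. A i j \<zeta>) =
       y3 / D + y2 * y1 / D * (- 3 * r 1 1 + 3 * r 0 1 * r 2 0)
       + y1 ^ 3 / D * (- 6 * r 0 1 * r 1 1 * r 2 0 + 3 * r 0 1 ^ 2 * r 2 0 ^ 2 + 3 * r 0 1 * r 2 1 - r 0 1 ^ 2 * r 3 0)"
proof -
  define c where "c = (\<lambda>j w. (deriv ^^ j) y w)"
  define \<rho> where "\<rho> = (\<lambda>i j w. A i j w / A 1 0 w)"
  have oN: "open N" using curve by (simp add: along_curve_def)
  have sol: "jet_solution c (\<lambda>(i, j). \<rho> i j) w" if "w \<in> N" for w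
    using along_curve_jet_solution(1)[OF curve that] nz that
    unfolding c_def \<rho>_def by (simp add: case_prod_unfold)
  have dc: "(c j has_field_derivative c (Suc j) w) (at w)" if "w \<in> N" "1 \<le> j" for j w
    using sol[OF that(1)] that(2) by (simp add: jet_solution_def)
  have d\<rho>: "(\<rho> i j has_field_derivative c 1 w * (\<rho> i (Suc j) w - \<rho> 0 1 w * \<rho> (Suc i) j w
      - \<rho> i j w * (\<rho> 1 1 w - \<rho> 0 1 w * \<rho> 2 0 w))) (at w)" if "w \<in> N" for i j w
    using sol[OF that] unfolding jet_solution_def dratio_def by fastforce
  have dD: "(A 1 0 has_field_derivative A 1 0 w * (c 1 w * (\<rho> 1 1 w - \<rho> 0 1 w * \<rho> 2 0 w))) (at w)" if "w \<in> N" for w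
    using along_curve_jet_solution(2)[OF curve that] nz that unfolding c_def \<rho>_def by simp
  have q: "q = (\<lambda>w. c 1 w / A 1 0 w)" by (simp add: q_def c_def)
  define q2 where "q2 = (\<lambda>w. (c 2 w - c 1 w ^ 2 * (\<rho> 1 1 w - \<rho> 0 1 w * \<rho> 2 0 w)) / A 1 0 w)"
  have dq: "deriv q w = q2 w" if w: "w \<in> N" for w
  proof (rule DERIV_imp_deriv)
    have "A 1 0 w \<noteq> 0" using nz w by blast
    then show "(q has_field_derivative q2 w) (at w)"
      unfolding q by (intro DERIV_cong[OF DERIV_divide[OF dc[OF w] dD[OF w]]])
        (simp_all add: q2_def field_simps power2_eq_square numeral_2_eq_2)
  qed
  have nz\<zeta>: "A 1 0 \<zeta> \<noteq> 0" using nz \<zeta> by blast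
  have rr: "r i j = \<rho> i j \<zeta>" for i j by (simp add: r_def \<rho>_def)
  show "deriv q \<zeta> = y2 / D + y1 ^ 2 / D * (- r 1 1 + r 0 1 * r 2 0)"
    unfolding dq[OF \<zeta>] q2_def rr
    by (simp add: y1_def y2_def D_def c_def field_simps diff_divide_distrib add_divide_distrib)
  have "(deriv ^^ 2) q \<zeta> = deriv (deriv q) \<zeta>" by (simp add: numeral_2_eq_2)
  also have "\<dots> = (c 3 \<zeta> - (2 * c 1 \<zeta> * c 2 \<zeta> * (\<rho> 1 1 \<zeta> - \<rho> 0 1 \<zeta> * \<rho> 2 0 \<zeta>) +
      c 1 \<zeta> ^ 2 * (c 1 \<zeta> * (\<rho> 1 2 \<zeta> - \<rho> 0 1 \<zeta> * \<rho> 2 1 \<zeta> - \<rho> 1 1 \<zeta> * (\<rho> 1 1 \<zeta> - \<rho> 0 1 \<zeta> * \<rho> 2 0 \<zeta>))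
        - (c 1 \<zeta> * (\<rho> 0 2 \<zeta> - \<rho> 0 1 \<zeta> * \<rho> 1 1 \<zeta> - \<rho> 0 1 \<zeta> * (\<rho> 1 1 \<zeta> - \<rho> 0 1 \<zeta> * \<rho> 2 0 \<zeta>)) * \<rho> 2 0 \<zeta>
          + \<rho> 0 1 \<zeta> * (c 1 \<zeta> * (\<rho> 2 1 \<zeta> - \<rho> 0 1 \<zeta> * \<rho> 3 0 \<zeta> - \<rho> 2 0 \<zeta> * (\<rho> 1 1 \<zeta> - \<rho> 0 1 \<zeta> * \<rho> 2 0 \<zeta>))))))
      - (c 2 \<zeta> - c 1 \<zeta> ^ 2 * (\<rho> 1 1 \<zeta> - \<rho> 0 1 \<zeta> * \<rho> 2 0 \<zeta>)) * (c 1 \<zeta> * (\<rho> 1 1 \<zeta> - \<rho> 0 1 \<zeta> * \<rho> 2 0 \<zeta>))) / A 1 0 \<zeta>"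
    (is "_ = ?rhs / _")
  proof (rule DERIV_imp_deriv)
    have "(c 1 has_field_derivative c 2 \<zeta>) (at \<zeta>)" "(c 2 has_field_derivative c 3 \<zeta>) (at \<zeta>)"
      using dc[OF \<zeta>, of 1] dc[OF \<zeta>, of 2] by (simp_all add: numeral_2_eq_2 numeral_3_eq_3)
    note dcs = this
    have "(\<rho> 1 1 has_field_derivative c 1 \<zeta> * (\<rho> 1 2 \<zeta> - \<rho> 0 1 \<zeta> * \<rho> 2 1 \<zeta> - \<rho> 1 1 \<zeta> * (\<rho> 1 1 \<zeta> - \<rho> 0 1 \<zeta> * \<rho> 2 0 \<zeta>))) (at \<zeta>)"
      "(\<rho> 0 1 has_field_derivative c 1 \<zeta> * (\<rho> 0 2 \<zeta> - \<rho> 0 1 \<zeta> * \<rho> 1 1 \<zeta> - \<rho> 0 1 \<zeta> * (\<rho> 1 1 \<zeta> - \<rho> 0 1 \<zeta> * \<rho> 2 0 \<zeta>))) (at \<zeta>)"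
      "(\<rho> 2 0 has_field_derivative c 1 \<zeta> * (\<rho> 2 1 \<zeta> - \<rho> 0 1 \<zeta> * \<rho> 3 0 \<zeta> - \<rho> 2 0 \<zeta> * (\<rho> 1 1 \<zeta> - \<rho> 0 1 \<zeta> * \<rho> 2 0 \<zeta>))) (at \<zeta>)"
      using d\<rho>[OF \<zeta>, of 1 1] d\<rho>[OF \<zeta>, of 0 1] d\<rho>[OF \<zeta>, of 2 0]
      by (simp_all add: numeral_2_eq_2 numeral_3_eq_3)
    note d\<rho>s = this
    have c1sq: "((\<lambda>w. c 1 w ^ 2) has_field_derivative 2 * c 1 \<zeta> * c 2 \<zeta>) (at \<zeta>)"
      by (rule DERIV_cong[OF DERIV_power[OF dcs(1), of 2]]) simp
    have num: "((\<lambda>w. c 2 w - c 1 w ^ 2 * (\<rho> 1 1 w - \<rho> 0 1 w * \<rho> 2 0 w)) has_field_derivative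
       c 3 \<zeta> - (2 * c 1 \<zeta> * c 2 \<zeta> * (\<rho> 1 1 \<zeta> - \<rho> 0 1 \<zeta> * \<rho> 2 0 \<zeta>) +
       c 1 \<zeta> ^ 2 * (c 1 \<zeta> * (\<rho> 1 2 \<zeta> - \<rho> 0 1 \<zeta> * \<rho> 2 1 \<zeta> - \<rho> 1 1 \<zeta> * (\<rho> 1 1 \<zeta> - \<rho> 0 1 \<zeta> * \<rho> 2 0 \<zeta>))
        - (c 1 \<zeta> * (\<rho> 0 2 \<zeta> - \<rho> 0 1 \<zeta> * \<rho> 1 1 \<zeta> - \<rho> 0 1 \<zeta> * (\<rho> 1 1 \<zeta> - \<rho> 0 1 \<zeta> * \<rho> 2 0 \<zeta>)) * \<rho> 2 0 \<zeta>
          + \<rho> 0 1 \<zeta> * (c 1 \<zeta> * (\<rho> 2 1 \<zeta> - \<rho> 0 1 \<zeta> * \<rho> 3 0 \<zeta> - \<rho> 2 0 \<zeta> * (\<rho> 1 1 \<zeta> - \<rho> 0 1 \<zeta> * \<rho> 2 0 \<zeta>))))))) (at \<zeta>)"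
      by (rule DERIV_cong[OF DERIV_diff[OF dcs(2) DERIV_mult[OF c1sq DERIV_diff[OF d\<rho>s(1) DERIV_mult[OF d\<rho>s(2,3)]]]]])
         (simp add: algebra_simps)
    have "(q2 has_field_derivative ?rhs / A 1 0 \<zeta>) (at \<zeta>)"
      unfolding q2_def
      by (rule DERIV_cong[OF DERIV_divide[OF num dD[OF \<zeta>] nz\<zeta>]])
         (use nz\<zeta> in \<open>simp add: divide_simps\<close>, use nz\<zeta> in \<open>simp add: algebra_simps\<close>)
    then show "(deriv q has_field_derivative ?rhs / A 1 0 \<zeta>) (at \<zeta>)"
      by (rule has_field_derivative_transform_within_open[OF _ oN \<zeta>]) (simp add: dq)
  qed
  finally have d2: "(deriv ^^ 2) q \<zeta> = ?rhs / D" by (simp add: D_def)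
  have cub: "q \<zeta> ^ 3 * cubic_factor (\<lambda>i j. A i j \<zeta>) =
      y1 ^ 3 * (\<rho> 0 1 \<zeta> * \<rho> 2 1 \<zeta> + \<rho> 1 2 \<zeta> - \<rho> 1 1 \<zeta> ^ 2 - \<rho> 1 1 \<zeta> ^ 2 - \<rho> 2 0 \<zeta> * \<rho> 0 2 \<zeta>) / D"
    using nz\<zeta> by (simp add: q_def y1_def D_def \<rho>_def cubic_factor_def field_simps power2_eq_square power3_eq_cube)
  have cs: "c 1 \<zeta> = y1" "c 2 \<zeta> = y2" "c 3 \<zeta> = y3" by (simp_all add: c_def y1_def y2_def y3_def)
  show "(deriv ^^ 2) q \<zeta> + q \<zeta> ^ 3 * cubic_factor (\<lambda>i j. A i j \<zeta>) =
       y3 / D + y2 * y1 / D * (- 3 * r 1 1 + 3 * r 0 1 * r 2 0)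
       + y1 ^ 3 / D * (- 6 * r 0 1 * r 1 1 * r 2 0 + 3 * r 0 1 ^ 2 * r 2 0 ^ 2 + 3 * r 0 1 * r 2 1 - r 0 1 ^ 2 * r 3 0)"
    unfolding d2 cub rr cs times_divide_eq_left add_divide_distrib[symmetric]
    by (intro arg_cong2[of _ _ _ _ "(/)"] refl) (simp add: algebra_simps power2_eq_square power3_eq_cube)
qed

section \<open>Standard monomials in the quotient by the equation\<close>

lemma independent_mod_coeffs_zero:
  assumes "independent_mod W B" "(\<Sum>b\<in>B. smult [:c b:] b) \<in> W" "b \<in> B"
  shows "c b = 0"
  using assms unfolding independent_mod_def by blast

text \<open>Induction over the rows j of the triangle: row d has \<delta> + 1 - d points, which is
  the drop of the second binomial. The truncated differences make rows beyond the triangle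
  empty.\<close>

lemma card_triangle_strip:
  "card {(i, j). i + j \<le> \<delta> \<and> j < d} + ((\<delta> + 2 - d) choose 2) = (\<delta> + 2) choose (2::nat)"
proof (induction d)
  case (Suc d)
  have fin: "finite {(i, j). i + j \<le> \<delta> \<and> j < d}"
    by (rule finite_subset[OF _ finite_pairs_sum_le[of \<delta>]]) auto
  have "{(i, j). i + j \<le> \<delta> \<and> j < Suc d} = {(i, j). i + j \<le> \<delta> \<and> j < d} \<union> (\<lambda>i. (i, d)) ` {..<\<delta> + 1 - d}"
    by (auto simp: less_Suc_eq)
  moreover have "card ((\<lambda>i. (i, d)) ` {..<\<delta> + 1 - d}) = \<delta> + 1 - d"
    by (subst card_image) (auto simp: inj_on_def)
  moreover have "{(i, j). i + j \<le> \<delta> \<and> j < d} \<inter> (\<lambda>i. (i, d)) ` {..<\<delta> + 1 - d} = {}" by auto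
  ultimately have "card {(i, j). i + j \<le> \<delta> \<and> j < Suc d} = card {(i, j). i + j \<le> \<delta> \<and> j < d} + (\<delta> + 1 - d)"
    using fin by (simp add: card_Un_disjoint)
  moreover have "(\<delta> + 2 - d) choose 2 = ((\<delta> + 2 - Suc d) choose 2) + (\<delta> + 1 - d)"
  proof (cases "d \<le> \<delta> + 1")
    case True
    then have "\<delta> + 2 - d = Suc (\<delta> + 1 - d)" "\<delta> + 2 - Suc d = \<delta> + 1 - d" by simp_all
    then show ?thesis by (simp only:) (simp add: numeral_2_eq_2)
  qed simp
  ultimately show ?case using Suc.IH by simp
qed simp

definition std_monomials :: "nat \<Rightarrow> nat \<Rightarrow> complex poly poly set" where
  "std_monomials d \<delta> = (\<lambda>(i, j). monom (monom 1 i) j) ` {(i, j). i + j \<le> \<delta> \<and> j < d}"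

lemma inj_monom_monom: "inj_on (\<lambda>(i, j). monom (monom (1 :: complex) i) j) S"
  by (auto simp: inj_on_def monom_eq_iff')

lemma finite_strip: "finite {(i, j). i + j \<le> \<delta> \<and> j < (d :: nat)}"
  by (rule finite_subset[OF _ finite_pairs_sum_le[of \<delta>]]) auto

lemma finite_std_monomials: "finite (std_monomials d \<delta>)"
  unfolding std_monomials_def by (intro finite_imageI finite_strip)

lemma card_std_monomials:
  "int (card (std_monomials d \<delta>)) = int ((\<delta> + 2) choose 2) - int ((\<delta> + 2 - d) choose 2)"
  using card_triangle_strip[of \<delta> d] unfolding std_monomials_def card_image[OF inj_monom_monom] by linarith

lemma std_monomials_polys_le: "std_monomials d \<delta> \<subseteq> polys_le \<delta>"
  by (auto simp: std_monomials_def mem_polys_le split: if_splits)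

lemma sum_std_monomials:
  "(\<Sum>b\<in>std_monomials d \<delta>. smult [:c b:] b) =
     (\<Sum>(i, j)\<in>{(i, j). i + j \<le> \<delta> \<and> j < d}. monom (monom (c (monom (monom 1 i) j)) i) j)"
  unfolding std_monomials_def
  by (subst sum.reindex[OF inj_monom_monom]) (auto intro!: sum.cong simp: smult_monom)

lemma coeff_sum_strip:
  "coeff (coeff (\<Sum>(i, j)\<in>{(i, j). i + j \<le> \<delta> \<and> j < d}. monom (monom (g i j) i) j) j) i =
     (if i + j \<le> \<delta> \<and> j < d then g i j else (0 :: complex))"
proof -
  have "coeff (coeff (\<Sum>(i, j)\<in>{(i, j). i + j \<le> \<delta> \<and> j < d}. monom (monom (g i j) i) j) j) i =
     (\<Sum>p\<in>{(i, j). i + j \<le> \<delta> \<and> j < d}. if p = (i, j) then g i j else 0)"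
    unfolding coeff_sum by (intro sum.cong) (auto split: prod.splits)
  then show ?thesis using finite_strip[of \<delta> d] by simp
qed

lemma std_monomials_span:
  assumes "S \<in> polys_le \<delta>" "\<forall>j\<ge>d. coeff S j = 0"
  shows "\<exists>c. S = (\<Sum>b\<in>std_monomials d \<delta>. smult [:c b:] b)"
proof -
  \<comment> \<open>Coefficients are indexed by the monomials themselves, so the exponents are
    recovered by inverting the injective map (i, j) \<mapsto> x^i y^j.\<close>
  define c where "c = (\<lambda>b. case the_inv_into {(i, j). i + j \<le> \<delta> \<and> j < d} (\<lambda>(i, j). monom (monom (1 :: complex) i) j) b
     of (i, j) \<Rightarrow> coeff (coeff S j) i)"
  have c: "c (monom (monom 1 i) j) = coeff (coeff S j) i" if "i + j \<le> \<delta>" "j < d" for i j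
    using the_inv_into_f_f[OF inj_monom_monom, of "(i, j)" "{(i, j). i + j \<le> \<delta> \<and> j < d}"] that
    by (simp add: c_def)
  have "S = (\<Sum>b\<in>std_monomials d \<delta>. smult [:c b:] b)"
    unfolding sum_std_monomials
  proof (rule poly_poly_eqI)
    fix i j
    show "coeff (coeff S j) i = coeff (coeff (\<Sum>(i, j)\<in>{(i, j). i + j \<le> \<delta> \<and> j < d}.
        monom (monom (c (monom (monom 1 i) j)) i) j) j) i"
    proof (cases "i + j \<le> \<delta> \<and> j < d")
      case True
      then show ?thesis unfolding coeff_sum_strip by (simp add: c)
    next
      case False
      then have "coeff (coeff S j) i = 0"
        using assms unfolding mem_polys_le by (metis coeff_0 not_less)
      with False show ?thesis unfolding coeff_sum_strip by auto
    qed
  qed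
  then show ?thesis by blast
qed

lemma sum_pointwise: "(\<Sum>x\<in>A. g x) v = (\<Sum>x\<in>A. g x v)" for g :: "'i \<Rightarrow> 'v \<Rightarrow> complex"
  by (induction A rule: infinite_finite_induct) auto

section \<open>From polynomials to sections: examples, independence, dimension\<close>

context plane_curve
begin

lemma J_examples:
  assumes k: "1 \<le> k" "k \<le> d - 3"
    and f: "local_map C \<zeta> f" "f \<zeta> \<in> affine_plane" "Rd 1 0 (f \<zeta>) \<noteq> 0"
  shows "let y' = y_der f \<zeta> 1; y'' = y_der f \<zeta> 2; y''' = y_der f \<zeta> 3;
                Rx = Rd 1 0 (f \<zeta>); Ry = Rd 0 1 (f \<zeta>);
                Rxx = Rd 2 0 (f \<zeta>); Rxy = Rd 1 1 (f \<zeta>);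
                Rxxx = Rd 3 0 (f \<zeta>); Rxxy = Rd 2 1 (f \<zeta>)
            in J 1 (jet_of 1 C \<zeta> f) = y' / Rx \<and>
               (2 \<le> k \<longrightarrow> J 2 (jet_of 2 C \<zeta> f) =
                  y'' / Rx + y' ^ 2 / Rx * (- (Rxy / Rx) + Ry / Rx * (Rxx / Rx))) \<and>
               (3 \<le> k \<longrightarrow> J 3 (jet_of 3 C \<zeta> f) =
                  y''' / Rx
                  + y'' * y' / Rx * (- 3 * (Rxy / Rx) + 3 * (Ry / Rx) * (Rxx / Rx))
                  + y' ^ 3 / Rx *
                      (- 6 * (Ry / Rx) * (Rxy / Rx) * (Rxx / Rx)
                       + 3 * (Ry / Rx) ^ 2 * (Rxx / Rx) ^ 2
                       + 3 * (Ry / Rx) * (Rxxy / Rx)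
                       - (Ry / Rx) ^ 2 * (Rxxx / Rx)))"
proof (rule along_curve_nonzero[OF f])
  fix N assume N: "along_curve N (\<lambda>w. xcoord (f w)) (\<lambda>w. ycoord (f w)) (\<lambda>i j w. Rd i j (f w))"
    "\<forall>w\<in>N. local_map C w f \<and> f w \<in> affine_plane" "\<zeta> \<in> N" "\<forall>w\<in>N. Rd 1 0 (f w) \<noteq> 0"
  define q where "q = (\<lambda>w. deriv (\<lambda>w. ycoord (f w)) w / Rd 1 0 (f w))"
  have oN: "open N" using N(1) by (simp add: along_curve_def)
  have Jq: "J1 f w = q w" if "w \<in> N" for w using N(4) that by (simp add: q_def J1_y)
  have ev: "eventually (\<lambda>w. J1 f w = q w) (nhds \<zeta>)"
    using Jq N(3) oN by (auto simp: eventually_nhds)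
  have d: "(deriv ^^ n) (J1 f) \<zeta> = (deriv ^^ n) q \<zeta>" for n
    by (rule higher_deriv_cong_ev[OF ev refl])
  have Jv: "Jval 1 \<zeta> f = q \<zeta>" "Jval 2 \<zeta> f = deriv q \<zeta>"
    "Jval 3 \<zeta> f = (deriv ^^ 2) q \<zeta> + q \<zeta> ^ 3 * cubic_factor (\<lambda>i j. Rd i j (f \<zeta>))"
    using d[of 0] d[of 1] d[of 2] Jq[OF N(3)] f(2) by (simp_all add: Jval_def)
  have y1: "y_der f \<zeta> 1 = deriv (\<lambda>w. ycoord (f w)) \<zeta>" by (simp add: y_der_def)
  have J: "J 1 (jet_of 1 C \<zeta> f) = Jval 1 \<zeta> f" "2 \<le> k \<longrightarrow> J 2 (jet_of 2 C \<zeta> f) = Jval 2 \<zeta> f"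
    "3 \<le> k \<longrightarrow> J 3 (jet_of 3 C \<zeta> f) = Jval 3 \<zeta> f"
    using k by (auto intro!: J_jet_of f)
  note ex = low_order_derivatives[OF N(1,4,3)]
  show ?thesis
    unfolding Let_def y1
  proof (intro conjI impI)
    show "J 1 (jet_of 1 C \<zeta> f) = deriv (\<lambda>w. ycoord (f w)) \<zeta> / Rd 1 0 (f \<zeta>)"
      unfolding J(1) Jv q_def ..
  next
    assume "2 \<le> k"
    from trans[OF mp[OF J(2) this] trans[OF Jv(2)[unfolded q_def] ex(1)]]
    show "J 2 (jet_of 2 C \<zeta> f) = y_der f \<zeta> 2 / Rd 1 0 (f \<zeta>) + deriv (\<lambda>w. ycoord (f w)) \<zeta> ^ 2 / Rd 1 0 (f \<zeta>)
        * (- (Rd 1 1 (f \<zeta>) / Rd 1 0 (f \<zeta>)) + Rd 0 1 (f \<zeta>) / Rd 1 0 (f \<zeta>) * (Rd 2 0 (f \<zeta>) / Rd 1 0 (f \<zeta>)))"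
      by (simp only: y_der_def)
  next
    assume "3 \<le> k"
    from trans[OF mp[OF J(3) this] trans[OF Jv(3)[unfolded q_def] ex(2)]]
    show "J 3 (jet_of 3 C \<zeta> f) = y_der f \<zeta> 3 / Rd 1 0 (f \<zeta>)
                  + y_der f \<zeta> 2 * deriv (\<lambda>w. ycoord (f w)) \<zeta> / Rd 1 0 (f \<zeta>) * (- 3 * (Rd 1 1 (f \<zeta>) / Rd 1 0 (f \<zeta>)) + 3 * (Rd 0 1 (f \<zeta>) / Rd 1 0 (f \<zeta>)) * (Rd 2 0 (f \<zeta>) / Rd 1 0 (f \<zeta>)))
                  + deriv (\<lambda>w. ycoord (f w)) \<zeta> ^ 3 / Rd 1 0 (f \<zeta>) *
                      (- 6 * (Rd 0 1 (f \<zeta>) / Rd 1 0 (f \<zeta>)) * (Rd 1 1 (f \<zeta>) / Rd 1 0 (f \<zeta>)) * (Rd 2 0 (f \<zeta>) / Rd 1 0 (f \<zeta>))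
                       + 3 * (Rd 0 1 (f \<zeta>) / Rd 1 0 (f \<zeta>)) ^ 2 * (Rd 2 0 (f \<zeta>) / Rd 1 0 (f \<zeta>)) ^ 2
                       + 3 * (Rd 0 1 (f \<zeta>) / Rd 1 0 (f \<zeta>)) * (Rd 2 1 (f \<zeta>) / Rd 1 0 (f \<zeta>))
                       - (Rd 0 1 (f \<zeta>) / Rd 1 0 (f \<zeta>)) ^ 2 * (Rd 3 0 (f \<zeta>) / Rd 1 0 (f \<zeta>)))" by (simp only: y_der_def)
  qed
qed

lemma secval_combination:
  "secval k m (\<lambda>\<mu>. \<Sum>i\<in>I. smult [:c i:] (G i \<mu>)) \<zeta> f = (\<Sum>i\<in>I. c i * secval k m (G i) \<zeta> f)"
  unfolding secval_def eval2_sum sum_distrib_left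
  by (subst sum.swap) (simp add: mult_ac)

lemma secval_diff: "secval k m (\<lambda>\<mu>. G \<mu> - G' \<mu>) \<zeta> f = secval k m G \<zeta> f - secval k m G' \<zeta> f"
  unfolding secval_def by (simp add: algebra_simps sum_subtractf)

lemma section_eq_combination:
  assumes m: "1 \<le> m" and I: "finite I" "\<And>i. i \<in> I \<Longrightarrow> \<Psi> i \<in> GG_sections k m C" and \<Phi>: "\<Phi> \<in> GG_sections k m C"
    and eq: "\<And>\<zeta> f. local_map C \<zeta> f \<Longrightarrow> f \<zeta> \<in> affine_plane \<Longrightarrow>
       \<Phi> (jet_of k C \<zeta> f) = (\<Sum>i\<in>I. c i * \<Psi> i (jet_of k C \<zeta> f))"
  shows "\<Phi> = (\<lambda>v. \<Sum>i\<in>I. c i * \<Psi> i v)"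
proof
  fix v
  \<comment> \<open>The extra index \<open>None\<close> carries \<Phi> with the coefficient -1,
    which makes the claim the vanishing of one combination of sections.\<close>
  have split: "(\<Sum>i\<in>insert None (Some ` I). (case i of None \<Rightarrow> - 1 | Some i \<Rightarrow> c i) * (case i of None \<Rightarrow> \<Phi> | Some i \<Rightarrow> \<Psi> i) u)
      = - \<Phi> u + (\<Sum>i\<in>I. c i * \<Psi> i u)" for u
    using I(1) by (subst sum.insert) (auto simp: sum.reindex)
  have "(\<Sum>i\<in>insert None (Some ` I). (case i of None \<Rightarrow> - 1 | Some i \<Rightarrow> c i) * (case i of None \<Rightarrow> \<Phi> | Some i \<Rightarrow> \<Psi> i) v) = 0"
  proof (rule GG_combination_zero[where k = k and m = m])
    show "finite (insert None (Some ` I))" using I(1) by simp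
    show "(case i of None \<Rightarrow> \<Phi> | Some i \<Rightarrow> \<Psi> i) \<in> GG_sections k m C" if "i \<in> insert None (Some ` I)" for i
      using that \<Phi> I(2) by auto
  qed (use m in \<open>simp_all only: split eq, simp_all\<close>)
  then show "\<Phi> v = (\<Sum>i\<in>I. c i * \<Psi> i v)" unfolding split by simp
qed

lemma section_eq_iff:
  assumes k: "k \<le> d - 3" and m: "1 \<le> m" and G: "admissible k d m G" "admissible k d m G'"
    and \<Phi>: "section_given_by k m C J G \<Phi>" "section_given_by k m C J G' \<Phi>'"
  shows "\<Phi> = \<Phi>' \<longleftrightarrow> (\<forall>\<mu>\<in>weighted_indices k m. G \<mu> - G' \<mu> \<in> multiples_le R d (delta k d \<mu>))"
proof -
  note \<Phi>s = \<Phi>[unfolded section_given_by_iff[OF k]]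
  have "admissible k d m (\<lambda>\<mu>. G \<mu> - G' \<mu>)"
    using G by (auto simp: admissible_def intro: polys_le_diff)
  from section_zero_iff[OF this]
  have "(\<forall>\<mu>\<in>weighted_indices k m. G \<mu> - G' \<mu> \<in> multiples_le R d (delta k d \<mu>)) \<longleftrightarrow>
     (\<forall>\<zeta> f. local_map C \<zeta> f \<and> f \<zeta> \<in> affine_plane \<longrightarrow> \<Phi> (jet_of k C \<zeta> f) = \<Phi>' (jet_of k C \<zeta> f))"
    using \<Phi>s by (simp add: secval_diff)
  also have "\<dots> \<longleftrightarrow> \<Phi> = \<Phi>'"
    using section_unique[OF m, of \<Phi> k \<Phi>'] \<Phi>s by blast
  finally show ?thesis by blast
qed

text \<open>A vanishing combination of sections is the expression attached to polynomials
  \<open>H \<nu>\<close>, each the combination of the elements of \<open>B \<nu>\<close>. These lie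
  in the multiples of \<open>R\<close>, so independence modulo the multiples kills all
  coefficients.\<close>

lemma sections_independent:
  assumes k: "k \<le> d - 3" and m: "1 \<le> m"
    and B: "\<And>\<mu>. \<mu> \<in> weighted_indices k m \<Longrightarrow> B \<mu> \<subseteq> polys_le (delta k d \<mu>)"
      "\<And>\<mu>. \<mu> \<in> weighted_indices k m \<Longrightarrow> independent_mod (multiples_le R d (delta k d \<mu>)) (B \<mu>)"
    and \<Psi>: "\<And>\<mu> b. \<mu> \<in> weighted_indices k m \<Longrightarrow> b \<in> B \<mu> \<Longrightarrow>
        section_given_by k m C J (\<lambda>\<nu>. if \<nu> = \<mu> then b else 0) (\<Psi> (\<mu>, b))"
  shows "inj_on \<Psi> (Sigma (weighted_indices k m) B)"
    "jet_fun.independent (\<Psi> ` Sigma (weighted_indices k m) B)"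
proof -
  let ?W = "weighted_indices k m"
  let ?I = "Sigma ?W B"
  have finB: "finite (B \<mu>)" if "\<mu> \<in> ?W" for \<mu> using B(2)[OF that] by (simp add: independent_mod_def)
  then have finI: "finite ?I" by (intro finite_SigmaI) auto
  \<comment> \<open>Stated for coefficients indexed by pairs instead of sections, this yields
    injectivity as well as independence.\<close>
  have zero: "c i = 0" if sum0: "\<And>v. (\<Sum>i\<in>?I. c i * \<Psi> i v) = 0" and i: "i \<in> ?I" for c i
  proof -
    obtain \<mu> b where \<mu>: "i = (\<mu>, b)" "\<mu> \<in> ?W" "b \<in> B \<mu>" using i by blast
    define G where "G = (\<lambda>(i :: (nat \<Rightarrow> nat) \<times> complex poly poly) \<nu>. if \<nu> = fst i then snd i else 0)"
    define H where "H = (\<lambda>\<nu>. \<Sum>i\<in>?I. smult [:c i:] (G i \<nu>))"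
    have H: "H \<nu> = (\<Sum>b\<in>B \<nu>. smult [:c (\<nu>, b):] b)" if \<nu>: "\<nu> \<in> ?W" for \<nu>
    proof -
      have "H \<nu> = (\<Sum>\<mu>\<in>?W. \<Sum>b\<in>B \<mu>. smult [:c (\<mu>, b):] (G (\<mu>, b) \<nu>))"
        unfolding H_def using finB by (subst sum.Sigma) (auto intro!: sum.cong)
      also have "\<dots> = (\<Sum>\<mu>\<in>?W. if \<mu> = \<nu> then (\<Sum>b\<in>B \<mu>. smult [:c (\<mu>, b):] b) else 0)"
        by (intro sum.cong) (auto simp: G_def)
      also have "\<dots> = (\<Sum>b\<in>B \<nu>. smult [:c (\<nu>, b):] b)" using \<nu> by simp
      finally show ?thesis .
    qed
    have "admissible k d m H"
      unfolding admissible_def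
    proof
      fix \<nu> assume \<nu>: "\<nu> \<in> ?W"
      show "H \<nu> \<in> polys_le (delta k d \<nu>)"
        unfolding H[OF \<nu>] using B(1)[OF \<nu>] by (intro polys_le_sum polys_le_smult) auto
    qed
    moreover have "secval k m H \<zeta> f = 0" if f: "local_map C \<zeta> f" "f \<zeta> \<in> affine_plane" for \<zeta> f
    proof -
      have "\<Psi> i (jet_of k C \<zeta> f) = secval k m (G i) \<zeta> f" if "i \<in> ?I" for i
        using that \<Psi>[of "fst i" "snd i"] f unfolding section_given_by_iff[OF k] G_def by auto
      then have "(\<Sum>i\<in>?I. c i * secval k m (G i) \<zeta> f) = (\<Sum>i\<in>?I. c i * \<Psi> i (jet_of k C \<zeta> f))"
        by (intro sum.cong) auto
      then show ?thesis unfolding H_def secval_combination using sum0 by simp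
    qed
    ultimately have "H \<mu> \<in> multiples_le R d (delta k d \<mu>)"
      using section_zero_iff[of k m H] \<mu>(2) by blast
    then show ?thesis
      using independent_mod_coeffs_zero[OF B(2)[OF \<mu>(2)], of "\<lambda>b. c (\<mu>, b)" b] \<mu> H[OF \<mu>(2)] by simp
  qed
  show inj: "inj_on \<Psi> ?I"
  proof (rule inj_onI, rule ccontr)
    fix i j assume ij: "i \<in> ?I" "j \<in> ?I" "\<Psi> i = \<Psi> j" "i \<noteq> j"
    \<comment> \<open>Two indices with the same section would give a vanishing combination with
      coefficients 1 and -1.\<close>
    define c where "c = (\<lambda>x. if x = i then 1 else if x = j then - 1 else (0 :: complex))"
    have "(\<Sum>x\<in>?I. c x * \<Psi> x v) = 0" for v
    proof -
      have "(\<Sum>x\<in>?I. c x * \<Psi> x v) = (\<Sum>x\<in>{i, j}. c x * \<Psi> x v)"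
        using ij finI by (intro sum.mono_neutral_right) (auto simp: c_def)
      then show ?thesis using ij by (simp add: c_def)
    qed
    from zero[OF this ij(1)] show False by (simp add: c_def)
  qed
  show "jet_fun.independent (\<Psi> ` ?I)"
  proof
    assume "jet_fun.dependent (\<Psi> ` ?I)"
    then have "\<exists>u. (\<exists>v\<in>\<Psi> ` ?I. u v \<noteq> 0) \<and> (\<Sum>v\<in>\<Psi> ` ?I. (\<lambda>ua. u v * v ua)) = 0"
      by (simp only: jet_fun.dependent_finite[OF finite_imageI[OF finI]])
    then obtain u where "(\<exists>v\<in>\<Psi> ` ?I. u v \<noteq> 0) \<and> (\<Sum>v\<in>\<Psi> ` ?I. (\<lambda>ua. u v * v ua)) = 0" ..
    note u = conjunct1[OF this] conjunct2[OF this]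
    have "(\<Sum>i\<in>?I. u (\<Psi> i) * \<Psi> i v) = 0" for v
    proof -
      have "(\<Sum>x\<in>\<Psi> ` ?I. (\<lambda>ua. u x * x ua)) v = (\<Sum>i\<in>?I. u (\<Psi> i) * \<Psi> i v)"
        by (simp add: sum.reindex[OF inj] sum_pointwise)
      then show ?thesis using u(2) by (simp add: zero_fun_def)
    qed
    then have "u (\<Psi> i) = 0" if "i \<in> ?I" for i by (rule zero[OF _ that])
    with u(1) show False by blast
  qed
qed

lemma std_monomials_independent_mod:
  "independent_mod (multiples_le R d \<delta>) (std_monomials d \<delta>)"
  unfolding independent_mod_def
proof (intro conjI allI impI ballI finite_std_monomials)
  fix c b assume in_mult: "(\<Sum>b\<in>std_monomials d \<delta>. smult [:c b:] b) \<in> multiples_le R d \<delta>" (is "?S \<in> _")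
    and b: "b \<in> std_monomials d \<delta>"
  have co: "coeff (coeff ?S j) i = (if i + j \<le> \<delta> \<and> j < d then c (monom (monom 1 i) j) else 0)" for i j
    unfolding sum_std_monomials by (rule coeff_sum_strip)
  have S0: "?S = 0"
  proof (rule zero_if_vanishing_on_curve)
    show "\<forall>j\<ge>d. coeff ?S j = 0" by (auto intro!: poly_eqI simp: co)
    show "eval2 ?S x y = 0" if "eval2 R x y = 0" for x y by (rule multiples_le_eval[OF in_mult that])
  qed
  obtain i j where ij: "i + j \<le> \<delta>" "j < d" "b = monom (monom 1 i) j"
    using b by (auto simp: std_monomials_def)
  show "c b = 0"
    using co[of j i] ij(1,2) unfolding S0 ij(3) by simp
qed

lemma sections_space:
  assumes k: "k \<le> d - 3" and m: "1 \<le> m"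
  defines "S \<equiv> {\<Phi>. \<exists>G. admissible k d m G \<and> section_given_by k m C J G \<Phi>}"
  shows "jet_fun.subspace S" "int (jet_fun.dim S) = section_count k d m"
proof -
  let ?W = "weighted_indices k m"
  define B where "B = (\<lambda>\<mu>. std_monomials d (delta k d \<mu>))"
  define I where "I = Sigma ?W B"
  define E where "E = (\<lambda>(i :: (nat \<Rightarrow> nat) \<times> complex poly poly) \<nu>. if \<nu> = fst i then snd i else 0)"
  have finI: "finite I" unfolding I_def B_def by (intro finite_SigmaI finite_std_monomials) auto
  have adm: "admissible k d m (E i)" if "i \<in> I" for i
    using that subsetD[OF std_monomials_polys_le] by (auto simp: I_def B_def E_def admissible_def)
  have "\<forall>i\<in>I. \<exists>\<Phi>. section_given_by k m C J (E i) \<Phi>" using section_exists[OF k adm] by blast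
  from bchoice[OF this] obtain \<Psi> where \<Psi>: "\<And>i. i \<in> I \<Longrightarrow> section_given_by k m C J (E i) (\<Psi> i)" by blast
  have "section_given_by k m C J (\<lambda>\<nu>. if \<nu> = \<mu> then b else 0) (\<Psi> (\<mu>, b))" if "\<mu> \<in> ?W" "b \<in> B \<mu>" for \<mu> b
    using \<Psi>[of "(\<mu>, b)"] that unfolding E_def fst_conv snd_conv by (simp add: I_def)
  from sections_independent[OF k m _ _ this, of B] 
  have ind: "inj_on \<Psi> I" "jet_fun.independent (\<Psi> ` I)"
    using std_monomials_polys_le std_monomials_independent_mod unfolding I_def B_def by blast+
  have GG: "\<Psi> i \<in> GG_sections k m C" if "i \<in> I" for i
    using \<Psi>[OF that] by (simp add: section_given_by_def)
  have affine: "\<Psi> i (jet_of k C \<zeta> f) = secval k m (E i) \<zeta> f"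
    if "i \<in> I" "local_map C \<zeta> f" "f \<zeta> \<in> affine_plane" for i \<zeta> f
    using \<Psi>[OF that(1)] that(2,3) unfolding section_given_by_iff[OF k] by blast
  have SE: "(\<Sum>i\<in>I. smult [:c i:] (E i \<nu>)) = (\<Sum>b\<in>B \<nu>. smult [:c (\<nu>, b):] b)" if \<nu>: "\<nu> \<in> ?W" for c \<nu>
  proof -
    have "(\<Sum>i\<in>I. smult [:c i:] (E i \<nu>)) = (\<Sum>\<mu>\<in>?W. \<Sum>b\<in>B \<mu>. smult [:c (\<mu>, b):] (E (\<mu>, b) \<nu>))"
      unfolding I_def B_def by (subst sum.Sigma) (auto intro!: sum.cong simp: finite_std_monomials)
    also have "\<dots> = (\<Sum>\<mu>\<in>?W. if \<mu> = \<nu> then (\<Sum>b\<in>B \<mu>. smult [:c (\<mu>, b):] b) else 0)"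
      by (intro sum.cong) (auto simp: E_def)
    also have "\<dots> = (\<Sum>b\<in>B \<nu>. smult [:c (\<nu>, b):] b)" using \<nu> by simp
    finally show ?thesis .
  qed
  \<comment> \<open>Injectivity of \<Psi> allows coefficients to be moved between sections and
    indices.\<close>
  have span: "jet_fun.span (\<Psi> ` I) = range (\<lambda>c v. \<Sum>i\<in>I. c i * \<Psi> i v)"
  proof -
    have "jet_fun.span (\<Psi> ` I) = range (\<lambda>u v. \<Sum>i\<in>I. u (\<Psi> i) * \<Psi> i v)"
      unfolding jet_fun.span_finite[OF finite_imageI[OF finI]]
      by (intro arg_cong[of _ _ range] ext) (simp add: sum.reindex[OF ind(1)] sum_pointwise)
    also have "\<dots> = range (\<lambda>c v. \<Sum>i\<in>I. c i * \<Psi> i v)"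
    proof (intro equalityI subsetI; elim imageE)
      fix \<Phi> c assume \<Phi>: "\<Phi> = (\<lambda>v. \<Sum>i\<in>I. c i * \<Psi> i v)"
      define u where "u = (\<lambda>x. c (the_inv_into I \<Psi> x))"
      have "\<Phi> = (\<lambda>v. \<Sum>i\<in>I. u (\<Psi> i) * \<Psi> i v)"
        unfolding \<Phi> u_def by (intro ext sum.cong) (auto simp: the_inv_into_f_f[OF ind(1)])
      then show "\<Phi> \<in> range (\<lambda>u v. \<Sum>i\<in>I. u (\<Psi> i) * \<Psi> i v)" by blast
    next
      fix \<Phi> u assume "\<Phi> = (\<lambda>v. \<Sum>i\<in>I. u (\<Psi> i) * \<Psi> i v)"
      then show "\<Phi> \<in> range (\<lambda>c v. \<Sum>i\<in>I. c i * \<Psi> i v)"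
        by (intro image_eqI[of _ _ "\<lambda>i. u (\<Psi> i)"]) auto
    qed
    finally show ?thesis .
  qed
  have "S = jet_fun.span (\<Psi> ` I)"
    unfolding span
  proof (intro equalityI subsetI)
    fix \<Phi> assume "\<Phi> \<in> S"
    then obtain G where G: "admissible k d m G" "section_given_by k m C J G \<Phi>" by (auto simp: S_def)
    \<comment> \<open>Each \<open>G \<mu>\<close> is replaced by its remainder modulo
      \<open>R\<close>, a combination of standard monomials; the section does not change.\<close>
    have "\<forall>\<mu>\<in>?W. \<exists>c. G \<mu> - (\<Sum>b\<in>B \<mu>. smult [:c b:] b) \<in> multiples_le R d (delta k d \<mu>)"
    proof
      fix \<mu> assume "\<mu> \<in> ?W"
      then have "G \<mu> \<in> polys_le (delta k d \<mu>)" using G(1) by (simp add: admissible_def)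
      then show "\<exists>c. G \<mu> - (\<Sum>b\<in>B \<mu>. smult [:c b:] b) \<in> multiples_le R d (delta k d \<mu>)"
      proof (rule reduction_mod_R)
        fix Q P assume *: "G \<mu> = R * Q + P" "P \<in> polys_le (delta k d \<mu>)" "\<forall>j\<ge>d. coeff P j = 0"
          "R * Q \<in> multiples_le R d (delta k d \<mu>)"
        from std_monomials_span[OF *(2,3)] obtain c where "P = (\<Sum>b\<in>B \<mu>. smult [:c b:] b)"
          unfolding B_def ..
        with *(1) have "G \<mu> - (\<Sum>b\<in>B \<mu>. smult [:c b:] b) = R * Q" by simp
        with *(4) show ?thesis by metis
      qed
    qed
    from bchoice[OF this] obtain c where
      c: "\<And>\<mu>. \<mu> \<in> ?W \<Longrightarrow> G \<mu> - (\<Sum>b\<in>B \<mu>. smult [:c \<mu> b:] b) \<in> multiples_le R d (delta k d \<mu>)" by blast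
    define c' where "c' = (\<lambda>i. c (fst i) (snd i))"
    define H where "H = (\<lambda>\<mu>. \<Sum>i\<in>I. smult [:c' i:] (E i \<mu>))"
    have H: "H \<mu> = (\<Sum>b\<in>B \<mu>. smult [:c \<mu> b:] b)" if "\<mu> \<in> ?W" for \<mu>
      unfolding H_def SE[OF that] by (simp add: c'_def)
    have admH: "admissible k d m H"
      unfolding admissible_def
    proof
      fix \<mu> assume \<mu>: "\<mu> \<in> ?W"
      show "H \<mu> \<in> polys_le (delta k d \<mu>)"
        unfolding H[OF \<mu>] B_def
        by (intro polys_le_sum polys_le_smult subsetD[OF std_monomials_polys_le])
    qed
    then have "admissible k d m (\<lambda>\<mu>. G \<mu> - H \<mu>)"
      using G(1) by (auto simp: admissible_def intro: polys_le_diff)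
    from section_zero_iff[OF this] have zero: "secval k m G \<zeta> f = secval k m H \<zeta> f"
      if "local_map C \<zeta> f" "f \<zeta> \<in> affine_plane" for \<zeta> f
      using c H that by (simp add: secval_diff)
    have "\<Phi> = (\<lambda>v. \<Sum>i\<in>I. c' i * \<Psi> i v)"
    proof (rule section_eq_combination[OF m finI GG])
      show "\<Phi> \<in> GG_sections k m C" using G(2) by (simp add: section_given_by_def)
      show "\<Phi> (jet_of k C \<zeta> f) = (\<Sum>i\<in>I. c' i * \<Psi> i (jet_of k C \<zeta> f))"
        if f: "local_map C \<zeta> f" "f \<zeta> \<in> affine_plane" for \<zeta> f
      proof -
        have "\<Phi> (jet_of k C \<zeta> f) = secval k m H \<zeta> f"
          using G(2) f zero[OF f] unfolding section_given_by_iff[OF k] by simp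
        also have "\<dots> = (\<Sum>i\<in>I. c' i * \<Psi> i (jet_of k C \<zeta> f))"
          unfolding H_def secval_combination using affine f by (intro sum.cong) auto
        finally show ?thesis .
      qed
    qed
    then show "\<Phi> \<in> range (\<lambda>c v. \<Sum>i\<in>I. c i * \<Psi> i v)" by blast
  next
    fix \<Phi> assume "\<Phi> \<in> range (\<lambda>c v. \<Sum>i\<in>I. c i * \<Psi> i v)"
    then obtain c where \<Phi>: "\<Phi> = (\<lambda>v. \<Sum>i\<in>I. c i * \<Psi> i v)" by blast
    define H where "H = (\<lambda>\<mu>. \<Sum>i\<in>I. smult [:c i:] (E i \<mu>))"
    have H: "admissible k d m H"
      unfolding admissible_def H_def
    proof (intro ballI polys_le_sum polys_le_smult)
      fix \<mu> i assume "\<mu> \<in> ?W" "i \<in> I"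
      then show "E i \<mu> \<in> polys_le (delta k d \<mu>)" using adm by (simp add: admissible_def)
    qed
    \<comment> \<open>The combination is identified as a section by comparing it with the section of
      the combined polynomials \<open>H\<close>, with which it agrees over the affine part.\<close>
    obtain \<Phi>' where \<Phi>': "section_given_by k m C J H \<Phi>'" using section_exists[OF k H] by blast
    have "\<Phi>' = \<Phi>"
      unfolding \<Phi>
    proof (rule section_eq_combination[OF m finI GG])
      show "\<Phi>' \<in> GG_sections k m C" using \<Phi>' by (simp add: section_given_by_def)
      show "\<Phi>' (jet_of k C \<zeta> f) = (\<Sum>i\<in>I. c i * \<Psi> i (jet_of k C \<zeta> f))"
        if f: "local_map C \<zeta> f" "f \<zeta> \<in> affine_plane" for \<zeta> f
      proof -
        have "\<Phi>' (jet_of k C \<zeta> f) = secval k m H \<zeta> f"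
          using \<Phi>' f unfolding section_given_by_iff[OF k] by simp
        also have "\<dots> = (\<Sum>i\<in>I. c i * \<Psi> i (jet_of k C \<zeta> f))"
          unfolding H_def secval_combination using affine f by (intro sum.cong) auto
        finally show ?thesis .
      qed
    qed
    then show "\<Phi> \<in> S" using H \<Phi>' by (auto simp: S_def)
  qed
  then show "jet_fun.subspace S" "int (jet_fun.dim S) = section_count k d m"
  proof -
    assume S: "S = jet_fun.span (\<Psi> ` I)"
    show "jet_fun.subspace S" unfolding S by (rule jet_fun.subspace_span)
    have "jet_fun.dim S = card I"
      unfolding S jet_fun.dim_span_eq_card_independent[OF ind(2)] by (rule card_image[OF ind(1)])
    also have "card I = (\<Sum>\<mu>\<in>?W. card (B \<mu>))"
      unfolding I_def B_def by (intro card_SigmaI) (auto simp: finite_std_monomials)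
    finally show "int (jet_fun.dim S) = section_count k d m"
      by (simp add: section_count_def B_def card_std_monomials)
  qed
qed

end

subsection \<open>Asymptotics of the number of sections\<close>

text \<open>In the factorization of the difference each of the r + 1 terms of the cofactor lies
  between b^r and a^r.\<close>

lemma power_difference_bounds:
  fixes a b :: real
  assumes "0 \<le> b" "b \<le> a"
  shows "real (Suc r) * b ^ r * (a - b) \<le> a ^ Suc r - b ^ Suc r"
    "a ^ Suc r - b ^ Suc r \<le> real (Suc r) * a ^ r * (a - b)"
proof -
  have eq: "a ^ Suc r - b ^ Suc r = (a - b) * (\<Sum>i<Suc r. b ^ (Suc r - Suc i) * a ^ i)"
    by (rule power_diff_sumr2)
  have "(\<Sum>i<Suc r. b ^ r) \<le> (\<Sum>i<Suc r. b ^ (Suc r - Suc i) * a ^ i)"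
  proof (intro sum_mono)
    fix i assume "i \<in> {..<Suc r}"
    then have "b ^ r = b ^ (Suc r - Suc i) * b ^ i" by (simp flip: power_add)
    also have "\<dots> \<le> b ^ (Suc r - Suc i) * a ^ i"
      using assms by (intro mult_left_mono power_mono) auto
    finally show "b ^ r \<le> b ^ (Suc r - Suc i) * a ^ i" .
  qed
  moreover have "(\<Sum>i<Suc r. b ^ (Suc r - Suc i) * a ^ i) \<le> (\<Sum>i<Suc r. a ^ r)"
  proof (intro sum_mono)
    fix i assume "i \<in> {..<Suc r}"
    then have "a ^ r = a ^ (Suc r - Suc i) * a ^ i" by (simp flip: power_add)
    moreover have "b ^ (Suc r - Suc i) * a ^ i \<le> a ^ (Suc r - Suc i) * a ^ i"
      using assms by (intro mult_right_mono power_mono) auto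
    ultimately show "b ^ (Suc r - Suc i) * a ^ i \<le> a ^ r" by simp
  qed
  ultimately have "real (Suc r) * b ^ r \<le> (\<Sum>i<Suc r. b ^ (Suc r - Suc i) * a ^ i)"
    "(\<Sum>i<Suc r. b ^ (Suc r - Suc i) * a ^ i) \<le> real (Suc r) * a ^ r" by simp_all
  then show "real (Suc r) * b ^ r * (a - b) \<le> a ^ Suc r - b ^ Suc r"
    "a ^ Suc r - b ^ Suc r \<le> real (Suc r) * a ^ r * (a - b)"
    unfolding eq using assms by (simp_all only: mult.commute[of _ "a - b"]) (intro mult_left_mono; simp)+
qed

lemma progression_sum_step:
  fixes f :: "nat \<Rightarrow> real"
  assumes "0 < w" "w \<le> n"
  shows "(\<Sum>i\<le>n div w. f (n - i * w)) = f n + (\<Sum>i\<le>(n - w) div w. f (n - w - i * w))"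
proof -
  have "n div w = Suc ((n - w) div w)" using assms by (simp add: le_div_geq)
  moreover have "n - Suc i * w = n - w - i * w" for i by simp
  ultimately show ?thesis by (simp only: sum.atMost_Suc_shift) simp
qed

text \<open>Comparison of a sum with step w with an integral: \<open>g\<close> is the integral of
  the r-th power from 0, divided by w. Passing from n - w to n increases \<open>g\<close> by an
  amount between (n - w)^r and n^r.\<close>

lemma progression_power_sum:
  assumes w: "0 < w"
  shows "real n ^ Suc r / (real w * real (Suc r)) \<le> (\<Sum>i\<le>n div w. real (n - i * w) ^ r)"
    "(\<Sum>i\<le>n div w. real (n - i * w) ^ r) \<le> real n ^ Suc r / (real w * real (Suc r)) + real n ^ r"
proof (induction n rule: less_induct)
  case (less n)
  define g where "g = (\<lambda>x :: nat. real x ^ Suc r / (real w * real (Suc r)))"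
  have pos: "0 < real w * real (Suc r)" using w by simp
  {
    assume nw: "n < w"
    then have "real n ^ Suc r \<le> real n ^ r * (real w * real (Suc r))"
    proof -
      have "real n * real n ^ r \<le> (real w * real (Suc r)) * real n ^ r"
      proof (rule mult_right_mono)
        have "real n * 1 \<le> real w * real (Suc r)" using nw by (intro mult_mono) auto
        then show "real n \<le> real w * real (Suc r)" by simp
      qed simp
      then show ?thesis by (simp add: mult.commute)
    qed
    then have "g n \<le> real n ^ r" using pos by (simp add: g_def divide_le_eq)
    moreover have "0 \<le> g n" by (simp add: g_def)
    moreover have "(\<Sum>i\<le>n div w. real (n - i * w) ^ r) = real n ^ r" using nw by simp
    ultimately have "g n \<le> (\<Sum>i\<le>n div w. real (n - i * w) ^ r) \<and> (\<Sum>i\<le>n div w. real (n - i * w) ^ r) \<le> g n + real n ^ r"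
      by simp
  }
  moreover {
    assume nw: "w \<le> n"
    have diff: "real n - real (n - w) = real w" using nw by simp
    have 1: "g n - g (n - w) = (real n ^ Suc r - real (n - w) ^ Suc r) / (real w * real (Suc r))"
      by (simp add: g_def diff_divide_distrib)
    have "g n - g (n - w) \<le> real n ^ r" "real (n - w) ^ r \<le> g n - g (n - w)"
      using power_difference_bounds[of "real (n - w)" "real n" r] pos unfolding 1 diff
      by (simp_all add: divide_le_eq le_divide_eq mult_ac)
    moreover have "g (n - w) \<le> (\<Sum>i\<le>(n - w) div w. real (n - w - i * w) ^ r)"
      "(\<Sum>i\<le>(n - w) div w. real (n - w - i * w) ^ r) \<le> g (n - w) + real (n - w) ^ r"
      using less.IH[of "n - w"] w nw unfolding g_def by auto
    ultimately have "g n \<le> (\<Sum>i\<le>n div w. real (n - i * w) ^ r) \<and> (\<Sum>i\<le>n div w. real (n - i * w) ^ r) \<le> g n + real n ^ r"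
      using progression_sum_step[OF w nw, of "\<lambda>x. real x ^ r"] by linarith
  }
  ultimately have "g n \<le> (\<Sum>i\<le>n div w. real (n - i * w) ^ r) \<and> (\<Sum>i\<le>n div w. real (n - i * w) ^ r) \<le> g n + real n ^ r"
    by linarith
  then show "real n ^ Suc r / (real w * real (Suc r)) \<le> (\<Sum>i\<le>n div w. real (n - i * w) ^ r)"
    "(\<Sum>i\<le>n div w. real (n - i * w) ^ r) \<le> real n ^ Suc r / (real w * real (Suc r)) + real n ^ r"
    unfolding g_def by auto
qed

text \<open>The error scale for a quantity of order n^r. It is 0 for r = 0 because the induction
  starts with an exact count; n + 1 bounds the number of terms of a progression sum, also at n =
  0.\<close>

definition err :: "nat \<Rightarrow> nat \<Rightarrow> real" where
  "err r n = (if r = 0 then 0 else (real n + 1) ^ (r - 1))"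

lemma err_le: "err r n \<le> (real n + 1) ^ r"
proof (cases r)
  case (Suc s)
  have "(real n + 1) ^ s * 1 \<le> (real n + 1) ^ s * (real n + 1)" by (intro mult_left_mono) auto
  then show ?thesis by (simp add: err_def Suc mult.commute)
qed (simp add: err_def)

text \<open>Summation raises the order by one. The main term is integrated, which costs at most c (n
  + 1)^r, and the errors of at most n + 1 terms add up to E (n + 1)^r.\<close>

lemma progression_sum_asymp:
  fixes f :: "nat \<Rightarrow> real"
  assumes w: "0 < w" and f: "\<And>n. \<bar>f n - c * real n ^ r\<bar> \<le> E * err r n" and c: "0 \<le> c" and E: "0 \<le> E"
  shows "\<bar>(\<Sum>i\<le>n div w. f (n - i * w)) - c / (real w * real (Suc r)) * real n ^ Suc r\<bar> \<le> (c + E) * err (Suc r) n"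
proof -
  let ?S = "\<Sum>i\<le>n div w. real (n - i * w) ^ r"
  have "\<bar>(\<Sum>i\<le>n div w. f (n - i * w)) - c * ?S\<bar> = \<bar>\<Sum>i\<le>n div w. f (n - i * w) - c * real (n - i * w) ^ r\<bar>"
    by (simp add: sum_subtractf sum_distrib_left)
  also have "\<dots> \<le> (\<Sum>i\<le>n div w. E * err r n)"
  proof (rule order_trans[OF sum_abs], rule sum_mono)
    fix i
    have "err r (n - i * w) \<le> err r n"
      unfolding err_def by (auto intro!: power_mono)
    then show "\<bar>f (n - i * w) - c * real (n - i * w) ^ r\<bar> \<le> E * err r n"
      using order_trans[OF f mult_left_mono[OF _ E]] by blast
  qed
  also have "\<dots> = (real (n div w) + 1) * (E * err r n)" by simp
  also have "\<dots> \<le> (real n + 1) * (E * err r n)"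
    using E by (intro mult_right_mono) (auto simp: err_def div_le_dividend)
  also have "\<dots> \<le> E * (real n + 1) ^ r"
    using E by (cases r) (auto simp: err_def)
  finally have 1: "\<bar>(\<Sum>i\<le>n div w. f (n - i * w)) - c * ?S\<bar> \<le> E * (real n + 1) ^ r" .
  have "\<bar>?S - real n ^ Suc r / (real w * real (Suc r))\<bar> \<le> real n ^ r"
    using progression_power_sum[OF w, where r = r and n = n] by (simp only: abs_le_iff) linarith
  also have "\<dots> \<le> (real n + 1) ^ r" by (intro power_mono) auto
  finally have "\<bar>c * ?S - c * (real n ^ Suc r / (real w * real (Suc r)))\<bar> \<le> c * (real n + 1) ^ r"
    using c unfolding right_diff_distrib[symmetric] abs_mult by (simp add: mult_left_mono)
  with 1 show ?thesis
    unfolding err_def by (simp add: algebra_simps)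
qed

section \<open>Counting weighted multi-indices\<close>

lemma weighted_sum_update:
  assumes "j \<in> {1..k}"
  shows "(\<Sum>q=1..k. q * (\<nu>(j := x)) q) + j * \<nu> j = (\<Sum>q=1..k. q * \<nu> q) + j * (x :: nat)"
proof -
  have *: "(\<Sum>q=1..k. q * \<mu> q) = j * \<mu> j + (\<Sum>q\<in>{1..k} - {j}. q * \<mu> q)" for \<mu> :: "nat \<Rightarrow> nat"
    using assms by (intro sum.remove) auto
  have "(\<Sum>q\<in>{1..k} - {j}. q * (\<nu>(j := x)) q) = (\<Sum>q\<in>{1..k} - {j}. q * \<nu> q)"
    by (intro sum.cong) auto
  then show ?thesis unfolding *[of "\<nu>(j := x)"] *[of \<nu>] by simp
qed

lemma weighted_indices_member_le:
  assumes "\<mu> \<in> weighted_indices k n" "j \<in> {1..k}" shows "j * \<mu> j \<le> n"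
proof -
  have "j * \<mu> j \<le> (\<Sum>q=1..k. q * \<mu> q)" using assms(2) by (intro member_le_sum) auto
  then show ?thesis using assms(1) by (simp add: weighted_indices_def)
qed

text \<open>The indices are sorted by their last entry \<open>i\<close>, which accounts for i (k +
  1) of the weight.\<close>

lemma card_weighted_indices_Suc:
  "card (weighted_indices (Suc k) n) = (\<Sum>i\<le>n div Suc k. card (weighted_indices k (n - i * Suc k)))"
proof -
  let ?A = "Sigma {..n div Suc k} (\<lambda>i. weighted_indices k (n - i * Suc k))"
  have "bij_betw (\<lambda>(i, \<nu>). \<nu>(Suc k := i)) ?A (weighted_indices (Suc k) n)"
  proof (rule bij_betw_byWitness[where f' = "\<lambda>\<mu>. (\<mu> (Suc k), \<mu>(Suc k := 0))"])
    show "\<forall>a\<in>?A. (\<lambda>\<mu>. (\<mu> (Suc k), \<mu>(Suc k := 0))) ((\<lambda>(i, \<nu>). \<nu>(Suc k := i)) a) = a"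
      by (auto simp: weighted_indices_def multi_indices_def fun_eq_iff)
    show "(\<lambda>(i, \<nu>). \<nu>(Suc k := i)) ` ?A \<subseteq> weighted_indices (Suc k) n"
    proof (rule image_subsetI)
      fix p assume "p \<in> ?A"
      then obtain i \<nu> where p: "p = (i, \<nu>)" and i: "i \<in> {..n div Suc k}"
        and \<nu>: "\<nu> \<in> weighted_indices k (n - i * Suc k)" by blast
      have "i * Suc k \<le> n div Suc k * Suc k" using i by (intro mult_right_mono) auto
      also have "\<dots> \<le> n" by (rule div_times_less_eq_dividend)
      finally have le: "i * Suc k \<le> n" .
      have "(\<Sum>q=1..k. q * (\<nu>(Suc k := i)) q) = (\<Sum>q=1..k. q * \<nu> q)" by (intro sum.cong) auto
      with \<nu> le have "\<nu>(Suc k := i) \<in> weighted_indices (Suc k) n"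
        by (auto simp: weighted_indices_def multi_indices_def mult.commute)
      then show "(case p of (i, \<nu>) \<Rightarrow> \<nu>(Suc k := i)) \<in> weighted_indices (Suc k) n" by (simp add: p)
    qed
    show "(\<lambda>\<mu>. (\<mu> (Suc k), \<mu>(Suc k := 0))) ` weighted_indices (Suc k) n \<subseteq> ?A"
    proof (rule image_subsetI)
      fix \<mu> assume \<mu>: "\<mu> \<in> weighted_indices (Suc k) n"
      have le: "Suc k * \<mu> (Suc k) \<le> n" by (rule weighted_indices_member_le[OF \<mu>]) simp
      then have 1: "\<mu> (Suc k) \<in> {..n div Suc k}" by (simp add: less_eq_div_iff_mult_less_eq mult.commute)
      have "(\<Sum>q=1..k. q * (\<mu>(Suc k := 0)) q) = (\<Sum>q=1..k. q * \<mu> q)" by (intro sum.cong) auto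
      with \<mu> le have "\<mu>(Suc k := 0) \<in> weighted_indices k (n - \<mu> (Suc k) * Suc k)"
        by (auto simp: weighted_indices_def multi_indices_def mult.commute)
      with 1 show "(\<mu> (Suc k), \<mu>(Suc k := 0)) \<in> ?A" by (rule SigmaI)
    qed
  qed auto
  from bij_betw_same_card[OF this] show ?thesis by (subst (asm) card_SigmaI) auto
qed

text \<open>Double counting of the pairs (\<mu>, i) with i \<le> \<mu> j: subtracting i from \<mu> j
  leaves an index of weight n - i j. The pairs with i = 0 are counted too and produce the
  cardinality on the left.\<close>

lemma sum_component_weighted_indices:
  assumes j: "j \<in> {1..k}"
  shows "(\<Sum>\<mu>\<in>weighted_indices k n. \<mu> j) + card (weighted_indices k n) =
     (\<Sum>i\<le>n div j. card (weighted_indices k (n - i * j)))"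
proof -
  let ?A = "Sigma {..n div j} (\<lambda>i. weighted_indices k (n - i * j))"
  let ?B = "Sigma (weighted_indices k n) (\<lambda>\<mu>. {..\<mu> j})"
  have "bij_betw (\<lambda>(i, \<nu>). (\<nu>(j := \<nu> j + i), i)) ?A ?B"
  proof (rule bij_betw_byWitness[where f' = "\<lambda>(\<mu>, i). (i, \<mu>(j := \<mu> j - i))"])
    show "(\<lambda>(i, \<nu>). (\<nu>(j := \<nu> j + i), i)) ` ?A \<subseteq> ?B"
    proof (rule image_subsetI)
      fix p assume "p \<in> ?A"
      then obtain i \<nu> where p: "p = (i, \<nu>)" and i: "i \<in> {..n div j}"
        and \<nu>: "\<nu> \<in> weighted_indices k (n - i * j)" by blast
      have "i * j \<le> n div j * j" using i by (intro mult_right_mono) auto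
      also have "\<dots> \<le> n" by (rule div_times_less_eq_dividend)
      finally have le: "i * j \<le> n" .
      have "(\<Sum>q=1..k. q * (\<nu>(j := \<nu> j + i)) q) = n"
        using weighted_sum_update[OF j, of \<nu> "\<nu> j + i"] \<nu> le
        by (simp add: weighted_indices_def algebra_simps)
      then have "\<nu>(j := \<nu> j + i) \<in> weighted_indices k n"
        using \<nu> j by (auto simp: weighted_indices_def multi_indices_def)
      then show "(case p of (i, \<nu>) \<Rightarrow> (\<nu>(j := \<nu> j + i), i)) \<in> ?B" by (simp add: p)
    qed
    show "(\<lambda>(\<mu>, i). (i, \<mu>(j := \<mu> j - i))) ` ?B \<subseteq> ?A"
    proof (rule image_subsetI)
      fix p assume "p \<in> ?B"
      then obtain \<mu> i where p: "p = (\<mu>, i)" and \<mu>: "\<mu> \<in> weighted_indices k n" and i: "i \<in> {..\<mu> j}" by blast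
      have "j * i \<le> j * \<mu> j" using i by simp
      also have "\<dots> \<le> n" by (rule weighted_indices_member_le[OF \<mu> j])
      finally have le: "j * i \<le> n" .
      then have 1: "i \<in> {..n div j}" using j by (simp add: less_eq_div_iff_mult_less_eq mult.commute)
      have "(\<Sum>q=1..k. q * (\<mu>(j := \<mu> j - i)) q) + j * \<mu> j = n + j * (\<mu> j - i)"
        using weighted_sum_update[OF j, of \<mu> "\<mu> j - i"] \<mu> by (simp add: weighted_indices_def)
      moreover have "j * \<mu> j = j * (\<mu> j - i) + j * i" using i by (simp flip: distrib_left)
      ultimately have "(\<Sum>q=1..k. q * (\<mu>(j := \<mu> j - i)) q) = n - i * j" by (simp add: mult.commute)
      then have "\<mu>(j := \<mu> j - i) \<in> weighted_indices k (n - i * j)"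
        using \<mu> j by (auto simp: weighted_indices_def multi_indices_def)
      with 1 show "(case p of (\<mu>, i) \<Rightarrow> (i, \<mu>(j := \<mu> j - i))) \<in> ?A" by (simp add: p)
    qed
  qed auto
  from bij_betw_same_card[OF this]
  have "(\<Sum>i\<le>n div j. card (weighted_indices k (n - i * j))) = (\<Sum>\<mu>\<in>weighted_indices k n. Suc (\<mu> j))"
    by (simp add: card_SigmaI)
  also have "\<dots> = (\<Sum>\<mu>\<in>weighted_indices k n. \<mu> j) + card (weighted_indices k n)"
    by (simp only: Suc_eq_plus1 sum.distrib) simp
  finally show ?thesis by simp
qed

text \<open>Admitting the weight r + 2 raises the order by one and divides the leading coefficient
  by (r + 2)(r + 1), which builds up both factorials.\<close>

lemma card_weighted_indices_asymp:
  "\<exists>E\<ge>0. \<forall>n. \<bar>real (card (weighted_indices (Suc r) n)) - 1 / (fact (Suc r) * fact r) * real n ^ r\<bar> \<le> E * err r n"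
proof (induction r)
  case 0
  have "weighted_indices (Suc 0) n = {(\<lambda>i. if i = 1 then n else 0)}" for n
    by (auto simp: weighted_indices_def multi_indices_def fun_eq_iff)
  then show ?case by (intro exI[of _ 0]) (simp add: err_def)
next
  case (Suc r)
  then obtain E where E: "E \<ge> 0" "\<And>n. \<bar>real (card (weighted_indices (Suc r) n)) - 1 / (fact (Suc r) * fact r) * real n ^ r\<bar> \<le> E * err r n"
    by blast
  have coef: "(1 / (fact (Suc r) * fact r)) / (real (Suc (Suc r)) * real (Suc r)) = 1 / (fact (Suc (Suc r)) * fact (Suc r) :: real)"
    by (simp add: field_simps)
  show ?case
  proof (intro exI[of _ "1 / (fact (Suc r) * fact r) + E"] conjI allI)
    fix n
    have "real (card (weighted_indices (Suc (Suc r)) n)) =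
        (\<Sum>i\<le>n div Suc (Suc r). real (card (weighted_indices (Suc r) (n - i * Suc (Suc r)))))"
      by (simp only: card_weighted_indices_Suc[of "Suc r"] of_nat_sum)
    with progression_sum_asymp[OF _ E(2) _ E(1), of "Suc (Suc r)" n]
    show "\<bar>real (card (weighted_indices (Suc (Suc r)) n)) - 1 / (fact (Suc (Suc r)) * fact (Suc r)) * real n ^ Suc r\<bar>
        \<le> (1 / (fact (Suc r) * fact r) + E) * err (Suc r) n"
      unfolding coef by simp
  qed (use E in simp)
qed

text \<open>A progression sum with step j over the cardinalities: their leading coefficient 1/((r +
  1)! r!) is divided by j (r + 1), completing the second factorial.\<close>

lemma sum_component_asymp:
  assumes j: "j \<in> {1..Suc r}"
  shows "\<exists>E\<ge>0. \<forall>n. \<bar>real (\<Sum>\<mu>\<in>weighted_indices (Suc r) n. \<mu> j) -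
     real n ^ Suc r / (fact (Suc r) * fact (Suc r) * real j)\<bar> \<le> E * (real n + 1) ^ r"
proof -
  let ?c = "1 / (fact (Suc r) * fact r) :: real"
  obtain E where E: "E \<ge> 0" "\<And>n. \<bar>real (card (weighted_indices (Suc r) n)) - ?c * real n ^ r\<bar> \<le> E * err r n"
    using card_weighted_indices_asymp by blast
  show ?thesis
  \<comment> \<open>One half bounds the error of the progression sum, the other the cardinality that
    is subtracted from it.\<close>
  proof (intro exI[of _ "2 * (?c + E)"] conjI allI)
    fix n
    have "real (\<Sum>i\<le>n div j. card (weighted_indices (Suc r) (n - i * j))) =
        (\<Sum>i\<le>n div j. real (card (weighted_indices (Suc r) (n - i * j))))" by simp
    moreover have "0 < j" using j by simp
    ultimately have 1: "\<bar>real (\<Sum>i\<le>n div j. card (weighted_indices (Suc r) (n - i * j)))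
        - ?c / (real j * real (Suc r)) * real n ^ Suc r\<bar> \<le> (?c + E) * (real n + 1) ^ r"
      using progression_sum_asymp[OF _ E(2) _ E(1), of j n] by (simp add: err_def)
    have "real (card (weighted_indices (Suc r) n)) \<le> ?c * real n ^ r + E * err r n"
      using E(2)[of n] by linarith
    also have "\<dots> \<le> ?c * (real n + 1) ^ r + E * (real n + 1) ^ r"
      using E(1) err_le by (intro add_mono mult_left_mono power_mono) auto
    finally have 2: "real (card (weighted_indices (Suc r) n)) \<le> (?c + E) * (real n + 1) ^ r"
      by (simp add: algebra_simps)
    have coef: "?c / (real j * real (Suc r)) * real n ^ Suc r = real n ^ Suc r / (fact (Suc r) * fact (Suc r) * real j)"
      by (simp add: field_simps)
    have "real (\<Sum>\<mu>\<in>weighted_indices (Suc r) n. \<mu> j) + real (card (weighted_indices (Suc r) n)) =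
        real (\<Sum>i\<le>n div j. card (weighted_indices (Suc r) (n - i * j)))"
      using sum_component_weighted_indices[OF j, of n] by (metis of_nat_add)
    with 1 2 show "\<bar>real (\<Sum>\<mu>\<in>weighted_indices (Suc r) n. \<mu> j) -
        real n ^ Suc r / (fact (Suc r) * fact (Suc r) * real j)\<bar> \<le> 2 * (?c + E) * (real n + 1) ^ r"
      unfolding coef by (simp only: mult.assoc)
  qed (use E in simp)
qed

section \<open>Expansion of the number of sections\<close>

lemma choose_2_difference:
  assumes "e \<le> a"
  shows "real (a choose 2) - real ((a - e) choose 2) = real e * (2 * real a - real e - 1) / 2"
proof -
  have c: "real (b choose 2) = real b * (real b - 1) / 2" for b
    by (cases b) (simp_all add: choose_two real_of_nat_div algebra_simps)
  show ?thesis unfolding c of_nat_diff[OF assms] by (simp add: field_simps)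
qed

text \<open>Each e - j - 2 is at least 1, so n is at most k times \<open>delta\<close>. Thus n \<ge>
  k e forces \<open>delta\<close> \<ge> e, no truncation occurs, and the difference of binomials is
  e \<delta> + e (3 - e)/2.\<close>

lemma section_count_large:
  assumes k: "1 \<le> k" and e: "k + 3 \<le> e" and n: "k * e \<le> n"
  shows "real_of_int (section_count k e n) =
    real e * (\<Sum>j=1..k. real (e - j - 2) * real (\<Sum>\<mu>\<in>weighted_indices k n. \<mu> j))
      + real e * (3 - real e) / 2 * real (card (weighted_indices k n))"
proof -
  have summand: "real_of_int (int ((delta k e \<mu> + 2) choose 2) - int ((delta k e \<mu> + 2 - e) choose 2)) =
      real e * real (delta k e \<mu>) + real e * (3 - real e) / 2" if \<mu>: "\<mu> \<in> weighted_indices k n" for \<mu>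
  proof -
    have "k * e \<le> (\<Sum>j=1..k. j * \<mu> j)" using \<mu> n by (simp add: weighted_indices_def)
    also have "\<dots> \<le> (\<Sum>j=1..k. k * (\<mu> j * (e - j - 2)))"
    proof (rule sum_mono)
      fix j assume j: "j \<in> {1..k}"
      then have "j \<le> k" by simp
      then have "1 \<le> e - j - 2" using e by linarith
      then have "\<mu> j * 1 \<le> \<mu> j * (e - j - 2)" by (rule mult_left_mono) simp
      then show "j * \<mu> j \<le> k * (\<mu> j * (e - j - 2))" using j by (intro mult_mono) auto
    qed
    also have "\<dots> = k * delta k e \<mu>" by (simp add: delta_def sum_distrib_left)
    finally have "k * e \<le> k * delta k e \<mu>" .
    then have "e \<le> delta k e \<mu>" using k by simp
    then show ?thesis
      using choose_2_difference[of e "delta k e \<mu> + 2"] by (simp add: field_simps)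
  qed
  have "real_of_int (section_count k e n) =
      (\<Sum>\<mu>\<in>weighted_indices k n. real e * real (delta k e \<mu>) + real e * (3 - real e) / 2)"
    unfolding section_count_def of_int_sum by (intro sum.cong refl summand)
  also have "\<dots> = real e * real (\<Sum>\<mu>\<in>weighted_indices k n. delta k e \<mu>)
      + real e * (3 - real e) / 2 * real (card (weighted_indices k n))"
    by (simp add: sum.distrib sum_distrib_left)
  also have "(\<Sum>\<mu>\<in>weighted_indices k n. delta k e \<mu>) = (\<Sum>j=1..k. (e - j - 2) * (\<Sum>\<mu>\<in>weighted_indices k n. \<mu> j))"
    unfolding delta_def by (subst sum.swap) (simp add: sum_distrib_left mult.commute)
  finally show ?thesis by simp
qed

lemma section_count_asymp:
  assumes e: "Suc r + 3 \<le> e"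
  shows "(\<lambda>n. real_of_int (section_count (Suc r) e n) -
     real n ^ Suc r / (fact (Suc r) * fact (Suc r)) * (real e * (\<Sum>j=1..Suc r. (real e - real j - 2) / real j)))
     \<in> O(\<lambda>n. real n ^ r)"
proof -
  let ?k = "Suc r"
  let ?Q = "\<lambda>n j. real (\<Sum>\<mu>\<in>weighted_indices ?k n. \<mu> j)"
  have "\<forall>j\<in>{1..?k}. \<exists>E\<ge>0. \<forall>n. \<bar>?Q n j - real n ^ ?k / (fact ?k * fact ?k * real j)\<bar> \<le> E * (real n + 1) ^ r"
    using sum_component_asymp by blast
  from bchoice[OF this] obtain E where E: "\<And>j. j \<in> {1..?k} \<Longrightarrow> E j \<ge> 0"
    "\<And>j n. j \<in> {1..?k} \<Longrightarrow> \<bar>?Q n j - real n ^ ?k / (fact ?k * fact ?k * real j)\<bar> \<le> E j * (real n + 1) ^ r"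
    by blast
  have le: "1 \<le> ?k" by simp
  obtain D where D: "D \<ge> 0" "\<And>n. \<bar>real (card (weighted_indices ?k n)) - 1 / (fact ?k * fact r) * real n ^ r\<bar> \<le> D * err r n"
    using card_weighted_indices_asymp by blast
  \<comment> \<open>The error constants of the component sums, weighted as in the exact formula, and
    the whole cardinality term, which is only of order n^r.\<close>
  define K where "K = real e * (\<Sum>j=1..?k. real (e - j - 2) * E j) + \<bar>real e * (3 - real e) / 2\<bar> * (1 / (fact ?k * fact r) + D)"
  have K: "\<bar>real_of_int (section_count ?k e n) - real n ^ ?k / (fact ?k * fact ?k) * (real e * (\<Sum>j=1..?k. (real e - real j - 2) / real j))\<bar>
      \<le> K * (real n + 1) ^ r" if n: "?k * e \<le> n" for n
  proof -
    have "real n ^ ?k / (fact ?k * fact ?k) * (real e * (\<Sum>j=1..?k. (real e - real j - 2) / real j)) =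
        real e * (\<Sum>j=1..?k. real (e - j - 2) * (real n ^ ?k / (fact ?k * fact ?k * real j)))"
    proof -
      have "real n ^ ?k / (fact ?k * fact ?k) * (\<Sum>j=1..?k. (real e - real j - 2) / real j) =
          (\<Sum>j=1..?k. real (e - j - 2) * (real n ^ ?k / (fact ?k * fact ?k * real j)))"
        unfolding sum_distrib_left
      proof (rule sum.cong[OF refl])
        fix j assume "j \<in> {1..?k}"
        then have "real (e - j - 2) = real e - real j - 2" using e by (simp add: of_nat_diff)
        then show "real n ^ ?k / (fact ?k * fact ?k) * ((real e - real j - 2) / real j) =
            real (e - j - 2) * (real n ^ ?k / (fact ?k * fact ?k * real j))" by simp
      qed
      then show ?thesis by (subst mult.left_commute) (simp only:)
    qed
    moreover have "(\<Sum>j=1..?k. real (e - j - 2) * (?Q n j - real n ^ ?k / (fact ?k * fact ?k * real j))) =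
        (\<Sum>j=1..?k. real (e - j - 2) * ?Q n j) - (\<Sum>j=1..?k. real (e - j - 2) * (real n ^ ?k / (fact ?k * fact ?k * real j)))"
      by (simp only: right_diff_distrib sum_subtractf)
    ultimately have eq: "real_of_int (section_count ?k e n) - real n ^ ?k / (fact ?k * fact ?k) * (real e * (\<Sum>j=1..?k. (real e - real j - 2) / real j))
       = real e * (\<Sum>j=1..?k. real (e - j - 2) * (?Q n j - real n ^ ?k / (fact ?k * fact ?k * real j)))
         + real e * (3 - real e) / 2 * real (card (weighted_indices ?k n))"
      unfolding section_count_large[OF le e n] by (simp only: right_diff_distrib)
    have "\<bar>\<Sum>j=1..?k. real (e - j - 2) * (?Q n j - real n ^ ?k / (fact ?k * fact ?k * real j))\<bar>
        \<le> (\<Sum>j=1..?k. real (e - j - 2) * (E j * (real n + 1) ^ r))"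
    proof (rule order_trans[OF sum_abs], rule sum_mono)
      fix j assume "j \<in> {1..?k}"
      from E(2)[OF this, of n]
      show "\<bar>real (e - j - 2) * (?Q n j - real n ^ ?k / (fact ?k * fact ?k * real j))\<bar> \<le> real (e - j - 2) * (E j * (real n + 1) ^ r)"
        unfolding abs_mult abs_of_nat by (rule mult_left_mono) simp
    qed
    then have 1: "\<bar>real e * (\<Sum>j=1..?k. real (e - j - 2) * (?Q n j - real n ^ ?k / (fact ?k * fact ?k * real j)))\<bar>
        \<le> real e * (\<Sum>j=1..?k. real (e - j - 2) * (E j * (real n + 1) ^ r))"
      unfolding abs_mult abs_of_nat by (rule mult_left_mono) simp
    have "real (card (weighted_indices ?k n)) \<le> 1 / (fact ?k * fact r) * real n ^ r + D * err r n"
      using D(2)[of n] by linarith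
    also have "\<dots> \<le> 1 / (fact ?k * fact r) * (real n + 1) ^ r + D * (real n + 1) ^ r"
      using D(1) err_le by (intro add_mono mult_left_mono power_mono) auto
    finally have "real (card (weighted_indices ?k n)) \<le> (1 / (fact ?k * fact r) + D) * (real n + 1) ^ r"
      by (simp only: distrib_right)
    then have 2: "\<bar>real e * (3 - real e) / 2 * real (card (weighted_indices ?k n))\<bar>
        \<le> \<bar>real e * (3 - real e) / 2\<bar> * ((1 / (fact ?k * fact r) + D) * (real n + 1) ^ r)"
      unfolding abs_mult[of _ "real (card _)"] abs_of_nat by (rule mult_left_mono) simp
    have "K * (real n + 1) ^ r = real e * (\<Sum>j=1..?k. real (e - j - 2) * (E j * (real n + 1) ^ r))
        + \<bar>real e * (3 - real e) / 2\<bar> * ((1 / (fact ?k * fact r) + D) * (real n + 1) ^ r)"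
      unfolding K_def by (simp only: distrib_right sum_distrib_right mult.assoc)
    then show ?thesis
      unfolding eq by (simp only:) (rule order_trans[OF abs_triangle_ineq add_mono[OF 1 2]])
  qed
  show ?thesis
  \<comment> \<open>The factor 2^r turns powers of n + 1 into powers of n for n \<ge> 1.\<close>
  proof (rule bigoI[of _ "\<bar>K\<bar> * 2 ^ r"])
    show "eventually (\<lambda>n. norm (real_of_int (section_count ?k e n) -
       real n ^ ?k / (fact ?k * fact ?k) * (real e * (\<Sum>j=1..?k. (real e - real j - 2) / real j)))
       \<le> \<bar>K\<bar> * 2 ^ r * norm (real n ^ r)) sequentially"
      using eventually_ge_at_top[of "max 1 (?k * e)"]
    proof eventually_elim
      case (elim n)
      have "K * (real n + 1) ^ r \<le> \<bar>K\<bar> * (2 * real n) ^ r"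
        using elim by (intro mult_mono power_mono) auto
      then show ?case using K[of n] elim by (simp add: power_mult_distrib)
    qed
  qed
qed

lemma harmonic_identity:
  "real e * (\<Sum>j=1..k. (real e - real j - 2) / real j) =
     (real e)\<^sup>2 * harm k - real e * (real k + 2 * harm k)"
proof -
  have "(\<Sum>j=1..k. (real e - real j - 2) / real j) = (\<Sum>j=1..k. (real e - 2) * inverse (real j) - 1)"
    by (intro sum.cong) (auto simp: field_simps)
  also have "\<dots> = (real e - 2) * harm k - real k"
    by (simp add: sum_subtractf harm_def sum_distrib_left)
  finally have *: "(\<Sum>j=1..k. (real e - real j - 2) / real j) = (real e - 2) * harm k - real k" .
  show ?thesis unfolding * by (simp add: power2_eq_square algebra_simps)
qed

text \<open>\<open>o1\<close> is the harmonic number minus the logarithm; it converges to Euler's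
  constant and so is bounded in k. \<open>od\<close> collects the part linear in d of the harmonic
  expression, and \<open>om\<close> is the remainder in m.\<close>

lemma section_count_expansion:
  "\<exists>(o1 :: nat \<Rightarrow> nat \<Rightarrow> nat \<Rightarrow> real) (od :: nat \<Rightarrow> nat \<Rightarrow> real) (om :: nat \<Rightarrow> nat \<Rightarrow> nat \<Rightarrow> real).
        (\<exists>K. \<forall>k e n. \<bar>o1 k e n\<bar> \<le> K) \<and>
        (\<forall>k\<ge>1. od k \<in> O(\<lambda>e. real e)) \<and>
        (\<forall>k\<ge>1. \<forall>e\<ge>k + 3. om k e \<in> O(\<lambda>n. real n ^ (k - 1))) \<and>
        (\<forall>k\<ge>1. \<forall>e\<ge>k + 3. \<forall>n\<ge>1.
           real_of_int (section_count k e n) =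
             real n ^ k / (fact k * fact k) *
               ((real e)\<^sup>2 * ln (real k) + (real e)\<^sup>2 * o1 k e n + od k e) + om k e n)"
proof -
  define o1 :: "nat \<Rightarrow> nat \<Rightarrow> nat \<Rightarrow> real" where "o1 = (\<lambda>k e n. harm k - ln (real k))"
  define od :: "nat \<Rightarrow> nat \<Rightarrow> real" where "od = (\<lambda>k e. - (real k + 2 * harm k) * real e)"
  define om where "om = (\<lambda>k e n. real_of_int (section_count k e n) -
     real n ^ k / (fact k * fact k) * ((real e)\<^sup>2 * ln (real k) + (real e)\<^sup>2 * o1 k e n + od k e))"
  have "Bseq (\<lambda>k. harm k - ln (real k))"
    using euler_mascheroni_convergent by (intro convergent_imp_Bseq) simp
  then have "\<exists>K. \<forall>k e n. \<bar>o1 k e n\<bar> \<le> K" unfolding o1_def Bseq_def by auto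
  moreover have "od k \<in> O(\<lambda>e. real e)" for k unfolding od_def by simp
  moreover have "om k e \<in> O(\<lambda>n. real n ^ (k - 1))" if ke: "1 \<le> k" "k + 3 \<le> e" for k e
  proof -
    obtain r where r: "k = Suc r" using ke by (cases k) auto
    have "om k e = (\<lambda>n. real_of_int (section_count k e n) -
        real n ^ k / (fact k * fact k) * (real e * (\<Sum>j=1..k. (real e - real j - 2) / real j)))"
      unfolding om_def harmonic_identity o1_def od_def by (simp add: algebra_simps)
    then show ?thesis using section_count_asymp[of r e] ke(2) unfolding r by simp
  qed
  ultimately show ?thesis
    by (intro exI[of _ o1] exI[of _ od] exI[of _ om]) (simp add: om_def)
qed

subsection \<open>Comparison of the affine equation with the given form\<close>

lemma form_scale: "form d a (c * T) (c * X) (c * Y) = c ^ d * form d a T X Y"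
  unfolding form_def sum_distrib_left
proof (intro sum.cong refl, clarify)
  fix i j :: nat assume "i + j \<le> d"
  then have "c ^ d = c ^ (d - i - j) * c ^ i * c ^ j" by (simp flip: power_add)
  then show "a i j * (c * T) ^ (d - i - j) * (c * X) ^ i * (c * Y) ^ j =
      c ^ d * (a i j * T ^ (d - i - j) * X ^ i * Y ^ j)"
    by (simp add: power_mult_distrib)
qed

text \<open>
  The given form only serves to see that the branches at its \<open>d\<close> points at infinity are limits of
  affine points; hence the homogenization of \<open>R\<close> vanishes there too, and having at most \<open>d\<close> zeros on
  the line at infinity it has exactly these, all simple.
\<close>

lemma plane_curveI:
  assumes d: "4 \<le> d" and C: "C = {pt T X Y | T X Y. (T, X, Y) \<noteq> (0, 0, 0) \<and> form d a T X Y = 0}"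
    and corner: "pt 0 0 1 \<notin> C" and card_inf: "card (C \<inter> line_at_infinity) = d"
    and aff: "C \<inter> affine_plane = {pt 1 x y | x y. eval2 R x y = 0}" and deg: "total_degree R = d"
    and smooth: "{(x, y). eval2 R x y = 0} \<inter> {(x, y). eval2 (partial 1 0 R) x y = 0}
           \<inter> {(x, y). eval2 (partial 0 1 R) x y = 0} = {}"
  shows "plane_curve C R d"
proof -
  have mem: "pt T X Y \<in> C \<longleftrightarrow> form d a T X Y = 0" if nz: "(T, X, Y) \<noteq> (0, 0, 0)" for T X Y
  proof
    assume "pt T X Y \<in> C"
    then obtain T' X' Y' where *: "pt T X Y = pt T' X' Y'" "(T', X', Y') \<noteq> (0, 0, 0)" "form d a T' X' Y' = 0"
      unfolding C by blast
    from *(1) obtain c where "c \<noteq> 0" "T' = c * T" "X' = c * X" "Y' = c * Y"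
      unfolding pt_eq_iff[OF nz *(2)] by blast
    then show "form d a T X Y = 0" using *(3) by (simp add: form_scale)
  qed (use nz in \<open>auto simp: C\<close>)
  let ?r = "\<lambda>i j. coeff (coeff R j) i"
  let ?F = "infpoly d a" and ?H = "hompoly d R"
  have F: "pt t 1 s \<in> C \<longleftrightarrow> eval2 ?F t s = 0" for t s
    using mem[of t 1 s] by (simp add: eval2_infpoly)
  have R_le: "R \<in> polys_le d" using deg by (simp add: polys_le_def)
  have C_aff: "pt 1 x y \<in> C \<longleftrightarrow> eval2 R x y = 0" for x y
  proof -
    have "pt 1 x y \<in> C \<inter> affine_plane \<longleftrightarrow> eval2 R x y = 0" unfolding aff by auto
    then show ?thesis by (auto simp: affine_plane_def)
  qed
  have top: "\<exists>j\<le>d. ?r (d - j) j \<noteq> 0"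
  proof (rule ccontr)
    assume *: "\<not> ?thesis"
    have "R \<in> polys_le (d - 1)"
      unfolding mem_polys_le
    proof (intro allI impI)
      fix i j assume nz: "coeff (coeff R j) i \<noteq> 0"
      then have "i + j \<le> d" using R_le unfolding mem_polys_le by blast
      moreover have "i + j \<noteq> d"
      proof
        assume "i + j = d"
        then have "j \<le> d" "d - j = i" by auto
        then show False using * nz by blast
      qed
      ultimately show "i + j \<le> d - 1" by simp
    qed
    then show False using deg d by (simp add: polys_le_def)
  qed
  \<comment> \<open>At (0, 0, 1) the form reduces to its single term \<open>a 0 d\<close>.\<close>
  have a0d: "a 0 d \<noteq> 0"
  proof
    assume "a 0 d = 0"
    have "form d a 0 0 1 = (\<Sum>p\<in>{(i, j). i + j \<le> d}. if p = (0, d) then a 0 d else 0)"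
      unfolding form_def by (intro sum.cong) (auto simp: power_0_left split: if_splits)
    then have "form d a 0 0 1 = 0" using \<open>a 0 d = 0\<close> by simp
    then show False using corner mem[of 0 0 1] by simp
  qed
  have inf: "C \<inter> line_at_infinity = pt 0 1 ` {s. eval2 ?F 0 s = 0}"
  proof (intro equalityI subsetI)
    fix p assume p: "p \<in> C \<inter> line_at_infinity"
    then obtain X Y where XY: "p = pt 0 X Y" "(X, Y) \<noteq> (0, 0)" by (auto simp: line_at_infinity_def)
    have "X \<noteq> 0"
    proof
      assume "X = 0"
      then have "p = pt 0 0 1" using XY by (subst XY(1), subst pt_eq_iff) (auto intro!: exI[of _ "1 / Y"])
      then show False using p corner by simp
    qed
    then have "p = pt 0 1 (Y / X)" using pt_infinity_eq[of X 0 Y] XY(1) by simp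
    then show "p \<in> pt 0 1 ` {s. eval2 ?F 0 s = 0}" using p F by auto
  next
    fix p assume "p \<in> pt 0 1 ` {s. eval2 ?F 0 s = 0}"
    then show "p \<in> C \<inter> line_at_infinity" using F by (auto simp: pt_in_line_at_infinity)
  qed
  have cardF: "card {s. eval2 ?F 0 s = 0} = d"
    using card_inf unfolding inf by (subst (asm) card_image) (auto simp: inj_on_def)
  have "eval2 ?H 0 s = 0" if s: "eval2 ?F 0 s = 0" for s
  proof -
    have "eval2 (partial 0 1 ?F) 0 s \<noteq> 0"
      using a0d by (intro infpoly_simple_roots cardF s exI[of _ d]) simp
    from implicit_y[OF s this] obtain U N g where g: "open N" "0 \<in> N" "g holomorphic_on N" "g 0 = s"
      "\<And>x y. (x, y) \<in> U \<and> eval2 ?F x y = 0 \<longleftrightarrow> x \<in> N \<and> y = g x" by metis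
    have "isCont (\<lambda>t. eval2 ?H t (g t)) 0"
    proof -
      have "(\<lambda>t. eval2 ?H t (g t)) holomorphic_on N" using g(3) by (auto intro!: holomorphic_intros)
      then show ?thesis
        using g(1,2) continuous_on_eq_continuous_at holomorphic_on_imp_continuous_on by blast
    qed
    then have "((\<lambda>t. eval2 ?H t (g t)) \<longlongrightarrow> eval2 ?H 0 s) (at 0)" using g(4) by (simp add: isCont_def)
    moreover have "eventually (\<lambda>t. t \<in> N - {0}) (at 0)"
      using g(1,2) by (rule eventually_at_in_open)
    then have "eventually (\<lambda>t. eval2 ?H t (g t) = 0) (at 0)"
    proof eventually_elim
      case (elim t)
      then have t: "t \<in> N" "t \<noteq> 0" by auto
      then have "pt t 1 (g t) \<in> C" using g(5) F by blast
      then have "eval2 R (1 / t) (g t / t) = 0"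
        using pt_affine_eq[OF t(2), of 1 "g t"] C_aff by simp
      then show ?case using eval2_hompoly[OF R_le t(2)] by simp
    qed
    then have "((\<lambda>t. eval2 ?H t (g t)) \<longlongrightarrow> 0) (at 0)" by (rule tendsto_eventually)
    ultimately show ?thesis by (rule tendsto_unique[OF at_neq_bot])
  qed
  then have sub: "{s. eval2 ?F 0 s = 0} \<subseteq> {s. eval2 ?H 0 s = 0}" by blast
  \<comment> \<open>The restriction of the homogenized \<open>R\<close> to the line at infinity;
    \<open>top\<close> makes it nonzero, so it has at most d roots.\<close>
  let ?q = "\<Sum>j\<le>d. monom (?r (d - j) j) j"
  have cq: "coeff ?q j = (if j \<le> d then ?r (d - j) j else 0)" for j
    by (simp add: coeff_sum if_distrib cong: if_cong)
  have qnz: "?q \<noteq> 0" using top cq by (metis coeff_0)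
  have qroots: "{s. eval2 ?H 0 s = 0} = {s. poly ?q s = 0}"
    unfolding hompoly_def eval2_infpoly_0 ..
  have finH: "finite {s. eval2 ?H 0 s = 0}" unfolding qroots by (rule poly_roots_finite[OF qnz])
  have "card {s. eval2 ?H 0 s = 0} \<le> degree ?q" unfolding qroots by (rule card_poly_roots_bound[OF qnz])
  also have "\<dots> \<le> d" by (rule degree_le) (simp add: cq)
  finally have eqFH: "{s. eval2 ?F 0 s = 0} = {s. eval2 ?H 0 s = 0}"
    using card_seteq[OF finH sub] cardF by simp
  then have cardH: "card {s. eval2 ?H 0 s = 0} = d" using cardF by simp
  show ?thesis
  proof
    show "coeff (coeff R d) 0 \<noteq> 0"
      using infpoly_top_coeff[of d ?r] top cardH unfolding hompoly_def by blast
    show "pt t 1 s \<in> C \<longleftrightarrow> eval2 ?H t s = 0" for t s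
    proof (cases "t = 0")
      case True
      then show ?thesis using eqFH F by blast
    next
      case False
      then show ?thesis
        using pt_affine_eq[OF False, of 1 s] C_aff eval2_hompoly[OF R_le False, of s] by simp
    qed
    show "eval2 (partial 0 1 ?H) 0 s \<noteq> 0" if "eval2 ?H 0 s = 0" for s
      using infpoly_simple_roots[of d ?r s] top cardH that unfolding hompoly_def by blast
    show "eval2 (partial 1 0 R) x y \<noteq> 0 \<or> eval2 (partial 0 1 R) x y \<noteq> 0" if "eval2 R x y = 0" for x y
      using smooth that by blast
  qed (fact d R_le C_aff corner cardH)+
qed

theorem mainTheorem1:
  fixes \<kappa> m d :: nat
    and C :: "proj2 set"
    and a :: "nat \<Rightarrow> nat \<Rightarrow> complex"
    and R :: "complex poly poly"
  assumes "\<kappa> \<ge> 1" and "m \<ge> 1" and "d \<ge> \<kappa> + 3"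
    and "smooth_plane_curve d a C"
    and "pt 0 1 0 \<notin> C" and "pt 0 0 1 \<notin> C"
    and "transversal_at_infinity d a"
    and "card (C \<inter> line_at_infinity) = d"
    and "C \<inter> affine_plane = {pt 1 x y | x y. eval2 R x y = 0}"
    and "total_degree R = d"
    and "{(x, y). eval2 R x y = 0} \<inter> {(x, y). eval2 (partial 1 0 R) x y = 0}
           \<inter> {(x, y). eval2 (partial 0 1 R) x y = 0} = {}"
  shows
    "(\<exists>(\<J> :: nat \<Rightarrow> (nat \<Rightarrow> nat) \<Rightarrow> int_mpoly) (J :: nat \<Rightarrow> jet \<Rightarrow> complex).
        \<comment> \<open>the jet differentials\<close>
        (\<forall>l\<in>{1..\<kappa>}.
           (\<forall>\<mu>\<in>weighted_indices (l - 1) l.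
              mpoly_vars (\<J> l \<mu>) \<subseteq>
                insert (0, 1) {(i, j). 2 \<le> i + j \<and> i + j \<le> (\<Sum>q=1..l - 1. \<mu> q)}) \<and>
           (\<forall>\<zeta> f. local_map C \<zeta> f \<and> f \<zeta> \<in> affine_plane \<and>
                partial_at R 1 0 (f \<zeta>) \<noteq> 0 \<and> partial_at R 0 1 (f \<zeta>) \<noteq> 0 \<longrightarrow>
                jet_expr_y (\<J> l) R l \<zeta> f = jet_expr_x (\<J> l) R l \<zeta> f) \<and>
           jet_differential l C (J l) \<and>
           (\<forall>\<zeta> f. local_map C \<zeta> f \<longrightarrow>
              (f \<zeta> \<in> affine_plane \<and> partial_at R 1 0 (f \<zeta>) \<noteq> 0 \<longrightarrow>
                 J l (jet_of l C \<zeta> f) = jet_expr_y (\<J> l) R l \<zeta> f) \<and>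
              (f \<zeta> \<in> affine_plane \<and> partial_at R 0 1 (f \<zeta>) \<noteq> 0 \<longrightarrow>
                 J l (jet_of l C \<zeta> f) = jet_expr_x (\<J> l) R l \<zeta> f) \<and>
              (f \<zeta> \<in> line_at_infinity \<longrightarrow> J l (jet_of l C \<zeta> f) = 0))) \<and>
        \<comment> \<open>the examples of order 1, 2, 3\<close>
        (\<forall>\<zeta> f. local_map C \<zeta> f \<and> f \<zeta> \<in> affine_plane \<and> partial_at R 1 0 (f \<zeta>) \<noteq> 0 \<longrightarrow>
           (let y' = y_der f \<zeta> 1; y'' = y_der f \<zeta> 2; y''' = y_der f \<zeta> 3;
                Rx = partial_at R 1 0 (f \<zeta>); Ry = partial_at R 0 1 (f \<zeta>);
                Rxx = partial_at R 2 0 (f \<zeta>); Rxy = partial_at R 1 1 (f \<zeta>);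
                Rxxx = partial_at R 3 0 (f \<zeta>); Rxxy = partial_at R 2 1 (f \<zeta>)
            in J 1 (jet_of 1 C \<zeta> f) = y' / Rx \<and>
               (2 \<le> \<kappa> \<longrightarrow> J 2 (jet_of 2 C \<zeta> f) =
                  y'' / Rx + y' ^ 2 / Rx * (- (Rxy / Rx) + Ry / Rx * (Rxx / Rx))) \<and>
               (3 \<le> \<kappa> \<longrightarrow> J 3 (jet_of 3 C \<zeta> f) =
                  y''' / Rx
                  + y'' * y' / Rx * (- 3 * (Rxy / Rx) + 3 * (Ry / Rx) * (Rxx / Rx))
                  + y' ^ 3 / Rx *
                      (- 6 * (Ry / Rx) * (Rxy / Rx) * (Rxx / Rx)
                       + 3 * (Ry / Rx) ^ 2 * (Rxx / Rx) ^ 2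
                       + 3 * (Ry / Rx) * (Rxxy / Rx)
                       - (Ry / Rx) ^ 2 * (Rxxx / Rx))))) \<and>
        \<comment> \<open>every admissible choice of polynomials gives a global section\<close>
        (\<forall>G. admissible \<kappa> d m G \<longrightarrow> (\<exists>\<Phi>. section_given_by \<kappa> m C J G \<Phi>)) \<and>
        \<comment> \<open>the section depends exactly on the classes of the polynomials in the quotients\<close>
        (\<forall>G G' \<Phi> \<Phi>'. admissible \<kappa> d m G \<and> admissible \<kappa> d m G' \<and>
             section_given_by \<kappa> m C J G \<Phi> \<and> section_given_by \<kappa> m C J G' \<Phi>' \<longrightarrow>
             (\<Phi> = \<Phi>' \<longleftrightarrow>
               (\<forall>\<mu>\<in>weighted_indices \<kappa> m. G \<mu> - G' \<mu> \<in> multiples_le R d (delta \<kappa> d \<mu>)))) \<and>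
        \<comment> \<open>linearly independent classes give linearly independent sections\<close>
        (\<forall>B \<Psi>. (\<forall>\<mu>\<in>weighted_indices \<kappa> m. B \<mu> \<subseteq> polys_le (delta \<kappa> d \<mu>) \<and>
                    independent_mod (multiples_le R d (delta \<kappa> d \<mu>)) (B \<mu>)) \<and>
             (\<forall>\<mu>\<in>weighted_indices \<kappa> m. \<forall>b\<in>B \<mu>.
                section_given_by \<kappa> m C J (\<lambda>\<nu>. if \<nu> = \<mu> then b else 0) (\<Psi> (\<mu>, b))) \<longrightarrow>
             inj_on \<Psi> (Sigma (weighted_indices \<kappa> m) B) \<and>
             jet_fun.independent (\<Psi> ` Sigma (weighted_indices \<kappa> m) B)) \<and>
        \<comment> \<open>the space of sections so obtained and its dimension\<close>
        (let S = {\<Phi>. \<exists>G. admissible \<kappa> d m G \<and> section_given_by \<kappa> m C J G \<Phi>}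
         in jet_fun.subspace S \<and> int (jet_fun.dim S) = section_count \<kappa> d m)) \<and>
     \<comment> \<open>the asymptotics, with error terms of the stated uniformity\<close>
     (\<exists>(o1 :: nat \<Rightarrow> nat \<Rightarrow> nat \<Rightarrow> real) (od :: nat \<Rightarrow> nat \<Rightarrow> real) (om :: nat \<Rightarrow> nat \<Rightarrow> nat \<Rightarrow> real).
        (\<exists>K. \<forall>k e n. \<bar>o1 k e n\<bar> \<le> K) \<and>
        (\<forall>k\<ge>1. od k \<in> O(\<lambda>e. real e)) \<and>
        (\<forall>k\<ge>1. \<forall>e\<ge>k + 3. om k e \<in> O(\<lambda>n. real n ^ (k - 1))) \<and>
        (\<forall>k\<ge>1. \<forall>e\<ge>k + 3. \<forall>n\<ge>1.
           real_of_int (section_count k e n) =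
             real n ^ k / (fact k * fact k) *
               ((real e)\<^sup>2 * ln (real k) + (real e)\<^sup>2 * o1 k e n + od k e) + om k e n))"
proof -
  have "plane_curve C R d"
    using assms by (intro plane_curveI[where a = a]) (auto simp: smooth_plane_curve_def)
  then interpret plane_curve C R d .
  have \<kappa>: "\<kappa> \<le> d - 3" using assms(3) by simp
  \<comment> \<open>The condition on \<open>l\<close> is moved inside the existential so that one
    family \<open>P\<close> can be chosen for all orders.\<close>
  have "\<forall>l. \<exists>p. 1 \<le> l \<longrightarrow> (\<forall>\<mu>\<in>weighted_indices (l - 1) l. mpoly_vars (p \<mu>) \<subseteq> admissible_vars (\<Sum>q=1..l - 1. \<mu> q)) \<and>
    (\<forall>\<zeta> f. local_map C \<zeta> f \<longrightarrow> f \<zeta> \<in> affine_plane \<longrightarrow>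
      (partial_at R 1 0 (f \<zeta>) \<noteq> 0 \<longrightarrow> Jval l \<zeta> f = jet_expr_y p R l \<zeta> f) \<and>
      (partial_at R 0 1 (f \<zeta>) \<noteq> 0 \<longrightarrow> Jval l \<zeta> f = jet_expr_x p R l \<zeta> f))"
    using jet_expressions by blast
  from choice[OF this] obtain P where P:
    "\<And>l \<mu>. 1 \<le> l \<Longrightarrow> \<mu> \<in> weighted_indices (l - 1) l \<Longrightarrow> mpoly_vars (P l \<mu>) \<subseteq> admissible_vars (\<Sum>q=1..l - 1. \<mu> q)"
    "\<And>l \<zeta> f. 1 \<le> l \<Longrightarrow> local_map C \<zeta> f \<Longrightarrow> f \<zeta> \<in> affine_plane \<Longrightarrow>
       partial_at R 1 0 (f \<zeta>) \<noteq> 0 \<Longrightarrow> Jval l \<zeta> f = jet_expr_y (P l) R l \<zeta> f"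
    "\<And>l \<zeta> f. 1 \<le> l \<Longrightarrow> local_map C \<zeta> f \<Longrightarrow> f \<zeta> \<in> affine_plane \<Longrightarrow>
       partial_at R 0 1 (f \<zeta>) \<noteq> 0 \<Longrightarrow> Jval l \<zeta> f = jet_expr_x (P l) R l \<zeta> f"
    by blast
  have recipe: "(\<forall>\<mu>\<in>weighted_indices (l - 1) l.
              mpoly_vars (P l \<mu>) \<subseteq>
                insert (0, 1) {(i, j). 2 \<le> i + j \<and> i + j \<le> (\<Sum>q=1..l - 1. \<mu> q)}) \<and>
           (\<forall>\<zeta> f. local_map C \<zeta> f \<and> f \<zeta> \<in> affine_plane \<and>
                partial_at R 1 0 (f \<zeta>) \<noteq> 0 \<and> partial_at R 0 1 (f \<zeta>) \<noteq> 0 \<longrightarrow>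
                jet_expr_y (P l) R l \<zeta> f = jet_expr_x (P l) R l \<zeta> f) \<and>
           jet_differential l C (J l) \<and>
           (\<forall>\<zeta> f. local_map C \<zeta> f \<longrightarrow>
              (f \<zeta> \<in> affine_plane \<and> partial_at R 1 0 (f \<zeta>) \<noteq> 0 \<longrightarrow>
                 J l (jet_of l C \<zeta> f) = jet_expr_y (P l) R l \<zeta> f) \<and>
              (f \<zeta> \<in> affine_plane \<and> partial_at R 0 1 (f \<zeta>) \<noteq> 0 \<longrightarrow>
                 J l (jet_of l C \<zeta> f) = jet_expr_x (P l) R l \<zeta> f) \<and>
              (f \<zeta> \<in> line_at_infinity \<longrightarrow> J l (jet_of l C \<zeta> f) = 0))"
    if "l \<in> {1..\<kappa>}" for l
  proof (intro conjI ballI allI impI)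
    have l: "1 \<le> l" "l \<le> d - 3" using that \<kappa> by auto
    show "jet_differential l C (J l)" by (rule J_jet_differential[OF l])
    show "mpoly_vars (P l \<mu>) \<subseteq> insert (0, 1) {(i, j). 2 \<le> i + j \<and> i + j \<le> (\<Sum>q=1..l - 1. \<mu> q)}"
      if "\<mu> \<in> weighted_indices (l - 1) l" for \<mu>
      using P(1)[OF l(1) that] unfolding admissible_vars_def .
    show "jet_expr_y (P l) R l \<zeta> f = jet_expr_x (P l) R l \<zeta> f"
      if "local_map C \<zeta> f \<and> f \<zeta> \<in> affine_plane \<and>
        partial_at R 1 0 (f \<zeta>) \<noteq> 0 \<and> partial_at R 0 1 (f \<zeta>) \<noteq> 0" for \<zeta> f
    proof -
      have "Jval l \<zeta> f = jet_expr_y (P l) R l \<zeta> f" using that by (intro P(2) l) auto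
      moreover have "Jval l \<zeta> f = jet_expr_x (P l) R l \<zeta> f" using that by (intro P(3) l) auto
      ultimately show ?thesis by simp
    qed
    fix \<zeta> f assume f: "local_map C \<zeta> f"
    note J = J_jet_of[OF l f]
    show "J l (jet_of l C \<zeta> f) = jet_expr_y (P l) R l \<zeta> f"
      if "f \<zeta> \<in> affine_plane \<and> partial_at R 1 0 (f \<zeta>) \<noteq> 0"
      unfolding J using that by (intro P(2) l f) auto
    show "J l (jet_of l C \<zeta> f) = jet_expr_x (P l) R l \<zeta> f"
      if "f \<zeta> \<in> affine_plane \<and> partial_at R 0 1 (f \<zeta>) \<noteq> 0"
      unfolding J using that by (intro P(3) l f) auto
    show "J l (jet_of l C \<zeta> f) = 0" if "f \<zeta> \<in> line_at_infinity"
      unfolding J using that by (simp add: Jval_def line_at_infinity_iff)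
  qed
  show ?thesis
    by (intro conjI exI[of _ P] exI[of _ J] section_count_expansion)
      (rule ballI, erule recipe,
       intro allI impI, elim conjE, rule J_examples[OF assms(1) \<kappa>], assumption+,
       use section_exists[OF \<kappa>] in blast,
       intro allI impI, elim conjE, rule section_eq_iff[OF \<kappa> assms(2)], assumption+,
       intro allI impI, rule conjI, (rule sections_independent[OF \<kappa> assms(2)]; blast)+,
       unfold Let_def, intro conjI sections_space[OF \<kappa> assms(2)])
qed

end
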